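(* Let $H_\omega=-\Delta+V_\omega$ be the Anderson Hamiltonian on $\ell^2(\mathbb{Z}^d)$ and let $E_F\in\Xi^{\mathrm{CL}}$ (the region of complete localization). Let $\ell_{E_F}>0$ be a localization length at $E_F$, i.e. a constant $\ell$ for which there exist an open interval $I_{E_F}\ni E_F$, an exponent $s\in(0,1)$ and a constant $K$ such that $$\sup_{E'\in I_{E_F}}\sup_{\eta\neq0}\mathbb{E}\{|\langle\delta_x,R(E'+i\eta)\delta_y\rangle|^s\}\le K e^{-|x-y|/\ell}\quad\text{for all }x,y\in\mathbb{Z}^d.$$ Then $$\limsup_{\nu\downarrow0}\frac{\overline{\sigma}^{\mathrm{in}}_{E_F}(\nu)}{\nu^2\left(\log\frac1\nu\right)^{d+2}}\le C^{d+2}\pi^3\|\rho\|_\infty^2\,\ell_{E_F}^{d+2},$$ where $\rho$ is the density of the single site distribution and $C$ is a constant independent of all parameters.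
   Context: The Anderson Hamiltonian is the random operator $H_\omega=-\Delta+V_\omega$ on $\ell^2(\mathbb{Z}^d)$, where $(\Delta\varphi)(x)=-\sum_{y\in\mathbb{Z}^d,|x-y|=1}\varphi(y)$ and $\{V_\omega(x)\}_{x\in\mathbb{Z}^d}$ are independent identically distributed random variables on a probability space $(\Omega,\mathbb{P})$ (expectation $\mathbb{E}$) whose common distribution has a bounded density $\rho$ with compact support. $R(z)=(H-z)^{-1}$. The region of complete localization $\Xi^{\mathrm{CL}}$ is the set of $E\in\mathbb{R}$ for which there are an open interval $I_E\ni E$, $s\in(0,1)$, $K<\infty$, $\ell>0$ with $\sup_{E'\in I_E}\sup_{\eta\ne0}\mathbb{E}\{|\langle\delta_x,R(E'+i\eta)\delta_y\rangle|^s\}\le Ke^{-|x-y|/\ell}$ for all $x,y$. Let $U(a)$ be the translations $U(a)\delta_b=\delta_{b+a}$ and $\tau_a$ the corresponding shifts of the potential, so $U(a)H_\omega U(a)^*=H_{\tau_a\omega}$. Let $\mathcal{K}_2$ be the Hilbert space of (a.e.-equivalence classes of) measurable maps $\omega\mapsto A_\omega$ of linear operators from finitely supported functions into $\ell^2(\mathbb{Z}^d)$ which are covariant ($U(a)A_\omega U(a)^*=A_{\tau_a\omega}$), locally bounded, and satisfy $\mathbb{E}\{\langle\delta_0,|\overline{A_\omega}|^2\delta_0\rangle\}<\infty$, with inner product $\langle\langle A,B\rangle\rangle=\mathbb{E}\{\langle A_\omega\delta_0,B_\omega\delta_0\rangle\}$. On $\mathcal{K}_2$ define the commuting bounded self-adjoint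 operators $\mathcal{H}_LA=HA$, $\mathcal{H}_RA=AH$, and $\mathcal{L}=\mathcal{H}_L-\mathcal{H}_R$, and $\mathcal{P}_{E_F}=\chi_{(-\infty,E_F]}(\mathcal{H}_L)-\chi_{(-\infty,E_F]}(\mathcal{H}_R)$. Let $X_1$ be multiplication by the first coordinate, $P_{E_F}=\chi_{(-\infty,E_F]}(H)$, and $Y_{E_F}=i[X_1,P_{E_F}]$ (which lies in $\mathcal{K}_2$ for $E_F\in\Xi^{\mathrm{CL}}$). The conductivity measure is $\Sigma_{E_F}(B)=\pi\langle\langle Y_{E_F},\chi_B(\mathcal{L})(-\mathcal{L}\mathcal{P}_{E_F})Y_{E_F}\rangle\rangle$ for Borel $B\subset\mathbb{R}$, and the average in phase conductivity is $\overline{\sigma}^{\mathrm{in}}_{E_F}(\nu)=\frac1\nu\Sigma_{E_F}([0,\nu])$ for $\nu>0$. *)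

theory Defs
  imports "HOL-Probability.Probability"
begin

text \<open>Points of Z^d are functions nat => int vanishing at indices >= d;
  coordinate i (0-based) is the (i+1)-th coordinate. So X_1 is x 0.\<close>

definition Zd :: "nat \<Rightarrow> (nat \<Rightarrow> int) set" where
  "Zd d = {x. \<forall>i\<ge>d. x i = 0}"

definition box :: "nat \<Rightarrow> nat \<Rightarrow> (nat \<Rightarrow> int) set" where
  "box d n = {a. (\<forall>i<d. \<bar>a i\<bar> \<le> int n) \<and> (\<forall>i\<ge>d. a i = 0)}"

definition zdist :: "nat \<Rightarrow> (nat \<Rightarrow> int) \<Rightarrow> (nat \<Rightarrow> int) \<Rightarrow> real" where
  "zdist d x y = sqrt (\<Sum>i<d. (real_of_int (x i - y i))^2)"

definition nbrs :: "nat \<Rightarrow> (nat \<Rightarrow> int) \<Rightarrow> (nat \<Rightarrow> int) set" where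
  "nbrs d x = {x(i := x i + 1) | i. i < d} \<union> {x(i := x i - 1) | i. i < d}"

text \<open>H_omega = -Delta + V_omega with (Delta phi)(x) = - sum_{|x-y|=1} phi(y),
  acting pointwise on arbitrary functions Z^d -> C (finite sums).\<close>
definition Hop :: "nat \<Rightarrow> ((nat \<Rightarrow> int) \<Rightarrow> real) \<Rightarrow> ((nat \<Rightarrow> int) \<Rightarrow> complex) \<Rightarrow> (nat \<Rightarrow> int) \<Rightarrow> complex" where
  "Hop d \<omega> f x = (\<Sum>y\<in>nbrs d x. f y) + complex_of_real (\<omega> x) * f x"

definition delta :: "(nat \<Rightarrow> int) \<Rightarrow> (nat \<Rightarrow> int) \<Rightarrow> complex" where
  "delta y = (\<lambda>x. if x = y then 1 else 0)"

definition innerZ :: "nat \<Rightarrow> ((nat \<Rightarrow> int) \<Rightarrow> complex) \<Rightarrow> ((nat \<Rightarrow> int) \<Rightarrow> complex) \<Rightarrow> complex" where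
  "innerZ d u v = infsum (\<lambda>x. cnj (u x) * v x) (Zd d)"

text \<open>Spectral measure of H_omega for a finitely supported vector v: the unique
  compactly supported finite Borel measure on R whose moments are <v, H^n v>
  (unique by Weierstrass approximation).\<close>
definition specmeas :: "nat \<Rightarrow> ((nat \<Rightarrow> int) \<Rightarrow> real) \<Rightarrow> ((nat \<Rightarrow> int) \<Rightarrow> complex) \<Rightarrow> real measure" where
  "specmeas d \<omega> v = (THE \<mu>. sets \<mu> = sets borel \<and> finite_measure \<mu> \<and>
      (\<exists>R. emeasure \<mu> (UNIV - {-R..R}) = 0) \<and>
      (\<forall>n. complex_of_real (\<integral>t. t ^ n \<partial>\<mu>) = innerZ d v ((Hop d \<omega> ^^ n) v)))"

text \<open>Matrix element <delta_x, f(H_omega) delta_y> for a bounded Borel f (polarization;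
  H_omega is real symmetric).\<close>
definition fmat :: "nat \<Rightarrow> ((nat \<Rightarrow> int) \<Rightarrow> real) \<Rightarrow> (real \<Rightarrow> complex) \<Rightarrow> (nat \<Rightarrow> int) \<Rightarrow> (nat \<Rightarrow> int) \<Rightarrow> complex" where
  "fmat d \<omega> f x y =
     ((\<integral>t. f t \<partial>specmeas d \<omega> (\<lambda>z. delta x z + delta y z))
      - (\<integral>t. f t \<partial>specmeas d \<omega> (\<lambda>z. delta x z - delta y z))) / 4"

definition green :: "nat \<Rightarrow> ((nat \<Rightarrow> int) \<Rightarrow> real) \<Rightarrow> complex \<Rightarrow> (nat \<Rightarrow> int) \<Rightarrow> (nat \<Rightarrow> int) \<Rightarrow> complex" where
  "green d \<omega> z x y = fmat d \<omega> (\<lambda>t. 1 / (complex_of_real t - z)) x y"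

definition fermiP :: "nat \<Rightarrow> ((nat \<Rightarrow> int) \<Rightarrow> real) \<Rightarrow> real \<Rightarrow> (nat \<Rightarrow> int) \<Rightarrow> (nat \<Rightarrow> int) \<Rightarrow> complex" where
  "fermiP d \<omega> E x y = fmat d \<omega> (\<lambda>t. if t \<le> E then 1 else 0) x y"

definition single_site_density :: "(real \<Rightarrow> real) \<Rightarrow> bool" where
  "single_site_density \<rho> \<longleftrightarrow> \<rho> \<in> borel_measurable borel \<and> (\<forall>t. 0 \<le> \<rho> t) \<and>
     (\<integral>\<^sup>+ t. ennreal (\<rho> t) \<partial>lborel) = 1 \<and> (\<exists>M. \<forall>t. \<rho> t \<le> M) \<and>
     (\<exists>R. \<forall>t. R < \<bar>t\<bar> \<longrightarrow> \<rho> t = 0)"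

definition Omega :: "nat \<Rightarrow> (real \<Rightarrow> real) \<Rightarrow> ((nat \<Rightarrow> int) \<Rightarrow> real) measure" where
  "Omega d \<rho> = PiM (Zd d) (\<lambda>_. density lborel (\<lambda>t. ennreal (\<rho> t)))"

definition normInf :: "(real \<Rightarrow> real) \<Rightarrow> ereal" where
  "normInf \<rho> = esssup lborel (\<lambda>t. ereal \<bar>\<rho> t\<bar>)"

text \<open>Y_omega = i[X_1, P_{E_F}] applied to a vector g (finitely supported in box d n).\<close>
definition Yapply :: "nat \<Rightarrow> ((nat \<Rightarrow> int) \<Rightarrow> real) \<Rightarrow> real \<Rightarrow> nat \<Rightarrow> ((nat \<Rightarrow> int) \<Rightarrow> complex) \<Rightarrow> (nat \<Rightarrow> int) \<Rightarrow> complex" where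
  "Yapply d \<omega> E n g = (\<lambda>x. \<Sum>a\<in>box d n. g a * (\<i> * of_int (x 0 - a 0) * fermiP d \<omega> E x a))"

text \<open>Joint moments <<Y, H_L^m H_R^n Y>> = E{<Y delta_0, H^m Y H^n delta_0>}.\<close>
definition Ymoment :: "nat \<Rightarrow> (real \<Rightarrow> real) \<Rightarrow> real \<Rightarrow> nat \<Rightarrow> nat \<Rightarrow> complex" where
  "Ymoment d \<rho> E m n = (\<integral>\<omega>. innerZ d (Yapply d \<omega> E 0 (delta (\<lambda>_. 0)))
        ((Hop d \<omega> ^^ m) (Yapply d \<omega> E n ((Hop d \<omega> ^^ n) (delta (\<lambda>_. 0))))) \<partial>Omega d \<rho>)"

text \<open>Joint spectral measure of the commuting pair (H_L, H_R) in the vector Y: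
  unique compactly supported finite Borel measure on R^2 with these moments.\<close>
definition Yjoint :: "nat \<Rightarrow> (real \<Rightarrow> real) \<Rightarrow> real \<Rightarrow> (real \<times> real) measure" where
  "Yjoint d \<rho> E = (THE \<mu>. sets \<mu> = sets borel \<and> finite_measure \<mu> \<and>
      (\<exists>R. emeasure \<mu> (UNIV - {-R..R} \<times> {-R..R}) = 0) \<and>
      (\<forall>m n. complex_of_real (\<integral>p. fst p ^ m * snd p ^ n \<partial>\<mu>) = Ymoment d \<rho> E m n))"

text \<open>Sigma_{E_F}(B) = pi <<Y, chi_B(L)(-L P) Y>>, computed with the joint spectral
  measure: L = lambda1 - lambda2, P = chi(lambda1 <= E) - chi(lambda2 <= E).\<close>
definition cond_measure :: "nat \<Rightarrow> (real \<Rightarrow> real) \<Rightarrow> real \<Rightarrow> real set \<Rightarrow> real" where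
  "cond_measure d \<rho> E B = pi * (\<integral>p. indicator {q. fst q - snd q \<in> B} p *
       (- (fst p - snd p) * ((if fst p \<le> E then 1 else 0) - (if snd p \<le> E then 1 else 0)))
       \<partial>Yjoint d \<rho> E)"

definition sigma_in :: "nat \<Rightarrow> (real \<Rightarrow> real) \<Rightarrow> real \<Rightarrow> real \<Rightarrow> real" where
  "sigma_in d \<rho> E \<nu> = cond_measure d \<rho> E {0..\<nu>} / \<nu>"

definition loc_estimate :: "nat \<Rightarrow> (real \<Rightarrow> real) \<Rightarrow> real \<Rightarrow> real \<Rightarrow> real \<Rightarrow> real \<Rightarrow> real \<Rightarrow> bool" where
  "loc_estimate d \<rho> a b s K l \<longleftrightarrow>
     (\<forall>E'\<in>{a<..<b}. \<forall>\<eta>::real. \<eta> \<noteq> 0 \<longrightarrow> (\<forall>x\<in>Zd d. \<forall>y\<in>Zd d.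
        (\<integral>\<^sup>+\<omega>. ennreal (cmod (green d \<omega> (Complex E' \<eta>) x y) powr s) \<partial>Omega d \<rho>)
          \<le> ennreal (K * exp (- zdist d x y / l))))"

end

theory Submission
  imports Defs "HOL-Computational_Algebra.Polynomial"
begin

text \<open>
  Everything is done in infinite volume. The spectral measures and the joint measure of the pair
  \<open>(H\<^sub>L, H\<^sub>R)\<close> in \<open>Y\<close> are given only by their moments, so they are produced by the Hausdorff moment
  problem; for the joint measure the required positivity is that of the trace per unit volume,
  \<open>\<langle>\<langle>Y, f(H\<^sub>L) g(H\<^sub>R) Y\<rangle>\<rangle> = T((Y \<surd>g)\<^sup>* f (Y \<surd>g))\<close>, which follows from the translation invariance of
  the potential.

  On \<open>\<lambda>\<^sub>1 - \<lambda>\<^sub>2 \<in> [0, \<nu>]\<close> the density \<open>- \<L> \<P>\<close> is at most \<open>\<nu>\<close> and lives on \<open>(E, E + \<nu>] \<times> (E - \<nu>, E]\<close>.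
  Writing \<open>F\<^sub>\<plusminus>\<close> for the spectral projections of these intervals, the averaged conductivity is therefore
  at most \<open>\<pi> T(F\<^sub>- X F\<^sub>+ X F\<^sub>-)\<close>. The Fermi projection decays exponentially in mean (write it as an
  integral of the resolvent along the vertical line through \<open>E\<close> and use fractional moments), so up to
  errors of higher order only sites in a box of side \<open>L \<approx> l ln (1/\<nu>)\<close> matter. There the
  trace is at most \<open>2 L\<^sup>2\<close> times the sum over the sites \<open>j\<close> of \<open>F\<^sub>+(j,j) F\<^sub>-(0,0)\<close>, and each term is
  a two-site determinant of \<open>F\<^sub>+ + F\<^sub>-\<close>, up to a sum that vanishes by orthogonality. Minami's estimate
  bounds the expected determinant by \<open>4 \<pi>\<^sup>2 \<nu>\<^sup>2\<close> times the square of the sup norm of the density: by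
  rank one perturbation, averaging over the two potentials at \<open>0\<close> and \<open>j\<close> bounds the expected
  determinant of the imaginary part of the resolvent.
\<close>

section \<open>Bounded Borel functions and the monotone class theorem\<close>

definition bdd_borel :: "('a::topological_space \<Rightarrow> real) \<Rightarrow> bool" where
  "bdd_borel f \<longleftrightarrow> f \<in> borel_measurable borel \<and> (\<exists>B. \<forall>x. \<bar>f x\<bar> \<le> B)"

lemma bdd_borelI: "f \<in> borel_measurable borel \<Longrightarrow> (\<And>x. \<bar>f x\<bar> \<le> B) \<Longrightarrow> bdd_borel f"
  unfolding bdd_borel_def by blast

lemma bdd_borel_measurable[measurable_dest]: "bdd_borel f \<Longrightarrow> f \<in> borel_measurable borel"
  by (simp add: bdd_borel_def)

lemma bdd_borelE:
  assumes "bdd_borel f" obtains B where "0 \<le> B" "\<And>x. \<bar>f x\<bar> \<le> B"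
  using assms unfolding bdd_borel_def by (metis abs_ge_zero order_trans)

lemma bdd_borel_const: "bdd_borel (\<lambda>_. c)"
  by (rule bdd_borelI[where B="\<bar>c\<bar>"]) auto

lemma bdd_borel_indicator: "A \<in> sets borel \<Longrightarrow> bdd_borel (indicator A)"
  by (rule bdd_borelI[where B=1]) (auto simp: indicator_def)

lemma bdd_borel_add:
  assumes "bdd_borel f" "bdd_borel g" shows "bdd_borel (\<lambda>x. f x + g x)"
proof -
  obtain B where "\<And>x. \<bar>f x\<bar> \<le> B" using bdd_borelE[OF assms(1)] by metis
  moreover obtain C where "\<And>x. \<bar>g x\<bar> \<le> C" using bdd_borelE[OF assms(2)] by metis
  ultimately show ?thesis
    using assms by (intro bdd_borelI[where B="B+C"])
      (auto intro!: borel_measurable_add bdd_borel_measurable intro: order_trans[OF abs_triangle_ineq add_mono])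
qed

lemma bdd_borel_mult:
  assumes "bdd_borel f" "bdd_borel g" shows "bdd_borel (\<lambda>x. f x * g x)"
proof -
  obtain B where "\<And>x. \<bar>f x\<bar> \<le> B" using bdd_borelE[OF assms(1)] by metis
  moreover obtain C where "\<And>x. \<bar>g x\<bar> \<le> C" using bdd_borelE[OF assms(2)] by metis
  ultimately show ?thesis
    using assms by (intro bdd_borelI[where B="B*C"])
      (auto intro!: borel_measurable_times bdd_borel_measurable mult_mono
        simp: abs_mult intro: order_trans[OF abs_ge_zero])
qed

lemma bdd_borel_cmult: "bdd_borel f \<Longrightarrow> bdd_borel (\<lambda>x. c * f x)"
  by (rule bdd_borel_mult[OF bdd_borel_const])

lemma bdd_borel_diff: "bdd_borel f \<Longrightarrow> bdd_borel g \<Longrightarrow> bdd_borel (\<lambda>x. f x - g x)"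
  using bdd_borel_add[OF _ bdd_borel_cmult[of g "-1"], of f] by simp

lemma bdd_borel_sum: "(\<And>i. i \<in> I \<Longrightarrow> bdd_borel (f i)) \<Longrightarrow> bdd_borel (\<lambda>x. \<Sum>i\<in>I. f i x)"
  by (induction I rule: infinite_finite_induct) (auto intro: bdd_borel_add bdd_borel_const)

lemma bdd_borel_compose:
  assumes "bdd_borel f" "h \<in> borel_measurable borel"
  shows "bdd_borel (\<lambda>x. f (h x))"
proof -
  obtain B where "\<And>x. \<bar>f x\<bar> \<le> B" using bdd_borelE[OF assms(1)] by metis
  then show ?thesis
    by (intro bdd_borelI[OF measurable_compose[OF assms(2) bdd_borel_measurable[OF assms(1)]]])
qed

lemma bdd_borel_continuous_compact:
  fixes f :: "'a::t2_space \<Rightarrow> real"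
  assumes "continuous_on UNIV f" "compact K"
  shows "bdd_borel (\<lambda>x. f x * indicator K x)"
proof -
  have "bounded (f ` K)"
    using assms by (intro compact_imp_bounded compact_continuous_image) (auto intro: continuous_on_subset)
  then obtain B where "\<And>x. x \<in> K \<Longrightarrow> \<bar>f x\<bar> \<le> B"
    unfolding bounded_iff by auto
  moreover have "K \<in> sets borel" using assms(2) by (simp add: borel_compact)
  ultimately show ?thesis
    using borel_measurable_continuous_onI[OF assms(1)]
    by (intro bdd_borelI[where B="max B 0"] borel_measurable_times borel_measurable_indicator)
      (auto simp: indicator_def le_max_iff_disj)
qed

lemma bdd_borel_LIMSEQ:
  fixes F :: "nat \<Rightarrow> 'a::topological_space \<Rightarrow> real"
  assumes "\<And>n. bdd_borel (F n)" "\<And>n x. \<bar>F n x\<bar> \<le> B" "\<And>x. (\<lambda>n. F n x) \<longlonglongrightarrow> f x"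
  shows "bdd_borel f"
proof (rule bdd_borelI[OF borel_measurable_LIMSEQ_real[OF assms(3)]])
  show "\<bar>f x\<bar> \<le> B" for x
    by (rule tendsto_upperbound[OF tendsto_rabs[OF assms(3)]]) (use assms(2) in auto)
qed (use assms(1) bdd_borel_measurable in auto)

locale bounded_limit_class =
  fixes P :: "('a::metric_space \<Rightarrow> real) \<Rightarrow> bool"
  assumes closed_add: "bdd_borel f \<Longrightarrow> bdd_borel g \<Longrightarrow> P f \<Longrightarrow> P g \<Longrightarrow> P (\<lambda>x. f x + g x)"
    and closed_cmult: "bdd_borel f \<Longrightarrow> P f \<Longrightarrow> P (\<lambda>x. c * f x)"
    and closed_limit: "(\<And>n. bdd_borel (F n)) \<Longrightarrow> (\<And>n. P (F n)) \<Longrightarrow> (\<And>n x. \<bar>F n x\<bar> \<le> B) \<Longrightarrow>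
         (\<And>x. (\<lambda>n. F n x) \<longlonglongrightarrow> f x) \<Longrightarrow> P f"
begin

lemma uniform_limit:
  assumes F: "\<And>n. bdd_borel (F n)" "\<And>n. P (F n)" and f: "bdd_borel f"
    and close: "\<And>n x. \<bar>F n x - f x\<bar> \<le> inverse (real (Suc n))"
  shows "P f"
proof -
  obtain B where B: "\<And>x. \<bar>f x\<bar> \<le> B" using bdd_borelE[OF f] by metis
  show ?thesis
  proof (rule closed_limit[OF F])
    show "\<bar>F n x\<bar> \<le> B + 1" for n x
      using close[of n x] B[of x] le_imp_inverse_le[of 1 "real (Suc n)"] by simp
    show "(\<lambda>n. F n x) \<longlonglongrightarrow> f x" for x
      by (rule Lim_transform_bound[OF _ LIMSEQ_inverse_real_of_nat, THEN Lim_null[THEN iffD2]])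
        (use close in simp)
  qed
qed

end

inductive linear_combination :: "('a \<Rightarrow> real) set \<Rightarrow> ('a \<Rightarrow> real) \<Rightarrow> bool" for S where
  base: "f \<in> S \<Longrightarrow> linear_combination S f"
| add: "linear_combination S f \<Longrightarrow> linear_combination S g \<Longrightarrow> linear_combination S (\<lambda>x. f x + g x)"
| scale: "linear_combination S f \<Longrightarrow> linear_combination S (\<lambda>x. c * f x)"

lemma linear_combination_mult_base:
  assumes "linear_combination S g" "\<And>h. h \<in> S \<Longrightarrow> (\<lambda>x. f x * h x) \<in> S"
  shows "linear_combination S (\<lambda>x. f x * g x)"
  using assms(1)
proof induction
  case (base h) then show ?case by (intro linear_combination.base assms(2))
next
  case (add g h)
  from linear_combination.add[OF add.IH] show ?case by (simp add: algebra_simps)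
next
  case (scale g c)
  from linear_combination.scale[OF scale.IH, of c] show ?case by (simp add: algebra_simps)
qed

lemma linear_combination_mult:
  assumes "linear_combination S f" "linear_combination S g"
    and "\<And>f g. f \<in> S \<Longrightarrow> g \<in> S \<Longrightarrow> (\<lambda>x. f x * g x) \<in> S"
  shows "linear_combination S (\<lambda>x. f x * g x)"
  using assms(1)
proof induction
  case (base f) then show ?case by (intro linear_combination_mult_base assms)
next
  case (add f h)
  from linear_combination.add[OF add.IH] show ?case by (simp add: algebra_simps)
next
  case (scale f c)
  from linear_combination.scale[OF scale.IH, of c] show ?case by (simp add: algebra_simps)
qed

locale separating_system =
  fixes K :: "'a::metric_space set" and S :: "('a \<Rightarrow> real) set"
  assumes compact: "compact K"
    and continuous: "f \<in> S \<Longrightarrow> continuous_on UNIV f"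
    and one: "(\<lambda>_. 1) \<in> S"
    and mult: "f \<in> S \<Longrightarrow> g \<in> S \<Longrightarrow> (\<lambda>x. f x * g x) \<in> S"
    and separates: "x \<in> K \<Longrightarrow> y \<in> K \<Longrightarrow> x \<noteq> y \<Longrightarrow> \<exists>f\<in>S. f x \<noteq> f y"
begin

lemma continuous_linear_combination: "linear_combination S f \<Longrightarrow> continuous_on UNIV f"
  by (induction rule: linear_combination.induct) (auto intro!: continuous_intros intro: continuous)

lemma linear_combination_dense:
  assumes "continuous_on K f" "0 < e"
  shows "\<exists>g. linear_combination S g \<and> (\<forall>x\<in>K. \<bar>f x - g x\<bar> < e)"
proof (rule Stone_Weierstrass_HOL[OF compact _ _ _ _ _ assms])
  show "linear_combination S (\<lambda>_. c)" for c
    using linear_combination.scale[OF linear_combination.base[OF one], of c] by simp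
  show "continuous_on K f" if "linear_combination S f" for f
    using continuous_linear_combination[OF that] by (rule continuous_on_subset) simp
  show "\<exists>f. linear_combination S f \<and> f x \<noteq> f y" if "x \<in> K \<and> y \<in> K \<and> x \<noteq> y" for x y
    using separates that linear_combination.base by blast
qed (auto intro: linear_combination.add linear_combination_mult mult)

end

locale monotone_class = separating_system K S + bounded_limit_class P
  for K :: "'a::metric_space set" and S P +
  assumes generators: "f \<in> S \<Longrightarrow> P (\<lambda>x. f x * indicator K x)"
begin

lemma K_borel[measurable]: "K \<in> sets borel"
  using compact by (rule borel_compact)

lemma continuous_restricted:
  assumes f: "continuous_on UNIV f"
  shows "P (\<lambda>x. f x * indicator K x)"
proof -
  note bb = bdd_borel_continuous_compact[OF _ compact]
  have lc: "P (\<lambda>x. g x * indicator K x)" if "linear_combination S g" for g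
    using that
  proof induction
    case (base f) then show ?case by (rule generators)
  next
    case (add f g)
    then show ?case using closed_add bb[OF continuous_linear_combination]
      by (simp add: distrib_right)
  next
    case (scale f c)
    then show ?case using closed_cmult bb[OF continuous_linear_combination]
      by (simp add: mult.assoc)
  qed
  have "\<exists>g. linear_combination S g \<and> (\<forall>x\<in>K. \<bar>f x - g x\<bar> < inverse (real (Suc n)))" for n
    by (rule linear_combination_dense) (use f in \<open>auto intro: continuous_on_subset\<close>)
  then obtain g where g: "\<And>n. linear_combination S (g n)"
      "\<And>n x. x \<in> K \<Longrightarrow> \<bar>f x - g n x\<bar> < inverse (real (Suc n))" by metis
  show ?thesis
  proof (rule uniform_limit[OF bb[OF continuous_linear_combination[OF g(1)]] lc[OF g(1)] bb[OF f]])
    show "\<bar>g n x * indicator K x - f x * indicator K x\<bar> \<le> inverse (real (Suc n))" for n x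
      using g(2)[of x n] by (cases "x \<in> K") auto
  qed
qed

lemma closed_restricted:
  assumes C: "closed C"
  shows "P (\<lambda>x. indicator C x * indicator K x)"
proof (cases "C = {}")
  case True then show ?thesis using continuous_restricted[of "\<lambda>_. 0"] by simp
next
  case False
  let ?h = "\<lambda>n x. max 0 (1 - real n * infdist x C)"
  have cont: "continuous_on UNIV (?h n)" for n by (intro continuous_intros)
  show ?thesis
  proof (rule closed_limit[where F="\<lambda>n x. ?h n x * indicator K x" and B=1])
    show "bdd_borel (\<lambda>x. ?h n x * indicator K x)" for n
      by (rule bdd_borel_continuous_compact[OF cont compact])
    show "P (\<lambda>x. ?h n x * indicator K x)" for n by (rule continuous_restricted[OF cont])
    show "\<bar>?h n x * indicator K x\<bar> \<le> 1" for n x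
      using infdist_nonneg[of x C] by (auto simp: indicator_def max_def)
    have "(\<lambda>n. ?h n x) \<longlonglongrightarrow> indicator C x" for x
    proof (cases "x \<in> C")
      case False
      then have pos: "infdist x C > 0"
        using C \<open>C \<noteq> {}\<close> in_closed_iff_infdist_zero infdist_nonneg[of x C] by fastforce
      obtain N where N: "1 < real N * infdist x C" using ex_less_of_nat_mult[OF pos] by blast
      have "eventually (\<lambda>n. ?h n x = 0) sequentially"
        using eventually_ge_at_top[of N]
      proof eventually_elim
        case (elim n)
        then have "real N * infdist x C \<le> real n * infdist x C" using pos by simp
        with N show ?case by simp
      qed
      then show ?thesis using False by (simp add: tendsto_eventually)
    qed simp
    then show "(\<lambda>n. ?h n x * indicator K x) \<longlonglongrightarrow> indicator C x * indicator K x" for x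
      by (intro tendsto_mult_right)
  qed
qed

lemma borel_set_restricted:
  assumes "A \<in> sets borel"
  shows "P (\<lambda>x. indicator A x * indicator K x)"
proof -
  have bb: "bdd_borel (\<lambda>x. indicator A x * indicator K x :: real)" if "A \<in> sets borel" for A
    by (intro bdd_borel_mult bdd_borel_indicator that K_borel)
  have "Int_stable (Collect closed :: 'a set set)" "Collect closed \<subseteq> Pow (UNIV :: 'a set)"
      "A \<in> sigma_sets UNIV (Collect closed)"
    using assms by (auto simp: Int_stable_def borel_eq_closed)
  then show ?thesis
  proof (induction rule: sigma_sets_induct_disjoint)
    case (basic A) then show ?case using closed_restricted by auto
  next
    case empty then show ?case using closed_restricted[of "{}"] by simp
  next
    case (compl A)
    then have A: "A \<in> sets borel" by (simp add: borel_eq_closed)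
    have "P (\<lambda>x. indicator UNIV x * indicator K x + (-1) * (indicator A x * indicator K x))"
      by (intro closed_add closed_cmult closed_restricted compl
          bb A bdd_borel_cmult) auto
    also have "(\<lambda>x. indicator UNIV x * indicator K x + (-1) * (indicator A x * indicator K x))
        = (\<lambda>x. indicator (UNIV - A) x * indicator K x :: real)"
      by (auto simp: indicator_def fun_eq_iff)
    finally show ?case .
  next
    case (union A)
    then have A: "A i \<in> sets borel" for i by (auto simp: borel_eq_closed)
    have eq: "(\<Sum>i<n. indicator (A i) x * indicator K x) = (indicator (\<Union>i<n. A i) x * indicator K x :: real)" for n x
      by (subst indicator_UN_disjoint)
        (use union(1) in \<open>auto simp: disjoint_family_on_def sum_distrib_right\<close>)
    have fin: "P (\<lambda>x. indicator (\<Union>i<n. A i) x * indicator K x)" for n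
      unfolding eq[symmetric]
    proof (induction n)
      case 0 then show ?case using closed_restricted[of "{}"] by simp
    next
      case (Suc n)
      have "bdd_borel (\<lambda>x. \<Sum>i<n. indicator (A i) x * indicator K x :: real)"
        by (intro bdd_borel_sum bb A)
      from closed_add[OF this bb[OF A] Suc union(3)] show ?case by simp
    qed
    show ?case
    proof (rule closed_limit[OF bb fin])
      show "(\<lambda>n. indicator (\<Union>i<n. A i) x * indicator K x :: real) \<longlonglongrightarrow> indicator (\<Union>(range A)) x * indicator K x" for x
        by (intro tendsto_mult_right LIMSEQ_indicator_UN)
    qed (use A in \<open>auto simp: indicator_def\<close>)
  qed
qed

lemma nonneg_restricted:
  assumes "f \<in> borel_measurable borel" "\<And>x. 0 \<le> f x" "\<And>x. f x \<le> B"
  shows "P (\<lambda>x. f x * indicator K x)"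
  using assms
proof (induction f arbitrary: B rule: borel_measurable_induct_real)
  case (set A) then show ?case using borel_set_restricted by simp
next
  case (mult u c)
  show ?case
  proof (cases "c = 0")
    case True then show ?thesis using closed_restricted[of "{}"] by simp
  next
    case False
    then have B: "u x \<le> B / c" for x using mult.prems[of x] mult.hyps(1) by (simp add: field_simps)
    have "bdd_borel u" using mult B by (intro bdd_borelI[where B="B / c"]) auto
    then have "bdd_borel (\<lambda>x. u x * indicator K x)" by (intro bdd_borel_mult bdd_borel_indicator K_borel)
    from closed_cmult[OF this mult.IH[OF B]] show ?thesis by (simp add: mult.assoc)
  qed
next
  case (add u v)
  have B: "u x \<le> B" "v x \<le> B" for x using add.prems[of x] add.hyps(2,4)[of x] by linarith+
  have "bdd_borel u" "bdd_borel v" using add B by (auto intro!: bdd_borelI[where B=B])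
  then have "bdd_borel (\<lambda>x. v x * indicator K x)" "bdd_borel (\<lambda>x. u x * indicator K x)"
    by (auto intro!: bdd_borel_mult bdd_borel_indicator K_borel)
  from closed_add[OF this add.IH(2)[OF B(2)] add.IH(1)[OF B(1)]] show ?case
    by (simp add: distrib_right)
next
  case (seq U)
  have B: "U n x \<le> B" for n x
  proof -
    have "incseq (\<lambda>n. U n x)" using seq.hyps(3) by (simp add: incseq_def le_fun_def)
    then show ?thesis by (intro order_trans[OF incseq_le[OF _ seq.hyps(4)] seq.prems]) simp_all
  qed
  have bb: "bdd_borel (U n)" for n
    using seq.hyps(1,2) B by (intro bdd_borelI[where B=B]) auto
  show ?case
  proof (rule closed_limit[where F="\<lambda>n x. U n x * indicator K x" and B=B])
    show "bdd_borel (\<lambda>x. U n x * indicator K x)" for n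
      by (intro bdd_borel_mult bdd_borel_indicator bb K_borel)
    show "P (\<lambda>x. U n x * indicator K x)" for n by (rule seq.IH[OF B])
    show "\<bar>U n x * indicator K x\<bar> \<le> B" for n x
      using seq.hyps(2)[of n x] B[of n x] by (auto simp: indicator_def)
    show "(\<lambda>n. U n x * indicator K x) \<longlonglongrightarrow> f x * indicator K x" for x
      using seq.hyps(4)[of x] by (intro tendsto_mult_right) simp
  qed
qed

theorem bdd_borel_restricted:
  assumes f: "bdd_borel f"
  shows "P (\<lambda>x. f x * indicator K x)"
proof -
  obtain B where B: "0 \<le> B" "\<And>x. \<bar>f x\<bar> \<le> B" using bdd_borelE[OF f] by metis
  let ?c = "\<lambda>x. B * (indicator K x :: real)" and ?g = "\<lambda>x. (f x + B) * indicator K x"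
  have bb: "bdd_borel ?c" "bdd_borel ?g"
    by (intro bdd_borel_mult bdd_borel_add bdd_borel_const bdd_borel_indicator f K_borel)+
  have "P ?c" by (intro continuous_restricted continuous_intros)
  moreover have "0 \<le> f x + B" "f x + B \<le> 2 * B" for x using B(2)[of x] by linarith+
  then have "P ?g" using bdd_borel_measurable[OF f] by (intro nonneg_restricted[of _ "2 * B"]) auto
  ultimately have "P (\<lambda>x. ?g x + (-1) * ?c x)"
    by (intro closed_add[OF bb(2) bdd_borel_cmult[OF bb(1)]] closed_cmult[OF bb(1)])
  then show ?thesis by (simp add: algebra_simps)
qed

end

section \<open>Normal functionals and the uniqueness of moments\<close>

locale normal_functional =
  fixes A :: "('a::topological_space \<Rightarrow> real) \<Rightarrow> real"
  assumes add: "bdd_borel f \<Longrightarrow> bdd_borel g \<Longrightarrow> A (\<lambda>x. f x + g x) = A f + A g"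
    and scale: "bdd_borel f \<Longrightarrow> A (\<lambda>x. c * f x) = c * A f"
    and limit: "(\<And>n. bdd_borel (F n)) \<Longrightarrow> (\<And>n x. \<bar>F n x\<bar> \<le> B) \<Longrightarrow> (\<And>x. (\<lambda>n. F n x) \<longlonglongrightarrow> f x) \<Longrightarrow>
      (\<lambda>n. A (F n)) \<longlonglongrightarrow> A f"

lemma normal_functional_add:
  assumes "normal_functional A" "normal_functional B" shows "normal_functional (\<lambda>f. A f + B f)"
proof -
  interpret A: normal_functional A by fact
  interpret B: normal_functional B by fact
  show ?thesis
  proof
    fix F :: "nat \<Rightarrow> 'a \<Rightarrow> real" and f b
    assume F: "\<And>n. bdd_borel (F n)" "\<And>n x. \<bar>F n x\<bar> \<le> b" "\<And>x. (\<lambda>n. F n x) \<longlonglongrightarrow> f x"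
    show "(\<lambda>n. A (F n) + B (F n)) \<longlonglongrightarrow> A f + B f" by (rule tendsto_add[OF A.limit[OF F] B.limit[OF F]])
  qed (simp_all add: A.add A.scale B.add B.scale distrib_left)
qed

lemma normal_functional_cmult:
  assumes "normal_functional A" shows "normal_functional (\<lambda>f. c * A f)"
proof -
  interpret normal_functional A by fact
  show ?thesis
  proof
    fix F :: "nat \<Rightarrow> 'a \<Rightarrow> real" and f b
    assume F: "\<And>n. bdd_borel (F n)" "\<And>n x. \<bar>F n x\<bar> \<le> b" "\<And>x. (\<lambda>n. F n x) \<longlonglongrightarrow> f x"
    show "(\<lambda>n. c * A (F n)) \<longlonglongrightarrow> c * A f" by (rule tendsto_mult_left[OF limit[OF F]])
  qed (simp_all add: add scale distrib_left)
qed

lemma normal_functional_diff: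
  "normal_functional A \<Longrightarrow> normal_functional B \<Longrightarrow> normal_functional (\<lambda>f. A f - B f)"
  using normal_functional_add[OF _ normal_functional_cmult[of B "-1"], of A] by simp

lemma normal_functional_pullback:
  assumes A: "normal_functional A" and h: "h \<in> borel_measurable borel" and g: "bdd_borel g"
  shows "normal_functional (\<lambda>f. A (\<lambda>x. f (h x) * g x))"
proof -
  interpret normal_functional A by (rule A)
  have bb: "bdd_borel (\<lambda>x. f (h x) * g x)" if "bdd_borel f" for f
    by (intro bdd_borel_mult bdd_borel_compose[OF _ h] that g)
  show ?thesis
  proof
    fix f f' :: "'b \<Rightarrow> real" assume "bdd_borel f" "bdd_borel f'"
    then show "A (\<lambda>x. (f (h x) + f' (h x)) * g x) = A (\<lambda>x. f (h x) * g x) + A (\<lambda>x. f' (h x) * g x)"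
      using add[OF bb bb] by (simp add: distrib_right)
  next
    fix c and f :: "'b \<Rightarrow> real" assume "bdd_borel f"
    then show "A (\<lambda>x. c * f (h x) * g x) = c * A (\<lambda>x. f (h x) * g x)"
      using scale[OF bb, of f c] by (simp add: mult.assoc)
  next
    fix F :: "nat \<Rightarrow> 'b \<Rightarrow> real" and f B
    assume F: "\<And>n. bdd_borel (F n)" "\<And>n x. \<bar>F n x\<bar> \<le> B" "\<And>x. (\<lambda>n. F n x) \<longlonglongrightarrow> f x"
    obtain C where C: "0 \<le> C" "\<And>x. \<bar>g x\<bar> \<le> C" using bdd_borelE[OF g] by metis
    show "(\<lambda>n. A (\<lambda>x. F n (h x) * g x)) \<longlonglongrightarrow> A (\<lambda>x. f (h x) * g x)"
    proof (rule limit[where B="B * C"])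
      show "\<bar>F n (h x) * g x\<bar> \<le> B * C" for n x
        unfolding abs_mult using F(2)[of n "h x"] C by (intro mult_mono) auto
    qed (auto intro!: bb F tendsto_mult_right)
  qed
qed

lemma (in normal_functional) linear_combination:
  assumes "\<And>i. i \<in> I \<Longrightarrow> bdd_borel (f i)"
  shows "A (\<lambda>x. \<Sum>i\<in>I. c i * f i x) = (\<Sum>i\<in>I. c i * A (f i))"
  using assms
proof (induction I rule: infinite_finite_induct)
  case (insert i I)
  then show ?case by (simp add: add scale bdd_borel_sum bdd_borel_cmult)
qed (use scale[OF bdd_borel_const, of 0 0] in simp_all)

lemma normal_functional_eqI:
  assumes A: "normal_functional A" and B: "normal_functional B" and S: "separating_system K S"
    and eq: "\<And>f. f \<in> S \<Longrightarrow> A (\<lambda>x. f x * indicator K x) = B (\<lambda>x. f x * indicator K x)"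
    and f: "bdd_borel f"
  shows "A (\<lambda>x. f x * indicator K x) = B (\<lambda>x. f x * indicator K x)"
proof -
  interpret A: normal_functional A by (rule A)
  interpret B: normal_functional B by (rule B)
  interpret separating_system K S by (rule S)
  interpret monotone_class K S "\<lambda>f. A f = B f"
  proof
    fix F :: "nat \<Rightarrow> 'a \<Rightarrow> real" and f b
    assume F: "\<And>n. bdd_borel (F n)" "\<And>n. A (F n) = B (F n)" "\<And>n t. \<bar>F n t\<bar> \<le> b" "\<And>t. (\<lambda>n. F n t) \<longlonglongrightarrow> f t"
    show "A f = B f" using A.limit[OF F(1,3,4)] B.limit[OF F(1,3,4)] F(2) by (auto intro: LIMSEQ_unique)
  qed (auto simp: A.add A.scale B.add B.scale eq)
  show ?thesis by (rule bdd_borel_restricted[OF f])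
qed

definition finite_borel_on :: "'a::topological_space set \<Rightarrow> 'a measure \<Rightarrow> bool" where
  "finite_borel_on K M \<longleftrightarrow> finite_measure M \<and> sets M = sets borel \<and> emeasure M (UNIV - K) = 0"

lemma finite_borel_on_mono:
  assumes M: "finite_borel_on K M" and K: "K \<in> sets borel" "K \<subseteq> L"
  shows "finite_borel_on L M"
proof -
  have "emeasure M (UNIV - L) = 0"
    by (rule emeasure_eq_0[where N="UNIV - K"]) (use M K in \<open>auto simp: finite_borel_on_def\<close>)
  with M show ?thesis by (simp add: finite_borel_on_def)
qed

lemma AE_finite_borel_on:
  assumes "finite_borel_on K M" "K \<in> sets borel"
  shows "AE x in M. x \<in> K"
proof (rule AE_I[where N="UNIV - K"])
  show "{x \<in> space M. x \<notin> K} \<subseteq> UNIV - K" by auto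
qed (use assms in \<open>auto simp: finite_borel_on_def\<close>)

lemma integral_eq_integral_indicator:
  fixes f :: "'a::topological_space \<Rightarrow> real"
  assumes M: "finite_borel_on K M" and K: "K \<in> sets borel" and f: "f \<in> borel_measurable borel"
  shows "(\<integral>x. f x \<partial>M) = (\<integral>x. f x * indicator K x \<partial>M)"
proof (rule integral_cong_AE)
  have [measurable_cong]: "sets M = sets borel" using M by (simp add: finite_borel_on_def)
  note [measurable] = K f
  show "f \<in> borel_measurable M" "(\<lambda>x. f x * indicator K x) \<in> borel_measurable M" by measurable
  show "AE x in M. f x = f x * indicator K x"
    using AE_finite_borel_on[OF M K] by eventually_elim auto
qed

lemma integrable_bdd_borel:
  assumes M: "finite_borel_on K M" and f: "bdd_borel f"
  shows "integrable M f"
proof -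
  interpret finite_measure M using M by (simp add: finite_borel_on_def)
  have [measurable_cong]: "sets M = sets borel" using M by (simp add: finite_borel_on_def)
  obtain B where "\<And>x. \<bar>f x\<bar> \<le> B" using bdd_borelE[OF f] by metis
  then show ?thesis using bdd_borel_measurable[OF f]
    by (intro integrable_const_bound[where B=B]) auto
qed

lemma integrable_continuous:
  fixes f :: "'a::t2_space \<Rightarrow> real"
  assumes M: "finite_borel_on K M" and K: "compact K" and f: "continuous_on UNIV f"
  shows "integrable M f"
proof (rule integrable_cong_AE_imp)
  have sets: "sets M = sets borel" using M by (simp add: finite_borel_on_def)
  show "integrable M (\<lambda>x. f x * indicator K x)"
    by (rule integrable_bdd_borel[OF M bdd_borel_continuous_compact[OF f K]])
  show "f \<in> borel_measurable M"
    using borel_measurable_continuous_onI[OF f] by (simp add: measurable_cong_sets[OF sets refl])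
  show "AE x in M. f x * indicator K x = f x"
    using AE_finite_borel_on[OF M borel_compact[OF K]] by eventually_elim auto
qed

lemma normal_functional_integral:
  assumes M: "finite_borel_on K M"
  shows "normal_functional (\<lambda>f. \<integral>x. f x \<partial>M)"
proof
  fix F :: "nat \<Rightarrow> 'a \<Rightarrow> real" and f B
  assume F: "\<And>n. bdd_borel (F n)" "\<And>n x. \<bar>F n x\<bar> \<le> B" "\<And>x. (\<lambda>n. F n x) \<longlonglongrightarrow> f x"
  interpret finite_measure M using M by (simp add: finite_borel_on_def)
  have [measurable_cong]: "sets M = sets borel" using M by (simp add: finite_borel_on_def)
  have [measurable]: "F n \<in> borel_measurable borel" "f \<in> borel_measurable borel" for n
    using F(1) bdd_borel_LIMSEQ[OF F] bdd_borel_measurable by auto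
  show "(\<lambda>n. integral\<^sup>L M (F n)) \<longlonglongrightarrow> integral\<^sup>L M f"
    by (rule integral_dominated_convergence[where w="\<lambda>_. B"]) (use F in auto)
qed (simp_all add: integrable_bdd_borel[OF M])

lemma
  fixes A :: "('a::topological_space \<Rightarrow> real) \<Rightarrow> 'b \<Rightarrow> real"
  assumes A: "\<And>p. p \<in> space M \<Longrightarrow> normal_functional (\<lambda>f. A f p)"
    and meas: "\<And>f. bdd_borel f \<Longrightarrow> A f \<in> borel_measurable M" and W: "integrable M W"
    and dom: "\<And>f B p. bdd_borel f \<Longrightarrow> (\<And>t. \<bar>f t\<bar> \<le> B) \<Longrightarrow> p \<in> space M \<Longrightarrow> \<bar>A f p\<bar> \<le> B * W p"
  shows integrable_normal_functional: "bdd_borel f \<Longrightarrow> integrable M (A f)"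
    and normal_functional_integral_dominated: "normal_functional (\<lambda>f. \<integral>p. A f p \<partial>M)"
proof -
  have int: "integrable M (A f)" if f: "bdd_borel f" for f
  proof -
    obtain B where B: "\<And>t. \<bar>f t\<bar> \<le> B" using bdd_borelE[OF f] by metis
    show ?thesis
    proof (rule Bochner_Integration.integrable_bound[OF integrable_mult_right[OF W, of B] meas[OF f]])
      show "AE p in M. norm (A f p) \<le> norm (B * W p)"
        using dom[OF f B] by (intro AE_I2) (fastforce intro: order_trans)
    qed
  qed
  then show "bdd_borel f \<Longrightarrow> integrable M (A f)" .
  show "normal_functional (\<lambda>f. \<integral>p. A f p \<partial>M)"
  proof
    fix f g :: "'a \<Rightarrow> real" assume fg: "bdd_borel f" "bdd_borel g"
    have "(\<integral>p. A (\<lambda>x. f x + g x) p \<partial>M) = (\<integral>p. A f p + A g p \<partial>M)"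
      by (rule Bochner_Integration.integral_cong[OF refl]) (rule normal_functional.add[OF A fg])
    then show "(\<integral>p. A (\<lambda>x. f x + g x) p \<partial>M) = (\<integral>p. A f p \<partial>M) + (\<integral>p. A g p \<partial>M)"
      by (simp add: int fg)
  next
    fix f :: "'a \<Rightarrow> real" and c assume f: "bdd_borel f"
    have "(\<integral>p. A (\<lambda>x. c * f x) p \<partial>M) = (\<integral>p. c * A f p \<partial>M)"
      by (rule Bochner_Integration.integral_cong[OF refl]) (rule normal_functional.scale[OF A f])
    then show "(\<integral>p. A (\<lambda>x. c * f x) p \<partial>M) = c * (\<integral>p. A f p \<partial>M)" by simp
  next
    fix F :: "nat \<Rightarrow> 'a \<Rightarrow> real" and f B
    assume F: "\<And>n. bdd_borel (F n)" "\<And>n x. \<bar>F n x\<bar> \<le> B" "\<And>x. (\<lambda>n. F n x) \<longlonglongrightarrow> f x"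
    show "(\<lambda>n. \<integral>p. A (F n) p \<partial>M) \<longlonglongrightarrow> (\<integral>p. A f p \<partial>M)"
    proof (rule integral_dominated_convergence[where w="\<lambda>p. B * W p"])
      show "AE p in M. (\<lambda>n. A (F n) p) \<longlonglongrightarrow> A f p"
        by (rule AE_I2) (rule normal_functional.limit[OF A F])
      show "AE p in M. norm (A (F n) p) \<le> B * W p" for n
        unfolding real_norm_def by (rule AE_I2) (rule dom[OF F(1,2)])
    qed (use W meas F(1) bdd_borel_LIMSEQ[OF F] in auto)
  qed
qed

theorem finite_borel_on_eqI:
  assumes M: "finite_borel_on K M" and N: "finite_borel_on K N" and S: "separating_system K S"
    and eq: "\<And>f. f \<in> S \<Longrightarrow> (\<integral>x. f x \<partial>M) = (\<integral>x. f x \<partial>N)"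
  shows "M = N"
proof (rule measure_eqI)
  interpret separating_system K S by (rule S)
  interpret M: finite_measure M using M by (simp add: finite_borel_on_def)
  interpret N: finite_measure N using N by (simp add: finite_borel_on_def)
  have K: "K \<in> sets borel" using compact by (rule borel_compact)
  note restrict = integral_eq_integral_indicator[OF M K] integral_eq_integral_indicator[OF N K]
  show "sets M = sets N" using M N by (simp add: finite_borel_on_def)
  fix A assume "A \<in> sets M"
  then have A: "A \<in> sets borel" "A \<in> sets M" "A \<in> sets N" using M N by (auto simp: finite_borel_on_def)
  have "(\<integral>x. indicat_real A x * indicator K x \<partial>M) = (\<integral>x. indicator A x * indicator K x \<partial>N)"
    by (rule normal_functional_eqI[where A="integral\<^sup>L M" and B="integral\<^sup>L N",
            OF normal_functional_integral[OF M] normal_functional_integral[OF N] S _ bdd_borel_indicator[OF A(1)]])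
      (use eq restrict[OF borel_measurable_continuous_onI[OF continuous]] in simp)
  then have "measure M A = measure N A"
    using restrict[of "indicator A"] A by simp
  then show "emeasure M A = emeasure N A" by (simp add: M.emeasure_eq_measure N.emeasure_eq_measure)
qed

lemma separating_system_powers: "separating_system {-R..R} (range (\<lambda>n t::real. t ^ n))"
proof
  show "(\<lambda>t. f t * g t) \<in> range (\<lambda>n t::real. t ^ n)"
    if "f \<in> range (\<lambda>n t. t ^ n)" "g \<in> range (\<lambda>n t. t ^ n)" for f g
    using that by (auto simp: power_add[symmetric])
  show "(\<lambda>_. 1) \<in> range (\<lambda>n t::real. t ^ n)" by (rule range_eqI[of _ _ 0]) simp
  show "\<exists>f\<in>range (\<lambda>n t. t ^ n). f x \<noteq> f y" if "x \<noteq> y" for x y :: real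
    by (rule bexI[OF _ rangeI[of _ 1]]) (use that in simp)
qed (auto intro!: continuous_intros)

definition square :: "real \<Rightarrow> (real \<times> real) set" where
  "square R = {-R..R} \<times> {-R..R}"

lemma square_mono: "R \<le> S \<Longrightarrow> square R \<subseteq> square S"
  by (auto simp: square_def)

lemma compact_square: "compact (square R)"
  unfolding square_def by (intro compact_Times) auto

lemma square_borel[measurable]: "square R \<in> sets borel"
  using compact_square by (rule borel_compact)

definition monomial :: "nat \<Rightarrow> nat \<Rightarrow> real \<times> real \<Rightarrow> real" where
  "monomial m n p = fst p ^ m * snd p ^ n"

lemma continuous_monomial: "continuous_on A (monomial m n)"
  unfolding monomial_def by (intro continuous_intros)

lemma separating_system_monomials: "separating_system (square R) (range (\<lambda>(m, n). monomial m n))"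
proof
  let ?S = "range (\<lambda>(m, n). monomial m n)"
  have S: "monomial m n \<in> ?S" for m n by auto
  show "(\<lambda>p. f p * g p) \<in> ?S" if "f \<in> ?S" "g \<in> ?S" for f g
  proof -
    from that obtain m n m' n' where "f = monomial m n" "g = monomial m' n'" by auto
    then have "(\<lambda>p. f p * g p) = monomial (m+m') (n+n')"
      by (auto simp: monomial_def power_add fun_eq_iff)
    then show ?thesis using S by metis
  qed
  show "(\<lambda>_. 1) \<in> ?S" using S[of 0 0] by (simp add: monomial_def[abs_def])
  show "\<exists>f\<in>?S. f p \<noteq> f q" if "p \<noteq> q" for p q
  proof (cases "fst p = fst q")
    case True
    then show ?thesis using that by (intro bexI[OF _ S[of 0 1]]) (auto simp: monomial_def prod_eq_iff)
  next
    case False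
    then show ?thesis by (intro bexI[OF _ S[of 1 0]]) (auto simp: monomial_def)
  qed
qed (auto intro: compact_square continuous_monomial)

lemma moments_determine_measure:
  fixes M N :: "real measure"
  assumes M: "finite_borel_on {-R..R} M" and N: "finite_borel_on {-S..S} N"
    and eq: "\<And>n. (\<integral>t. t ^ n \<partial>M) = (\<integral>t. t ^ n \<partial>N)"
  shows "M = N"
proof (rule finite_borel_on_eqI[OF _ _ separating_system_powers[of "max R S"]])
  show "finite_borel_on {-max R S..max R S} M" "finite_borel_on {-max R S..max R S} N"
    using finite_borel_on_mono[OF M] finite_borel_on_mono[OF N] by (simp_all add: atLeastatMost_subset_iff)
qed (use eq in auto)

lemma joint_moments_determine_measure:
  assumes M: "finite_borel_on (square R) M" and N: "finite_borel_on (square S) N"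
    and eq: "\<And>m n. (\<integral>p. monomial m n p \<partial>M) = (\<integral>p. monomial m n p \<partial>N)"
  shows "M = N"
proof (rule finite_borel_on_eqI[OF _ _ separating_system_monomials[of "max R S"]])
  show "finite_borel_on (square (max R S)) M" "finite_borel_on (square (max R S)) N"
    using finite_borel_on_mono[OF M] finite_borel_on_mono[OF N] by (simp_all add: square_mono)
qed (use eq in auto)

section \<open>The two-dimensional Hausdorff moment problem\<close>

lemma binary_expansion:
  fixes x :: real
  assumes "x \<in> {0..1}"
  obtains d :: "nat \<Rightarrow> nat" where "\<And>i. d i \<le> 1" "(\<lambda>i. real (d i) * (1/2) ^ Suc i) sums x"
proof -
  define y where "y n = ((\<lambda>u. if u < 1/2 then 2 * u else 2 * u - 1) ^^ n) x" for n
  define d where "d n = (if y n < 1/2 then 0 else 1::nat)" for n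
  have y_Suc: "y (Suc n) = 2 * y n - real (d n)" for n by (simp add: y_def d_def)
  have y_range: "y n \<in> {0..1}" for n
  proof (induction n)
    case 0 show ?case using assms by (simp add: y_def)
  next
    case (Suc n) then show ?case by (auto simp: y_Suc d_def)
  qed
  have "(\<Sum>i<n. real (d i) * (1/2) ^ Suc i) = x - y n * (1/2) ^ n" for n
  proof (induction n)
    case 0 show ?case by (simp add: y_def)
  next
    case (Suc n) then show ?case by (simp add: y_Suc field_simps)
  qed
  moreover have "(\<lambda>n. y n * (1/2) ^ n) \<longlonglongrightarrow> 0"
    by (rule Lim_null_comparison[OF _ LIMSEQ_power_zero[of "1/2::real"]])
      (use y_range in \<open>auto simp: abs_mult power_abs intro!: mult_left_le_one_le\<close>)
  ultimately have "(\<lambda>i. real (d i) * (1/2) ^ Suc i) sums x"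
    using tendsto_diff[OF tendsto_const[of x]] by (fastforce simp: sums_def)
  then show ?thesis by (rule that[rotated]) (simp add: d_def)
qed

text \<open>Schoenberg's space-filling curve reduces weak compactness in the plane to Helly's theorem on
  the line: \<open>schoenberg 0\<close> and \<open>schoenberg 1\<close> read off the even and the odd ternary digits of points
  of the Cantor set.\<close>

definition schoenberg_wave :: "real \<Rightarrow> real" where
  "schoenberg_wave t = max 0 (min 1 (1/2 - cos (pi * t)))"

definition schoenberg :: "nat \<Rightarrow> real \<Rightarrow> real" where
  "schoenberg c t = (\<Sum>k. schoenberg_wave (3 ^ (2 * k + c) * t) * (1/2) ^ Suc k)"

lemma schoenberg_wave_range: "schoenberg_wave t \<in> {0..1}"
  by (auto simp: schoenberg_wave_def)

lemma schoenberg_wave_digit: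
  assumes "d \<le> (1::nat)" "r \<in> {0..1}"
  shows "schoenberg_wave (2 * of_int N + (2 * real d + r) / 3) = real d"
proof -
  let ?s = "(2 * real d + r) / 3"
  have "cos (pi * (2 * of_int N + ?s)) = cos (2 * pi * of_int N + pi * ?s)" by (simp add: algebra_simps)
  also have "\<dots> = cos (pi * ?s)" by (simp add: cos_add del: times_divide_eq_right)
  finally have eq: "cos (pi * (2 * of_int N + ?s)) = cos (pi * ?s)" .
  consider "d = 0" | "d = 1" using assms(1) by linarith
  then show ?thesis
  proof cases
    case 1
    have "cos (pi / 3) \<le> cos (pi * ?s)"
      using assms(2) 1 by (intro cos_monotone_0_pi_le) auto
    then show ?thesis unfolding schoenberg_wave_def eq using 1 by (simp add: cos_60)
  next
    case 2
    have "cos (pi * ?s) \<le> cos (2 * pi / 3)"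
      using assms(2) 2 by (intro cos_monotone_0_pi_le) auto
    then show ?thesis unfolding schoenberg_wave_def eq using 2 by (simp add: cos_120)
  qed
qed

lemma schoenberg_term_le: "norm (schoenberg_wave t * (1/2) ^ Suc k) \<le> (1/2) ^ Suc k"
  using schoenberg_wave_range[of t] by (simp add: abs_mult mult_left_le_one_le)

lemma continuous_schoenberg: "continuous_on UNIV (schoenberg c)"
proof (rule uniform_limit_theorem)
  show "uniform_limit UNIV (\<lambda>n t. \<Sum>k<n. schoenberg_wave (3 ^ (2 * k + c) * t) * (1/2) ^ Suc k) (schoenberg c) sequentially"
    unfolding schoenberg_def
    by (rule Weierstrass_m_test[OF schoenberg_term_le sums_summable[OF power_half_series]])
  show "\<forall>\<^sub>F n in sequentially. continuous_on UNIV (\<lambda>t. \<Sum>k<n. schoenberg_wave (3 ^ (2 * k + c) * t) * (1/2) ^ Suc k)"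
    unfolding schoenberg_wave_def by (intro always_eventually allI continuous_intros)
qed simp

lemma schoenberg_range: "schoenberg c t \<in> {0..1}"
proof -
  let ?f = "\<lambda>k. schoenberg_wave (3 ^ (2 * k + c) * t) * (1/2) ^ Suc k"
  have f: "0 \<le> ?f k" "?f k \<le> (1/2) ^ Suc k" for k
    using schoenberg_wave_range[of "3 ^ (2 * k + c) * t"] by (auto simp: mult_left_le_one_le)
  have s: "summable ?f"
    by (rule summable_comparison_test'[OF sums_summable[OF power_half_series] schoenberg_term_le])
  show ?thesis
    using suminf_nonneg[OF s f(1)] suminf_le[OF f(2) s sums_summable[OF power_half_series]]
      sums_unique[OF power_half_series] by (simp add: schoenberg_def)
qed

lemma schoenberg_wave_ternary:
  fixes d :: "nat \<Rightarrow> nat"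
  assumes d: "\<And>i. d i \<le> 1"
  obtains t where "t \<in> {0..1}" "\<And>n. schoenberg_wave (3 ^ n * t) = real (d n)"
proof -
  define u where "u n = (\<Sum>i. 2 * real (d (i + n)) * (1/3) ^ Suc i)" for n
  have third: "(\<lambda>i. 2 * (1/3::real) ^ Suc i) sums 1"
    using sums_mult[OF geometric_sums[of "1/3::real"], of "2/3"] by simp
  have le: "2 * real (d j) * (1/3) ^ Suc i \<le> 2 * (1/3) ^ Suc i" for i j using d[of j] by (simp add: mult_left_le_one_le)
  have s: "summable (\<lambda>i. 2 * real (d (i + n)) * (1/3) ^ Suc i)" for n
    by (rule summable_comparison_test'[OF sums_summable[OF third]]) (use le in simp)
  have u_range: "u n \<in> {0..1}" for n
    using suminf_nonneg[OF s[of n]] suminf_le[OF le s[of n] sums_summable[OF third]] sums_unique[OF third]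
    by (simp add: u_def)
  have u_Suc: "u n = (2 * real (d n) + u (Suc n)) / 3" for n
  proof -
    have "u n = 2 * real (d n) / 3 + (\<Sum>i. 2 * real (d (Suc i + n)) * (1/3) ^ Suc (Suc i))"
      using suminf_split_head[OF s[of n]] by (simp add: u_def)
    also have "(\<Sum>i. 2 * real (d (Suc i + n)) * (1/3) ^ Suc (Suc i)) = 1/3 * u (Suc n)"
      unfolding u_def by (subst suminf_mult[OF s, symmetric]) (simp add: mult_ac)
    finally show ?thesis by simp
  qed
  have "\<exists>N. 3 ^ n * u 0 = 2 * of_int N + u n" for n
  proof (induction n)
    case 0 show ?case by (rule exI[of _ 0]) simp
  next
    case (Suc n)
    then obtain N where "3 ^ n * u 0 = 2 * of_int N + u n" by blast
    then have "3 ^ Suc n * u 0 = 3 * (2 * of_int N + u n)" by simp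
    also have "\<dots> = 2 * of_int (3 * N + int (d n)) + u (Suc n)" using u_Suc[of n] by simp
    finally show ?case by blast
  qed
  then have "schoenberg_wave (3 ^ n * u 0) = real (d n)" for n
    using schoenberg_wave_digit[OF d u_range] u_Suc by metis
  with u_range show ?thesis by (rule that)
qed

lemma schoenberg_surj:
  assumes "x \<in> {0..1}" "y \<in> {0..1}"
  obtains t where "t \<in> {0..1}" "schoenberg 0 t = x" "schoenberg 1 t = y"
proof -
  obtain a where a: "\<And>i. a i \<le> 1" "(\<lambda>i. real (a i) * (1/2) ^ Suc i) sums x"
    using binary_expansion[OF assms(1)] by metis
  obtain b where b: "\<And>i. b i \<le> 1" "(\<lambda>i. real (b i) * (1/2) ^ Suc i) sums y"
    using binary_expansion[OF assms(2)] by metis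
  define d where "d n = (if even n then a (n div 2) else b (n div 2))" for n
  obtain t where t: "t \<in> {0..1}" "\<And>n. schoenberg_wave (3 ^ n * t) = real (d n)"
    by (rule schoenberg_wave_ternary[of d]) (auto simp: d_def a(1) b(1) simp del: One_nat_def)
  have "schoenberg_wave (3 ^ (2 * k) * t) = real (a k)" "schoenberg_wave (3 ^ (2 * k + 1) * t) = real (b k)" for k
    using t(2)[of "2 * k"] t(2)[of "2 * k + 1"] by (simp_all add: d_def)
  then show ?thesis
    using a(2) b(2) by (intro that[OF t(1)]) (simp_all add: schoenberg_def sums_iff)
qed

lemma square_filling_curve:
  assumes "0 < R"
  obtains g :: "real \<Rightarrow> real \<times> real" where "continuous_on UNIV g" "range g \<subseteq> square R" "square R \<subseteq> g ` {0..1}"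
proof
  let ?g = "\<lambda>t. (2 * R * schoenberg 0 t - R, 2 * R * schoenberg 1 t - R)"
  show "continuous_on UNIV ?g" by (intro continuous_intros continuous_schoenberg)
  show "range ?g \<subseteq> square R"
    using schoenberg_range[of 0] schoenberg_range[of 1] assms by (auto simp: square_def)
  show "square R \<subseteq> ?g ` {0..1}"
  proof
    fix p assume p: "p \<in> square R"
    obtain t where "t \<in> {0..1}" "schoenberg 0 t = (fst p + R) / (2 * R)" "schoenberg 1 t = (snd p + R) / (2 * R)"
      by (rule schoenberg_surj[of "(fst p + R) / (2 * R)" "(snd p + R) / (2 * R)"])
        (use p assms in \<open>auto simp: square_def\<close>)
    then show "p \<in> ?g ` {0..1}" using assms by (intro image_eqI[of _ _ t]) (auto simp: prod_eq_iff)
  qed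
qed

lemma helly_selection_unit_interval:
  fixes \<nu> :: "nat \<Rightarrow> real measure"
  assumes "\<And>n. real_distribution (\<nu> n)" "\<And>n. measure (\<nu> n) {0..1} = 1"
  obtains r M where "strict_mono r" "real_distribution M" "weak_conv_m (\<lambda>n. \<nu> (r n)) M"
proof -
  have "1 - e < measure (\<nu> n) {-1<..1}" if "0 < e" for e n
  proof -
    interpret real_distribution "\<nu> n" by (rule assms(1))
    have "measure (\<nu> n) {0..1} \<le> measure (\<nu> n) {-1<..1}" by (intro finite_measure_mono) auto
    then show ?thesis using assms(2)[of n] that by simp
  qed
  then have "tight \<nu>"
    unfolding tight_def by (intro conjI allI impI assms(1) exI[of _ "-1"] exI[of _ 1]) auto
  from tight_imp_convergent_subsubsequence[OF this strict_mono_id] show ?thesis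
    using that by (auto simp: o_def)
qed

lemma (in prob_space) finite_borel_on_distr:
  assumes "g \<in> borel_measurable M" "\<And>x. x \<in> space M \<Longrightarrow> g x \<in> K" "K \<in> sets borel"
  shows "finite_borel_on K (distr M borel g)"
proof -
  interpret D: prob_space "distr M borel g" by (rule prob_space_distr[OF assms(1)])
  have "g -` (UNIV - K) \<inter> space M = {}" using assms(2) by auto
  then show ?thesis
    using assms D.finite_measure_axioms by (simp add: finite_borel_on_def emeasure_distr)
qed

lemma weighted_points_compactness_prob:
  fixes I :: "nat \<Rightarrow> 'i set" and w :: "nat \<Rightarrow> 'i \<Rightarrow> real" and z :: "nat \<Rightarrow> 'i \<Rightarrow> real \<times> real"
  assumes R: "0 < R" and fin: "\<And>n. finite (I n)" and w: "\<And>n i. i \<in> I n \<Longrightarrow> 0 \<le> w n i"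
    and mass: "\<And>n. (\<Sum>i\<in>I n. w n i) = 1" and z: "\<And>n i. i \<in> I n \<Longrightarrow> z n i \<in> square R"
  obtains r M where "strict_mono r" "finite_borel_on (square R) M"
    "\<And>h. continuous_on UNIV h \<Longrightarrow> (\<lambda>n. \<Sum>i\<in>I (r n). w (r n) i * h (z (r n) i)) \<longlonglongrightarrow> (\<integral>p. h p \<partial>M)"
proof -
  obtain g :: "real \<Rightarrow> real \<times> real" where g: "continuous_on UNIV g" "range g \<subseteq> square R" "square R \<subseteq> g ` {0..1}"
    using that by (rule square_filling_curve[OF R])
  define t where "t n i = inv_into {0..1} g (z n i)" for n i
  have "z n i \<in> g ` {0..1}" if "i \<in> I n" for n i using z[OF that] g(3) by blast
  then have t: "t n i \<in> {0..1}" "g (t n i) = z n i" if "i \<in> I n" for n i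
    using inv_into_into[of "z n i" g "{0..1}"] f_inv_into_f[of "z n i" g "{0..1}"] that by (auto simp: t_def)
  define D where "D n = point_measure (I n) (\<lambda>i. ennreal (w n i))" for n
  have D: "space (D n) = I n" "sets (D n) = Pow (I n)" for n
    by (auto simp: D_def space_point_measure sets_point_measure)
  have prob_D: "prob_space (D n)" for n
    by (rule prob_spaceI) (simp add: D, simp add: D_def emeasure_point_measure_finite fin sum_ennreal w mass)
  have meas_t: "t n \<in> borel_measurable (D n)" for n by (auto simp: measurable_def D)
  let ?\<nu> = "\<lambda>n. distr (D n) borel (t n)"
  have \<nu>: "real_distribution (?\<nu> n)" "measure (?\<nu> n) {0..1} = 1" for n
  proof -
    interpret prob_space "D n" by (rule prob_D)
    have "t n -` {0..1} \<inter> space (D n) = space (D n)" using t(1) by (auto simp: D)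
    then show "real_distribution (?\<nu> n)" "measure (?\<nu> n) {0..1} = 1"
      using meas_t[of n] prob_space by (simp_all add: measure_distr)
  qed
  have int: "(\<integral>x. f x \<partial>?\<nu> n) = (\<Sum>i\<in>I n. w n i * f (t n i))" if "f \<in> borel_measurable borel" for f :: "real \<Rightarrow> real" and n
    unfolding integral_distr[OF meas_t that] unfolding D_def
    by (subst lebesgue_integral_point_measure_finite[OF fin]) (use w in auto)
  obtain r M where r: "strict_mono r" "real_distribution M" "weak_conv_m (\<lambda>n. ?\<nu> (r n)) M"
    using that by (rule helly_selection_unit_interval[of ?\<nu>, OF \<nu>])
  interpret M: real_distribution M by fact
  have meas_g: "g \<in> borel_measurable M" using borel_measurable_continuous_onI[OF g(1)] by simp
  show ?thesis
  proof (rule that[OF r(1)])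
    show "finite_borel_on (square R) (distr M borel g)" by (rule M.finite_borel_on_distr[OF meas_g _ square_borel]) (use g(2) in auto)
    fix h :: "real \<times> real \<Rightarrow> real" assume h: "continuous_on UNIV h"
    have hg: "continuous_on UNIV (\<lambda>x. h (g x))" by (rule continuous_on_compose2[OF h g(1)]) auto
    have "bounded (h ` square R)"
      by (intro compact_imp_bounded compact_continuous_image compact_square continuous_on_subset[OF h]) simp
    then obtain B where B: "\<And>x. norm (h (g x)) \<le> B" unfolding bounded_iff using g(2) by auto
    have "(\<lambda>n. \<integral>x. h (g x) \<partial>?\<nu> (r n)) \<longlonglongrightarrow> (\<integral>x. h (g x) \<partial>M)"
      by (rule weak_conv_imp_integral_bdd_continuous_conv[OF \<nu>(1) r(2,3) _ B])
        (use hg in \<open>simp add: continuous_on_eq_continuous_at\<close>)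
    moreover have "(\<integral>x. h (g x) \<partial>?\<nu> n) = (\<Sum>i\<in>I n. w n i * h (z n i))" for n
      unfolding int[OF borel_measurable_continuous_onI[OF hg]] using t(2) by simp
    ultimately show "(\<lambda>n. \<Sum>i\<in>I (r n). w (r n) i * h (z (r n) i)) \<longlonglongrightarrow> (\<integral>p. h p \<partial>distr M borel g)"
      using integral_distr[OF meas_g borel_measurable_continuous_onI[OF h]] by simp
  qed
qed

lemma weighted_points_compactness:
  fixes I :: "nat \<Rightarrow> 'i set" and w :: "nat \<Rightarrow> 'i \<Rightarrow> real" and z :: "nat \<Rightarrow> 'i \<Rightarrow> real \<times> real"
  assumes R: "0 < R" and fin: "\<And>n. finite (I n)" and w: "\<And>n i. i \<in> I n \<Longrightarrow> 0 \<le> w n i"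
    and mass: "\<And>n. (\<Sum>i\<in>I n. w n i) = c" and z: "\<And>n i. i \<in> I n \<Longrightarrow> z n i \<in> square R"
  obtains r M where "strict_mono r" "finite_borel_on (square R) M"
    "\<And>h. continuous_on UNIV h \<Longrightarrow> (\<lambda>n. \<Sum>i\<in>I (r n). w (r n) i * h (z (r n) i)) \<longlonglongrightarrow> (\<integral>p. h p \<partial>M)"
proof (cases "c = 0")
  case True
  then have "w n i = 0" if "i \<in> I n" for n i
    using mass[of n] w that by (simp add: sum_nonneg_eq_0_iff[OF fin])
  then show ?thesis
    by (intro that[of id "null_measure borel"])
      (auto simp: strict_mono_id finite_borel_on_def integral_null_measure intro!: finite_measureI)
next
  case False
  have "0 \<le> c" using mass[of 0] w by (auto intro: sum_nonneg)
  with False have c: "0 < c" by simp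
  obtain r M where M: "strict_mono r" "finite_borel_on (square R) M"
    "\<And>h. continuous_on UNIV h \<Longrightarrow> (\<lambda>n. \<Sum>i\<in>I (r n). w (r n) i / c * h (z (r n) i)) \<longlonglongrightarrow> (\<integral>p. h p \<partial>M)"
  proof (rule weighted_points_compactness_prob[of R I "\<lambda>n i. w n i / c" z])
    show "(\<Sum>i\<in>I n. w n i / c) = 1" for n using mass[of n] c by (simp add: sum_divide_distrib[symmetric])
  qed (use R fin w z c in auto)
  show ?thesis
  proof (rule that[OF M(1)])
    let ?M = "density M (\<lambda>_. ennreal c)"
    have sets: "sets M = sets borel" using M(2) by (simp add: finite_borel_on_def)
    note sp = sets_eq_imp_space_eq[OF sets]
    show "finite_borel_on (square R) ?M"
      unfolding finite_borel_on_def
    proof (intro conjI finite_measureI)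
      show "emeasure ?M (space ?M) \<noteq> \<infinity>" "emeasure ?M (UNIV - square R) = 0"
        using M(2) square_borel finite_measure.emeasure_finite[of M]
        by (auto simp: finite_borel_on_def emeasure_density_const sets sp ennreal_mult_eq_top_iff)
    qed (simp add: sets)
    fix h :: "real \<times> real \<Rightarrow> real" assume h: "continuous_on UNIV h"
    have "h \<in> borel_measurable M"
      using borel_measurable_continuous_onI[OF h] by (simp add: measurable_cong_sets[OF sets refl])
    then have "(\<integral>p. h p \<partial>?M) = c * (\<integral>p. h p \<partial>M)"
      using c by (subst integral_real_density) auto
    then show "(\<lambda>n. \<Sum>i\<in>I (r n). w (r n) i * h (z (r n) i)) \<longlonglongrightarrow> (\<integral>p. h p \<partial>?M)"
      using tendsto_mult_left[OF M(3)[OF h], of c] c by (simp add: sum_distrib_left mult.assoc[symmetric])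
  qed
qed

locale poly_bilinear =
  fixes L :: "real poly \<Rightarrow> real poly \<Rightarrow> real"
  assumes add_left: "L (p + p') q = L p q + L p' q" and add_right: "L p (q + q') = L p q + L p q'"
    and smult_left: "L (smult c p) q = c * L p q" and smult_right: "L p (smult c q) = c * L p q"
begin

lemma sum_left: "L (\<Sum>i\<in>I. f i) q = (\<Sum>i\<in>I. L (f i) q)"
  using smult_left[of 0 0 q] by (induction I rule: infinite_finite_induct) (auto simp: add_left)

lemma sum_right: "L p (\<Sum>i\<in>I. f i) = (\<Sum>i\<in>I. L p (f i))"
  using smult_right[of p 0 0] by (induction I rule: infinite_finite_induct) (auto simp: add_right)

lemma poly_bilinear_pcompose: "poly_bilinear (\<lambda>p q. L (pcompose p T) (pcompose q T))"
  by unfold_locales (simp_all add: pcompose_add pcompose_smult add_left add_right smult_left smult_right)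

lemma expand:
  "L p q = (\<Sum>i\<le>degree p. \<Sum>j\<le>degree q. coeff p i * coeff q j * L ([:0, 1:] ^ i) ([:0, 1:] ^ j))"
proof -
  have X: "(\<Sum>i\<le>degree p. smult (coeff p i) ([:0, 1:] ^ i)) = p" for p :: "real poly"
    using poly_as_sum_of_monoms[of p] by (simp add: monom_altdef)
  have "L p q = L (\<Sum>i\<le>degree p. smult (coeff p i) ([:0, 1:] ^ i)) (\<Sum>j\<le>degree q. smult (coeff q j) ([:0, 1:] ^ j))"
    by (simp only: X)
  then show ?thesis
    by (subst sum.swap) (simp add: sum_left sum_right smult_left smult_right sum_distrib_left mult_ac)
qed

end

lemma poly_bilinear_eqI:
  assumes "poly_bilinear L" "poly_bilinear L'"
    and "\<And>a b. L ([:0, 1:] ^ a) ([:0, 1:] ^ b) = L' ([:0, 1:] ^ a) ([:0, 1:] ^ b)"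
  shows "L p q = L' p q"
  using assms by (simp add: poly_bilinear.expand[of L p q] poly_bilinear.expand[of L' p q])

definition moment_form :: "(nat \<Rightarrow> nat \<Rightarrow> real) \<Rightarrow> real poly \<Rightarrow> real poly \<Rightarrow> real" where
  "moment_form m p q = (\<Sum>i\<le>degree p. \<Sum>j\<le>degree q. coeff p i * coeff q j * m i j)"

lemma moment_form_altdef:
  assumes "degree p \<le> N" "degree q \<le> M"
  shows "moment_form m p q = (\<Sum>i\<le>N. \<Sum>j\<le>M. coeff p i * coeff q j * m i j)"
proof -
  have "(\<Sum>i\<le>N. \<Sum>j\<le>M. coeff p i * coeff q j * m i j) = (\<Sum>i\<le>degree p. \<Sum>j\<le>M. coeff p i * coeff q j * m i j)"
    using assms by (intro sum.mono_neutral_right) (auto simp: coeff_eq_0)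
  also have "\<dots> = moment_form m p q"
    unfolding moment_form_def using assms
    by (intro sum.cong refl sum.mono_neutral_right) (auto simp: coeff_eq_0)
  finally show ?thesis by simp
qed

lemma poly_bilinear_moment_form: "poly_bilinear (moment_form m)"
proof
  fix p p' q q' :: "real poly" and c
  have deg: "degree (p + p') \<le> max (degree p) (degree p')" "degree (q + q') \<le> max (degree q) (degree q')"
    by (rule degree_add_le_max)+
  show "moment_form m (p + p') q = moment_form m p q + moment_form m p' q"
    using deg(1) by (simp add: moment_form_altdef[of _ "max (degree p) (degree p')" _ "degree q"]
        sum.distrib[symmetric] algebra_simps)
  show "moment_form m p (q + q') = moment_form m p q + moment_form m p q'"
    using deg(2) by (simp add: moment_form_altdef[of _ "degree p" _ "max (degree q) (degree q')"]
        sum.distrib[symmetric] algebra_simps)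
  show "moment_form m (smult c p) q = c * moment_form m p q" "moment_form m p (smult c q) = c * moment_form m p q"
    using degree_smult_le[of c p] degree_smult_le[of c q]
    by (simp_all add: moment_form_altdef[of _ "degree p" _ "degree q"] sum_distrib_left mult_ac)
qed

lemma moment_form_X_power: "moment_form m ([:0, 1:] ^ a) ([:0, 1:] ^ b) = m a b"
proof -
  have "moment_form m ([:0, 1:] ^ a) ([:0, 1:] ^ b) = (\<Sum>i\<le>a. \<Sum>j\<le>b. if i = a then (if j = b then m a b else 0) else 0)"
    by (subst moment_form_altdef[of _ a _ b])
      (auto simp: monom_altdef[of 1, simplified, symmetric] degree_monom_le coeff_monom intro!: sum.cong)
  also have "\<dots> = (\<Sum>i\<le>a. if i = a then (\<Sum>j\<le>b. if j = b then m a b else 0) else 0)"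
    by (intro sum.cong) auto
  finally show ?thesis by (simp add: sum.delta)
qed

definition binomial_ratio :: "nat \<Rightarrow> nat \<Rightarrow> nat \<Rightarrow> real" where
  "binomial_ratio n a k = real (k choose a) / real (n choose a)"

lemma binomial_ratio_0: "binomial_ratio n 0 k = 1"
  by (simp add: binomial_ratio_def)

lemma binomial_ratio_range: "k \<le> n \<Longrightarrow> binomial_ratio n a k \<in> {0..1}"
  by (auto simp: binomial_ratio_def divide_le_eq_1 intro!: binomial_right_mono)

lemma bernstein_sum:
  fixes T T' :: "real poly"
  assumes "T + T' = 1" "a \<le> n"
  shows "(\<Sum>k\<le>n. smult (binomial_ratio n a k * real (n choose k)) (T ^ k * T' ^ (n - k))) = T ^ a"
proof -
  have "(\<Sum>k\<le>n. smult (binomial_ratio n a k * real (n choose k)) (T ^ k * T' ^ (n - k)))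
      = (\<Sum>k\<in>{a..n}. smult (binomial_ratio n a k * real (n choose k)) (T ^ k * T' ^ (n - k)))"
    by (rule sum.mono_neutral_right) (auto simp: binomial_eq_0 binomial_ratio_def)
  also have "\<dots> = (\<Sum>k\<in>{a..n}. smult (real ((n - a) choose (k - a))) (T ^ k * T' ^ (n - k)))"
  proof (intro sum.cong refl arg_cong2[where f=smult])
    fix k assume k: "k \<in> {a..n}"
    have "(n choose k) * (k choose a) = (n choose a) * ((n - a) choose (k - a))"
      using k by (intro choose_mult) auto
    then have "real (n choose k) * real (k choose a) = real (n choose a) * real ((n - a) choose (k - a))"
      by (metis of_nat_mult)
    then show "binomial_ratio n a k * real (n choose k) = real ((n - a) choose (k - a))"
      using assms(2) by (simp add: binomial_ratio_def field_simps)
  qed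
  also have "\<dots> = (\<Sum>i\<le>n - a. smult (real ((n - a) choose i)) (T ^ (i + a) * T' ^ (n - a - i)))"
    by (rule sum.reindex_bij_witness[of _ "\<lambda>i. i + a" "\<lambda>k. k - a"]) (use assms(2) in auto)
  also have "\<dots> = T ^ a * (\<Sum>i\<le>n - a. of_nat ((n - a) choose i) * T ^ i * T' ^ (n - a - i))"
    unfolding sum_distrib_left by (intro sum.cong refl) (simp add: power_add of_nat_poly mult_ac)
  also have "(\<Sum>i\<le>n - a. of_nat ((n - a) choose i) * T ^ i * T' ^ (n - a - i)) = (T + T') ^ (n - a)"
    by (rule binomial_ring[symmetric])
  finally show ?thesis using assms(1) by simp
qed

lemma binomial_ratio_close:
  assumes n: "2 * a < n" and k: "k \<le> n"
  shows "\<bar>binomial_ratio n a k - (real k / real n) ^ a\<bar> \<le> real a * (real a / real (n - a))"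
proof -
  have ratio: "binomial_ratio n a k = (\<Prod>i\<in>{0..<a}. (real k - real i) / (real n - real i))"
    by (simp add: binomial_ratio_def binomial_gbinomial gbinomial_prod_rev prod_dividef)
  have "\<bar>binomial_ratio n a k - (real k / real n) ^ a\<bar>
      = norm ((\<Prod>i\<in>{0..<a}. (real k - real i) / (real n - real i)) - (\<Prod>i\<in>{0..<a}. real k / real n))"
    by (simp add: ratio)
  also have "\<dots> \<le> (\<Sum>i\<in>{0..<a}. norm ((real k - real i) / (real n - real i) - real k / real n))"
  proof (rule norm_prod_diff)
    fix i assume i: "i \<in> {0..<a}"
    then have "\<bar>real k - real i\<bar> \<le> real n - real i" "0 < real n - real i" using n k by auto
    then show "norm ((real k - real i) / (real n - real i)) \<le> 1" by simp
    show "norm (real k / real n) \<le> 1" using n k by simp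
  qed
  also have "\<dots> \<le> (\<Sum>i\<in>{0..<a}. real a / real (n - a))"
  proof (rule sum_mono)
    fix i assume i: "i \<in> {0..<a}"
    have pos: "0 < real n - real i" "0 < real n" "0 < real (n - a)" using i n by auto
    have "(real k - real i) / (real n - real i) - real k / real n = - (real i * (real n - real k)) / ((real n - real i) * real n)"
      using pos by (simp add: field_simps)
    then have "norm ((real k - real i) / (real n - real i) - real k / real n) = (real i / (real n - real i)) * ((real n - real k) / real n)"
      using pos k by (simp add: abs_mult abs_divide)
    also have "\<dots> \<le> (real i / (real n - real i)) * 1"
      using pos k by (intro mult_left_mono) auto
    also have "\<dots> \<le> real a / real (n - a)"
      using i n by (simp add: frac_le of_nat_diff)
    finally show "norm ((real k - real i) / (real n - real i) - real k / real n) \<le> real a / real (n - a)" .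
  qed
  finally show ?thesis by simp
qed

lemma abs_diff_mult_le:
  fixes x y r s :: real
  assumes "\<bar>x\<bar> \<le> 1" "\<bar>s\<bar> \<le> 1"
  shows "\<bar>x * y - r * s\<bar> \<le> \<bar>x - r\<bar> + \<bar>y - s\<bar>"
proof -
  have "x * y - r * s = x * (y - s) + (x - r) * s" by (simp add: algebra_simps)
  also have "\<bar>\<dots>\<bar> \<le> \<bar>x\<bar> * \<bar>y - s\<bar> + \<bar>x - r\<bar> * \<bar>s\<bar>"
    by (rule order_trans[OF abs_triangle_ineq]) (simp only: abs_mult order_refl)
  also have "\<dots> \<le> 1 * \<bar>y - s\<bar> + \<bar>x - r\<bar> * 1"
    using assms by (intro add_mono mult_right_mono mult_left_mono) auto
  finally show ?thesis by simp
qed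

locale bernstein_weights = poly_bilinear +
  fixes T T' :: "real poly"
  assumes sum_one: "T + T' = 1" and nonneg: "0 \<le> L (T ^ k * T' ^ l) (T ^ i * T' ^ j)"
begin

definition weight :: "nat \<Rightarrow> nat \<times> nat \<Rightarrow> real" where
  "weight n = (\<lambda>(k, j). real (n choose k) * real (n choose j) * L (T ^ k * T' ^ (n - k)) (T ^ j * T' ^ (n - j)))"

lemma weight_nonneg: "0 \<le> weight n i"
  by (auto simp: weight_def nonneg split: prod.split)

lemma sum_weight_binomial_ratio:
  assumes "a \<le> n" "b \<le> n"
  shows "(\<Sum>i\<in>{..n} \<times> {..n}. weight n i * (binomial_ratio n a (fst i) * binomial_ratio n b (snd i))) = L (T ^ a) (T ^ b)"
proof -
  have "L (T ^ a) (T ^ b) = (\<Sum>k\<le>n. \<Sum>j\<le>n. weight n (k, j) * (binomial_ratio n a k * binomial_ratio n b j))"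
    unfolding bernstein_sum[OF sum_one assms(1), symmetric] bernstein_sum[OF sum_one assms(2), symmetric]
    by (subst sum.swap) (simp add: sum_left sum_right smult_left smult_right weight_def sum_distrib_left mult_ac)
  then show ?thesis by (simp add: sum.cartesian_product split_def)
qed

lemma sum_weight: "(\<Sum>i\<in>{..n} \<times> {..n}. weight n i) = L 1 1"
  using sum_weight_binomial_ratio[of 0 n 0] by (simp add: binomial_ratio_0)

lemma sum_weight_power_close:
  assumes n: "2 * a < n" "2 * b < n"
  shows "\<bar>(\<Sum>i\<in>{..n} \<times> {..n}. weight n i * ((real (fst i) / real n) ^ a * (real (snd i) / real n) ^ b)) - L (T ^ a) (T ^ b)\<bar>
    \<le> L 1 1 * (real a * (real a / real (n - a)) + real b * (real b / real (n - b)))" (is "\<bar>?S - _\<bar> \<le> _ * ?e")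
proof -
  let ?d = "\<lambda>i. (real (fst i) / real n) ^ a * (real (snd i) / real n) ^ b
      - binomial_ratio n a (fst i) * binomial_ratio n b (snd i)"
  have diff: "?S - L (T ^ a) (T ^ b) = (\<Sum>i\<in>{..n} \<times> {..n}. weight n i * ?d i)"
    using n by (subst sum_weight_binomial_ratio[of a n b, symmetric])
      (auto simp: sum_subtractf[symmetric] right_diff_distrib)
  have "\<bar>?S - L (T ^ a) (T ^ b)\<bar> \<le> (\<Sum>i\<in>{..n} \<times> {..n}. weight n i * ?e)"
    unfolding diff
  proof (rule order_trans[OF sum_abs], rule sum_mono)
    fix i assume "i \<in> {..n} \<times> {..n}"
    then have i: "fst i \<le> n" "snd i \<le> n" by auto
    have "\<bar>?d i\<bar> \<le> \<bar>(real (fst i) / real n) ^ a - binomial_ratio n a (fst i)\<bar>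
        + \<bar>(real (snd i) / real n) ^ b - binomial_ratio n b (snd i)\<bar>"
      using i n binomial_ratio_range[OF i(2), of b] by (intro abs_diff_mult_le) (auto simp: power_le_one)
    also have "\<dots> \<le> ?e"
      using binomial_ratio_close[OF n(1) i(1)] binomial_ratio_close[OF n(2) i(2)] by (simp add: abs_minus_commute)
    finally show "\<bar>weight n i * ?d i\<bar> \<le> weight n i * ?e"
      unfolding abs_mult using weight_nonneg[of n i] by (simp only: abs_of_nonneg mult_left_mono)
  qed
  also have "\<dots> = L 1 1 * ?e" by (simp only: sum_distrib_right[symmetric] sum_weight)
  finally show ?thesis .
qed

lemma sum_weight_power_tendsto:
  "(\<lambda>n. \<Sum>i\<in>{..n} \<times> {..n}. weight n i * ((real (fst i) / real n) ^ a * (real (snd i) / real n) ^ b)) \<longlonglongrightarrow> L (T ^ a) (T ^ b)"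
proof -
  have "(\<lambda>n. real c / real (n - c)) \<longlonglongrightarrow> 0" for c
    by (rule LIMSEQ_offset[where k=c]) (simp add: lim_const_over_n)
  then have "(\<lambda>n. L 1 1 * (real a * (real a / real (n - a)) + real b * (real b / real (n - b)))) \<longlonglongrightarrow> L 1 1 * (real a * 0 + real b * 0)"
    by (intro tendsto_intros)
  then have null: "(\<lambda>n. L 1 1 * (real a * (real a / real (n - a)) + real b * (real b / real (n - b)))) \<longlonglongrightarrow> 0" by simp
  have "\<forall>\<^sub>F n in sequentially.
      norm ((\<Sum>i\<in>{..n} \<times> {..n}. weight n i * ((real (fst i) / real n) ^ a * (real (snd i) / real n) ^ b)) - L (T ^ a) (T ^ b))
      \<le> L 1 1 * (real a * (real a / real (n - a)) + real b * (real b / real (n - b)))"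
    using eventually_gt_at_top[of "2 * a"] eventually_gt_at_top[of "2 * b"]
    by eventually_elim (use sum_weight_power_close in auto)
  from Lim_null_comparison[OF this null] show ?thesis by (rule LIM_zero_cancel)
qed

end

definition bernstein :: "real \<Rightarrow> nat \<Rightarrow> nat \<Rightarrow> real poly" where
  "bernstein R k l = [:1/2, 1/(2*R):] ^ k * [:1/2, -1/(2*R):] ^ l"

lemma poly_bernstein_nonneg: "0 < R \<Longrightarrow> t \<in> {-R..R} \<Longrightarrow> 0 \<le> poly (bernstein R k l) t"
  by (auto simp: bernstein_def field_simps)

lemma poly_bilinear_integral:
  assumes M: "finite_borel_on (square R) M"
  shows "poly_bilinear (\<lambda>p q. \<integral>u. poly p (fst u) * poly q (snd u) \<partial>M)"
proof -
  have "integrable M (\<lambda>u. poly p (fst u) * poly q (snd u))" for p q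
    by (rule integrable_continuous[OF M compact_square]) (intro continuous_intros)
  then show ?thesis
    by unfold_locales (simp_all add: distrib_right distrib_left mult.assoc mult.left_commute[of _ c for c :: real])
qed

theorem hausdorff_moment_problem_square:
  assumes R: "0 < R" and pos: "\<And>k l i j. 0 \<le> moment_form m (bernstein R k l) (bernstein R i j)"
  obtains M where "finite_borel_on (square R) M" "\<And>a b. (\<integral>p. monomial a b p \<partial>M) = m a b"
proof -
  define T T' :: "real poly" where "T = [:1/2, 1/(2*R):]" and "T' = [:1/2, -1/(2*R):]"
  note T_defs = this
  interpret bernstein_weights "moment_form m" T T'
  proof -
    interpret poly_bilinear "moment_form m" by (rule poly_bilinear_moment_form)
    show "bernstein_weights (moment_form m) T T'"
      by unfold_locales (use pos in \<open>simp_all add: T_defs bernstein_def one_pCons\<close>)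
  qed
  let ?z = "\<lambda>n i. (2 * R * (real (fst i) / real n) - R, 2 * R * (real (snd i) / real n) - R)"
  obtain r M where r: "strict_mono r" and M: "finite_borel_on (square R) M"
    and lim: "\<And>h. continuous_on UNIV h \<Longrightarrow> (\<lambda>n. \<Sum>i\<in>{..Suc (r n)} \<times> {..Suc (r n)}. weight (Suc (r n)) i * h (?z (Suc (r n)) i))
      \<longlonglongrightarrow> (\<integral>p. h p \<partial>M)"
  proof (rule weighted_points_compactness[of R "\<lambda>n. {..Suc n} \<times> {..Suc n}" "\<lambda>n. weight (Suc n)" "moment_form m 1 1" "\<lambda>n. ?z (Suc n)"])
    show "?z (Suc n) i \<in> square R" if "i \<in> {..Suc n} \<times> {..Suc n}" for n i
    proof -
      have "2 * R * u - R \<in> {-R..R}" if "u \<in> {0..1}" for u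
        using that R mult_left_le[of u "2 * R"] by auto
      moreover have "real (fst i) / real (Suc n) \<in> {0..1}" "real (snd i) / real (Suc n) \<in> {0..1}"
        using that by (auto simp del: of_nat_Suc)
      ultimately show ?thesis by (simp only: square_def mem_Times_iff fst_conv snd_conv)
    qed
  qed (use R in \<open>auto simp: weight_nonneg sum_weight\<close>)
  let ?I = "\<lambda>p q. \<integral>u. poly p (fst u) * poly q (snd u) \<partial>M"
  have on_powers: "?I (T ^ a) (T ^ b) = moment_form m (T ^ a) (T ^ b)" for a b
  proof (rule LIMSEQ_unique)
    have "poly T (2 * R * x / y - R) = x / y" for x y using R by (simp add: T_defs field_simps)
    then show "(\<lambda>n. \<Sum>i\<in>{..Suc (r n)} \<times> {..Suc (r n)}. weight (Suc (r n)) i *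
        ((real (fst i) / real (Suc (r n))) ^ a * (real (snd i) / real (Suc (r n))) ^ b)) \<longlonglongrightarrow> ?I (T ^ a) (T ^ b)"
      using lim[of "\<lambda>u. poly (T ^ a) (fst u) * poly (T ^ b) (snd u)"]
      by (simp add: poly_power continuous_intros del: of_nat_Suc)
    show "(\<lambda>n. \<Sum>i\<in>{..Suc (r n)} \<times> {..Suc (r n)}. weight (Suc (r n)) i *
        ((real (fst i) / real (Suc (r n))) ^ a * (real (snd i) / real (Suc (r n))) ^ b)) \<longlonglongrightarrow> moment_form m (T ^ a) (T ^ b)"
      using LIMSEQ_subseq_LIMSEQ[OF LIMSEQ_Suc[OF sum_weight_power_tendsto] r] unfolding o_def .
  qed
  have X_power: "pcompose ([:0, 1:] ^ n) T = T ^ n" for n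
    by (induction n) (simp_all add: pcompose_1 pcompose_mult pcompose_pCons)
  have on_T: "?I (pcompose p T) (pcompose q T) = moment_form m (pcompose p T) (pcompose q T)" for p q
    by (rule poly_bilinear_eqI[OF poly_bilinear.poly_bilinear_pcompose[OF poly_bilinear_integral[OF M]]
          poly_bilinear_pcompose]) (simp only: X_power on_powers)
  have "pcompose [:-R, 2*R:] T = [:0, 1:]" using R by (simp add: T_defs pcompose_pCons)
  then have invert: "pcompose (pcompose p [:-R, 2*R:]) T = p" for p
    using pcompose_assoc[of p "[:-R, 2*R:]" T] by simp
  have "(\<integral>p. monomial a b p \<partial>M) = m a b" for a b
    using on_T[of "pcompose ([:0, 1:] ^ a) [:-R, 2*R:]" "pcompose ([:0, 1:] ^ b) [:-R, 2*R:]"]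
    by (simp add: invert moment_form_X_power monomial_def poly_power)
  with M show ?thesis by (rule that)
qed

definition moment_functional :: "(nat \<Rightarrow> real) \<Rightarrow> real poly \<Rightarrow> real" where
  "moment_functional m p = (\<Sum>i\<le>degree p. coeff p i * m i)"

theorem hausdorff_moment_problem:
  assumes R: "0 < R" and pos: "\<And>k l. 0 \<le> moment_functional m (bernstein R k l)"
  obtains M where "finite_borel_on {-R..R} M" "\<And>n. (\<integral>t. t ^ n \<partial>M) = m n"
proof -
  define m2 where "m2 i j = (if j = 0 then m i else 0)" for i j :: nat
  have m2: "moment_form m2 p q = coeff q 0 * moment_functional m p" for p q
  proof -
    have "moment_form m2 p q = (\<Sum>i\<le>degree p. \<Sum>j\<le>degree q. if j = 0 then coeff p i * coeff q 0 * m i else 0)"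
      unfolding moment_form_def m2_def by (intro sum.cong) auto
    then show ?thesis by (simp add: moment_functional_def sum_distrib_left mult_ac)
  qed
  have pos2: "0 \<le> moment_form m2 (bernstein R k l) (bernstein R i j)" for k l i j
    unfolding m2 by (intro mult_nonneg_nonneg pos) (simp add: bernstein_def coeff_mult_0 coeff_0_power)
  obtain M where M: "finite_borel_on (square R) M" "\<And>a b. (\<integral>p. monomial a b p \<partial>M) = m2 a b"
    using that by (rule hausdorff_moment_problem_square[OF R pos2])
  have sets: "sets M = sets borel" "space M = UNIV" and fin: "finite_measure M"
    using M(1) sets_eq_imp_space_eq[of M borel] by (auto simp: finite_borel_on_def)
  have fst: "fst \<in> measurable M (borel :: real measure)"
    unfolding measurable_cong_sets[OF sets(1) refl] unfolding borel_prod[symmetric] by simp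
  show ?thesis
  proof
    have "fst -` (UNIV - {-R..R}) \<subseteq> UNIV - square R" by (auto simp: square_def)
    then have "emeasure M (fst -` (UNIV - {-R..R})) = 0"
      by (rule emeasure_eq_0[rotated 2]) (use M(1) square_borel in \<open>simp_all add: finite_borel_on_def\<close>)
    then show "finite_borel_on {-R..R} (distr M borel fst)"
      using finite_measure.finite_measure_distr[OF fin fst] emeasure_distr[OF fst]
      by (simp add: finite_borel_on_def sets)
    show "(\<integral>t. t ^ n \<partial>distr M borel fst) = m n" for n
      using M(2)[of n 0] by (subst integral_distr[OF fst]) (auto simp: monomial_def m2_def)
  qed
qed

section \<open>Measurable dependence of a measure on its moments\<close>

definition has_moments :: "(nat \<Rightarrow> complex) \<Rightarrow> real measure \<Rightarrow> bool" where
  "has_moments m \<mu> \<longleftrightarrow> (\<exists>R. finite_borel_on {-R..R} \<mu>) \<and> (\<forall>n. complex_of_real (\<integral>t. t ^ n \<partial>\<mu>) = m n)"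

definition moment_measure :: "(nat \<Rightarrow> complex) \<Rightarrow> real measure" where
  "moment_measure m = (THE \<mu>. has_moments m \<mu>)"

definition hausdorff_condition :: "real \<Rightarrow> (nat \<Rightarrow> complex) \<Rightarrow> bool" where
  "hausdorff_condition R m \<longleftrightarrow> (\<forall>n. Im (m n) = 0) \<and>
    (\<forall>k l. 0 \<le> moment_functional (\<lambda>n. Re (m n)) (bernstein R k l))"

lemma moment_measure_eqI:
  assumes "has_moments m \<mu>" shows "moment_measure m = \<mu>"
  unfolding moment_measure_def
proof (rule the_equality[where P="has_moments m", OF assms])
  show "\<nu> = \<mu>" if "has_moments m \<nu>" for \<nu>
    using assms that unfolding has_moments_def by (metis moments_determine_measure of_real_eq_iff)
qed

lemma integral_poly_eq_moment_functional:
  assumes M: "finite_borel_on {-R..R} M" and m: "\<And>n. (\<integral>t. t ^ n \<partial>M) = m n"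
  shows "(\<integral>t. poly p t \<partial>M) = moment_functional m p"
proof -
  have "integrable M (\<lambda>t. coeff p i * t ^ i)" for i
    by (rule integrable_continuous[OF M compact_Icc]) (intro continuous_intros)
  then show ?thesis unfolding poly_altdef moment_functional_def by (simp add: m)
qed

lemma has_moments_imp_hausdorff_condition:
  assumes "has_moments m \<mu>"
  shows "\<exists>j::nat. hausdorff_condition (real (Suc j)) m"
proof -
  obtain R where R: "finite_borel_on {-R..R} \<mu>" and m: "\<And>n. complex_of_real (\<integral>t. t ^ n \<partial>\<mu>) = m n"
    using assms unfolding has_moments_def by blast
  obtain j :: nat where "R \<le> real j" using real_arch_simple[of R] by blast
  then have j: "finite_borel_on {-real (Suc j)..real (Suc j)} \<mu>"
    by (intro finite_borel_on_mono[OF R]) auto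
  have re: "(\<integral>t. t ^ n \<partial>\<mu>) = Re (m n)" and im: "Im (m n) = 0" for n
    using m[of n] by (metis Re_complex_of_real, metis Im_complex_of_real)
  have "0 \<le> moment_functional (\<lambda>n. Re (m n)) (bernstein (real (Suc j)) k l)" for k l
    unfolding integral_poly_eq_moment_functional[OF j re, symmetric]
  proof (rule integral_nonneg_AE)
    have "AE t in \<mu>. t \<in> {-real (Suc j)..real (Suc j)}" by (rule AE_finite_borel_on[OF j]) simp
    then show "AE t in \<mu>. 0 \<le> poly (bernstein (real (Suc j)) k l) t"
      by eventually_elim (rule poly_bernstein_nonneg, simp_all)
  qed
  with im show ?thesis unfolding hausdorff_condition_def by blast
qed

lemma hausdorff_condition_imp_moment_measure:
  assumes R: "0 < R" and m: "hausdorff_condition R m"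
  shows "finite_borel_on {-R..R} (moment_measure m)" "complex_of_real (\<integral>t. t ^ n \<partial>moment_measure m) = m n"
proof -
  have pos: "0 \<le> moment_functional (\<lambda>n. Re (m n)) (bernstein R k l)" for k l
    using m by (simp add: hausdorff_condition_def)
  obtain M where M: "finite_borel_on {-R..R} M" "\<And>n. (\<integral>t. t ^ n \<partial>M) = Re (m n)"
    using that by (rule hausdorff_moment_problem[OF R pos])
  then have "has_moments m M"
    using m by (auto simp: has_moments_def hausdorff_condition_def complex_eq_iff)
  with M(1) show "finite_borel_on {-R..R} (moment_measure m)"
    "complex_of_real (\<integral>t. t ^ n \<partial>moment_measure m) = m n"
    by (simp_all add: moment_measure_eqI has_moments_def)
qed

lemma measurable_integral_moment_measure_bounded:
  fixes m :: "'w \<Rightarrow> nat \<Rightarrow> complex"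
  assumes m: "\<And>n. (\<lambda>V. m V n) \<in> borel_measurable N" and f: "bdd_borel f"
    and R: "0 < R" and cond: "\<And>V. V \<in> space N \<Longrightarrow> hausdorff_condition R (m V)"
  shows "(\<lambda>V. \<integral>t. f t \<partial>moment_measure (m V)) \<in> borel_measurable N"
proof -
  note M = hausdorff_condition_imp_moment_measure[OF R cond]
  note int = integrable_bdd_borel[OF M(1)]
  let ?P = "\<lambda>f. (\<lambda>V. \<integral>t. f t \<partial>moment_measure (m V)) \<in> borel_measurable N"
  interpret separating_system "{-R..R}" "range (\<lambda>n t::real. t ^ n)" by (rule separating_system_powers)
  interpret monotone_class "{-R..R}" "range (\<lambda>n t::real. t ^ n)" ?P
  proof
    fix f g :: "real \<Rightarrow> real" assume fg: "bdd_borel f" "bdd_borel g" "?P f" "?P g"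
    show "?P (\<lambda>t. f t + g t)"
      by (subst measurable_cong[of N _ "\<lambda>V. (\<integral>t. f t \<partial>moment_measure (m V)) + (\<integral>t. g t \<partial>moment_measure (m V))"])
        (use fg int in auto)
  next
    fix F :: "nat \<Rightarrow> real \<Rightarrow> real" and f B
    assume F: "\<And>n. bdd_borel (F n)" "\<And>n. ?P (F n)" "\<And>n t. \<bar>F n t\<bar> \<le> B" "\<And>t. (\<lambda>n. F n t) \<longlonglongrightarrow> f t"
    show "?P f"
      by (rule borel_measurable_LIMSEQ_metric[OF F(2)])
        (rule normal_functional.limit[OF normal_functional_integral[OF M(1)] F(1,3,4)])
  next
    fix f :: "real \<Rightarrow> real" assume "f \<in> range (\<lambda>n t. t ^ n)"
    then obtain n where f: "f = (\<lambda>t. t ^ n)" by blast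
    have "(\<integral>t. t ^ n * indicator {-R..R} t \<partial>moment_measure (m V)) = Re (m V n)" if "V \<in> space N" for V
      using integral_eq_integral_indicator[OF M(1)[OF that], of "\<lambda>t. t ^ n"] M(2)[OF that, of n]
      by (simp add: complex_eq_iff)
    then show "?P (\<lambda>t. f t * indicator {-R..R} t)" unfolding f
      by (subst measurable_cong[of N _ "\<lambda>V. Re (m V n)"]) (use m in auto)
  qed simp
  have "?P (\<lambda>t. f t * indicator {-R..R} t)" by (rule bdd_borel_restricted[OF f])
  then show ?thesis
    by (subst measurable_cong) (use integral_eq_integral_indicator[OF M(1) _ bdd_borel_measurable[OF f]] in auto)
qed

lemma measurable_integral_moment_measure:
  fixes m :: "'w \<Rightarrow> nat \<Rightarrow> complex"
  assumes m[measurable]: "\<And>n. (\<lambda>V. m V n) \<in> borel_measurable N" and f: "bdd_borel f"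
  shows "(\<lambda>V. \<integral>t. f t \<partial>moment_measure (m V)) \<in> borel_measurable N"
proof -
  define G where "G j = {V. hausdorff_condition (real (Suc j)) (m V)}" for j
  have G: "G j \<inter> space N \<in> sets N" for j
  proof -
    have "{V \<in> space N. hausdorff_condition (real (Suc j)) (m V)} \<in> sets N"
      unfolding hausdorff_condition_def moment_functional_def by measurable
    then show ?thesis by (simp add: G_def Int_def conj_commute)
  qed
  let ?bad = "- (\<Union>j. G j)" and ?F = "\<lambda>V. \<integral>t. f t \<partial>moment_measure (m V)"
  have "space N - (\<Union>j. G j \<inter> space N) \<in> sets N"
    using G by (intro sets.Diff sets.top sets.countable_UN) auto
  also have "space N - (\<Union>j. G j \<inter> space N) = ?bad \<inter> space N" by blast
  finally have bad: "?bad \<inter> space N \<in> sets N" .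
  have F_good: "?F \<in> borel_measurable (restrict_space N (G j))" for j
    by (rule measurable_integral_moment_measure_bounded[OF measurable_restrict_space1[OF m] f, of "real (Suc j)"])
      (auto simp: space_restrict_space G_def)
  have "has_moments (m V) = (\<lambda>_. False)" if "V \<in> ?bad" for V
    using that has_moments_imp_hausdorff_condition[of "m V"] by (force simp: G_def)
  then have "?F V = (\<integral>t. f t \<partial>(THE \<mu>. False))" if "V \<in> ?bad" for V
    using that by (simp add: moment_measure_def)
  then have F_bad: "?F \<in> borel_measurable (restrict_space N ?bad)"
    by (subst measurable_cong[where g="\<lambda>_. \<integral>t. f t \<partial>(THE \<mu>. False)"]) (auto simp: space_restrict_space)
  show ?thesis
    by (rule measurable_piecewise_restrict[where C="insert ?bad (range G)"]) (use G bad F_good F_bad in auto)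
qed

section \<open>Functional calculus for a bounded potential\<close>

type_synonym site = "nat \<Rightarrow> int"

definition Hop_real :: "nat \<Rightarrow> (site \<Rightarrow> real) \<Rightarrow> (site \<Rightarrow> real) \<Rightarrow> site \<Rightarrow> real" where
  "Hop_real d V v x = (\<Sum>y\<in>nbrs d x. v y) + V x * v x"

definition kron :: "site \<Rightarrow> site \<Rightarrow> real" where
  "kron y = (\<lambda>x. if x = y then 1 else 0)"

definition supp :: "('a \<Rightarrow> real) \<Rightarrow> 'a set" where
  "supp v = {x. v x \<noteq> 0}"

definition finsupp :: "nat \<Rightarrow> (site \<Rightarrow> real) \<Rightarrow> bool" where
  "finsupp d v \<longleftrightarrow> finite (supp v) \<and> supp v \<subseteq> Zd d"

definition dot :: "('a \<Rightarrow> real) \<Rightarrow> ('a \<Rightarrow> real) \<Rightarrow> real" where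
  "dot v w = (\<Sum>x\<in>supp v. v x * w x)"

lemma finite_nbrs: "finite (nbrs d x)"
  unfolding nbrs_def by simp

lemma nbrs_sym: "y \<in> nbrs d x \<longleftrightarrow> x \<in> nbrs d y"
proof -
  have "x \<in> nbrs d y" if "y \<in> nbrs d x" for x y
  proof -
    consider i where "i < d" "y = x(i := x i + 1)" | i where "i < d" "y = x(i := x i - 1)"
      using \<open>y \<in> nbrs d x\<close> unfolding nbrs_def by blast
    then show ?thesis
    proof cases
      case (1 i)
      then have "x = y(i := y i - 1)" by auto
      then show ?thesis using 1(1) by (auto simp: nbrs_def)
    next
      case (2 i)
      then have "x = y(i := y i + 1)" by auto
      then show ?thesis using 2(1) by (auto simp: nbrs_def)
    qed
  qed
  then show ?thesis by blast
qed

lemma nbrs_Zd: "x \<in> Zd d \<Longrightarrow> nbrs d x \<subseteq> Zd d"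
  unfolding nbrs_def Zd_def by auto

lemma card_nbrs: "card (nbrs d x) \<le> 2 * d"
proof -
  have "{x(i := x i + 1) |i. i < d} = (\<lambda>i. x(i := x i + 1)) ` {..<d}"
    "{x(i := x i - 1) |i. i < d} = (\<lambda>i. x(i := x i - 1)) ` {..<d}" by auto
  then have "card {x(i := x i + 1) |i. i < d} \<le> d" "card {x(i := x i - 1) |i. i < d} \<le> d"
    using card_image_le[of "{..<d}"] by (metis card_lessThan finite_lessThan)+
  then show ?thesis unfolding nbrs_def using card_Un_le[of "{x(i := x i + 1) |i. i < d}" "{x(i := x i - 1) |i. i < d}"]
    by linarith
qed

lemma Hop_real_linear:
  "Hop_real d V (\<lambda>x. a * v x + b * w x) = (\<lambda>x. a * Hop_real d V v x + b * Hop_real d V w x)"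
  unfolding Hop_real_def by (auto simp: sum.distrib sum_distrib_left algebra_simps)

lemma Hop_real_power_linear:
  "(Hop_real d V ^^ n) (\<lambda>x. a * v x + b * w x) = (\<lambda>x. a * (Hop_real d V ^^ n) v x + b * (Hop_real d V ^^ n) w x)"
  by (induction n) (auto simp: Hop_real_linear)

lemma Hop_real_sum: "Hop_real d V (\<lambda>x. \<Sum>i\<in>I. c i * f i x) = (\<lambda>x. \<Sum>i\<in>I. c i * Hop_real d V (f i) x)"
proof (induction I rule: infinite_finite_induct)
  case (insert j F)
  then show ?case using Hop_real_linear[of d V "c j" "f j" 1 "\<lambda>x. \<Sum>i\<in>F. c i * f i x"] by simp
qed (auto simp: Hop_real_def)

lemma Hop_power_cmult: "(Hop d V ^^ n) (\<lambda>x. c * f x) = (\<lambda>x. c * (Hop d V ^^ n) f x)"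
proof (induction n)
  case (Suc n)
  have "Hop d V (\<lambda>x. c * g x) = (\<lambda>x. c * Hop d V g x)" for g
    by (auto simp: Hop_def fun_eq_iff sum_distrib_left algebra_simps)
  then show ?case using Suc by simp
qed simp

lemma delta_eq_kron: "delta y = (\<lambda>x. complex_of_real (kron y x))"
  by (auto simp: delta_def kron_def)

lemma Hop_power_of_real:
  "(Hop d V ^^ n) (\<lambda>x. complex_of_real (v x)) = (\<lambda>x. complex_of_real ((Hop_real d V ^^ n) v x))"
proof (induction n)
  case (Suc n)
  have "Hop d V (\<lambda>x. complex_of_real (w x)) = (\<lambda>x. complex_of_real (Hop_real d V w x))" for w
    unfolding Hop_def Hop_real_def by auto
  with Suc show ?case by simp
qed simp

lemma finsupp_subset: "supp v \<subseteq> S \<Longrightarrow> finite S \<Longrightarrow> S \<subseteq> Zd d \<Longrightarrow> finsupp d v"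
  unfolding finsupp_def by (meson finite_subset order_trans)

lemma finsupp_Hop_real:
  assumes "finsupp d v" shows "finsupp d (Hop_real d V v)"
proof (rule finsupp_subset)
  let ?S = "supp v \<union> (\<Union>x\<in>supp v. nbrs d x)"
  show "supp (Hop_real d V v) \<subseteq> ?S"
  proof
    fix x assume x: "x \<in> supp (Hop_real d V v)"
    show "x \<in> ?S"
    proof (rule ccontr)
      assume n: "x \<notin> ?S"
      then have "v y = 0" if "y \<in> nbrs d x" for y using that nbrs_sym[of y d x] by (auto simp: supp_def)
      then have "Hop_real d V v x = 0" using n unfolding Hop_real_def by (auto simp: supp_def)
      then show False using x by (simp add: supp_def)
    qed
  qed
  show "finite ?S" using assms finite_nbrs by (auto simp: finsupp_def)
  show "?S \<subseteq> Zd d" using assms nbrs_Zd unfolding finsupp_def by blast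
qed

lemma finsupp_Hop_real_power: "finsupp d v \<Longrightarrow> finsupp d ((Hop_real d V ^^ n) v)"
  by (induction n) (auto intro: finsupp_Hop_real)

lemma finsupp_linear:
  assumes "finsupp d v" "finsupp d w" shows "finsupp d (\<lambda>x. a * v x + b * w x)"
  by (rule finsupp_subset[of _ "supp v \<union> supp w"]) (use assms in \<open>auto simp: finsupp_def supp_def\<close>)

lemma finsupp_add: "finsupp d v \<Longrightarrow> finsupp d w \<Longrightarrow> finsupp d (\<lambda>x. v x + w x)"
  using finsupp_linear[of d v w 1 1] by simp

lemma finsupp_diff: "finsupp d v \<Longrightarrow> finsupp d w \<Longrightarrow> finsupp d (\<lambda>x. v x - w x)"
  using finsupp_linear[of d v w 1 "-1"] by simp

lemma finsupp_cmult: "finsupp d v \<Longrightarrow> finsupp d (\<lambda>x. c * v x)"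
  using finsupp_linear[of d v v c 0] by simp

lemma finsupp_0: "finsupp d (\<lambda>x. 0)"
  by (simp add: finsupp_def supp_def)

lemma finsupp_sum: "(\<And>i. i \<in> I \<Longrightarrow> finsupp d (f i)) \<Longrightarrow> finsupp d (\<lambda>x. \<Sum>i\<in>I. f i x)"
  by (induction I rule: infinite_finite_induct) (auto intro: finsupp_0 finsupp_add)

lemma finsupp_kron: "x \<in> Zd d \<Longrightarrow> finsupp d (kron x)"
  by (auto simp: finsupp_def supp_def kron_def)

lemma finsupp_as_sum: "finsupp d w \<Longrightarrow> w = (\<lambda>x. \<Sum>u\<in>supp w. w u * kron u x)"
proof
  fix x assume w: "finsupp d w"
  have "(\<Sum>u\<in>supp w. w u * kron u x) = (\<Sum>u\<in>supp w. if u = x then w x else 0)"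
    by (intro sum.cong) (auto simp: kron_def)
  also have "\<dots> = w x" using w by (auto simp: supp_def finsupp_def)
  finally show "w x = (\<Sum>u\<in>supp w. w u * kron u x)" by simp
qed

lemma dot_superset: "finite S \<Longrightarrow> supp v \<subseteq> S \<Longrightarrow> dot v w = (\<Sum>x\<in>S. v x * w x)"
  unfolding dot_def by (rule sum.mono_neutral_left) (auto simp: supp_def)

lemma dot_commute: assumes "finsupp d v" "finsupp d w" shows "dot v w = dot w v"
proof -
  have "finite (supp v \<union> supp w)" using assms by (auto simp: finsupp_def)
  then show ?thesis by (simp add: dot_superset[of "supp v \<union> supp w"] mult.commute)
qed

lemma dot_linear_right: "dot v (\<lambda>x. a * w x + b * u x) = a * dot v w + b * dot v u"
  unfolding dot_def by (simp add: sum.distrib sum_distrib_left algebra_simps)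

lemma dot_sum_right: "dot v (\<lambda>x. \<Sum>i\<in>I. f i x) = (\<Sum>i\<in>I. dot v (f i))"
  unfolding dot_def by (simp add: sum_distrib_left) (rule sum.swap)

lemma dot_linear_left:
  assumes "finsupp d v" "finsupp d w"
  shows "dot (\<lambda>x. a * v x + b * w x) u = a * dot v u + b * dot w u"
proof -
  let ?S = "supp v \<union> supp w"
  have f: "finite ?S" using assms by (auto simp: finsupp_def)
  have s: "supp (\<lambda>x. a * v x + b * w x) \<subseteq> ?S" by (auto simp: supp_def)
  show ?thesis
    by (simp add: dot_superset[OF f s] dot_superset[OF f, of v] dot_superset[OF f, of w]
        sum.distrib sum_distrib_left algebra_simps)
qed

lemma dot_nonneg: "0 \<le> dot v v"
  unfolding dot_def by (intro sum_nonneg) simp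

lemma dot_kron_left: "dot (kron x) w = w x"
  unfolding dot_def supp_def kron_def by simp

lemma dot_kron_kron: "dot (kron x) (kron y) = (if x = y then 1 else 0)"
  unfolding dot_kron_left by (simp add: kron_def)

lemma Hop_real_on_finite:
  assumes S: "finite S" "supp v \<subseteq> S"
  shows "Hop_real d V v x = (\<Sum>y\<in>S. of_bool (y \<in> nbrs d x) * v y) + V x * v x"
proof -
  have "(\<Sum>y\<in>nbrs d x. v y) = (\<Sum>y\<in>nbrs d x \<inter> S. v y)"
    using S finite_nbrs by (intro sum.mono_neutral_right) (auto simp: supp_def)
  also have "\<dots> = (\<Sum>y\<in>S. of_bool (y \<in> nbrs d x) * v y)"
    using S by (intro sum.mono_neutral_cong_left) auto
  finally show ?thesis by (simp add: Hop_real_def)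
qed

lemma dot_Hop_real_on_finite:
  assumes "finite S" "supp v \<subseteq> S" "supp w \<subseteq> S"
  shows "dot v (Hop_real d V w) = (\<Sum>x\<in>S. \<Sum>y\<in>S. of_bool (y \<in> nbrs d x) * (v x * w y)) + (\<Sum>x\<in>S. V x * (v x * w x))"
  unfolding dot_superset[OF assms(1,2)] Hop_real_on_finite[OF assms(1,3)]
  by (simp only: distrib_left sum.distrib sum_distrib_left mult_ac)

lemma dot_Hop_real_sym:
  assumes "finsupp d v" "finsupp d w"
  shows "dot (Hop_real d V v) w = dot v (Hop_real d V w)"
proof -
  let ?S = "supp v \<union> supp w"
  have f: "finite ?S" using assms by (auto simp: finsupp_def)
  have "dot (Hop_real d V v) w = dot w (Hop_real d V v)" by (rule dot_commute[OF finsupp_Hop_real[OF assms(1)] assms(2)])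
  also have "\<dots> = (\<Sum>x\<in>?S. \<Sum>y\<in>?S. of_bool (y \<in> nbrs d x) * (w x * v y)) + (\<Sum>x\<in>?S. V x * (w x * v x))"
    using f by (intro dot_Hop_real_on_finite) auto
  also have "(\<Sum>x\<in>?S. \<Sum>y\<in>?S. of_bool (y \<in> nbrs d x) * (w x * v y)) = (\<Sum>x\<in>?S. \<Sum>y\<in>?S. of_bool (y \<in> nbrs d x) * (v x * w y))"
    by (subst sum.swap) (simp add: nbrs_sym[of _ d] mult_ac)
  also have "\<dots> + (\<Sum>x\<in>?S. V x * (w x * v x)) = dot v (Hop_real d V w)"
    using f by (subst dot_Hop_real_on_finite[of ?S]) (auto simp: mult_ac)
  finally show ?thesis .
qed

lemma dot_Hop_real_power_sym:
  assumes "finsupp d v" "finsupp d w"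
  shows "dot ((Hop_real d V ^^ n) v) w = dot v ((Hop_real d V ^^ n) w)"
  using assms(2)
proof (induction n arbitrary: w)
  case (Suc n)
  have "dot ((Hop_real d V ^^ Suc n) v) w = dot ((Hop_real d V ^^ n) v) (Hop_real d V w)"
    using dot_Hop_real_sym[OF finsupp_Hop_real_power[OF assms(1)] Suc.prems] by simp
  also have "\<dots> = dot v ((Hop_real d V ^^ n) (Hop_real d V w))" by (rule Suc.IH[OF finsupp_Hop_real[OF Suc.prems]])
  finally show ?case by (simp add: funpow_swap1)
qed simp

lemma dot_Hop_real_sym_left_finsupp:
  assumes v: "finsupp d v"
  shows "dot (Hop_real d V v) w = dot v (Hop_real d V w)"
proof -
  define S where "S = supp v \<union> supp (Hop_real d V v) \<union> (\<Union>x\<in>supp v. nbrs d x)"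
  define w' where "w' x = (if x \<in> S then w x else 0)" for x
  have S: "finite S" "S \<subseteq> Zd d"
    using v finsupp_Hop_real[OF v, of V] finite_nbrs nbrs_Zd unfolding S_def finsupp_def by (auto, blast)
  have w': "finsupp d w'" unfolding finsupp_def
  proof
    have "supp w' \<subseteq> S" by (auto simp: supp_def w'_def)
    then show "finite (supp w')" "supp w' \<subseteq> Zd d" using S by (auto intro: finite_subset)
  qed
  have "dot (Hop_real d V v) w = dot (Hop_real d V v) w'"
    unfolding dot_def by (intro sum.cong) (auto simp: w'_def S_def)
  also have "\<dots> = dot v (Hop_real d V w')" by (rule dot_Hop_real_sym[OF v w'])
  also have "\<dots> = dot v (Hop_real d V w)"
    unfolding dot_def
  proof (intro sum.cong refl arg_cong2[where f="(*)"])
    fix x assume x: "x \<in> supp v"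
    have "w' x = w x" using x by (auto simp: w'_def S_def)
    moreover have "(\<Sum>y\<in>nbrs d x. w' y) = (\<Sum>y\<in>nbrs d x. w y)"
      by (rule sum.cong) (use x in \<open>auto simp: w'_def S_def\<close>)
    ultimately show "Hop_real d V w' x = Hop_real d V w x" by (simp only: Hop_real_def[of d V _ x])
  qed
  finally show ?thesis .
qed

lemma dot_Hop_real_power_sym_left_finsupp:
  "finsupp d v \<Longrightarrow> dot ((Hop_real d V ^^ n) v) w = dot v ((Hop_real d V ^^ n) w)"
proof (induction n arbitrary: v)
  case (Suc n)
  have "dot ((Hop_real d V ^^ Suc n) v) w = dot ((Hop_real d V ^^ n) (Hop_real d V v)) w" by (simp add: funpow_swap1)
  also have "\<dots> = dot v ((Hop_real d V ^^ Suc n) w)"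
    using Suc.IH[OF finsupp_Hop_real[OF Suc.prems]] dot_Hop_real_sym_left_finsupp[OF Suc.prems] by simp
  finally show ?case .
qed simp

definition poly_op :: "nat \<Rightarrow> (site \<Rightarrow> real) \<Rightarrow> real poly \<Rightarrow> (site \<Rightarrow> real) \<Rightarrow> site \<Rightarrow> real" where
  "poly_op d V p v x = (\<Sum>i\<le>degree p. coeff p i * (Hop_real d V ^^ i) v x)"

lemma poly_op_altdef: "degree p \<le> N \<Longrightarrow> poly_op d V p v x = (\<Sum>i\<le>N. coeff p i * (Hop_real d V ^^ i) v x)"
  unfolding poly_op_def by (rule sum.mono_neutral_left) (auto simp: coeff_eq_0)

lemma finsupp_poly_op: "finsupp d v \<Longrightarrow> finsupp d (poly_op d V p v)"
  unfolding poly_op_def[abs_def] by (intro finsupp_sum finsupp_cmult finsupp_Hop_real_power)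

lemma poly_op_add: "poly_op d V (p + q) v = (\<lambda>x. poly_op d V p v x + poly_op d V q v x)"
proof
  fix x
  have "degree (p + q) \<le> max (degree p) (degree q)" by (rule degree_add_le_max)
  then show "poly_op d V (p + q) v x = poly_op d V p v x + poly_op d V q v x"
    by (simp add: poly_op_altdef[of _ "max (degree p) (degree q)"] sum.distrib[symmetric] algebra_simps)
qed

lemma poly_op_smult: "poly_op d V (smult c p) v = (\<lambda>x. c * poly_op d V p v x)"
  using degree_smult_le[of c p]
  by (auto simp: poly_op_altdef[of _ "degree p"] sum_distrib_left mult.assoc)

lemma poly_op_const: "poly_op d V [:c:] v = (\<lambda>x. c * v x)"
  by (simp add: poly_op_def fun_eq_iff)

lemma poly_op_pCons_0: "poly_op d V (pCons 0 p) v = Hop_real d V (poly_op d V p v)"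
proof
  fix x
  have "poly_op d V (pCons 0 p) v x = (\<Sum>i\<le>Suc (degree p). coeff (pCons 0 p) i * (Hop_real d V ^^ i) v x)"
    by (rule poly_op_altdef) (rule degree_pCons_le)
  also have "\<dots> = (\<Sum>i\<le>degree p. coeff p i * (Hop_real d V ^^ Suc i) v x)"
    by (subst sum.atMost_Suc_shift) simp
  also have "\<dots> = Hop_real d V (poly_op d V p v) x"
    unfolding poly_op_def[abs_def] Hop_real_sum by simp
  finally show "poly_op d V (pCons 0 p) v x = Hop_real d V (poly_op d V p v) x" .
qed

lemma poly_op_pCons: "poly_op d V (pCons a p) v = (\<lambda>x. a * v x + Hop_real d V (poly_op d V p v) x)"
  using poly_op_add[of d V "[:a:]" "pCons 0 p" v] by (simp add: poly_op_const poly_op_pCons_0)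

lemma poly_op_mult: "poly_op d V (p * q) v = poly_op d V p (poly_op d V q v)"
proof (induction p)
  case 0 show ?case by (simp add: poly_op_def fun_eq_iff)
next
  case (pCons a p)
  then show ?case by (simp add: poly_op_add poly_op_smult poly_op_pCons_0 poly_op_pCons)
qed

lemma dot_poly_op: "dot v (poly_op d V p w) = (\<Sum>i\<le>degree p. coeff p i * dot v ((Hop_real d V ^^ i) w))"
  unfolding poly_op_def[abs_def] dot_sum_right
  using dot_linear_right[of v _ _ 0 "\<lambda>_. 0"] by simp

lemma dot_poly_op_sym:
  assumes "finsupp d v" "finsupp d w"
  shows "dot (poly_op d V p v) w = dot v (poly_op d V p w)"
proof -
  have "dot (poly_op d V p v) w = dot w (poly_op d V p v)" by (rule dot_commute[OF finsupp_poly_op[OF assms(1)] assms(2)])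
  also have "\<dots> = dot v (poly_op d V p w)"
    unfolding dot_poly_op using dot_Hop_real_power_sym[OF assms] dot_commute[OF assms(2) finsupp_Hop_real_power[OF assms(1)]] by simp
  finally show ?thesis .
qed

definition pos_poly :: "nat \<Rightarrow> (site \<Rightarrow> real) \<Rightarrow> real poly \<Rightarrow> bool" where
  "pos_poly d V p \<longleftrightarrow> (\<forall>v. finsupp d v \<longrightarrow> 0 \<le> dot v (poly_op d V p v))"

lemma pos_poly_add: "pos_poly d V p \<Longrightarrow> pos_poly d V q \<Longrightarrow> pos_poly d V (p + q)"
  unfolding pos_poly_def poly_op_add
  using dot_linear_right[where 'a=site, of _ 1 _ 1] by simp

lemma pos_poly_1: "pos_poly d V 1"
  by (simp add: pos_poly_def one_pCons poly_op_const dot_nonneg)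

lemma pos_poly_square_mult:
  assumes "pos_poly d V h" shows "pos_poly d V (g * g * h)"
  unfolding pos_poly_def
proof (intro allI impI)
  fix v assume v: "finsupp d v"
  have "dot v (poly_op d V (g * g * h) v) = dot v (poly_op d V g (poly_op d V (h * g) v))"
    by (simp only: poly_op_mult[symmetric] mult_ac)
  also have "\<dots> = dot (poly_op d V g v) (poly_op d V (h * g) v)"
    by (rule dot_poly_op_sym[symmetric]) (intro finsupp_poly_op v)+
  also have "\<dots> \<ge> 0"
    using assms finsupp_poly_op[OF v] by (simp add: poly_op_mult pos_poly_def)
  finally show "0 \<le> dot v (poly_op d V (g * g * h) v)" .
qed

text \<open>Commuting positive operators with sum one: squares can be split off, and \<open>T T' = T\<^sup>2 T' + T'\<^sup>2 T\<close>.\<close>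

lemma pos_poly_power_mult:
  assumes T: "pos_poly d V T" and T': "pos_poly d V T'" and sum: "T + T' = 1"
  shows "pos_poly d V (T ^ k * T' ^ l)"
proof -
  have small: "pos_poly d V (T ^ r * T' ^ s)" if rs: "r < 2" "s < 2" for r s
  proof -
    consider "r = 0 \<and> s = 0" | "r = 1 \<and> s = 0" | "r = 0 \<and> s = 1" | "r = 1 \<and> s = 1" using rs by linarith
    then show ?thesis
    proof cases
      case 4
      have "T * T' = T * T' * (T + T')" by (simp add: sum)
      also have "\<dots> = T * T * T' + T' * T' * T" by (simp add: algebra_simps)
      finally show ?thesis using 4 pos_poly_add[OF pos_poly_square_mult[OF T'] pos_poly_square_mult[OF T]] by simp
    qed (use T T' pos_poly_1 in simp_all)
  qed
  have split: "p ^ n = p ^ (n div 2) * p ^ (n div 2) * p ^ (n mod 2)" for p :: "real poly" and n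
    by (simp add: power_add[symmetric] mult_2[symmetric])
  have "T ^ k * T' ^ l = (T ^ (k div 2) * T' ^ (l div 2)) * (T ^ (k div 2) * T' ^ (l div 2)) * (T ^ (k mod 2) * T' ^ (l mod 2))"
    by (subst split[of T k], subst split[of T' l]) (simp only: mult_ac)
  then show ?thesis using pos_poly_square_mult[OF small] by simp
qed

lemma nbrs_form_bound:
  fixes v :: "site \<Rightarrow> real"
  assumes S: "finite S"
  shows "\<bar>\<Sum>x\<in>S. \<Sum>y\<in>S. of_bool (y \<in> nbrs d x) * (v x * v y)\<bar> \<le> (\<Sum>x\<in>S. 2 * real d * (v x)\<^sup>2)"
proof -
  let ?n = "\<lambda>x y. of_bool (y \<in> nbrs d x) :: real"
  have "\<bar>a * b\<bar> \<le> a\<^sup>2 / 2 + b\<^sup>2 / 2" for a b :: real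
    using sum_squares_bound[of "\<bar>a\<bar>" "\<bar>b\<bar>"] by (simp add: abs_mult)
  then have "\<bar>\<Sum>x\<in>S. \<Sum>y\<in>S. ?n x y * (v x * v y)\<bar> \<le> (\<Sum>x\<in>S. \<Sum>y\<in>S. ?n x y * ((v x)\<^sup>2 / 2 + (v y)\<^sup>2 / 2))"
    by (intro order_trans[OF sum_abs] sum_mono) (auto simp: of_bool_def)
  also have "\<dots> = (\<Sum>x\<in>S. \<Sum>y\<in>S. ?n x y * ((v x)\<^sup>2 / 2)) + (\<Sum>x\<in>S. \<Sum>y\<in>S. ?n x y * ((v y)\<^sup>2 / 2))"
    by (simp only: distrib_left sum.distrib)
  also have "(\<Sum>x\<in>S. \<Sum>y\<in>S. ?n x y * ((v y)\<^sup>2 / 2)) = (\<Sum>x\<in>S. \<Sum>y\<in>S. ?n x y * ((v x)\<^sup>2 / 2))"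
    by (subst sum.swap) (simp add: nbrs_sym[of _ d])
  also have "(\<Sum>x\<in>S. \<Sum>y\<in>S. ?n x y * ((v x)\<^sup>2 / 2)) + \<dots> = (\<Sum>x\<in>S. (\<Sum>y\<in>S. ?n x y) * (v x)\<^sup>2)"
    unfolding sum.distrib[symmetric] sum_distrib_right by (intro sum.cong refl) simp
  also have "\<dots> \<le> (\<Sum>x\<in>S. 2 * real d * (v x)\<^sup>2)"
  proof (intro sum_mono mult_right_mono)
    fix x
    have "(\<Sum>y\<in>S. ?n x y) = real (card (S \<inter> nbrs d x))"
      using S by (simp add: of_bool_def sum.inter_filter[symmetric] Int_def)
    also have "card (S \<inter> nbrs d x) \<le> 2 * d"
      by (rule order_trans[OF card_mono[OF finite_nbrs Int_lower2] card_nbrs])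
    finally show "(\<Sum>y\<in>S. ?n x y) \<le> 2 * real d" by simp
  qed simp
  finally show ?thesis .
qed

locale bounded_potential =
  fixes d :: nat and V :: "site \<Rightarrow> real" and R :: real
  assumes R0: "0 \<le> R" and bounded: "\<And>x. x \<in> Zd d \<Longrightarrow> \<bar>V x\<bar> \<le> R"
begin

definition rad :: real where
  "rad = R + 2 * real d + 1"

lemma rad_pos: "0 < rad"
  using R0 by (simp add: rad_def)

lemma form_bound:
  assumes v: "finsupp d v"
  shows "\<bar>dot v (Hop_real d V v)\<bar> \<le> rad * dot v v"
proof -
  have S: "finite (supp v)" "supp v \<subseteq> Zd d" using v by (auto simp: finsupp_def)
  have "\<bar>\<Sum>x\<in>supp v. V x * (v x * v x)\<bar> \<le> (\<Sum>x\<in>supp v. R * (v x)\<^sup>2)"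
    by (rule order_trans[OF sum_abs], rule sum_mono)
      (use S bounded in \<open>auto simp: abs_mult power2_eq_square intro!: mult_right_mono\<close>)
  then have "\<bar>dot v (Hop_real d V v)\<bar> \<le> (\<Sum>x\<in>supp v. 2 * real d * (v x)\<^sup>2) + (\<Sum>x\<in>supp v. R * (v x)\<^sup>2)"
    unfolding dot_Hop_real_on_finite[OF S(1) order_refl order_refl]
    using nbrs_form_bound[OF S(1), of d v] by linarith
  also have "\<dots> \<le> rad * dot v v"
    unfolding dot_def rad_def sum_distrib_left sum.distrib[symmetric]
    by (intro sum_mono) (simp add: algebra_simps power2_eq_square)
  finally show ?thesis .
qed

lemma pos_poly_bernstein: "pos_poly d V (bernstein rad k l)"
  unfolding bernstein_def
proof (rule pos_poly_power_mult)
  have "poly_op d V [:a, b:] v = (\<lambda>x. a * v x + b * Hop_real d V v x)" for a b v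
    using poly_op_pCons[of d V a "[:b:]" v] Hop_real_linear[of d V b v 0 v] by (simp add: poly_op_const)
  then have "dot v (poly_op d V [:a, b:] v) = a * dot v v + b * dot v (Hop_real d V v)" for a b v
    by (simp add: dot_linear_right)
  then show "pos_poly d V [:1/2, 1/(2*rad):]" "pos_poly d V [:1/2, -1/(2*rad):]"
    unfolding pos_poly_def using rad_pos by (auto dest!: form_bound simp: field_simps abs_le_iff)
qed (simp add: one_pCons)

end

section \<open>The spectral form\<close>

definition spec_measure :: "nat \<Rightarrow> (site \<Rightarrow> real) \<Rightarrow> (site \<Rightarrow> real) \<Rightarrow> real measure" where
  "spec_measure d V v = specmeas d V (\<lambda>x. complex_of_real (v x))"

definition spec_form :: "nat \<Rightarrow> (site \<Rightarrow> real) \<Rightarrow> (real \<Rightarrow> real) \<Rightarrow> (site \<Rightarrow> real) \<Rightarrow> (site \<Rightarrow> real) \<Rightarrow> real" where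
  "spec_form d V f v w =
    ((\<integral>t. f t \<partial>spec_measure d V (\<lambda>x. v x + w x)) - (\<integral>t. f t \<partial>spec_measure d V (\<lambda>x. v x - w x))) / 4"

lemma specmeas_eq_moment_measure: "specmeas d V v = moment_measure (\<lambda>n. innerZ d v ((Hop d V ^^ n) v))"
  unfolding specmeas_def moment_measure_def has_moments_def finite_borel_on_def
  by (rule arg_cong[where f=The]) auto

lemma innerZ_of_real:
  assumes "finsupp d v"
  shows "innerZ d (\<lambda>x. complex_of_real (v x)) (\<lambda>x. complex_of_real (w x)) = complex_of_real (dot v w)"
proof -
  have "innerZ d (\<lambda>x. complex_of_real (v x)) (\<lambda>x. complex_of_real (w x)) = infsum (\<lambda>x. complex_of_real (v x * w x)) (supp v)"
    unfolding innerZ_def using assms by (intro infsum_cong_neutral) (auto simp: supp_def finsupp_def)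
  also have "\<dots> = complex_of_real (dot v w)"
    using assms by (simp add: infsum_finite dot_def finsupp_def)
  finally show ?thesis .
qed

lemma spec_measure_eq_moment_measure:
  assumes "finsupp d v"
  shows "spec_measure d V v = moment_measure (\<lambda>n. complex_of_real (dot v ((Hop_real d V ^^ n) v)))"
  unfolding spec_measure_def specmeas_eq_moment_measure Hop_power_of_real innerZ_of_real[OF assms] ..

lemma fmat_eq_spec_form:
  "fmat d V (\<lambda>t. complex_of_real (f t)) x y = complex_of_real (spec_form d V f (kron x) (kron y))"
proof -
  have "(\<lambda>z. delta x z + delta y z) = (\<lambda>z. complex_of_real (kron x z + kron y z))"
    "(\<lambda>z. delta x z - delta y z) = (\<lambda>z. complex_of_real (kron x z - kron y z))"
    by (auto simp: delta_def kron_def)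
  then show ?thesis unfolding fmat_def spec_form_def spec_measure_def by simp
qed

definition cut_pow :: "real \<Rightarrow> nat \<Rightarrow> real \<Rightarrow> real" where
  "cut_pow C n t = t ^ n * indicator {-C..C} t"

lemma bdd_borel_cut_pow: "bdd_borel (cut_pow C n)"
  unfolding cut_pow_def by (intro bdd_borel_continuous_compact continuous_intros) auto

lemma cut_pow_mult: "cut_pow C m t * cut_pow C n t = cut_pow C (m + n) t"
  by (simp add: cut_pow_def indicator_def power_add)

lemma normal_functional_eqI_cut_pow:
  assumes "normal_functional A" "normal_functional B" "bdd_borel f"
    and "\<And>n. A (cut_pow C n) = B (cut_pow C n)"
    and "A (\<lambda>t. f t * indicator {-C..C} t) = A f" "B (\<lambda>t. f t * indicator {-C..C} t) = B f"
  shows "A f = B f"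
proof -
  have "A (\<lambda>t. f t * indicator {-C..C} t) = B (\<lambda>t. f t * indicator {-C..C} t)"
    by (rule normal_functional_eqI[OF assms(1,2) separating_system_powers _ assms(3)])
      (use assms(4) in \<open>auto simp: cut_pow_def[abs_def]\<close>)
  with assms(5,6) show ?thesis by simp
qed

lemma quadratic_form_discriminant:
  fixes a b c :: real
  assumes nonneg: "\<And>s r. 0 \<le> s\<^sup>2 * a + 2 * s * r * b + r\<^sup>2 * c"
  shows "b\<^sup>2 \<le> a * c"
proof -
  have a: "0 \<le> a" and c: "0 \<le> c" using nonneg[of 1 0] nonneg[of 0 1] by simp_all
  have "0 \<le> a * (a * c - b\<^sup>2)" using nonneg[of "-b" a] by (simp add: power2_eq_square algebra_simps)
  moreover have "0 \<le> c * (a * c - b\<^sup>2)" using nonneg[of c "-b"] by (simp add: power2_eq_square algebra_simps)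
  moreover have "b = 0" if "a = 0" "c = 0" using nonneg[of 1 1] nonneg[of 1 "-1"] that by simp
  ultimately show ?thesis using a c by (cases "a = 0 \<and> c = 0") (auto simp: zero_le_mult_iff)
qed

context bounded_potential
begin

lemma finite_borel_on_spec_measure:
    "finsupp d v \<Longrightarrow> finite_borel_on {-rad..rad} (spec_measure d V v)"
  and spec_measure_moment: "finsupp d v \<Longrightarrow> (\<integral>t. t ^ n \<partial>spec_measure d V v) = dot v ((Hop_real d V ^^ n) v)"
proof -
  assume v: "finsupp d v"
  have "0 \<le> moment_functional (\<lambda>n. dot v ((Hop_real d V ^^ n) v)) (bernstein rad k l)" for k l
    using pos_poly_bernstein[of k l] v unfolding pos_poly_def dot_poly_op moment_functional_def by simp
  then have "hausdorff_condition rad (\<lambda>n. complex_of_real (dot v ((Hop_real d V ^^ n) v)))"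
    by (simp add: hausdorff_condition_def)
  note M = hausdorff_condition_imp_moment_measure[OF rad_pos this]
  show "finite_borel_on {-rad..rad} (spec_measure d V v)"
    "(\<integral>t. t ^ n \<partial>spec_measure d V v) = dot v ((Hop_real d V ^^ n) v)"
    using M(1) M(2)[of n] by (simp_all add: spec_measure_eq_moment_measure[OF v])
qed

lemma spec_measure_restrict:
  fixes f :: "real \<Rightarrow> real"
  assumes "finsupp d v" "f \<in> borel_measurable borel"
  shows "(\<integral>t. f t * indicator {-rad..rad} t \<partial>spec_measure d V v) = (\<integral>t. f t \<partial>spec_measure d V v)"
  by (rule integral_eq_integral_indicator[OF finite_borel_on_spec_measure[OF assms(1)] _ assms(2), symmetric]) simp

lemma spec_measure_power:
  "finsupp d v \<Longrightarrow> (\<integral>t. cut_pow rad n t \<partial>spec_measure d V v) = dot v ((Hop_real d V ^^ n) v)"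
  using spec_measure_restrict[of v "\<lambda>t. t ^ n"] by (simp add: spec_measure_moment cut_pow_def)

lemma normal_functional_spec_measure: "finsupp d v \<Longrightarrow> normal_functional (\<lambda>f. \<integral>t. f t \<partial>spec_measure d V v)"
  by (rule normal_functional_integral[OF finite_borel_on_spec_measure])

lemma normal_functional_spec_form:
  assumes "finsupp d v" "finsupp d w" shows "normal_functional (\<lambda>f. spec_form d V f v w)"
proof -
  have "normal_functional (\<lambda>f. (1/4) * ((\<integral>t. f t \<partial>spec_measure d V (\<lambda>x. v x + w x)) - (\<integral>t. f t \<partial>spec_measure d V (\<lambda>x. v x - w x))))"
    using assms by (intro normal_functional_cmult normal_functional_diff normal_functional_spec_measure finsupp_add finsupp_diff)
  then show ?thesis unfolding spec_form_def by simp
qed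

lemma spec_form_restrict:
  fixes f :: "real \<Rightarrow> real"
  assumes "finsupp d v" "finsupp d w" "f \<in> borel_measurable borel"
  shows "spec_form d V (\<lambda>t. f t * indicator {-rad..rad} t) v w = spec_form d V f v w"
  unfolding spec_form_def using assms by (simp add: spec_measure_restrict finsupp_add finsupp_diff)

lemma spec_form_power:
  assumes v: "finsupp d v" and w: "finsupp d w"
  shows "spec_form d V (cut_pow rad n) v w = dot v ((Hop_real d V ^^ n) w)"
proof -
  let ?H = "Hop_real d V ^^ n"
  have add: "dot (\<lambda>x. v x + w x) (?H (\<lambda>x. v x + w x)) = dot v (?H v) + dot v (?H w) + dot w (?H v) + dot w (?H w)"
    using Hop_real_power_linear[of n d V 1 v 1 w] dot_linear_left[OF v w, of 1 1 "\<lambda>x. ?H v x + ?H w x"]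
      dot_linear_right[of v 1 "?H v" 1 "?H w"] dot_linear_right[of w 1 "?H v" 1 "?H w"] by simp
  have diff: "dot (\<lambda>x. v x - w x) (?H (\<lambda>x. v x - w x)) = dot v (?H v) - dot v (?H w) - dot w (?H v) + dot w (?H w)"
    using Hop_real_power_linear[of n d V 1 v "-1" w] dot_linear_left[OF v w, of 1 "-1" "\<lambda>x. ?H v x - ?H w x"]
      dot_linear_right[of v 1 "?H v" "-1" "?H w"] dot_linear_right[of w 1 "?H v" "-1" "?H w"] by simp
  have "dot w (?H v) = dot v (?H w)"
    using dot_Hop_real_power_sym[OF v w] dot_commute[OF w finsupp_Hop_real_power[OF v]] by simp
  then show ?thesis
    unfolding spec_form_def spec_measure_power[OF finsupp_add[OF v w]] spec_measure_power[OF finsupp_diff[OF v w]] add diff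
    by simp
qed

lemma spec_form_diag:
  assumes v: "finsupp d v" and f: "bdd_borel f"
  shows "spec_form d V f v v = (\<integral>t. f t \<partial>spec_measure d V v)"
  by (rule normal_functional_eqI_cut_pow[where C=rad, OF normal_functional_spec_form[OF v v] normal_functional_spec_measure[OF v] f])
    (simp_all add: spec_form_power spec_measure_power spec_form_restrict spec_measure_restrict v f bdd_borel_measurable)

lemma spec_form_sym:
  assumes v: "finsupp d v" and w: "finsupp d w" and f: "bdd_borel f"
  shows "spec_form d V f v w = spec_form d V f w v"
  by (rule normal_functional_eqI_cut_pow[where C=rad, OF normal_functional_spec_form[OF v w] normal_functional_spec_form[OF w v] f])
    (use dot_Hop_real_power_sym[OF v w] dot_commute[OF w finsupp_Hop_real_power[OF v]]
      in \<open>simp_all add: spec_form_power spec_form_restrict v w f bdd_borel_measurable\<close>)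

lemma spec_form_linear_right:
  assumes v: "finsupp d v" and w: "finsupp d w" and u: "finsupp d u" and f: "bdd_borel f"
  shows "spec_form d V f v (\<lambda>x. a * w x + b * u x) = a * spec_form d V f v w + b * spec_form d V f v u"
  by (rule normal_functional_eqI_cut_pow[where C=rad, OF normal_functional_spec_form[OF v finsupp_linear[OF w u]]
        normal_functional_add[OF normal_functional_cmult[OF normal_functional_spec_form[OF v w]]
          normal_functional_cmult[OF normal_functional_spec_form[OF v u]]] f])
    (simp_all add: spec_form_power spec_form_restrict v w u f bdd_borel_measurable finsupp_linear
      Hop_real_power_linear dot_linear_right)

lemma spec_form_linear_left:
  assumes v: "finsupp d v" and w: "finsupp d w" and u: "finsupp d u" and f: "bdd_borel f"
  shows "spec_form d V f (\<lambda>x. a * w x + b * u x) v = a * spec_form d V f w v + b * spec_form d V f u v"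
  using spec_form_linear_right[OF v w u f] spec_form_sym[OF v _ f] w u finsupp_linear by simp

lemma spec_form_sum_right:
  assumes v: "finsupp d v" and f: "bdd_borel f" and S: "finite S" "S \<subseteq> Zd d"
  shows "spec_form d V f v (\<lambda>x. \<Sum>u\<in>S. c u * kron u x) = (\<Sum>u\<in>S. c u * spec_form d V f v (kron u))"
  using S
proof (induction S rule: finite_induct)
  case empty
  show ?case using spec_form_linear_right[OF v finsupp_0 finsupp_0 f, of 0 0] by simp
next
  case (insert u S)
  have "finsupp d (\<lambda>x. \<Sum>u\<in>S. c u * kron u x)" using insert by (intro finsupp_sum finsupp_cmult finsupp_kron) auto
  then show ?case
    using insert spec_form_linear_right[OF v finsupp_kron[of u] _ f, of "\<lambda>x. \<Sum>u\<in>S. c u * kron u x" "c u" 1] by simp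
qed

lemma spec_form_expand:
  "finsupp d v \<Longrightarrow> finsupp d w \<Longrightarrow> bdd_borel f \<Longrightarrow> spec_form d V f v w = (\<Sum>u\<in>supp w. w u * spec_form d V f v (kron u))"
  using spec_form_sum_right[of v f "supp w" w] finsupp_as_sum[of d w] by (auto simp: finsupp_def)

lemma spec_form_nonneg:
  assumes v: "finsupp d v" and f: "bdd_borel f" "\<And>t. t \<in> {-rad..rad} \<Longrightarrow> 0 \<le> f t"
  shows "0 \<le> spec_form d V f v v"
proof -
  have "spec_form d V f v v = (\<integral>t. f t * indicator {-rad..rad} t \<partial>spec_measure d V v)"
    using spec_form_diag[OF v f(1)] spec_measure_restrict[OF v bdd_borel_measurable[OF f(1)]] by simp
  also have "\<dots> \<ge> 0" by (intro Bochner_Integration.integral_nonneg) (use f(2) in \<open>auto simp: indicator_def\<close>)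
  finally show ?thesis .
qed

lemma sum_spec_form_nonneg:
  assumes f: "bdd_borel f" "\<And>t. t \<in> {-rad..rad} \<Longrightarrow> 0 \<le> f t" and S: "finite S" "S \<subseteq> Zd d"
  shows "0 \<le> (\<Sum>(x, y)\<in>S \<times> S. spec_form d V f (kron x) (kron y) * (c x * c y))"
proof -
  define v where "v = (\<lambda>z. \<Sum>u\<in>S. c u * kron u z)"
  have fv: "finsupp d v" unfolding v_def using S by (intro finsupp_sum finsupp_cmult finsupp_kron) auto
  have expand: "spec_form d V f w v = (\<Sum>x\<in>S. c x * spec_form d V f w (kron x))" if "finsupp d w" for w
    unfolding v_def using S finsupp_kron by (intro spec_form_sum_right that f) auto
  have "spec_form d V f v v = (\<Sum>x\<in>S. c x * (\<Sum>y\<in>S. c y * spec_form d V f (kron x) (kron y)))"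
    unfolding expand[OF fv]
  proof (intro sum.cong refl arg_cong2[where f="(*)"])
    fix x assume "x \<in> S" then have x: "finsupp d (kron x)" using S finsupp_kron by auto
    show "spec_form d V f v (kron x) = (\<Sum>y\<in>S. c y * spec_form d V f (kron x) (kron y))"
      using expand[OF x] spec_form_sym[OF x fv f(1)] by simp
  qed
  also have "\<dots> = (\<Sum>(x, y)\<in>S \<times> S. spec_form d V f (kron x) (kron y) * (c x * c y))"
    by (simp add: sum_distrib_left sum.cartesian_product[symmetric] mult_ac)
  finally show ?thesis using spec_form_nonneg[OF fv f] by simp
qed

lemma spec_form_one: "finsupp d v \<Longrightarrow> finsupp d w \<Longrightarrow> spec_form d V (\<lambda>_. 1) v w = dot v w"
  using spec_form_power[of v w 0] spec_form_restrict[of v w "\<lambda>_. 1"] by (simp add: cut_pow_def[abs_def])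

lemma spec_form_cmult:
  "finsupp d v \<Longrightarrow> finsupp d w \<Longrightarrow> bdd_borel f \<Longrightarrow> spec_form d V (\<lambda>t. c * f t) v w = c * spec_form d V f v w"
  by (rule normal_functional.scale[OF normal_functional_spec_form])

lemma spec_form_add:
  "finsupp d v \<Longrightarrow> finsupp d w \<Longrightarrow> bdd_borel f \<Longrightarrow> bdd_borel g \<Longrightarrow>
    spec_form d V (\<lambda>t. f t + g t) v w = spec_form d V f v w + spec_form d V g v w"
  by (rule normal_functional.add[OF normal_functional_spec_form])

lemma spec_form_diff:
  "finsupp d v \<Longrightarrow> finsupp d w \<Longrightarrow> bdd_borel f \<Longrightarrow> bdd_borel g \<Longrightarrow>
    spec_form d V (\<lambda>t. f t - g t) v w = spec_form d V f v w - spec_form d V g v w"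
  using spec_form_add[of v w f "\<lambda>t. - 1 * g t"] spec_form_cmult[of v w g "-1"] bdd_borel_cmult[of g "-1"] by simp

lemma spec_form_mono:
  assumes v: "finsupp d v" and f: "bdd_borel f" "bdd_borel g" "\<And>t. t \<in> {-rad..rad} \<Longrightarrow> f t \<le> g t"
  shows "spec_form d V f v v \<le> spec_form d V g v v"
  using spec_form_nonneg[OF v bdd_borel_diff[OF f(2,1)]] f spec_form_diff[OF v v f(2,1)] by simp

lemma spec_form_le:
  assumes v: "finsupp d v" and f: "bdd_borel f" "\<And>t. t \<in> {-rad..rad} \<Longrightarrow> f t \<le> c"
  shows "spec_form d V f v v \<le> c * dot v v"
  using spec_form_mono[OF v f(1) bdd_borel_const[of c]] f(2) spec_form_cmult[OF v v bdd_borel_const[of 1], of c]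
    spec_form_one[OF v v] by simp

lemma spec_form_Cauchy_Schwarz:
  assumes v: "finsupp d v" and w: "finsupp d w" and f: "bdd_borel f" "\<And>t. t \<in> {-rad..rad} \<Longrightarrow> 0 \<le> f t"
  shows "(spec_form d V f v w)\<^sup>2 \<le> spec_form d V f v v * spec_form d V f w w"
proof (rule quadratic_form_discriminant)
  fix s r
  let ?u = "\<lambda>x. s * v x + r * w x"
  have u: "finsupp d ?u" by (rule finsupp_linear[OF v w])
  have "0 \<le> spec_form d V f ?u ?u" by (rule spec_form_nonneg[OF u f])
  also have "spec_form d V f ?u ?u = s * spec_form d V f v ?u + r * spec_form d V f w ?u"
    by (rule spec_form_linear_left[OF u v w f(1)])
  also have "\<dots> = s\<^sup>2 * spec_form d V f v v + 2 * s * r * spec_form d V f v w + r\<^sup>2 * spec_form d V f w w"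
    by (simp add: spec_form_linear_right v w f(1) spec_form_sym[OF w v f(1)] power2_eq_square algebra_simps)
  finally show "0 \<le> s\<^sup>2 * spec_form d V f v v + 2 * s * r * spec_form d V f v w + r\<^sup>2 * spec_form d V f w w" .
qed

end

section \<open>Products in the functional calculus\<close>

definition sq_sum_le :: "'a set \<Rightarrow> real \<Rightarrow> ('a \<Rightarrow> real) \<Rightarrow> bool" where
  "sq_sum_le X M a \<longleftrightarrow> (\<forall>S. finite S \<longrightarrow> S \<subseteq> X \<longrightarrow> (\<Sum>u\<in>S. (a u)\<^sup>2) \<le> M)"

lemma sq_sum_leD: "sq_sum_le X M a \<Longrightarrow> finite S \<Longrightarrow> S \<subseteq> X \<Longrightarrow> (\<Sum>u\<in>S. (a u)\<^sup>2) \<le> M"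
  by (simp add: sq_sum_le_def)

lemma has_sum_abs_le:
  fixes f :: "'a \<Rightarrow> real"
  assumes "(f has_sum s) A" "\<And>T. finite T \<Longrightarrow> T \<subseteq> A \<Longrightarrow> \<bar>sum f T\<bar> \<le> c"
  shows "\<bar>s\<bar> \<le> c"
proof -
  have "(sum f \<longlongrightarrow> s) (finite_subsets_at_top A)" using assms(1) by (simp add: has_sum_def)
  then have "((\<lambda>T. \<bar>sum f T\<bar>) \<longlongrightarrow> \<bar>s\<bar>) (finite_subsets_at_top A)" by (rule tendsto_rabs)
  then show ?thesis
    by (rule tendsto_upperbound) (auto intro!: eventually_finite_subsets_at_top_weakI assms(2))
qed

lemma sq_sum_le_summable: "sq_sum_le X M a \<Longrightarrow> (\<lambda>u. (a u)\<^sup>2) summable_on X"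
  by (rule nonneg_bdd_above_summable_on) (auto intro!: bdd_aboveI2[where M=M] simp: sq_sum_le_def)

lemma sq_sum_le_mult_summable:
  fixes a b :: "'a \<Rightarrow> real"
  assumes "sq_sum_le X M a" "sq_sum_le X N b"
  shows "(\<lambda>u. \<bar>a u * b u\<bar>) summable_on X" "(\<lambda>u. a u * b u) summable_on X"
proof -
  have "(\<lambda>u. (a u)\<^sup>2 + (b u)\<^sup>2) summable_on X"
    by (intro summable_on_add sq_sum_le_summable[OF assms(1)] sq_sum_le_summable[OF assms(2)])
  moreover have "2 * \<bar>a u * b u\<bar> \<le> (a u)\<^sup>2 + (b u)\<^sup>2" for u
    using sum_squares_bound[of "\<bar>a u\<bar>" "\<bar>b u\<bar>"] by (simp add: abs_mult mult.assoc)
  then have "\<bar>a u * b u\<bar> \<le> (a u)\<^sup>2 + (b u)\<^sup>2" for u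
    using abs_ge_zero[of "a u * b u"] by (smt (verit))
  ultimately have abs: "(\<lambda>u. \<bar>a u * b u\<bar>) summable_on X"
    by (rule summable_on_comparison_test) simp_all
  then show "(\<lambda>u. \<bar>a u * b u\<bar>) summable_on X" .
  show "(\<lambda>u. a u * b u) summable_on X"
    by (rule abs_summable_summable) (use abs in \<open>simp only: real_norm_def\<close>)
qed

lemma sq_sum_le_LIMSEQ:
  assumes b: "\<And>n::nat. sq_sum_le X N (b n)" and lim: "\<And>u. u \<in> X \<Longrightarrow> (\<lambda>n. b n u) \<longlonglongrightarrow> b' u"
  shows "sq_sum_le X N b'"
  unfolding sq_sum_le_def
proof (intro allI impI)
  fix S assume S: "finite S" "S \<subseteq> X"
  show "(\<Sum>u\<in>S. (b' u)\<^sup>2) \<le> N"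
  proof (rule tendsto_upperbound[where f="\<lambda>n. \<Sum>u\<in>S. (b n u)\<^sup>2" and F=sequentially])
    show "(\<lambda>n. \<Sum>u\<in>S. (b n u)\<^sup>2) \<longlonglongrightarrow> (\<Sum>u\<in>S. (b' u)\<^sup>2)"
      using S lim by (intro tendsto_sum tendsto_power) auto
  qed (use sq_sum_leD[OF b S] in auto)
qed

lemma infsum_split_finite:
  fixes f :: "'a \<Rightarrow> real"
  assumes "f summable_on X" "finite S" "S \<subseteq> X"
  shows "infsum f X = sum f S + infsum f (X - S)"
  using infsum_Diff[OF assms(1) summable_on_finite[OF assms(2)] assms(3)] assms(2) by simp

lemma abs_sum_mult_le_sqrt:
  fixes a b :: "'a \<Rightarrow> real"
  shows "\<bar>\<Sum>u\<in>T. a u * b u\<bar> \<le> sqrt (\<Sum>u\<in>T. (a u)\<^sup>2) * sqrt (\<Sum>u\<in>T. (b u)\<^sup>2)"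
  using real_sqrt_le_mono[OF Cauchy_Schwarz_ineq_sum[of a b T]] by (simp add: real_sqrt_mult)

lemma abs_infsum_mult_le_sqrt:
  fixes a b :: "'a \<Rightarrow> real"
  assumes a: "sq_sum_le X M a" and b: "sq_sum_le X N b"
  shows "\<bar>infsum (\<lambda>u. a u * b u) X\<bar> \<le> sqrt (infsum (\<lambda>u. (a u)\<^sup>2) X) * sqrt N"
proof (rule has_sum_abs_le[OF has_sum_infsum[OF sq_sum_le_mult_summable(2)[OF a b]]])
  fix T assume T: "finite T" "T \<subseteq> X"
  have "\<bar>\<Sum>u\<in>T. a u * b u\<bar> \<le> sqrt (\<Sum>u\<in>T. (a u)\<^sup>2) * sqrt (\<Sum>u\<in>T. (b u)\<^sup>2)"
    by (rule abs_sum_mult_le_sqrt)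
  also have "\<dots> \<le> sqrt (infsum (\<lambda>u. (a u)\<^sup>2) X) * sqrt N"
  proof (intro mult_mono real_sqrt_le_mono sq_sum_leD[OF b T])
    show "(\<Sum>u\<in>T. (a u)\<^sup>2) \<le> infsum (\<lambda>u. (a u)\<^sup>2) X"
      using T by (intro finite_sum_le_infsum sq_sum_le_summable[OF a]) auto
  qed (simp_all add: infsum_nonneg sum_nonneg)
  finally show "\<bar>\<Sum>u\<in>T. a u * b u\<bar> \<le> sqrt (infsum (\<lambda>u. (a u)\<^sup>2) X) * sqrt N" .
qed

lemma small_l2_tail:
  fixes a :: "'a \<Rightarrow> real"
  assumes a: "sq_sum_le X M a" and e: "0 < e"
  obtains S where "finite S" "S \<subseteq> X" "sqrt (infsum (\<lambda>u. (a u)\<^sup>2) (X - S)) * c < e"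
proof -
  let ?s = "infsum (\<lambda>u. (a u)\<^sup>2) X"
  have sum: "(\<lambda>u. (a u)\<^sup>2) summable_on X" by (rule sq_sum_le_summable[OF a])
  have "((\<lambda>S. \<Sum>u\<in>S. (a u)\<^sup>2) \<longlongrightarrow> ?s) (finite_subsets_at_top X)"
    using has_sum_infsum[OF sum] by (simp add: has_sum_def)
  then have "((\<lambda>S. sqrt (?s - (\<Sum>u\<in>S. (a u)\<^sup>2)) * c) \<longlongrightarrow> sqrt (?s - ?s) * c) (finite_subsets_at_top X)"
    by (intro tendsto_intros)
  then have "eventually (\<lambda>S. sqrt (?s - (\<Sum>u\<in>S. (a u)\<^sup>2)) * c < e) (finite_subsets_at_top X)"
    by (rule order_tendstoD) (use e in simp)
  then obtain S where S: "finite S" "S \<subseteq> X" "sqrt (?s - (\<Sum>u\<in>S. (a u)\<^sup>2)) * c < e"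
    by (auto simp: eventually_finite_subsets_at_top)
  then show ?thesis using infsum_split_finite[OF sum S(1,2)] by (intro that) auto
qed

lemma weak_l2_limit:
  fixes a :: "'a \<Rightarrow> real" and b :: "nat \<Rightarrow> 'a \<Rightarrow> real"
  assumes a: "sq_sum_le X M a" and b: "\<And>n. sq_sum_le X N (b n)"
    and lim: "\<And>u. u \<in> X \<Longrightarrow> (\<lambda>n. b n u) \<longlonglongrightarrow> b' u"
  shows "(\<lambda>n. infsum (\<lambda>u. a u * b n u) X) \<longlonglongrightarrow> infsum (\<lambda>u. a u * b' u) X"
proof (rule LIMSEQ_I)
  fix e :: real assume e: "0 < e"
  note b' = sq_sum_le_LIMSEQ[OF b lim]
  obtain S where S: "finite S" "S \<subseteq> X" "sqrt (infsum (\<lambda>u. (a u)\<^sup>2) (X - S)) * sqrt N < e / 3"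
    by (rule small_l2_tail[OF a, of "e / 3" "sqrt N"]) (use e in auto)
  have split: "\<bar>infsum (\<lambda>u. a u * c u) X - (\<Sum>u\<in>S. a u * c u)\<bar> < e / 3" if c: "sq_sum_le X N c" for c
  proof -
    have "sq_sum_le (X - S) M a" "sq_sum_le (X - S) N c" using a c by (auto simp: sq_sum_le_def)
    from abs_infsum_mult_le_sqrt[OF this] show ?thesis
      using infsum_split_finite[OF sq_sum_le_mult_summable(2)[OF a c] S(1,2)] S(3) by linarith
  qed
  have "(\<lambda>n. \<Sum>u\<in>S. a u * b n u) \<longlonglongrightarrow> (\<Sum>u\<in>S. a u * b' u)"
    using S lim by (intro tendsto_sum tendsto_mult_left) auto
  from LIMSEQ_D[OF this, of "e / 3"] e
  obtain n0 where n0: "\<And>n. n \<ge> n0 \<Longrightarrow> \<bar>(\<Sum>u\<in>S. a u * b n u) - (\<Sum>u\<in>S. a u * b' u)\<bar> < e / 3"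
    unfolding real_norm_def by auto
  have "norm (infsum (\<lambda>u. a u * b n u) X - infsum (\<lambda>u. a u * b' u) X) < e" if "n \<ge> n0" for n
    using n0[OF that] split[OF b[of n]] split[OF b'] unfolding real_norm_def by linarith
  then show "\<exists>no. \<forall>n\<ge>no. norm (infsum (\<lambda>u. a u * b n u) X - infsum (\<lambda>u. a u * b' u) X) < e" by blast
qed

context bounded_potential
begin

lemma bessel_nonneg:
  assumes v: "finsupp d v" and f: "bdd_borel f" "\<And>t. 0 \<le> f t" "\<And>t. f t \<le> c"
  shows "sq_sum_le (Zd d) (c\<^sup>2 * dot v v) (\<lambda>u. spec_form d V f v (kron u))"
  unfolding sq_sum_le_def
proof (intro allI impI)
  fix S assume S: "finite S" "S \<subseteq> Zd d"
  define a where "a u = spec_form d V f v (kron u)" for u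
  define w where "w = (\<lambda>x. \<Sum>u\<in>S. a u * kron u x)"
  define s where "s = (\<Sum>u\<in>S. (a u)\<^sup>2)"
  have w: "finsupp d w" unfolding w_def using S by (intro finsupp_sum finsupp_cmult finsupp_kron) auto
  have s0: "0 \<le> s" unfolding s_def by (intro sum_nonneg) simp
  have c0: "0 \<le> c" using f(2,3)[of 0] by linarith
  have "w x = (if x \<in> S then a x else 0)" for x
    unfolding w_def kron_def using S by (simp add: if_distrib[of "\<lambda>z. _ * z"] cong: if_cong)
  then have ww: "dot w w = s"
    unfolding s_def by (subst dot_superset[of S]) (auto simp: S supp_def power2_eq_square)
  have "spec_form d V f v w = s"
    unfolding w_def spec_form_sum_right[OF v f(1) S] s_def a_def by (simp add: power2_eq_square)
  then have "s\<^sup>2 \<le> spec_form d V f v v * spec_form d V f w w"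
    using spec_form_Cauchy_Schwarz[OF v w f(1)] f(2) by simp
  also have "\<dots> \<le> (c * dot v v) * (c * s)"
    using spec_form_le[OF v f(1), of c] spec_form_le[OF w f(1), of c] f(2,3) ww c0 spec_form_nonneg[OF w f(1)] dot_nonneg[of v]
    by (intro mult_mono) auto
  finally have "s * s \<le> (c\<^sup>2 * dot v v) * s" by (simp add: power2_eq_square mult_ac)
  then have "s \<le> c\<^sup>2 * dot v v" using s0 dot_nonneg[of v]
    by (cases "s = 0") (auto simp: mult_le_cancel_right)
  then show "(\<Sum>u\<in>S. (spec_form d V f v (kron u))\<^sup>2) \<le> c\<^sup>2 * dot v v" by (simp add: s_def a_def)
qed

lemma bessel:
  assumes v: "finsupp d v" and f: "bdd_borel f" "\<And>t. \<bar>f t\<bar> \<le> c"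
  shows "sq_sum_le (Zd d) (4 * c\<^sup>2 * dot v v) (\<lambda>u. spec_form d V f v (kron u))"
  unfolding sq_sum_le_def
proof (intro allI impI)
  fix S assume S: "finite S" "S \<subseteq> Zd d"
  define p n where "p t = max (f t) 0" and "n t = max (- f t) 0" for t
  have bb: "bdd_borel p" "bdd_borel n" and pn: "0 \<le> p t" "p t \<le> c" "0 \<le> n t" "n t \<le> c" for t
    using f(2) bdd_borel_measurable[OF f(1)] order_trans[OF abs_ge_zero f(2)]
    unfolding p_def n_def by (auto intro!: bdd_borelI[where B=c] simp: max_def abs_le_iff)
  have f_eq: "f = (\<lambda>t. p t - n t)" by (auto simp: p_def n_def max_def)
  have "(\<Sum>u\<in>S. (spec_form d V f v (kron u))\<^sup>2)
      \<le> (\<Sum>u\<in>S. 2 * (spec_form d V p v (kron u))\<^sup>2 + 2 * (spec_form d V n v (kron u))\<^sup>2)"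
  proof (rule sum_mono)
    fix u assume "u \<in> S"
    then have "spec_form d V f v (kron u) = spec_form d V p v (kron u) - spec_form d V n v (kron u)"
      unfolding f_eq using S by (intro spec_form_diff v finsupp_kron bb) auto
    moreover have "(x - y)\<^sup>2 \<le> 2 * x\<^sup>2 + 2 * y\<^sup>2" for x y :: real
      using zero_le_power2[of "x + y"] by (simp add: power2_eq_square algebra_simps)
    ultimately show "(spec_form d V f v (kron u))\<^sup>2
        \<le> 2 * (spec_form d V p v (kron u))\<^sup>2 + 2 * (spec_form d V n v (kron u))\<^sup>2" by simp
  qed
  also have "\<dots> = 2 * (\<Sum>u\<in>S. (spec_form d V p v (kron u))\<^sup>2) + 2 * (\<Sum>u\<in>S. (spec_form d V n v (kron u))\<^sup>2)"
    by (simp add: sum.distrib sum_distrib_left)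
  also have "\<dots> \<le> 2 * (c\<^sup>2 * dot v v) + 2 * (c\<^sup>2 * dot v v)"
    by (intro add_mono mult_left_mono sq_sum_leD[OF bessel_nonneg[OF v bb(1) pn(1,2)] S]
        sq_sum_leD[OF bessel_nonneg[OF v bb(2) pn(3,4)] S]) auto
  finally show "(\<Sum>u\<in>S. (spec_form d V f v (kron u))\<^sup>2) \<le> 4 * c\<^sup>2 * dot v v" by (simp add: mult_ac)
qed

lemma bessel_left:
  assumes w: "finsupp d w" and g: "bdd_borel g" "\<And>t. \<bar>g t\<bar> \<le> c"
  shows "sq_sum_le (Zd d) (4 * c\<^sup>2 * dot w w) (\<lambda>u. spec_form d V g (kron u) w)"
proof -
  have "(\<Sum>u\<in>S. (spec_form d V g (kron u) w)\<^sup>2) = (\<Sum>u\<in>S. (spec_form d V g w (kron u))\<^sup>2)" if "S \<subseteq> Zd d" for S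
    using that by (intro sum.cong refl) (auto simp: spec_form_sym[OF _ w g(1)] finsupp_kron)
  then show ?thesis using bessel[OF w g] by (simp add: sq_sum_le_def)
qed

lemma spec_form_mult_cut_pow:
  assumes v: "finsupp d v" and w: "finsupp d w" and f: "bdd_borel f"
  shows "spec_form d V (\<lambda>t. f t * cut_pow rad n t) v w = spec_form d V f v ((Hop_real d V ^^ n) w)"
proof (rule normal_functional_eqI_cut_pow[where C=rad and A="\<lambda>f. spec_form d V (\<lambda>t. f t * cut_pow rad n t) v w", OF _ _ f])
  note w' = finsupp_Hop_real_power[OF w, where V=V and n=n]
  show "normal_functional (\<lambda>f. spec_form d V (\<lambda>t. f t * cut_pow rad n t) v w)"
    by (rule normal_functional_pullback[OF normal_functional_spec_form[OF v w] _ bdd_borel_cut_pow]) simp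
  show "normal_functional (\<lambda>f. spec_form d V f v ((Hop_real d V ^^ n) w))" by (rule normal_functional_spec_form[OF v w'])
  show "spec_form d V (\<lambda>t. cut_pow rad m t * cut_pow rad n t) v w = spec_form d V (cut_pow rad m) v ((Hop_real d V ^^ n) w)" for m
    using spec_form_power[OF v w] spec_form_power[OF v w'] by (simp add: cut_pow_mult funpow_add)
  have "(\<lambda>t. f t * indicator {-rad..rad} t * cut_pow rad n t) = (\<lambda>t. f t * cut_pow rad n t)"
    by (auto simp: cut_pow_def indicator_def)
  then show "spec_form d V (\<lambda>t. f t * indicator {-rad..rad} t * cut_pow rad n t) v w = spec_form d V (\<lambda>t. f t * cut_pow rad n t) v w"
    by simp
  show "spec_form d V (\<lambda>t. f t * indicator {-rad..rad} t) v ((Hop_real d V ^^ n) w) = spec_form d V f v ((Hop_real d V ^^ n) w)"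
    by (rule spec_form_restrict[OF v w' bdd_borel_measurable[OF f]])
qed

end

text \<open>The matrix element \<open>\<langle>v, f(H\<^sub>V) g(H\<^sub>V\<^sub>') w\<rangle>\<close> of a product of functions of two Hamiltonians.\<close>

definition cross_form ::
  "nat \<Rightarrow> (site \<Rightarrow> real) \<Rightarrow> (site \<Rightarrow> real) \<Rightarrow> (real \<Rightarrow> real) \<Rightarrow> (real \<Rightarrow> real) \<Rightarrow> (site \<Rightarrow> real) \<Rightarrow> (site \<Rightarrow> real) \<Rightarrow> real" where
  "cross_form d V V' f g v w = infsum (\<lambda>u. spec_form d V f v (kron u) * spec_form d V' g (kron u) w) (Zd d)"

locale potential_pair = bounded_potential d V R + b': bounded_potential d V' R for d V V' R
begin

abbreviation "cross \<equiv> cross_form d V V'"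

lemma cross_form_summable:
  assumes "finsupp d v" "finsupp d w" "bdd_borel f" "bdd_borel g"
  shows "(\<lambda>u. \<bar>spec_form d V f v (kron u) * spec_form d V' g (kron u) w\<bar>) summable_on Zd d"
    "(\<lambda>u. spec_form d V f v (kron u) * spec_form d V' g (kron u) w) summable_on Zd d"
proof -
  obtain c where c: "\<And>t. \<bar>f t\<bar> \<le> c" using bdd_borelE[OF assms(3)] by metis
  obtain e where e: "\<And>t. \<bar>g t\<bar> \<le> e" using bdd_borelE[OF assms(4)] by metis
  note l2 = bessel[OF assms(1,3) c] b'.bessel_left[OF assms(2,4) e]
  show "(\<lambda>u. \<bar>spec_form d V f v (kron u) * spec_form d V' g (kron u) w\<bar>) summable_on Zd d"
    "(\<lambda>u. spec_form d V f v (kron u) * spec_form d V' g (kron u) w) summable_on Zd d"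
    by (rule sq_sum_le_mult_summable[OF l2])+
qed

lemma cross_form_swap:
  assumes "finsupp d v" "finsupp d w" "bdd_borel f" "bdd_borel g"
  shows "cross f g v w = cross_form d V' V g f w v"
  unfolding cross_form_def
  by (intro infsum_cong)
    (simp add: spec_form_sym[OF assms(1) finsupp_kron assms(3)] b'.spec_form_sym[OF _ assms(2,4)] finsupp_kron mult.commute)

lemma normal_functional_cross_right:
  assumes v: "finsupp d v" and w: "finsupp d w" and f: "bdd_borel f"
  shows "normal_functional (\<lambda>g. cross f g v w)"
proof
  note sum = cross_form_summable(2)[OF v w f]
  show "cross f (\<lambda>t. g t + h t) v w = cross f g v w + cross f h v w" if "bdd_borel g" "bdd_borel h" for g h
    unfolding cross_form_def infsum_add[OF sum[OF that(1)] sum[OF that(2)], symmetric]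
    by (intro infsum_cong) (simp add: b'.spec_form_add finsupp_kron w that distrib_left)
  show "cross f (\<lambda>t. c * g t) v w = c * cross f g v w" if "bdd_borel g" for c g
    unfolding cross_form_def infsum_cmult_right'[symmetric]
    by (intro infsum_cong) (simp add: b'.spec_form_cmult finsupp_kron w that)
  fix F :: "nat \<Rightarrow> real \<Rightarrow> real" and g B
  assume F: "\<And>n. bdd_borel (F n)" "\<And>n t. \<bar>F n t\<bar> \<le> B" "\<And>t. (\<lambda>n. F n t) \<longlonglongrightarrow> g t"
  obtain c where c: "\<And>t. \<bar>f t\<bar> \<le> c" using bdd_borelE[OF f] by metis
  show "(\<lambda>n. cross f (F n) v w) \<longlonglongrightarrow> cross f g v w"
    unfolding cross_form_def
    by (rule weak_l2_limit[OF bessel[OF v f c] b'.bessel_left[OF w F(1,2)]])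
      (rule normal_functional.limit[OF b'.normal_functional_spec_form[OF finsupp_kron w] F])
qed

lemma cross_form_cut_pow_right:
  assumes v: "finsupp d v" and w: "finsupp d w" and f: "bdd_borel f"
  shows "cross f (cut_pow rad n) v w = spec_form d V f v ((Hop_real d V' ^^ n) w)"
proof -
  let ?w = "(Hop_real d V' ^^ n) w"
  have fw: "finsupp d ?w" by (rule finsupp_Hop_real_power[OF w])
  have eq: "spec_form d V' (cut_pow rad n) (kron u) w = ?w u" if "u \<in> Zd d" for u
    using b'.spec_form_power[OF finsupp_kron[OF that] w] by (simp add: dot_kron_left)
  have "cross f (cut_pow rad n) v w = infsum (\<lambda>u. ?w u * spec_form d V f v (kron u)) (supp ?w)"
    unfolding cross_form_def
    by (rule infsum_cong_neutral) (use eq fw in \<open>auto simp: finsupp_def supp_def\<close>)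
  also have "\<dots> = spec_form d V f v ?w"
    using fw by (simp add: spec_form_expand[OF v fw f] finsupp_def)
  finally show ?thesis .
qed

lemma cross_form_restrict_right:
  assumes "finsupp d w" "bdd_borel g"
  shows "cross f (\<lambda>t. g t * indicator {-rad..rad} t) v w = cross f g v w"
  unfolding cross_form_def
  by (intro infsum_cong) (simp add: b'.spec_form_restrict finsupp_kron assms bdd_borel_measurable)

end

lemma (in bounded_potential) spec_form_mult:
  assumes v: "finsupp d v" and w: "finsupp d w" and f: "bdd_borel f" and g: "bdd_borel g"
  shows "((\<lambda>u. spec_form d V f v (kron u) * spec_form d V g (kron u) w) has_sum spec_form d V (\<lambda>t. f t * g t) v w) (Zd d)"
    "(\<lambda>u. \<bar>spec_form d V f v (kron u) * spec_form d V g (kron u) w\<bar>) summable_on Zd d"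
proof -
  interpret potential_pair d V V R by unfold_locales
  have "cross f g v w = spec_form d V (\<lambda>t. g t * f t) v w"
  proof (rule normal_functional_eqI_cut_pow[where C=rad and A="\<lambda>g. cross f g v w" and B="\<lambda>g. spec_form d V (\<lambda>t. g t * f t) v w",
        OF normal_functional_cross_right[OF v w f] _ g])
    show "normal_functional (\<lambda>g. spec_form d V (\<lambda>t. g t * f t) v w)"
      by (rule normal_functional_pullback[OF normal_functional_spec_form[OF v w] _ f]) simp
    show "cross f (cut_pow rad n) v w = spec_form d V (\<lambda>t. cut_pow rad n t * f t) v w" for n
      using cross_form_cut_pow_right[OF v w f] spec_form_mult_cut_pow[OF v w f, of n] by (simp add: mult.commute)
    show "spec_form d V (\<lambda>t. g t * indicator {-rad..rad} t * f t) v w = spec_form d V (\<lambda>t. g t * f t) v w"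
      using spec_form_restrict[OF v w bdd_borel_measurable[OF bdd_borel_mult[OF g f]]] by (simp add: mult_ac)
  qed (rule cross_form_restrict_right[OF w g])
  then show "((\<lambda>u. spec_form d V f v (kron u) * spec_form d V g (kron u) w) has_sum spec_form d V (\<lambda>t. f t * g t) v w) (Zd d)"
    using has_sum_infsum[OF cross_form_summable(2)[OF v w f g]] by (simp add: cross_form_def mult.commute)
  show "(\<lambda>u. \<bar>spec_form d V f v (kron u) * spec_form d V g (kron u) w\<bar>) summable_on Zd d"
    by (rule cross_form_summable(1)[OF v w f g])
qed

section \<open>Changing the potential at one site\<close>

locale two_potentials = potential_pair d V V' R
  for d V V' R +
  fixes k assumes k: "k \<in> Zd d" and off: "\<And>x. x \<noteq> k \<Longrightarrow> V' x = V x"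
begin

lemma Hop_real_perturb: "Hop_real d V v = (\<lambda>x. 1 * Hop_real d V' v x + ((V k - V' k) * v k) * kron k x)"
proof
  fix x show "Hop_real d V v x = 1 * Hop_real d V' v x + ((V k - V' k) * v k) * kron k x"
    unfolding Hop_real_def kron_def by (cases "x = k") (simp_all add: off algebra_simps)
qed

lemma perturb_identity:
  assumes v: "finsupp d v" and w: "finsupp d w" and f: "bdd_borel f" and g: "bdd_borel g"
  shows "cross (\<lambda>t. f t * cut_pow rad 1 t) g v w - cross f (\<lambda>t. g t * cut_pow rad 1 t) v w
    = (V k - V' k) * spec_form d V f v (kron k) * spec_form d V' g (kron k) w"
proof -
  let ?tf = "\<lambda>t. f t * cut_pow rad 1 t" and ?c = "(V k - V' k) * spec_form d V f v (kron k)"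
  let ?A = "\<lambda>g. cross ?tf g v w - cross f (\<lambda>t. g t * cut_pow rad 1 t) v w"
  have tf: "bdd_borel ?tf" by (rule bdd_borel_mult[OF f bdd_borel_cut_pow])
  have "?A g = ?c * spec_form d V' g (kron k) w"
  proof (rule normal_functional_eqI_cut_pow[where C=rad and A="?A", OF _ _ g])
    show "normal_functional ?A"
      by (intro normal_functional_diff normal_functional_cross_right[OF v w tf]
          normal_functional_pullback[OF normal_functional_cross_right[OF v w f] _ bdd_borel_cut_pow]) simp
    show "normal_functional (\<lambda>g. ?c * spec_form d V' g (kron k) w)"
      by (intro normal_functional_cmult b'.normal_functional_spec_form finsupp_kron k w)
    have "(\<lambda>t. g t * indicator {-rad..rad} t * cut_pow rad 1 t) = (\<lambda>t. g t * cut_pow rad 1 t)"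
      by (auto simp: indicator_def cut_pow_def)
    then show "?A (\<lambda>t. g t * indicator {-rad..rad} t) = ?A g"
      using cross_form_restrict_right[OF w g, of ?tf] by simp
    show "?c * spec_form d V' (\<lambda>t. g t * indicator {-rad..rad} t) (kron k) w = ?c * spec_form d V' g (kron k) w"
      using b'.spec_form_restrict[OF finsupp_kron[OF k] w bdd_borel_measurable[OF g]] by (simp only:)
    fix n
    let ?w = "(Hop_real d V' ^^ n) w"
    have w': "finsupp d ?w" by (rule finsupp_Hop_real_power[OF w])
    have "?A (cut_pow rad n) = spec_form d V ?tf v ?w - spec_form d V f v (Hop_real d V' ?w)"
      using cross_form_cut_pow_right[OF v w tf, of n] cross_form_cut_pow_right[OF v w f, of "Suc n"] by (simp add: cut_pow_mult)
    also have "spec_form d V ?tf v ?w = spec_form d V f v (Hop_real d V ?w)"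
      using spec_form_mult_cut_pow[OF v w' f, of 1] by simp
    also have "\<dots> = 1 * spec_form d V f v (Hop_real d V' ?w) + ((V k - V' k) * ?w k) * spec_form d V f v (kron k)"
      unfolding Hop_real_perturb by (rule spec_form_linear_right[OF v finsupp_Hop_real[OF w'] finsupp_kron[OF k] f])
    also have "?w k = spec_form d V' (cut_pow rad n) (kron k) w"
      using b'.spec_form_power[OF finsupp_kron[OF k] w] by (simp add: dot_kron_left)
    finally show "?A (cut_pow rad n) = ?c * spec_form d V' (cut_pow rad n) (kron k) w" by (simp add: mult_ac)
  qed
  then show ?thesis .
qed

end

section \<open>The resolvent\<close>

definition res_re :: "real \<Rightarrow> real \<Rightarrow> real \<Rightarrow> real" where
  "res_re E \<eta> t = (t - E) / ((t - E)\<^sup>2 + \<eta>\<^sup>2)"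

definition res_im :: "real \<Rightarrow> real \<Rightarrow> real \<Rightarrow> real" where
  "res_im E \<eta> t = \<eta> / ((t - E)\<^sup>2 + \<eta>\<^sup>2)"

lemma res_denominator_pos: "0 < \<eta> \<Longrightarrow> 0 < (t - E)\<^sup>2 + (\<eta>::real)\<^sup>2"
  by (simp add: add_nonneg_pos)

lemma res_im_pos: "0 < \<eta> \<Longrightarrow> 0 < res_im E \<eta> t"
  by (simp add: res_im_def res_denominator_pos)

lemma res_im_le:
  assumes "0 < \<eta>" shows "res_im E \<eta> t \<le> 1 / \<eta>"
proof -
  have "\<eta> / ((t - E)\<^sup>2 + \<eta>\<^sup>2) \<le> \<eta> / \<eta>\<^sup>2" using assms by (intro divide_left_mono) (auto simp: add_nonneg_pos)
  then show ?thesis using assms by (simp add: res_im_def power2_eq_square)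
qed

lemma abs_res_re_le:
  assumes "0 < \<eta>" shows "\<bar>res_re E \<eta> t\<bar> \<le> 1 / \<eta>"
proof -
  have "2 * \<bar>t - E\<bar> * \<eta> \<le> \<bar>t - E\<bar>\<^sup>2 + \<eta>\<^sup>2" by (rule sum_squares_bound)
  moreover have "0 \<le> \<bar>t - E\<bar> * \<eta>" using assms by simp
  ultimately have "\<bar>t - E\<bar> * \<eta> \<le> (t - E)\<^sup>2 + \<eta>\<^sup>2" by simp
  then show ?thesis using assms res_denominator_pos[OF assms, of t E] by (simp add: res_re_def field_simps)
qed

lemma bdd_borel_res_im: "0 < \<eta> \<Longrightarrow> bdd_borel (res_im E \<eta>)"
  by (rule bdd_borelI[where B="1/\<eta>"]) (use res_im_pos[of \<eta>] res_im_le[of \<eta>] in \<open>auto simp: abs_of_pos res_im_def[abs_def]\<close>)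

lemma bdd_borel_res_re: "0 < \<eta> \<Longrightarrow> bdd_borel (res_re E \<eta>)"
  by (rule bdd_borelI[where B="1/\<eta>"]) (use abs_res_re_le[of \<eta>] in \<open>auto simp: res_re_def[abs_def]\<close>)

lemma res_re_times:
  assumes "0 < \<eta>" shows "res_re E \<eta> t * t = 1 + E * res_re E \<eta> t - \<eta> * res_im E \<eta> t"
proof -
  define D where "D = (t - E)\<^sup>2 + \<eta>\<^sup>2"
  have D: "D \<noteq> 0" unfolding D_def using res_denominator_pos[OF assms, of t E] by (rule less_imp_neq[symmetric])
  have "1 + E * ((t - E) / D) - \<eta> * (\<eta> / D) = (D + E * (t - E) - \<eta> * \<eta>) / D"
    using D by (simp add: field_simps)
  also have "D + E * (t - E) - \<eta> * \<eta> = (t - E) * t" by (simp add: D_def algebra_simps power2_eq_square)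
  finally show ?thesis by (simp add: res_re_def res_im_def D_def)
qed

lemma res_im_times: "res_im E \<eta> t * t = E * res_im E \<eta> t + \<eta> * res_re E \<eta> t"
  unfolding res_re_def res_im_def by (simp add: add_divide_distrib[symmetric] algebra_simps)

lemma resolvent_function_eq:
  "1 / (complex_of_real t - Complex E \<eta>) = complex_of_real (res_re E \<eta> t) + \<i> * complex_of_real (res_im E \<eta> t)"
proof -
  have "complex_of_real t - Complex E \<eta> = Complex (t - E) (- \<eta>)" by (simp add: complex_eq_iff)
  then have "1 / (complex_of_real t - Complex E \<eta>) = Complex (res_re E \<eta> t) (res_im E \<eta> t)"
    by (simp add: complex_eq_iff Re_divide Im_divide res_re_def res_im_def)
  then show ?thesis by (simp add: complex_eq_iff)
qed

definition resolvent :: "nat \<Rightarrow> (site \<Rightarrow> real) \<Rightarrow> real \<Rightarrow> real \<Rightarrow> site \<Rightarrow> site \<Rightarrow> complex" where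
  "resolvent d V E \<eta> x y = Complex (spec_form d V (res_re E \<eta>) (kron x) (kron y)) (spec_form d V (res_im E \<eta>) (kron x) (kron y))"

definition im_resolvent :: "nat \<Rightarrow> (site \<Rightarrow> real) \<Rightarrow> real \<Rightarrow> real \<Rightarrow> site \<Rightarrow> site \<Rightarrow> real" where
  "im_resolvent d V E \<eta> x y = spec_form d V (res_im E \<eta>) (kron x) (kron y)"

definition spec_det :: "nat \<Rightarrow> (site \<Rightarrow> real) \<Rightarrow> (real \<Rightarrow> real) \<Rightarrow> site \<Rightarrow> site \<Rightarrow> real" where
  "spec_det d V f j k = spec_form d V f (kron j) (kron j) * spec_form d V f (kron k) (kron k)
    - (spec_form d V f (kron j) (kron k))\<^sup>2"

lemma spec_det_res_im: "spec_det d V (res_im E \<eta>) j k =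
    im_resolvent d V E \<eta> j j * im_resolvent d V E \<eta> k k - (im_resolvent d V E \<eta> j k)\<^sup>2"
  by (simp add: spec_det_def im_resolvent_def)

lemma Im_resolvent: "Im (resolvent d V E \<eta> x y) = im_resolvent d V E \<eta> x y"
  by (simp add: resolvent_def im_resolvent_def)

context bounded_potential
begin

lemma green_eq_resolvent:
  assumes \<eta>: "0 < \<eta>" and x: "x \<in> Zd d" and y: "y \<in> Zd d"
  shows "green d V (Complex E \<eta>) x y = resolvent d V E \<eta> x y"
proof -
  have int: "(\<integral>t. complex_of_real (res_re E \<eta> t) + \<i> * complex_of_real (res_im E \<eta> t) \<partial>spec_measure d V v) =
      complex_of_real (\<integral>t. res_re E \<eta> t \<partial>spec_measure d V v) + \<i> * complex_of_real (\<integral>t. res_im E \<eta> t \<partial>spec_measure d V v)"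
    if v: "finsupp d v" for v
    using integrable_bdd_borel[OF finite_borel_on_spec_measure[OF v] bdd_borel_res_re[OF \<eta>, of E]]
      integrable_bdd_borel[OF finite_borel_on_spec_measure[OF v] bdd_borel_res_im[OF \<eta>, of E]]
    by (subst Bochner_Integration.integral_add) auto
  have delta: "(\<lambda>z. delta x z + delta y z) = (\<lambda>z. complex_of_real (kron x z + kron y z))"
    "(\<lambda>z. delta x z - delta y z) = (\<lambda>z. complex_of_real (kron x z - kron y z))"
    by (auto simp: delta_def kron_def)
  show ?thesis
    unfolding green_def fmat_def resolvent_function_eq delta spec_measure_def[symmetric]
      int[OF finsupp_add[OF finsupp_kron[OF x] finsupp_kron[OF y]]] int[OF finsupp_diff[OF finsupp_kron[OF x] finsupp_kron[OF y]]]
    by (simp add: resolvent_def spec_form_def complex_eq_iff)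
qed

lemma resolvent_sym: "0 < \<eta> \<Longrightarrow> x \<in> Zd d \<Longrightarrow> y \<in> Zd d \<Longrightarrow> resolvent d V E \<eta> x y = resolvent d V E \<eta> y x"
  unfolding resolvent_def using spec_form_sym[OF finsupp_kron finsupp_kron] bdd_borel_res_re bdd_borel_res_im by auto

lemma im_resolvent_pos:
  assumes \<eta>: "0 < \<eta>" and x: "x \<in> Zd d"
  shows "0 < im_resolvent d V E \<eta> x x"
proof -
  define m where "m = \<eta> / ((rad + \<bar>E\<bar>)\<^sup>2 + \<eta>\<^sup>2)"
  note kx = finsupp_kron[OF x]
  have m: "0 < m" unfolding m_def using \<eta> by (simp add: add_nonneg_pos)
  have "m \<le> res_im E \<eta> t" if "t \<in> {-rad..rad}" for t
  proof -
    have "\<bar>t - E\<bar> \<le> rad + \<bar>E\<bar>" using that by auto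
    then have "(t - E)\<^sup>2 \<le> (rad + \<bar>E\<bar>)\<^sup>2" by (metis abs_ge_zero power2_abs power_mono)
    then show ?thesis unfolding m_def res_im_def using \<eta> res_denominator_pos[OF \<eta>, of t E]
      by (intro divide_left_mono) (auto intro!: mult_pos_pos simp: add_nonneg_pos)
  qed
  from spec_form_mono[OF kx bdd_borel_const[of m] bdd_borel_res_im[OF \<eta>, of E] this]
  have "spec_form d V (\<lambda>_. m) (kron x) (kron x) \<le> im_resolvent d V E \<eta> x x" by (simp add: im_resolvent_def)
  moreover have "spec_form d V (\<lambda>_. m) (kron x) (kron x) = m"
    using spec_form_cmult[OF kx kx bdd_borel_const[of 1], of m] spec_form_one[OF kx kx] by (simp add: dot_kron_kron)
  ultimately show ?thesis using m by simp
qed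

lemma spec_det_nonneg:
  "bdd_borel f \<Longrightarrow> (\<And>t. 0 \<le> f t) \<Longrightarrow> j \<in> Zd d \<Longrightarrow> k \<in> Zd d \<Longrightarrow> 0 \<le> spec_det d V f j k"
  using spec_form_Cauchy_Schwarz[OF finsupp_kron finsupp_kron, of j k f] by (simp add: spec_det_def)

end

context potential_pair
begin

lemma cross_form_one_right:
  assumes v: "finsupp d v" and w: "finsupp d w" and f: "bdd_borel f"
  shows "cross f (\<lambda>_. 1) v w = spec_form d V f v w"
  using cross_form_cut_pow_right[OF v w f, of 0] cross_form_restrict_right[OF w bdd_borel_const[of 1], of f v]
  by (simp add: cut_pow_def[abs_def])

lemma cross_form_res_right:
  assumes v: "finsupp d v" and w: "finsupp d w" and f: "bdd_borel f" and \<eta>: "0 < \<eta>"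
  shows "cross f (\<lambda>t. res_re E \<eta> t * cut_pow rad 1 t) v w
      = spec_form d V f v w + E * cross f (res_re E \<eta>) v w - \<eta> * cross f (res_im E \<eta>) v w" (is ?re)
    and "cross f (\<lambda>t. res_im E \<eta> t * cut_pow rad 1 t) v w = E * cross f (res_im E \<eta>) v w + \<eta> * cross f (res_re E \<eta>) v w" (is ?im)
proof -
  interpret N: normal_functional "\<lambda>g. cross f g v w" by (rule normal_functional_cross_right[OF v w f])
  note bb = bdd_borel_res_re[OF \<eta>, of E] bdd_borel_res_im[OF \<eta>, of E]
  have times: "cross f (\<lambda>t. h t * cut_pow rad 1 t) v w = cross f h' v w"
    if "bdd_borel h'" "\<And>t. h t * t = h' t" for h h' :: "real \<Rightarrow> real"
    using cross_form_restrict_right[OF w that(1), of f v] by (simp add: cut_pow_def that(2) mult.assoc[symmetric])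
  have "cross f (\<lambda>t. res_re E \<eta> t * cut_pow rad 1 t) v w = cross f (\<lambda>t. (1 + E * res_re E \<eta> t) + (-\<eta>) * res_im E \<eta> t) v w"
    by (rule times, (intro bdd_borel_add bdd_borel_cmult bdd_borel_const bb)[1]) (simp add: res_re_times[OF \<eta>])
  also have "\<dots> = cross f (\<lambda>_. 1) v w + E * cross f (res_re E \<eta>) v w + (-\<eta>) * cross f (res_im E \<eta>) v w"
    by (simp only: N.add N.scale bdd_borel_add bdd_borel_cmult bdd_borel_const bb)
  finally show ?re by (simp add: cross_form_one_right v w f)
  have "cross f (\<lambda>t. res_im E \<eta> t * cut_pow rad 1 t) v w = cross f (\<lambda>t. E * res_im E \<eta> t + \<eta> * res_re E \<eta> t) v w"
    by (rule times) (auto simp: res_im_times intro!: bdd_borel_add bdd_borel_cmult bb)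
  then show ?im by (simp only: N.add N.scale bdd_borel_cmult bb)
qed

lemma cross_form_res_left:
  assumes v: "finsupp d v" and w: "finsupp d w" and g: "bdd_borel g" and \<eta>: "0 < \<eta>"
  shows "cross (\<lambda>t. res_re E \<eta> t * cut_pow rad 1 t) g v w
      = spec_form d V' g v w + E * cross (res_re E \<eta>) g v w - \<eta> * cross (res_im E \<eta>) g v w"
    and "cross (\<lambda>t. res_im E \<eta> t * cut_pow rad 1 t) g v w = E * cross (res_im E \<eta>) g v w + \<eta> * cross (res_re E \<eta>) g v w"
proof -
  interpret swap: potential_pair d V' V R by unfold_locales
  note bb = bdd_borel_res_re[OF \<eta>] bdd_borel_res_im[OF \<eta>] bdd_borel_mult bdd_borel_cut_pow
  show "cross (\<lambda>t. res_re E \<eta> t * cut_pow rad 1 t) g v w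
      = spec_form d V' g v w + E * cross (res_re E \<eta>) g v w - \<eta> * cross (res_im E \<eta>) g v w"
    "cross (\<lambda>t. res_im E \<eta> t * cut_pow rad 1 t) g v w = E * cross (res_im E \<eta>) g v w + \<eta> * cross (res_re E \<eta>) g v w"
    using swap.cross_form_res_right[OF w v g \<eta>, of E] b'.spec_form_sym[OF v w g]
    by (simp_all add: cross_form_swap[OF v w _ g] bb)
qed

end

context two_potentials
begin

lemma resolvent_rank_one:
  assumes \<eta>: "0 < \<eta>" and x: "x \<in> Zd d" "y \<in> Zd d"
  shows "resolvent d V' E \<eta> x y
    = resolvent d V E \<eta> x y + complex_of_real (V k - V' k) * resolvent d V E \<eta> x k * resolvent d V' E \<eta> k y"
proof -
  note kx = finsupp_kron[OF x(1)] and ky = finsupp_kron[OF x(2)]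
  note re = bdd_borel_res_re[OF \<eta>, of E] and im = bdd_borel_res_im[OF \<eta>, of E]
  note P = perturb_identity[OF kx ky] and left = cross_form_res_left[OF kx ky _ \<eta>, of _ E]
    and right = cross_form_res_right[OF kx ky _ \<eta>, of _ E]
  show ?thesis
    unfolding resolvent_def complex_eq_iff
    using P[OF re re, unfolded left(1)[OF re] right(1)[OF re]] P[OF im im, unfolded left(2)[OF im] right(2)[OF im]]
      P[OF re im, unfolded left(1)[OF im] right(2)[OF re]] P[OF im re, unfolded left(2)[OF re] right(1)[OF im]]
    by (simp add: algebra_simps)
qed

lemma resolvent_rank_one_solved:
  fixes E :: real
  assumes \<eta>: "0 < \<eta>" and y: "y \<in> Zd d"
  defines "s \<equiv> 1 + complex_of_real (V' k - V k) * resolvent d V E \<eta> k k"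
  shows "s \<noteq> 0" "resolvent d V' E \<eta> k y = resolvent d V E \<eta> k y / s"
proof -
  show s: "s \<noteq> 0"
  proof
    assume s: "s = 0"
    then have "Im s = 0" by simp
    then have "(V' k - V k) * im_resolvent d V E \<eta> k k = 0" by (simp add: s_def Im_resolvent)
    then have "V' k - V k = 0" using im_resolvent_pos[OF \<eta> k, of E] by simp
    then show False using s unfolding s_def by simp
  qed
  have "resolvent d V' E \<eta> k y * s = resolvent d V E \<eta> k y"
    using resolvent_rank_one[OF \<eta> k y, of E] unfolding s_def by (simp add: algebra_simps)
  then show "resolvent d V' E \<eta> k y = resolvent d V E \<eta> k y / s" using s by (simp add: field_simps)
qed

end

text \<open>The determinant of the imaginary part of a two-site block of the resolvent is multiplied by
  \<open>|1 + w r|\<^sup>-\<^sup>2\<close> under a change \<open>w\<close> of the potential at one of the sites.\<close>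

lemma det_rank_one_algebra:
  fixes p q r :: complex and w :: real
  defines "s \<equiv> 1 + complex_of_real w * r"
  assumes s: "s \<noteq> 0"
  shows "Im (p - complex_of_real w * q * q / s) * Im (r / s) - (Im (q / s))\<^sup>2 = (Im p * Im r - (Im q)\<^sup>2) / (cmod s)\<^sup>2"
    "Im (r / s) = Im r / (cmod s)\<^sup>2"
proof -
  define N where "N = (cmod s)\<^sup>2"
  have Im_div: "Im (z / s) = (Im z * Re s - Re z * Im s) / N" for z
    by (simp add: Im_divide cmod_power2 N_def)
  have N: "N = (1 + w * Re r)\<^sup>2 + (w * Im r)\<^sup>2" unfolding N_def s_def cmod_power2 by simp
  have N0: "N \<noteq> 0" using s by (simp add: N_def)
  let ?A = "w * (2 * Re q * Im q * (1 + w * Re r) - ((Re q)\<^sup>2 - (Im q)\<^sup>2) * (w * Im r))"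
  let ?B = "Im q * (1 + w * Re r) - Re q * (w * Im r)"
  have ir: "Im (r / s) = Im r / N" unfolding Im_div by (simp add: s_def algebra_simps)
  have iq: "Im (q / s) = ?B / N" unfolding Im_div by (simp add: s_def)
  have iqq: "Im (complex_of_real w * q * q / s) = ?A / N"
    unfolding Im_div by (simp add: s_def algebra_simps power2_eq_square)
  have "(Im p - ?A / N) * (Im r / N) - (?B / N)\<^sup>2 = (Im p * Im r * N - (?A * Im r + ?B\<^sup>2)) / (N * N)"
    using N0 by (simp add: field_simps power2_eq_square)
  also have "?A * Im r + ?B\<^sup>2 = (Im q)\<^sup>2 * N"
    unfolding N by (simp add: algebra_simps power2_eq_square)
  also have "(Im p * Im r * N - (Im q)\<^sup>2 * N) / (N * N) = (Im p * Im r - (Im q)\<^sup>2) / N"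
    using N0 by (simp add: field_simps)
  finally show "Im (p - complex_of_real w * q * q / s) * Im (r / s) - (Im (q / s))\<^sup>2 = (Im p * Im r - (Im q)\<^sup>2) / (cmod s)\<^sup>2"
    unfolding minus_complex.simps iqq ir iq N_def .
  show "Im (r / s) = Im r / (cmod s)\<^sup>2" unfolding ir N_def ..
qed

context two_potentials
begin

lemma im_resolvent_perturb:
  assumes \<eta>: "0 < \<eta>"
  shows "im_resolvent d V' E \<eta> k k
    = im_resolvent d V E \<eta> k k / (cmod (1 + complex_of_real (V' k - V k) * resolvent d V E \<eta> k k))\<^sup>2"
  using det_rank_one_algebra(2)[OF resolvent_rank_one_solved(1)[OF \<eta> k]] resolvent_rank_one_solved(2)[OF \<eta> k]
  unfolding Im_resolvent[symmetric] by simp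

lemma spec_det_res_im_perturb:
  assumes \<eta>: "0 < \<eta>" and j: "j \<in> Zd d"
  shows "spec_det d V' (res_im E \<eta>) j k
    = spec_det d V (res_im E \<eta>) j k / (cmod (1 + complex_of_real (V' k - V k) * resolvent d V E \<eta> k k))\<^sup>2"
proof -
  let ?G = "resolvent d V E \<eta>" and ?G' = "resolvent d V' E \<eta>" and ?w = "V' k - V k"
  let ?s = "1 + complex_of_real ?w * ?G k k"
  have s: "?s \<noteq> 0" by (rule resolvent_rank_one_solved(1)[OF \<eta> k])
  have kk: "?G' k k = ?G k k / ?s" by (rule resolvent_rank_one_solved(2)[OF \<eta> k])
  have kj: "?G' k j = ?G k j / ?s" by (rule resolvent_rank_one_solved(2)[OF \<eta> j])
  have "?G' j j = ?G j j + (- complex_of_real ?w) * ?G j k * ?G' k j"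
    using resolvent_rank_one[OF \<eta> j j, of E] by simp
  then have jj: "?G' j j = ?G j j - complex_of_real ?w * ?G k j * ?G k j / ?s"
    unfolding kj resolvent_sym[OF \<eta> j k]
    by (simp only: mult_minus_left times_divide_eq_right minus_divide_left[symmetric] add_uminus_conv_diff)
  have jk: "im_resolvent d V E \<eta> j k = im_resolvent d V E \<eta> k j" "im_resolvent d V' E \<eta> j k = im_resolvent d V' E \<eta> k j"
    unfolding Im_resolvent[symmetric] using resolvent_sym[OF \<eta> j k] b'.resolvent_sym[OF \<eta> j k] by auto
  show ?thesis
    unfolding spec_det_res_im jk unfolding Im_resolvent[symmetric] jj kk kj by (rule det_rank_one_algebra(1)[OF s])
qed

end

section \<open>Spectral averaging\<close>

lemma nn_integral_inverse_1_plus_square: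
  "(\<integral>\<^sup>+x. ennreal (inverse (1 + x\<^sup>2)) \<partial>lborel) = ennreal pi"
proof -
  have "integrable lborel (\<lambda>x::real. inverse (1 + x\<^sup>2))" "(\<integral>x. inverse (1 + x\<^sup>2) \<partial>lborel) = pi"
    using integrable_inverse_1_plus_square LBINT_inverse_1_plus_square
    by (simp_all add: set_integrable_def interval_lebesgue_integral_def set_lebesgue_integral_def)
  then show ?thesis using nn_integral_eq_integral[of lborel "\<lambda>x::real. inverse (1 + x\<^sup>2)"] by simp
qed

lemma nn_integral_rank_one:
  assumes r: "0 < Im r"
  shows "(\<integral>\<^sup>+v. ennreal (1 / (cmod (1 + complex_of_real (v - v0) * r))\<^sup>2) \<partial>lborel) = ennreal (pi / Im r)"
proof -
  define n where "n = (cmod r)\<^sup>2"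
  have n: "n = (Re r)\<^sup>2 + (Im r)\<^sup>2" by (simp add: n_def cmod_power2)
  have n0: "0 < n" unfolding n using r by (simp add: add_nonneg_pos)
  define c where "c = Im r / n"
  have c: "0 < c" using r n0 by (simp add: c_def)
  have "(cmod (1 + complex_of_real (v0 - Re r / n + c * x - v0) * r))\<^sup>2 = ((Im r)\<^sup>2 / n) * (1 + x\<^sup>2)" for x
  proof -
    have u: "v0 - Re r / n + c * x - v0 = (x * Im r - Re r) / n" by (simp add: c_def diff_divide_distrib)
    have "(cmod (1 + complex_of_real u * r))\<^sup>2 = 1 + 2 * u * Re r + u\<^sup>2 * n" for u
      unfolding cmod_power2 n by (simp add: power2_eq_square algebra_simps)
    then have "(cmod (1 + complex_of_real ((x * Im r - Re r) / n) * r))\<^sup>2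
        = (n + 2 * (x * Im r - Re r) * Re r + (x * Im r - Re r)\<^sup>2) / n"
      using n0 by (simp only:) (simp add: field_simps power2_eq_square)
    also have "n + 2 * (x * Im r - Re r) * Re r + (x * Im r - Re r)\<^sup>2 = (Im r)\<^sup>2 * (1 + x\<^sup>2)"
      unfolding n by (simp add: power2_eq_square algebra_simps)
    finally show ?thesis unfolding u by simp
  qed
  moreover have "c * (1 / ((Im r)\<^sup>2 / n * y)) = 1 / Im r * inverse y" if "0 < y" for y
    using n0 r that by (simp add: c_def field_simps power2_eq_square)
  ultimately have "c * (1 / (cmod (1 + complex_of_real (v0 - Re r / n + c * x - v0) * r))\<^sup>2) = 1 / Im r * inverse (1 + x\<^sup>2)" for x
    by (simp only: add_pos_nonneg zero_less_one zero_le_power2)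
  then have eq: "ennreal c * ennreal (1 / (cmod (1 + complex_of_real (v0 - Re r / n + c * x - v0) * r))\<^sup>2)
      = ennreal (1 / Im r) * ennreal (inverse (1 + x\<^sup>2))" for x
    using c r by (simp add: ennreal_mult[symmetric])
  have "(\<integral>\<^sup>+v. ennreal (1 / (cmod (1 + complex_of_real (v - v0) * r))\<^sup>2) \<partial>lborel)
      = (\<integral>\<^sup>+x. ennreal c * ennreal (1 / (cmod (1 + complex_of_real (v0 - Re r / n + c * x - v0) * r))\<^sup>2) \<partial>lborel)"
    using c by (subst nn_integral_real_affine[where c=c and t="v0 - Re r / n"]) (auto simp: nn_integral_cmult)
  also have "\<dots> = ennreal (1 / Im r) * ennreal pi"
    unfolding eq by (subst nn_integral_cmult) (auto simp: nn_integral_inverse_1_plus_square)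
  finally show ?thesis using r by (simp add: ennreal_mult[symmetric])
qed

lemma nn_integral_cmult_rank_one:
  assumes r: "0 < Im r" and a: "0 \<le> a" and f: "\<And>v. f v = a / (cmod (1 + complex_of_real (v - v0) * r))\<^sup>2"
  shows "(\<integral>\<^sup>+v. ennreal (f v) \<partial>lborel) = ennreal (pi * (a / Im r))"
proof -
  have "(\<integral>\<^sup>+v. ennreal (f v) \<partial>lborel)
      = (\<integral>\<^sup>+v. ennreal a * ennreal (1 / (cmod (1 + complex_of_real (v - v0) * r))\<^sup>2) \<partial>lborel)"
    using a by (intro nn_integral_cong) (simp add: f ennreal_mult[symmetric])
  also have "\<dots> = ennreal a * ennreal (pi / Im r)"
    unfolding nn_integral_rank_one[OF r, of v0, symmetric] by (intro nn_integral_cmult) auto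
  finally show ?thesis using a r by (simp add: ennreal_mult[symmetric] mult.commute)
qed

context bounded_potential
begin

lemma two_potentials_update:
  assumes k: "k \<in> Zd d"
  shows "two_potentials d V (V (k := v)) (max R \<bar>v\<bar>) k"
  by unfold_locales (use R0 bounded k in \<open>auto simp: le_max_iff_disj\<close>)

lemma average_im_resolvent:
  assumes \<eta>: "0 < \<eta>" and k: "k \<in> Zd d"
  shows "(\<integral>\<^sup>+v. ennreal (im_resolvent d (V (k := v)) E \<eta> k k) \<partial>lborel) = ennreal pi"
proof -
  have r: "0 < im_resolvent d V E \<eta> k k" by (rule im_resolvent_pos[OF \<eta> k])
  have "im_resolvent d (V (k := v)) E \<eta> k k
      = im_resolvent d V E \<eta> k k / (cmod (1 + complex_of_real (v - V k) * resolvent d V E \<eta> k k))\<^sup>2" for v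
    using two_potentials.im_resolvent_perturb[OF two_potentials_update[OF k] \<eta>] by simp
  from nn_integral_cmult_rank_one[OF _ _ this] show ?thesis using r by (simp add: Im_resolvent)
qed

lemma average_spec_det:
  assumes \<eta>: "0 < \<eta>" and k: "k \<in> Zd d" and j: "j \<in> Zd d"
  shows "(\<integral>\<^sup>+v. ennreal (spec_det d (V (k := v)) (res_im E \<eta>) j k) \<partial>lborel) \<le> ennreal (pi * im_resolvent d V E \<eta> j j)"
proof -
  have r: "0 < im_resolvent d V E \<eta> k k" by (rule im_resolvent_pos[OF \<eta> k])
  have nonneg: "0 \<le> spec_det d V (res_im E \<eta>) j k"
    by (intro spec_det_nonneg bdd_borel_res_im \<eta> j k less_imp_le res_im_pos)
  have "spec_det d (V (k := v)) (res_im E \<eta>) j k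
      = spec_det d V (res_im E \<eta>) j k / (cmod (1 + complex_of_real (v - V k) * resolvent d V E \<eta> k k))\<^sup>2" for v
    using two_potentials.spec_det_res_im_perturb[OF two_potentials_update[OF k] \<eta> j] by simp
  from nn_integral_cmult_rank_one[OF _ nonneg this]
  have "(\<integral>\<^sup>+v. ennreal (spec_det d (V (k := v)) (res_im E \<eta>) j k) \<partial>lborel)
      = ennreal (pi * (spec_det d V (res_im E \<eta>) j k / im_resolvent d V E \<eta> k k))"
    using r by (simp add: Im_resolvent)
  also have "\<dots> \<le> ennreal (pi * im_resolvent d V E \<eta> j j)"
    using r by (intro ennreal_leI mult_left_mono) (simp_all add: spec_det_res_im pos_divide_le_eq)
  finally show ?thesis .
qed

end

section \<open>The random potential\<close>

lemma countable_Zd: "countable (Zd d)"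
proof -
  have "inj_on (\<lambda>x. map x [0..<d]) (Zd d)"
  proof (rule inj_onI, rule ext)
    fix x y i assume x: "x \<in> Zd d" and y: "y \<in> Zd d" and eq: "map x [0..<d] = map y [0..<d]"
    show "x i = y i"
      using x y eq by (cases "i < d") (auto simp: list_eq_iff_nth_eq Zd_def)
  qed
  then show ?thesis by (rule countable_image_inj_on[rotated]) (rule countableI_type)
qed

definition shift :: "site \<Rightarrow> site \<Rightarrow> nat \<Rightarrow> int" where
  "shift a x = (\<lambda>i. x i + a i)"

definition neg :: "site \<Rightarrow> nat \<Rightarrow> int" where
  "neg a = (\<lambda>i. - a i)"

lemma shift_Zd: "a \<in> Zd d \<Longrightarrow> x \<in> Zd d \<Longrightarrow> shift a x \<in> Zd d"
  by (simp add: shift_def Zd_def)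

lemma neg_Zd: "a \<in> Zd d \<Longrightarrow> neg a \<in> Zd d"
  by (simp add: neg_def Zd_def)

lemma shift_neg[simp]: "shift a (shift (neg a) x) = x" "shift (neg a) (shift a x) = x"
  by (simp_all add: shift_def neg_def)

lemma zero_Zd: "(\<lambda>_. 0) \<in> Zd d"
  by (simp add: Zd_def)

lemma inj_shift: "inj (shift a)"
  by (rule inj_on_inverseI[where g="shift (neg a)"]) simp

lemma nbrs_shift: "nbrs d (shift a x) = shift a ` nbrs d x"
proof -
  have "nbrs d y = (\<lambda>i. y(i := y i + 1)) ` {..<d} \<union> (\<lambda>i. y(i := y i - 1)) ` {..<d}" for y
    unfolding nbrs_def by auto
  moreover have "(shift a x)(i := shift a x i + 1) = shift a (x(i := x i + 1))"
    "(shift a x)(i := shift a x i - 1) = shift a (x(i := x i - 1))" for i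
    by (auto simp: shift_def)
  ultimately show ?thesis by (simp only: image_Un image_image)
qed

definition shift_potential :: "nat \<Rightarrow> site \<Rightarrow> (site \<Rightarrow> real) \<Rightarrow> site \<Rightarrow> real" where
  "shift_potential d a V = (\<lambda>x\<in>Zd d. V (shift a x))"

lemma Hop_real_power_shift:
  assumes a: "a \<in> Zd d" and z: "z \<in> Zd d"
  shows "(Hop_real d (shift_potential d a V) ^^ n) (\<lambda>z. v (shift a z)) z = (Hop_real d V ^^ n) v (shift a z)"
  using z
proof (induction n arbitrary: z)
  case (Suc n)
  have "(\<Sum>y\<in>nbrs d z. (Hop_real d (shift_potential d a V) ^^ n) (\<lambda>z. v (shift a z)) y)
      = (\<Sum>y\<in>nbrs d z. (Hop_real d V ^^ n) v (shift a y))"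
    using nbrs_Zd[OF Suc.prems] by (intro sum.cong refl Suc.IH) auto
  also have "\<dots> = (\<Sum>y\<in>nbrs d (shift a z). (Hop_real d V ^^ n) v y)"
    unfolding nbrs_shift by (subst sum.reindex) (auto intro: inj_on_subset[OF inj_shift])
  moreover have "shift_potential d a V z = V (shift a z)" using Suc.prems by (simp add: shift_potential_def)
  ultimately show ?case
    unfolding funpow.simps o_apply Hop_real_def[of d "shift_potential d a V" _ z] Hop_real_def[of d V _ "shift a z"]
    using Suc.IH[OF Suc.prems] by simp
qed simp

lemma supp_shift: "supp (\<lambda>z. v (shift a z)) = shift (neg a) ` supp v"
proof
  show "supp (\<lambda>z. v (shift a z)) \<subseteq> shift (neg a) ` supp v"
    by (auto simp: supp_def intro!: image_eqI[of _ "shift (neg a)" "shift a _"])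
qed (auto simp: supp_def)

lemma spec_measure_shift:
  assumes a: "a \<in> Zd d" and v: "finsupp d v"
  shows "spec_measure d (shift_potential d a V) (\<lambda>z. v (shift a z)) = spec_measure d V v"
proof -
  have fs: "finsupp d (\<lambda>z. v (shift a z))"
    unfolding finsupp_def supp_shift using v a by (auto simp: finsupp_def intro!: shift_Zd neg_Zd)
  have "dot (\<lambda>z. v (shift a z)) ((Hop_real d (shift_potential d a V) ^^ n) (\<lambda>z. v (shift a z))) = dot v ((Hop_real d V ^^ n) v)" for n
  proof -
    have "dot (\<lambda>z. v (shift a z)) ((Hop_real d (shift_potential d a V) ^^ n) (\<lambda>z. v (shift a z)))
        = (\<Sum>z\<in>shift (neg a) ` supp v. v (shift a z) * (Hop_real d V ^^ n) v (shift a z))"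
      unfolding dot_def supp_shift
      by (intro sum.cong refl) (use v a in \<open>auto simp: finsupp_def Hop_real_power_shift shift_Zd neg_Zd subset_iff\<close>)
    also have "\<dots> = dot v ((Hop_real d V ^^ n) v)"
      unfolding dot_def by (subst sum.reindex) (auto intro: inj_on_subset[OF inj_shift])
    finally show ?thesis .
  qed
  then show ?thesis unfolding spec_measure_eq_moment_measure[OF fs] spec_measure_eq_moment_measure[OF v] by simp
qed

lemma spec_form_shift:
  assumes a: "a \<in> Zd d" and x: "x \<in> Zd d" and y: "y \<in> Zd d"
  shows "spec_form d (shift_potential d a V) f (kron x) (kron y) = spec_form d V f (kron (shift a x)) (kron (shift a y))"
proof -
  have kron: "kron (shift a u) (shift a z) = kron u z" for u z
    using inj_shift[of a] by (auto simp: kron_def inj_eq)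
  have "finsupp d (\<lambda>z. kron (shift a x) z + kron (shift a y) z)" "finsupp d (\<lambda>z. kron (shift a x) z - kron (shift a y) z)"
    using a x y by (auto intro!: finsupp_add finsupp_diff finsupp_kron shift_Zd)
  from this[THEN spec_measure_shift[OF a], of V] show ?thesis unfolding kron spec_form_def by simp
qed

locale anderson =
  fixes d :: nat and \<rho> :: "real \<Rightarrow> real"
  assumes d: "1 \<le> d" and density: "single_site_density \<rho>"
begin

abbreviation "X \<equiv> Zd d"
abbreviation "site_law \<equiv> density lborel (\<lambda>t. ennreal (\<rho> t))"
abbreviation "\<Omega> \<equiv> Omega d \<rho>"
abbreviation "E_abs F \<equiv> \<integral>\<^sup>+V. ennreal \<bar>F V\<bar> \<partial>\<Omega>"

lemma rho_measurable[measurable]: "\<rho> \<in> borel_measurable borel" and rho_nonneg: "0 \<le> \<rho> t"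
  using density by (auto simp: single_site_density_def)

lemma prob_space_site_law: "prob_space site_law"
proof
  show "emeasure site_law (space site_law) = 1"
    using density by (simp add: emeasure_density single_site_density_def)
qed

lemma sets_site_law: "sets site_law = sets borel" by simp

sublocale P: prob_space \<Omega>
  unfolding Omega_def by (rule prob_space_PiM) (rule prob_space_site_law)

definition V_max :: real where
  "V_max = (SOME R. 0 \<le> R \<and> (\<forall>t. R < \<bar>t\<bar> \<longrightarrow> \<rho> t = 0))"

lemma V_max: "0 \<le> V_max" "V_max < \<bar>t\<bar> \<Longrightarrow> \<rho> t = 0"
proof -
  obtain R where R: "\<forall>t. R < \<bar>t\<bar> \<longrightarrow> \<rho> t = 0" using density by (auto simp: single_site_density_def)
  then have "0 \<le> max R 0 \<and> (\<forall>t. max R 0 < \<bar>t\<bar> \<longrightarrow> \<rho> t = 0)" by auto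
  then have "0 \<le> V_max \<and> (\<forall>t. V_max < \<bar>t\<bar> \<longrightarrow> \<rho> t = 0)" unfolding V_max_def by (rule someI)
  then show "0 \<le> V_max" "V_max < \<bar>t\<bar> \<Longrightarrow> \<rho> t = 0" by auto
qed

definition admissible :: "(site \<Rightarrow> real) \<Rightarrow> bool" where
  "admissible V \<longleftrightarrow> (\<forall>x\<in>X. \<bar>V x\<bar> \<le> V_max)"

lemma admissibleD: "admissible V \<Longrightarrow> bounded_potential d V V_max"
  by unfold_locales (use V_max in \<open>auto simp: admissible_def\<close>)

lemma AE_admissible: "AE V in \<Omega>. admissible V"
  unfolding admissible_def
proof (rule AE_ball_countable[THEN iffD2, OF countable_Zd], rule ballI)
  fix x assume x: "x \<in> X"
  have "0 < ennreal (\<rho> t) \<longrightarrow> \<bar>t\<bar> \<le> V_max" for t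
    using V_max(2)[of t] by (cases "\<bar>t\<bar> \<le> V_max") auto
  then have "AE t in site_law. \<bar>t\<bar> \<le> V_max" by (subst AE_density) auto
  from AE_PiM_component[of X "\<lambda>_. site_law", OF _ x this]
  show "AE V in \<Omega>. \<bar>V x\<bar> \<le> V_max" unfolding Omega_def by (simp add: prob_space_site_law)
qed

lemma measurable_site: "x \<in> X \<Longrightarrow> (\<lambda>V. V x) \<in> borel_measurable \<Omega>"
  using measurable_component_singleton[of x X "\<lambda>_. site_law"] measurable_cong_sets[OF refl sets_site_law]
  unfolding Omega_def by blast

lemma measurable_Hop_real_power: "x \<in> X \<Longrightarrow> (\<lambda>V. (Hop_real d V ^^ n) v x) \<in> borel_measurable \<Omega>"
proof (induction n arbitrary: x)
  case (Suc n)
  have [measurable]: "(\<lambda>V. (Hop_real d V ^^ n) v y) \<in> borel_measurable \<Omega>" if "y \<in> nbrs d x" for y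
    using nbrs_Zd[OF Suc.prems] that by (intro Suc.IH) auto
  note [measurable] = Suc.IH[OF Suc.prems] measurable_site[OF Suc.prems]
  show ?case unfolding funpow.simps o_apply Hop_real_def[where x=x] by measurable
qed simp

lemma measurable_integral_spec_measure:
  assumes v: "finsupp d v" and f: "bdd_borel f"
  shows "(\<lambda>V. \<integral>t. f t \<partial>spec_measure d V v) \<in> borel_measurable \<Omega>"
  unfolding spec_measure_eq_moment_measure[OF v]
proof (rule measurable_integral_moment_measure[OF _ f])
  fix n
  have "(\<lambda>V. dot v ((Hop_real d V ^^ n) v)) \<in> borel_measurable \<Omega>"
    unfolding dot_def using v
    by (intro borel_measurable_sum borel_measurable_times measurable_Hop_real_power) (auto simp: finsupp_def)
  then show "(\<lambda>V. complex_of_real (dot v ((Hop_real d V ^^ n) v))) \<in> borel_measurable \<Omega>" by simp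
qed

lemma measurable_spec_form:
  assumes "bdd_borel f" "x \<in> X" "y \<in> X"
  shows "(\<lambda>V. spec_form d V f (kron x) (kron y)) \<in> borel_measurable \<Omega>"
  unfolding spec_form_def using assms
  by (intro borel_measurable_divide borel_measurable_diff measurable_integral_spec_measure finsupp_add finsupp_diff finsupp_kron) auto

lemma measurable_im_resolvent:
  "0 < \<eta> \<Longrightarrow> x \<in> X \<Longrightarrow> y \<in> X \<Longrightarrow> (\<lambda>V. im_resolvent d V E \<eta> x y) \<in> borel_measurable \<Omega>"
  unfolding im_resolvent_def by (intro measurable_spec_form bdd_borel_res_im)

lemma measurable_spec_det:
  "bdd_borel f \<Longrightarrow> j \<in> X \<Longrightarrow> k \<in> X \<Longrightarrow> (\<lambda>V. spec_det d V f j k) \<in> borel_measurable \<Omega>"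
  unfolding spec_det_def
  by (intro borel_measurable_diff borel_measurable_times borel_measurable_power measurable_spec_form)

lemma measurable_shift_potential: "a \<in> X \<Longrightarrow> shift_potential d a \<in> measurable \<Omega> \<Omega>"
  unfolding shift_potential_def[abs_def] Omega_def
  by (intro measurable_restrict measurable_component_singleton shift_Zd)

lemma distr_shift_potential: "a \<in> X \<Longrightarrow> distr \<Omega> \<Omega> (shift_potential d a) = \<Omega>"
  using distr_PiM_reindex[of X "\<lambda>_. site_law" "shift a"] prob_space_site_law inj_on_subset[OF inj_shift, of X a]
  unfolding shift_potential_def[abs_def] Omega_def by (auto intro: shift_Zd)

lemma space_update: "V \<in> space \<Omega> \<Longrightarrow> k \<in> X \<Longrightarrow> V (k := v) \<in> space \<Omega>"
  unfolding Omega_def by (auto simp: space_PiM PiE_def extensional_def)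

lemma measurable_update:
  assumes V: "V \<in> space \<Omega>" and k: "k \<in> X"
  shows "(\<lambda>v. V (k := v)) \<in> measurable borel \<Omega>"
proof -
  have "(\<lambda>v. V (k := v)) \<in> measurable site_law (PiM X (\<lambda>_. site_law))"
    by (rule measurable_fun_upd[where J=X]) (use V k in \<open>auto simp: Omega_def\<close>)
  then show ?thesis unfolding Omega_def using measurable_cong_sets[OF sets_site_law refl] by blast
qed

lemma resample:
  assumes k: "k \<in> X" and F[measurable]: "F \<in> borel_measurable \<Omega>"
  shows "(\<integral>\<^sup>+V. F V \<partial>\<Omega>) = (\<integral>\<^sup>+V. (\<integral>\<^sup>+v. F (V (k := v)) \<partial>site_law) \<partial>\<Omega>)"
    "(\<lambda>V. \<integral>\<^sup>+v. F (V (k := v)) \<partial>site_law) \<in> borel_measurable \<Omega>"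
proof -
  interpret site: prob_space site_law by (rule prob_space_site_law)
  interpret pair: pair_prob_space site_law \<Omega> ..
  let ?upd = "\<lambda>(x, Y). Y (k := x)"
  have ins: "insert k X = X" using k by auto
  have upd: "(\<lambda>(f, y). f (k := y)) \<in> measurable (\<Omega> \<Otimes>\<^sub>M site_law) \<Omega>"
    using measurable_add_dim[of k X "\<lambda>_. site_law"] unfolding ins Omega_def by simp
  have upd': "?upd \<in> measurable (site_law \<Otimes>\<^sub>M \<Omega>) \<Omega>"
    using measurable_compose[OF measurable_pair_swap' upd] by (simp add: split_def)
  have "distr (site_law \<Otimes>\<^sub>M \<Omega>) \<Omega> ?upd = \<Omega>"
    using distr_pair_PiM_eq_PiM[of X "\<lambda>_. site_law" k] prob_space_site_law unfolding ins Omega_def by simp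
  then have "(\<integral>\<^sup>+V. F V \<partial>\<Omega>) = (\<integral>\<^sup>+V. F V \<partial>distr (site_law \<Otimes>\<^sub>M \<Omega>) \<Omega> ?upd)" by simp
  also have "\<dots> = (\<integral>\<^sup>+p. (case p of (v, V) \<Rightarrow> F (V (k := v))) \<partial>(site_law \<Otimes>\<^sub>M \<Omega>))"
    by (subst nn_integral_distr[OF upd']) (simp_all add: F split_def)
  also have "\<dots> = (\<integral>\<^sup>+V. (\<integral>\<^sup>+v. F (V (k := v)) \<partial>site_law) \<partial>\<Omega>)"
    using pair.nn_integral_snd[of "\<lambda>(v, V). F (V (k := v))"] measurable_compose[OF upd' F] by (simp add: split_def)
  finally show "(\<integral>\<^sup>+V. F V \<partial>\<Omega>) = (\<integral>\<^sup>+V. (\<integral>\<^sup>+v. F (V (k := v)) \<partial>site_law) \<partial>\<Omega>)" .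
  have "(\<lambda>(V, v). F (V (k := v))) \<in> borel_measurable (\<Omega> \<Otimes>\<^sub>M site_law)"
    using measurable_compose[OF upd F] by (simp add: split_def)
  then show "(\<lambda>V. \<integral>\<^sup>+v. F (V (k := v)) \<partial>site_law) \<in> borel_measurable \<Omega>"
    by (rule site.borel_measurable_nn_integral)
qed

definition rho_sup :: real where
  "rho_sup = real_of_ereal (normInf \<rho>)"

lemma normInf_rho: "normInf \<rho> = ereal rho_sup" and rho_sup_nonneg: "0 \<le> rho_sup"
  and rho_le: "AE t in lborel. \<rho> t \<le> rho_sup"
proof -
  obtain M where M: "\<And>t. \<rho> t \<le> M" using density by (auto simp: single_site_density_def)
  have "normInf \<rho> \<le> ereal M" unfolding normInf_def
    by (rule esssup_I) (use M rho_nonneg in auto)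
  moreover have "esssup lborel (\<lambda>t::real. 0 :: ereal) \<le> normInf \<rho>" unfolding normInf_def by (rule esssup_mono) auto
  then have "0 \<le> normInf \<rho>" by (simp add: esssup_const)
  ultimately show eq: "normInf \<rho> = ereal rho_sup" and "0 \<le> rho_sup"
    unfolding rho_sup_def by (cases "normInf \<rho>"; simp)+
  have "AE t in lborel. ereal \<bar>\<rho> t\<bar> \<le> normInf \<rho>" unfolding normInf_def by (rule esssup_AE)
  then show "AE t in lborel. \<rho> t \<le> rho_sup" unfolding eq by eventually_elim (use rho_nonneg in auto)
qed

lemma nn_integral_site_law_le:
  assumes f[measurable]: "f \<in> borel_measurable borel"
  shows "(\<integral>\<^sup>+v. f v \<partial>site_law) \<le> ennreal rho_sup * (\<integral>\<^sup>+v. f v \<partial>lborel)"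
proof -
  have "(\<integral>\<^sup>+v. f v \<partial>site_law) = (\<integral>\<^sup>+v. ennreal (\<rho> v) * f v \<partial>lborel)" by (subst nn_integral_density) auto
  also have "\<dots> \<le> (\<integral>\<^sup>+v. ennreal rho_sup * f v \<partial>lborel)"
    by (rule nn_integral_mono_AE) (use rho_le in \<open>eventually_elim, auto intro!: mult_right_mono ennreal_leI\<close>)
  finally show ?thesis by (simp add: nn_integral_cmult)
qed

lemma average_spec_det_two_sites:
  assumes V: "V \<in> space \<Omega>" "admissible V" and \<eta>: "0 < \<eta>" and j: "j \<in> X" and k: "k \<in> X"
  shows "(\<integral>\<^sup>+v1. (\<integral>\<^sup>+v2. ennreal (spec_det d (V (j := v1, k := v2)) (res_im E \<eta>) j k) \<partial>site_law) \<partial>site_law)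
    \<le> ennreal (rho_sup\<^sup>2 * pi\<^sup>2)"
proof -
  interpret bounded_potential d V V_max by (rule admissibleD) fact
  let ?F = "\<lambda>V. ennreal (spec_det d V (res_im E \<eta>) j k)" and ?G = "\<lambda>V. ennreal (im_resolvent d V E \<eta> j j)"
  have F: "?F \<in> borel_measurable \<Omega>" and G: "?G \<in> borel_measurable \<Omega>"
    using measurable_spec_det[OF bdd_borel_res_im[OF \<eta>] j k] measurable_im_resolvent[OF \<eta> j j] by simp_all
  have inner: "(\<integral>\<^sup>+v2. ?F (V (j := v1, k := v2)) \<partial>site_law) \<le> ennreal (rho_sup * pi) * ?G (V (j := v1))" for v1
  proof -
    interpret b: bounded_potential d "V (j := v1)" "max V_max \<bar>v1\<bar>"
      by unfold_locales (use R0 bounded in \<open>auto simp: le_max_iff_disj\<close>)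
    have "(\<integral>\<^sup>+v2. ?F (V (j := v1, k := v2)) \<partial>site_law) \<le> ennreal rho_sup * (\<integral>\<^sup>+v2. ?F (V (j := v1, k := v2)) \<partial>lborel)"
      by (rule nn_integral_site_law_le[OF measurable_compose[OF measurable_update[OF space_update[OF V(1) j] k] F]])
    also have "\<dots> \<le> ennreal rho_sup * ennreal (pi * im_resolvent d (V (j := v1)) E \<eta> j j)"
      by (intro mult_left_mono b.average_spec_det[OF \<eta> k j]) simp
    finally show ?thesis
      using rho_sup_nonneg b.im_resolvent_pos[OF \<eta> j, of E] by (simp add: ennreal_mult[symmetric] mult.assoc)
  qed
  have G': "(\<lambda>v1. ?G (V (j := v1))) \<in> borel_measurable borel"
    by (rule measurable_compose[OF measurable_update[OF V(1) j] G])
  have "(\<integral>\<^sup>+v1. (\<integral>\<^sup>+v2. ?F (V (j := v1, k := v2)) \<partial>site_law) \<partial>site_law)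
      \<le> (\<integral>\<^sup>+v1. ennreal (rho_sup * pi) * ?G (V (j := v1)) \<partial>site_law)"
    by (intro nn_integral_mono inner)
  also have "\<dots> = ennreal (rho_sup * pi) * (\<integral>\<^sup>+v1. ?G (V (j := v1)) \<partial>site_law)"
    using G' by (intro nn_integral_cmult) simp
  also have "\<dots> \<le> ennreal (rho_sup * pi) * (ennreal rho_sup * ennreal pi)"
    using nn_integral_site_law_le[OF G'] unfolding average_im_resolvent[OF \<eta> j] by (intro mult_left_mono) auto
  finally show ?thesis
    using rho_sup_nonneg by (simp add: ennreal_mult[symmetric] power2_eq_square mult_ac)
qed

lemma minami_im_resolvent:
  assumes \<eta>: "0 < \<eta>" and j: "j \<in> X" and k: "k \<in> X"
  shows "(\<integral>\<^sup>+V. ennreal (spec_det d V (res_im E \<eta>) j k) \<partial>\<Omega>) \<le> ennreal (rho_sup\<^sup>2 * pi\<^sup>2)"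
proof -
  let ?F = "\<lambda>V. ennreal (spec_det d V (res_im E \<eta>) j k)"
  have F: "?F \<in> borel_measurable \<Omega>" using measurable_spec_det[OF bdd_borel_res_im[OF \<eta>] j k] by simp
  have "(\<integral>\<^sup>+V. ?F V \<partial>\<Omega>) = (\<integral>\<^sup>+V. (\<integral>\<^sup>+v1. (\<integral>\<^sup>+v2. ?F (V (j := v1, k := v2)) \<partial>site_law) \<partial>site_law) \<partial>\<Omega>)"
    unfolding resample(1)[OF k F] by (rule resample(1)[OF j resample(2)[OF k F]])
  also have "\<dots> \<le> (\<integral>\<^sup>+V. ennreal (rho_sup\<^sup>2 * pi\<^sup>2) \<partial>\<Omega>)"
  proof (rule nn_integral_mono_AE)
    show "AE V in \<Omega>. (\<integral>\<^sup>+v1. (\<integral>\<^sup>+v2. ?F (V (j := v1, k := v2)) \<partial>site_law) \<partial>site_law) \<le> ennreal (rho_sup\<^sup>2 * pi\<^sup>2)"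
      using AE_admissible AE_space
      by eventually_elim (rule average_spec_det_two_sites[OF _ _ \<eta> j k])
  qed
  finally show ?thesis by (simp add: P.emeasure_space_1)
qed

end

lemma psd_det_mono:
  fixes a b c x y z :: real
  assumes "0 \<le> a" "0 \<le> c" "b\<^sup>2 \<le> a * c" "0 \<le> x" "0 \<le> z" "y\<^sup>2 \<le> x * z"
  shows "a * c - b\<^sup>2 \<le> (a + x) * (c + z) - (b + y)\<^sup>2"
proof -
  have "(b * y)\<^sup>2 \<le> (a * c) * (x * z)"
    unfolding power_mult_distrib using assms by (intro mult_mono) auto
  moreover have "4 * ((a * c) * (x * z)) \<le> (a * z + c * x)\<^sup>2"
    using zero_le_power2[of "a * z - c * x"] by (simp add: power2_eq_square algebra_simps)
  ultimately have "(2 * (b * y))\<^sup>2 \<le> (a * z + c * x)\<^sup>2" by (simp add: power_mult_distrib)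
  moreover have "0 \<le> a * z + c * x" using assms by simp
  ultimately have "2 * (b * y) \<le> a * z + c * x" by (rule power2_le_imp_le)
  then show ?thesis using assms by (simp add: algebra_simps power2_eq_square)
qed

lemma (in bounded_potential) spec_det_mono:
  assumes f: "bdd_borel f" "\<And>t. 0 \<le> f t" and g: "bdd_borel g" "\<And>t. f t \<le> g t" and j: "j \<in> Zd d" and k: "k \<in> Zd d"
  shows "spec_det d V f j k \<le> spec_det d V g j k"
proof -
  let ?h = "\<lambda>t. g t - f t"
  have h: "bdd_borel ?h" "0 \<le> ?h t" for t using bdd_borel_diff[OF g(1) f(1)] g(2) by auto
  have split: "spec_form d V g (kron x) (kron y) = spec_form d V f (kron x) (kron y) + spec_form d V ?h (kron x) (kron y)"
    if "x \<in> Zd d" "y \<in> Zd d" for x y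
    by (simp add: spec_form_diff finsupp_kron that f(1) g(1))
  show ?thesis
    unfolding spec_det_def split[OF j j] split[OF k k] split[OF j k]
    by (intro psd_det_mono spec_form_nonneg spec_form_Cauchy_Schwarz finsupp_kron f h j k)
qed

lemma indicator_le_res_im:
  assumes \<nu>: "0 < \<nu>" shows "indicator {E - \<nu><..E + \<nu>} t \<le> 2 * \<nu> * res_im E \<nu> t"
proof (cases "t \<in> {E - \<nu><..E + \<nu>}")
  case True
  then have "\<bar>t - E\<bar> \<le> \<nu>" by auto
  then have "(t - E)\<^sup>2 \<le> \<nu>\<^sup>2" using \<nu> by (metis abs_ge_zero power2_abs power_mono)
  then have "(t - E)\<^sup>2 + \<nu>\<^sup>2 \<le> 2 * \<nu> * \<nu>" by (simp add: power2_eq_square)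
  then have "1 \<le> 2 * \<nu> * \<nu> / ((t - E)\<^sup>2 + \<nu>\<^sup>2)" using res_denominator_pos[OF \<nu>, of t E] by (simp add: le_divide_eq_1)
  then show ?thesis using True by (simp add: res_im_def)
next
  case False
  then show ?thesis using \<nu> res_im_pos[OF \<nu>, of E t] by simp
qed

lemma (in anderson) minami:
  fixes E \<nu> :: real
  assumes \<nu>: "0 < \<nu>" and j: "j \<in> X" and k: "k \<in> X"
  shows "(\<integral>\<^sup>+V. ennreal (spec_det d V (indicator {E - \<nu><..E + \<nu>}) j k) \<partial>\<Omega>) \<le> ennreal (4 * \<nu>\<^sup>2 * pi\<^sup>2 * rho_sup\<^sup>2)"
proof -
  let ?f = "indicator {E - \<nu><..E + \<nu>} :: real \<Rightarrow> real" and ?D = "\<lambda>V. spec_det d V (res_im E \<nu>) j k"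
  note im = bdd_borel_res_im[OF \<nu>, of E]
  have "AE V in \<Omega>. ennreal (spec_det d V ?f j k) \<le> ennreal (4 * \<nu>\<^sup>2) * ennreal (?D V)"
    using AE_admissible
  proof eventually_elim
    case (elim V)
    interpret bounded_potential d V V_max by (rule admissibleD) fact
    have "spec_det d V ?f j k \<le> spec_det d V (\<lambda>t. 2 * \<nu> * res_im E \<nu> t) j k"
      by (intro spec_det_mono bdd_borel_cmult im j k indicator_le_res_im \<nu> bdd_borel_indicator) auto
    also have "\<dots> = 4 * \<nu>\<^sup>2 * ?D V"
      by (simp only: spec_det_def spec_form_cmult finsupp_kron j k im) (simp add: power2_eq_square algebra_simps)
    finally show ?case
      using spec_det_nonneg[OF im _ j k] res_im_pos[OF \<nu>] by (simp add: ennreal_mult[symmetric] ennreal_leI less_imp_le)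
  qed
  then have "(\<integral>\<^sup>+V. ennreal (spec_det d V ?f j k) \<partial>\<Omega>) \<le> (\<integral>\<^sup>+V. ennreal (4 * \<nu>\<^sup>2) * ennreal (?D V) \<partial>\<Omega>)"
    by (rule nn_integral_mono_AE)
  also have "\<dots> = ennreal (4 * \<nu>\<^sup>2) * (\<integral>\<^sup>+V. ennreal (?D V) \<partial>\<Omega>)"
    using measurable_spec_det[OF im j k] by (intro nn_integral_cmult) simp
  also have "\<dots> \<le> ennreal (4 * \<nu>\<^sup>2) * ennreal (rho_sup\<^sup>2 * pi\<^sup>2)"
    by (intro mult_left_mono minami_im_resolvent[OF \<nu> j k]) auto
  also have "\<dots> = ennreal (4 * \<nu>\<^sup>2 * pi\<^sup>2 * rho_sup\<^sup>2)" by (simp add: ennreal_mult[symmetric] mult_ac)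
  finally show ?thesis .
qed

section \<open>Exponential decay of the Fermi projection\<close>

lemma integral_lorentz:
  assumes e: "0 < e"
  shows "integrable lborel (\<lambda>x. e / (x\<^sup>2 + e\<^sup>2))" "(\<integral>x. e / (x\<^sup>2 + e\<^sup>2) \<partial>lborel) = pi"
proof -
  have eq: "ennreal e * ennreal (e / ((e * x)\<^sup>2 + e\<^sup>2)) = ennreal (inverse (1 + x\<^sup>2))" for x
  proof -
    have "e * (e / ((e * x)\<^sup>2 + e\<^sup>2)) = e\<^sup>2 / (e\<^sup>2 * (1 + x\<^sup>2))" by (simp add: power2_eq_square algebra_simps)
    also have "\<dots> = inverse (1 + x\<^sup>2)" using e by (simp add: inverse_eq_divide)
    finally show ?thesis using e by (simp add: ennreal_mult[symmetric])
  qed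
  have "(\<integral>\<^sup>+x. ennreal (e / (x\<^sup>2 + e\<^sup>2)) \<partial>lborel) = (\<integral>\<^sup>+x. ennreal e * ennreal (e / ((e * x)\<^sup>2 + e\<^sup>2)) \<partial>lborel)"
    using e by (subst nn_integral_real_affine[where c=e and t=0]) (auto simp: nn_integral_cmult)
  then have nn: "(\<integral>\<^sup>+x. ennreal (e / (x\<^sup>2 + e\<^sup>2)) \<partial>lborel) = ennreal pi"
    unfolding eq nn_integral_inverse_1_plus_square .
  have pos: "0 \<le> e / (x\<^sup>2 + e\<^sup>2)" for x using e by simp
  show "integrable lborel (\<lambda>x. e / (x\<^sup>2 + e\<^sup>2))"
    by (rule integrableI_nonneg) (use nn pos in auto)
  show "(\<integral>x. e / (x\<^sup>2 + e\<^sup>2) \<partial>lborel) = pi"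
    by (subst integral_eq_nn_integral) (use nn pos in auto)
qed

lemma integral_res_re:
  "integrable lborel (\<lambda>\<eta>. res_re E \<eta> t)" "(\<integral>\<eta>. res_re E \<eta> t \<partial>lborel) = pi * sgn (t - E)"
  "(\<integral>\<eta>. \<bar>res_re E \<eta> t\<bar> \<partial>lborel) = pi * \<bar>sgn (t - E)\<bar>"
proof -
  let ?u = "t - E"
  have eq: "res_re E \<eta> t = sgn ?u * (\<bar>?u\<bar> / (\<eta>\<^sup>2 + \<bar>?u\<bar>\<^sup>2))" for \<eta>
    unfolding res_re_def by (simp add: mult_sgn_abs add.commute)
  have abs_eq: "\<bar>res_re E \<eta> t\<bar> = \<bar>sgn ?u\<bar> * (\<bar>?u\<bar> / (\<eta>\<^sup>2 + \<bar>?u\<bar>\<^sup>2))" for \<eta>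
    unfolding eq abs_mult by simp
  have "integrable lborel (\<lambda>\<eta>. res_re E \<eta> t) \<and> (\<integral>\<eta>. res_re E \<eta> t \<partial>lborel) = pi * sgn ?u
    \<and> (\<integral>\<eta>. \<bar>res_re E \<eta> t\<bar> \<partial>lborel) = pi * \<bar>sgn ?u\<bar>"
  proof (cases "?u = 0")
    case True
    then show ?thesis by (simp add: res_re_def)
  next
    case False
    then have "0 < \<bar>?u\<bar>" by simp
    note L = integral_lorentz[OF this]
    show ?thesis unfolding abs_eq unfolding eq
      by (intro conjI integrable_mult_right L(1)) (simp_all only: integral_mult_right_zero L(2) mult.commute)
  qed
  then show "integrable lborel (\<lambda>\<eta>. res_re E \<eta> t)" "(\<integral>\<eta>. res_re E \<eta> t \<partial>lborel) = pi * sgn (t - E)"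
    "(\<integral>\<eta>. \<bar>res_re E \<eta> t\<bar> \<partial>lborel) = pi * \<bar>sgn (t - E)\<bar>" by auto
qed

lemma bdd_borel_sgn: "bdd_borel (\<lambda>t. sgn (t - E))"
  by (rule bdd_borelI[where B=1]) (auto simp: sgn_if)

lemma integral_res_re_measure:
  assumes \<mu>: "finite_borel_on C \<mu>"
  shows "integrable lborel (\<lambda>\<eta>. \<integral>t. res_re E \<eta> t \<partial>\<mu>)"
    "(\<integral>\<eta>. (\<integral>t. res_re E \<eta> t \<partial>\<mu>) \<partial>lborel) = pi * (\<integral>t. sgn (t - E) \<partial>\<mu>)"
proof -
  interpret \<mu>: finite_measure \<mu> using \<mu> by (simp add: finite_borel_on_def)
  interpret pair_sigma_finite \<mu> lborel ..
  have [measurable_cong]: "sets \<mu> = sets borel" using \<mu> by (simp add: finite_borel_on_def)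
  have "bdd_borel (\<lambda>t. pi * \<bar>sgn (t - E)\<bar>)"
    by (rule bdd_borelI[where B=pi]) (auto simp: sgn_if)
  from integrable_bdd_borel[OF \<mu> this]
  have "integrable (\<mu> \<Otimes>\<^sub>M lborel) (\<lambda>p. res_re E (snd p) (fst p))"
    by (intro Fubini_integrable) (simp_all add: integral_res_re, simp add: res_re_def)
  then have int: "integrable (\<mu> \<Otimes>\<^sub>M lborel) (case_prod (\<lambda>t \<eta>. res_re E \<eta> t))" by (simp add: split_def)
  show "integrable lborel (\<lambda>\<eta>. \<integral>t. res_re E \<eta> t \<partial>\<mu>)" using integrable_snd[OF int] .
  show "(\<integral>\<eta>. (\<integral>t. res_re E \<eta> t \<partial>\<mu>) \<partial>lborel) = pi * (\<integral>t. sgn (t - E) \<partial>\<mu>)"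
    using Fubini_integral[OF int] by (simp add: integral_res_re)
qed

definition res_weight :: "real \<Rightarrow> real \<Rightarrow> real \<Rightarrow> real" where
  "res_weight B p \<eta> = (min (1 / \<bar>\<eta>\<bar>) (B / \<eta>\<^sup>2)) powr p"

lemma nn_integral_res_weight_finite:
  fixes B p :: real
  assumes p: "1/2 < p" "p < 1" and B: "0 < B"
  shows "(\<integral>\<^sup>+\<eta>. ennreal (res_weight B p \<eta>) \<partial>lborel) < \<infinity>"
proof -
  define \<phi> where "\<phi> t = (if t \<in> {0..1} then t powr (-p) else 0) + (B powr p) * (if t \<in> {1..} then t powr (-2*p) else 0)" for t :: real
  have m[measurable]: "\<phi> \<in> borel_measurable borel" unfolding \<phi>_def by measurable
  have \<phi>0: "0 \<le> \<phi> t" for t unfolding \<phi>_def by auto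
  have "((\<lambda>t. t powr (-p)) has_integral (1 powr (-p+1) / (-p+1))) {0..1}"
    "((\<lambda>t. t powr (-2*p)) has_integral -(1 powr (-2*p+1)) / (-2*p+1)) {1..}"
    using p by (intro has_integral_powr_from_0 has_integral_powr_to_inf; simp)+
  then have "(\<phi> has_integral (1 powr (-p+1) / (-p+1) + B powr p * (-(1 powr (-2*p+1)) / (-2*p+1)))) UNIV"
    unfolding \<phi>_def by (intro has_integral_add has_integral_mult_right has_integral_restrict_UNIV[THEN iffD2])
  from nn_integral_has_integral_lborel[OF m \<phi>0 this] have fin: "(\<integral>\<^sup>+t. ennreal (\<phi> t) \<partial>lborel) < \<infinity>" by simp
  have pos: "res_weight B p t \<le> \<phi> t" if t: "0 < t" for t
  proof (cases "t \<le> 1")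
    case True
    have "res_weight B p t \<le> (1 / t) powr p" unfolding res_weight_def using t B p by (intro powr_mono2) auto
    also have "\<dots> = t powr (-p)" using t by (simp add: powr_divide powr_minus_divide)
    also have "\<dots> \<le> \<phi> t" unfolding \<phi>_def using True t by simp
    finally show ?thesis .
  next
    case False
    have "res_weight B p t \<le> (B / t\<^sup>2) powr p" unfolding res_weight_def using t B p by (intro powr_mono2) auto
    also have "\<dots> = B powr p * t powr (-2*p)"
      using t B by (simp add: powr_divide powr_minus_divide powr_powr flip: powr_numeral)
    also have "\<dots> \<le> \<phi> t" unfolding \<phi>_def using False t by simp
    finally show ?thesis .
  qed
  have "res_weight B p \<eta> \<le> \<phi> \<eta> + \<phi> (- \<eta>)" if "\<eta> \<noteq> 0" for \<eta>
    using pos[of \<eta>] pos[of "-\<eta>"] \<phi>0[of \<eta>] \<phi>0[of "-\<eta>"] that by (cases "0 < \<eta>") (auto simp: res_weight_def)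
  then have "(\<integral>\<^sup>+\<eta>. ennreal (res_weight B p \<eta>) \<partial>lborel) \<le> (\<integral>\<^sup>+\<eta>. ennreal (\<phi> \<eta>) + ennreal (\<phi> (- \<eta>)) \<partial>lborel)"
    using AE_lborel_singleton[of 0] \<phi>0
    by (intro nn_integral_mono_AE) (auto elim!: eventually_mono simp: ennreal_plus[symmetric] ennreal_leI simp del: ennreal_plus)
  also have "\<dots> = (\<integral>\<^sup>+\<eta>. ennreal (\<phi> \<eta>) \<partial>lborel) + (\<integral>\<^sup>+\<eta>. ennreal (\<phi> (- \<eta>)) \<partial>lborel)"
    by (intro nn_integral_add) auto
  also have "(\<integral>\<^sup>+\<eta>. ennreal (\<phi> (- \<eta>)) \<partial>lborel) = (\<integral>\<^sup>+\<eta>. ennreal (\<phi> \<eta>) \<partial>lborel)"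
    using nn_integral_real_affine[of "\<lambda>t. ennreal (\<phi> t)" "-1" 0] by simp
  also have "(\<integral>\<^sup>+\<eta>. ennreal (\<phi> \<eta>) \<partial>lborel) + (\<integral>\<^sup>+\<eta>. ennreal (\<phi> \<eta>) \<partial>lborel) < \<infinity>"
    using fin by (simp add: less_top[symmetric])
  finally show ?thesis .
qed

context bounded_potential
begin

lemma spec_form_sgn:
  assumes v: "finsupp d v" and w: "finsupp d w"
  shows "integrable lborel (\<lambda>\<eta>. spec_form d V (res_re E \<eta>) v w)"
    "(\<integral>\<eta>. spec_form d V (res_re E \<eta>) v w \<partial>lborel) = pi * spec_form d V (\<lambda>t. sgn (t - E)) v w"
proof -
  note a = integral_res_re_measure[OF finite_borel_on_spec_measure[OF finsupp_add[OF v w]], of E]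
  note b = integral_res_re_measure[OF finite_borel_on_spec_measure[OF finsupp_diff[OF v w]], of E]
  show "integrable lborel (\<lambda>\<eta>. spec_form d V (res_re E \<eta>) v w)" unfolding spec_form_def using a(1) b(1) by simp
  show "(\<integral>\<eta>. spec_form d V (res_re E \<eta>) v w \<partial>lborel) = pi * spec_form d V (\<lambda>t. sgn (t - E)) v w"
    unfolding spec_form_def using a b by (simp add: right_diff_distrib diff_divide_distrib)
qed

lemma abs_spec_form_diag_le:
  assumes u: "finsupp d u" and f: "bdd_borel f" "\<And>t. t \<in> {-rad..rad} \<Longrightarrow> \<bar>f t\<bar> \<le> c"
  shows "\<bar>spec_form d V f u u\<bar> \<le> c * dot u u"
proof -
  have "spec_form d V f u u \<le> c * dot u u" by (rule spec_form_le[OF u f(1)]) (use f(2) in \<open>auto simp: abs_le_iff\<close>)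
  moreover have "spec_form d V (\<lambda>t. - 1 * f t) u u \<le> c * dot u u"
    by (rule spec_form_le[OF u bdd_borel_cmult[OF f(1)]]) (use f(2) in \<open>auto simp: abs_le_iff\<close>)
  moreover have "spec_form d V (\<lambda>t. - 1 * f t) u u = - 1 * spec_form d V f u u" by (rule spec_form_cmult[OF u u f(1)])
  ultimately show ?thesis by (simp add: abs_le_iff)
qed

lemma abs_spec_form_kron_le:
  assumes f: "bdd_borel f" "\<And>t. t \<in> {-rad..rad} \<Longrightarrow> \<bar>f t\<bar> \<le> c" and x: "x \<in> Zd d" "y \<in> Zd d"
  shows "\<bar>spec_form d V f (kron x) (kron y)\<bar> \<le> c"
proof -
  note v = finsupp_kron[OF x(1)] and w = finsupp_kron[OF x(2)]
  let ?p = "\<lambda>z. kron x z + kron y z" and ?m = "\<lambda>z. kron x z - kron y z"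
  have p: "finsupp d ?p" and m: "finsupp d ?m" using finsupp_add[OF v w] finsupp_diff[OF v w] by auto
  have "dot ?p ?p = dot (kron x) ?p + dot (kron y) ?p" using dot_linear_left[OF v w, of 1 1 ?p] by simp
  moreover have "dot ?m ?m = dot (kron x) ?m - dot (kron y) ?m" using dot_linear_left[OF v w, of 1 "-1" ?m] by simp
  ultimately have parallelogram: "dot ?p ?p + dot ?m ?m = 4" unfolding dot_kron_left by (simp add: kron_def)
  have "4 * \<bar>spec_form d V f (kron x) (kron y)\<bar> = \<bar>spec_form d V f ?p ?p - spec_form d V f ?m ?m\<bar>"
    unfolding spec_form_diag[OF p f(1)] spec_form_diag[OF m f(1)] by (simp add: spec_form_def)
  also have "\<dots> \<le> c * dot ?p ?p + c * dot ?m ?m"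
    using abs_spec_form_diag_le[OF p f] abs_spec_form_diag_le[OF m f] by linarith
  also have "\<dots> = c * 4" unfolding distrib_left[symmetric] parallelogram ..
  finally show ?thesis by simp
qed

lemma abs_spec_form_res_re_le:
  assumes \<eta>: "\<eta> \<noteq> 0" and q: "0 \<le> q" "q \<le> 1" and B: "\<And>t. t \<in> {-rad..rad} \<Longrightarrow> \<bar>t - E\<bar> \<le> B"
    and x: "x \<in> Zd d" "y \<in> Zd d"
  shows "\<bar>spec_form d V (res_re E \<eta>) (kron x) (kron y)\<bar>
    \<le> res_weight B (1 - q) \<eta> * cmod (resolvent d V E \<bar>\<eta>\<bar> x y) powr q"
proof -
  have pos: "0 < \<bar>\<eta>\<bar>" using \<eta> by simp
  have re_abs: "res_re E \<eta> = res_re E \<bar>\<eta>\<bar>" by (simp add: res_re_def fun_eq_iff)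
  let ?g = "\<bar>spec_form d V (res_re E \<eta>) (kron x) (kron y)\<bar>"
  have "0 \<le> B" using B[of 0] rad_pos abs_ge_zero[of "0 - E"] by (simp del: abs_ge_zero)
  have "?g \<le> 1 / \<bar>\<eta>\<bar>"
    unfolding re_abs by (rule abs_spec_form_kron_le[OF bdd_borel_res_re[OF pos] abs_res_re_le[OF pos] x])
  moreover have "?g \<le> B / \<eta>\<^sup>2"
    unfolding re_abs
  proof (rule abs_spec_form_kron_le[OF bdd_borel_res_re[OF pos] _ x])
    fix t assume "t \<in> {-rad..rad}"
    then have "\<bar>t - E\<bar> / ((t - E)\<^sup>2 + \<bar>\<eta>\<bar>\<^sup>2) \<le> B / \<eta>\<^sup>2"
      using \<eta> B \<open>0 \<le> B\<close> by (intro frac_le) auto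
    then show "\<bar>res_re E \<bar>\<eta>\<bar> t\<bar> \<le> B / \<eta>\<^sup>2" by (simp add: res_re_def abs_divide)
  qed
  moreover have "?g \<le> cmod (resolvent d V E \<bar>\<eta>\<bar> x y)"
    using abs_Re_le_cmod[of "resolvent d V E \<bar>\<eta>\<bar> x y"] unfolding re_abs by (simp add: resolvent_def)
  ultimately have "?g powr (1 - q) * ?g powr q \<le> res_weight B (1 - q) \<eta> * cmod (resolvent d V E \<bar>\<eta>\<bar> x y) powr q"
    unfolding res_weight_def using q by (intro mult_mono powr_mono2) auto
  then show ?thesis by (simp add: powr_add[symmetric])
qed

lemma spec_form_singleton_le:
  assumes \<eta>: "0 < \<eta>" and s: "0 < s" "s < 1" and x: "x \<in> Zd d"
  shows "spec_form d V (indicator {E}) (kron x) (kron x) \<le> \<eta> powr s * cmod (resolvent d V E \<eta> x x) powr s"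
proof -
  let ?q = "\<eta> * im_resolvent d V E \<eta> x x"
  note kx = finsupp_kron[OF x] and im = bdd_borel_res_im[OF \<eta>, of E]
  have pos: "0 < im_resolvent d V E \<eta> x x" by (rule im_resolvent_pos[OF \<eta> x])
  have "indicator {E} t \<le> \<eta> * res_im E \<eta> t" for t
    using \<eta> res_im_pos[OF \<eta>, of E t] by (auto simp: indicator_def res_im_def power2_eq_square)
  then have "spec_form d V (indicator {E}) (kron x) (kron x) \<le> spec_form d V (\<lambda>t. \<eta> * res_im E \<eta> t) (kron x) (kron x)"
    by (intro spec_form_mono kx bdd_borel_cmult im bdd_borel_indicator) auto
  also have "\<dots> = ?q" by (simp add: spec_form_cmult kx im im_resolvent_def)
  also have "?q = ?q powr 1" using \<eta> pos by simp
  also have "\<dots> \<le> ?q powr s"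
  proof (rule powr_mono')
    have "\<bar>im_resolvent d V E \<eta> x x\<bar> \<le> 1 / \<eta>"
      unfolding im_resolvent_def by (rule abs_spec_form_kron_le[OF im _ x x])
        (use res_im_pos[OF \<eta>, of E] res_im_le[OF \<eta>, of E] in \<open>auto simp: abs_of_pos\<close>)
    then show "?q \<le> 1" using \<eta> by (simp add: abs_of_pos[OF pos] field_simps)
  qed (use \<eta> pos s in auto)
  also have "\<dots> = \<eta> powr s * im_resolvent d V E \<eta> x x powr s" using \<eta> pos by (simp add: powr_mult)
  also have "\<dots> \<le> \<eta> powr s * cmod (resolvent d V E \<eta> x x) powr s"
    using pos s abs_Im_le_cmod[of "resolvent d V E \<eta> x x"] by (intro mult_left_mono powr_mono2) (auto simp: Im_resolvent)
  finally show ?thesis .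
qed

lemma abs_spec_form_atMost_le:
  assumes x: "x \<in> Zd d" and y: "y \<in> Zd d" and "x \<noteq> y" and no_atom: "spec_form d V (indicator {E}) (kron x) (kron x) = 0"
  shows "ennreal \<bar>spec_form d V (indicator {..E}) (kron x) (kron y)\<bar>
    \<le> (\<integral>\<^sup>+\<eta>. ennreal \<bar>spec_form d V (res_re E \<eta>) (kron x) (kron y)\<bar> \<partial>lborel)"
proof -
  note kx = finsupp_kron[OF x] and ky = finsupp_kron[OF y]
  have point: "bdd_borel (indicator {E} :: real \<Rightarrow> real)" by (rule bdd_borel_indicator) simp
  note bb = bdd_borel_add bdd_borel_diff bdd_borel_const bdd_borel_sgn point
  let ?F = "\<lambda>f. spec_form d V f (kron x) (kron y)" and ?s = "spec_form d V (\<lambda>t. sgn (t - E)) (kron x) (kron y)"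
  have "(?F (indicator {E}))\<^sup>2 \<le> 0"
    using spec_form_Cauchy_Schwarz[OF kx ky point] no_atom by simp
  then have atom: "?F (indicator {E}) = 0" by simp
  have "indicator {..E} = (\<lambda>t. (1/2) * ((1 - sgn (t - E)) + indicator {E} t))"
    by (auto simp: indicator_def sgn_if fun_eq_iff)
  then have "?F (indicator {..E}) = (1/2) * ((?F (\<lambda>_. 1) - ?s) + ?F (indicator {E}))"
    by (simp only: spec_form_cmult[OF kx ky] spec_form_add[OF kx ky] spec_form_diff[OF kx ky] bb)
  also have "\<dots> = - ?s / 2" using atom spec_form_one[OF kx ky] \<open>x \<noteq> y\<close> by (simp add: dot_kron_kron)
  finally have "ennreal \<bar>?F (indicator {..E})\<bar> \<le> ennreal (pi * \<bar>?s\<bar>)"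
    using mult_right_mono[of "1/2" pi "\<bar>?s\<bar>"] pi_gt3 by (intro ennreal_leI) simp
  also have "\<dots> = ennreal (norm (\<integral>\<eta>. ?F (res_re E \<eta>) \<partial>lborel))"
    unfolding spec_form_sgn(2)[OF kx ky] by (simp add: abs_mult)
  also have "\<dots> \<le> (\<integral>\<^sup>+\<eta>. ennreal (norm (?F (res_re E \<eta>))) \<partial>lborel)"
    by (rule integral_norm_bound_ennreal[OF spec_form_sgn(1)[OF kx ky]])
  finally show ?thesis by simp
qed

end

lemma Caratheodory_measurable:
  fixes f :: "'a \<Rightarrow> real \<Rightarrow> real"
  assumes meas: "\<And>u. (\<lambda>x. f x u) \<in> borel_measurable M" and cont: "\<And>x. x \<in> space M \<Longrightarrow> continuous_on UNIV (f x)"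
  shows "(\<lambda>p. f (fst p) (snd p)) \<in> borel_measurable (M \<Otimes>\<^sub>M borel)"
proof (rule borel_measurable_LIMSEQ_metric)
  let ?q = "\<lambda>n u. real_of_int \<lfloor>real (Suc n) * u\<rfloor> / real (Suc n)"
  show "(\<lambda>p. f (fst p) (?q n (snd p))) \<in> borel_measurable (M \<Otimes>\<^sub>M borel)" for n
    by (rule measurable_compose_countable[where f="\<lambda>i p. f (fst p) (real_of_int i / real (Suc n))"
          and g="\<lambda>p. \<lfloor>real (Suc n) * snd p\<rfloor>"])
      (use measurable_compose[OF measurable_fst meas] in \<open>simp_all, measurable\<close>)
  show "(\<lambda>n. f (fst p) (?q n (snd p))) \<longlonglongrightarrow> f (fst p) (snd p)" if "p \<in> space (M \<Otimes>\<^sub>M borel)" for p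
  proof (rule continuous_on_tendsto_compose[OF cont])
    have "\<bar>?q n u - u\<bar> \<le> inverse (real (Suc n))" for n u
    proof -
      have "?q n u - u = (real_of_int \<lfloor>real (Suc n) * u\<rfloor> - real (Suc n) * u) / real (Suc n)"
        by (simp add: diff_divide_distrib del: of_nat_Suc)
      then have "\<bar>?q n u - u\<bar> = \<bar>real_of_int \<lfloor>real (Suc n) * u\<rfloor> - real (Suc n) * u\<bar> / real (Suc n)"
        by (simp only: abs_divide abs_of_nat)
      also have "\<dots> \<le> 1 / real (Suc n)" by (intro divide_right_mono) linarith+
      finally show ?thesis by (simp add: inverse_eq_divide)
    qed
    then have "(\<lambda>n. ?q n (snd p) - snd p) \<longlonglongrightarrow> 0"
      by (intro Lim_null_comparison[OF _ LIMSEQ_inverse_real_of_nat]) simp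
    then show "(\<lambda>n. ?q n (snd p)) \<longlonglongrightarrow> snd p" by (rule LIM_zero_cancel)
  qed (use that in \<open>auto simp: space_pair_measure\<close>)
qed

context anderson
begin

definition spec_bound :: real where
  "spec_bound = bounded_potential.rad d V_max"

abbreviation "cut_power \<equiv> cut_pow spec_bound"

lemma spec_bound_pos: "0 < spec_bound"
proof -
  interpret bounded_potential d "\<lambda>_. 0" V_max by unfold_locales (use V_max(1) in auto)
  show ?thesis unfolding spec_bound_def by (rule rad_pos)
qed

definition kernel :: "(real \<Rightarrow> real) \<Rightarrow> (site \<Rightarrow> real) \<Rightarrow> site \<Rightarrow> site \<Rightarrow> real" where
  "kernel f V x y = (if admissible V then spec_form d V f (kron x) (kron y) else 0)"

lemma measurable_admissible: "Measurable.pred \<Omega> admissible"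
proof -
  have "Measurable.pred \<Omega> (\<lambda>V. \<bar>V x\<bar> \<le> V_max)" if "x \<in> X" for x using measurable_site[OF that] by measurable
  then have "(\<Inter>x\<in>X. {V \<in> space \<Omega>. \<bar>V x\<bar> \<le> V_max}) \<in> sets \<Omega>"
    unfolding pred_def using zero_Zd by (intro sets.countable_INT' countable_Zd) auto
  moreover have "(\<Inter>x\<in>X. {V \<in> space \<Omega>. \<bar>V x\<bar> \<le> V_max}) = {V \<in> space \<Omega>. admissible V}"
    using zero_Zd by (auto simp: admissible_def)
  ultimately show ?thesis by (simp add: pred_def)
qed

lemma measurable_kernel:
  assumes "bdd_borel f" "x \<in> X" "y \<in> X"
  shows "(\<lambda>V. kernel f V x y) \<in> borel_measurable \<Omega>"
proof -
  note [measurable] = measurable_spec_form[OF assms] measurable_admissible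
  show ?thesis unfolding kernel_def by measurable
qed

lemma normal_functional_kernel:
  assumes "x \<in> X" "y \<in> X" shows "normal_functional (\<lambda>f. kernel f V x y)"
proof (cases "admissible V")
  case True
  then show ?thesis
    using bounded_potential.normal_functional_spec_form[OF admissibleD finsupp_kron finsupp_kron] assms
    by (simp add: kernel_def)
qed (unfold_locales, simp_all add: kernel_def)

lemma kernel_add:
  "bdd_borel f \<Longrightarrow> bdd_borel g \<Longrightarrow> x \<in> X \<Longrightarrow> y \<in> X \<Longrightarrow> kernel (\<lambda>t. f t + g t) V x y = kernel f V x y + kernel g V x y"
  by (rule normal_functional.add[OF normal_functional_kernel])

lemma kernel_cmult: "bdd_borel f \<Longrightarrow> x \<in> X \<Longrightarrow> y \<in> X \<Longrightarrow> kernel (\<lambda>t. c * f t) V x y = c * kernel f V x y"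
  by (rule normal_functional.scale[OF normal_functional_kernel])

lemma kernel_diff:
  "bdd_borel f \<Longrightarrow> bdd_borel g \<Longrightarrow> x \<in> X \<Longrightarrow> y \<in> X \<Longrightarrow> kernel (\<lambda>t. f t - g t) V x y = kernel f V x y - kernel g V x y"
  unfolding kernel_def using bounded_potential.spec_form_diff[OF admissibleD finsupp_kron finsupp_kron] by auto

lemma kernel_sym: "bdd_borel f \<Longrightarrow> x \<in> X \<Longrightarrow> y \<in> X \<Longrightarrow> kernel f V x y = kernel f V y x"
  unfolding kernel_def using bounded_potential.spec_form_sym[OF admissibleD finsupp_kron finsupp_kron] by auto

lemma abs_kernel_le:
  assumes f: "bdd_borel f" "\<And>t. t \<in> {-spec_bound..spec_bound} \<Longrightarrow> \<bar>f t\<bar> \<le> c" and c: "0 \<le> c" and x: "x \<in> X" "y \<in> X"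
  shows "\<bar>kernel f V x y\<bar> \<le> c"
  unfolding kernel_def
  using bounded_potential.abs_spec_form_kron_le[OF admissibleD f(1) _ x] f(2) c
  by (simp add: spec_bound_def)

lemma kernel_restrict:
  "bdd_borel f \<Longrightarrow> x \<in> X \<Longrightarrow> y \<in> X \<Longrightarrow> kernel (\<lambda>t. f t * indicator {-spec_bound..spec_bound} t) V x y = kernel f V x y"
  unfolding kernel_def spec_bound_def
  using bounded_potential.spec_form_restrict[OF admissibleD finsupp_kron finsupp_kron bdd_borel_measurable] by auto

lemma kernel_cut_pow:
  "admissible V \<Longrightarrow> x \<in> X \<Longrightarrow> y \<in> X \<Longrightarrow> kernel (cut_power n) V x y = (Hop_real d V ^^ n) (kron y) x"
  unfolding kernel_def spec_bound_def
  using bounded_potential.spec_form_power[OF admissibleD finsupp_kron finsupp_kron] by (simp add: dot_kron_left)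

lemma measurable_kernel_res_re:
  assumes x: "x \<in> X" and y: "y \<in> X"
  shows "(\<lambda>p. kernel (res_re E (exp (ln \<bar>snd p\<bar>))) (fst p) x y) \<in> borel_measurable (\<Omega> \<Otimes>\<^sub>M lborel)"
proof -
  have "continuous_on UNIV (\<lambda>u. kernel (res_re E (exp u)) V x y)" for V
    unfolding continuous_on_sequentially o_def
  proof (intro allI ballI impI)
    fix u and r :: "nat \<Rightarrow> real" assume "(\<forall>n. r n \<in> UNIV) \<and> r \<longlonglongrightarrow> u"
    then have r: "r \<longlonglongrightarrow> u" by simp
    then have "bounded (range r)" by (intro convergent_imp_bounded)
    then obtain B where B: "\<And>n. \<bar>r n\<bar> \<le> B" unfolding bounded_iff by auto
    show "(\<lambda>n. kernel (res_re E (exp (r n))) V x y) \<longlonglongrightarrow> kernel (res_re E (exp u)) V x y"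
    proof (rule normal_functional.limit[OF normal_functional_kernel[OF x y], where B="exp B"])
      have "1 / exp (r n) \<le> exp B" for n using B[of n] by (simp add: exp_minus[symmetric] inverse_eq_divide[symmetric] abs_le_iff)
      then show "\<bar>res_re E (exp (r n)) t\<bar> \<le> exp B" for n t
        using abs_res_re_le[of "exp (r n)" E t] by (rule order_trans[rotated]) simp
      show "(\<lambda>n. res_re E (exp (r n)) t) \<longlonglongrightarrow> res_re E (exp u) t" for t
        unfolding res_re_def by (intro tendsto_intros r) (metis exp_gt_zero less_irrefl res_denominator_pos)
    qed (rule bdd_borel_res_re, simp)
  qed
  then have "(\<lambda>p. kernel (res_re E (exp (snd p))) (fst p) x y) \<in> borel_measurable (\<Omega> \<Otimes>\<^sub>M borel)"
    by (intro Caratheodory_measurable measurable_kernel bdd_borel_res_re x y) auto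
  from measurable_compose[OF _ this, of "\<lambda>p. (fst p, ln \<bar>snd p\<bar>)" "\<Omega> \<Otimes>\<^sub>M lborel"]
  show ?thesis by simp
qed

end

locale localized_anderson = anderson +
  fixes a b s K l :: real
  assumes s: "0 < s" "s < 1" and l: "0 < l" and loc: "loc_estimate d \<rho> a b s K l"
begin

lemma measurable_cmod_resolvent:
  assumes "0 < \<eta>" "x \<in> X" "y \<in> X"
  shows "(\<lambda>V. cmod (resolvent d V E \<eta> x y)) \<in> borel_measurable \<Omega>"
proof -
  note [measurable] = measurable_spec_form[OF bdd_borel_res_re[OF assms(1)] assms(2,3), of E]
    measurable_spec_form[OF bdd_borel_res_im[OF assms(1)] assms(2,3), of E]
  show ?thesis unfolding resolvent_def cmod_def by simp
qed

lemma fractional_moment: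
  assumes E: "E \<in> {a<..<b}" and \<eta>: "0 < \<eta>" and x: "x \<in> X" and y: "y \<in> X"
  shows "(\<integral>\<^sup>+V. ennreal (cmod (resolvent d V E \<eta> x y) powr s) \<partial>\<Omega>) \<le> ennreal (max K 0 * exp (- zdist d x y / l))"
proof -
  have "(\<integral>\<^sup>+V. ennreal (cmod (resolvent d V E \<eta> x y) powr s) \<partial>\<Omega>) = (\<integral>\<^sup>+V. ennreal (cmod (green d V (Complex E \<eta>) x y) powr s) \<partial>\<Omega>)"
    by (rule nn_integral_cong_AE) (use AE_admissible in
        \<open>eventually_elim, simp add: bounded_potential.green_eq_resolvent[OF admissibleD \<eta> x y]\<close>)
  also have "\<dots> \<le> ennreal (K * exp (- zdist d x y / l))"
    using loc E \<eta> x y unfolding loc_estimate_def by auto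
  also have "\<dots> \<le> ennreal (max K 0 * exp (- zdist d x y / l))" by (intro ennreal_leI mult_right_mono) auto
  finally show ?thesis .
qed

lemma powr_half_le:
  fixes g L :: real
  assumes g: "0 \<le> g" and L: "0 < L"
  shows "g powr (s/2) \<le> L/2 * g powr s + 1 / (2 * L)"
proof -
  have sq: "g powr s = (g powr (s/2))\<^sup>2" using g by (simp add: power2_eq_square powr_add[symmetric])
  have "0 \<le> (L * g powr (s/2) - 1)\<^sup>2 / (2 * L)" using L by simp
  also have "\<dots> = L/2 * (g powr (s/2))\<^sup>2 + 1 / (2 * L) - g powr (s/2)" using L by (simp add: power2_eq_square field_simps)
  finally show ?thesis unfolding sq by simp
qed

lemma half_fractional_moment:
  assumes E: "E \<in> {a<..<b}" and \<eta>: "0 < \<eta>" and x: "x \<in> X" and y: "y \<in> X"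
  shows "(\<integral>\<^sup>+V. ennreal (cmod (resolvent d V E \<eta> x y) powr (s/2)) \<partial>\<Omega>)
    \<le> ennreal ((max K 0 + 1) / 2 * exp (- zdist d x y / (2 * l)))"
proof -
  define L where "L = exp (zdist d x y / (2 * l))"
  have L: "0 < L" by (simp add: L_def)
  let ?G = "\<lambda>V. cmod (resolvent d V E \<eta> x y)"
  note [measurable] = measurable_cmod_resolvent[OF \<eta> x y, of E]
  have "(\<integral>\<^sup>+V. ennreal (?G V powr (s/2)) \<partial>\<Omega>) \<le> (\<integral>\<^sup>+V. ennreal (L/2) * ennreal (?G V powr s) + ennreal (1 / (2 * L)) \<partial>\<Omega>)"
    using powr_half_le[OF norm_ge_zero L] L
    by (intro nn_integral_mono) (simp add: ennreal_mult[symmetric] ennreal_plus[symmetric] ennreal_leI del: ennreal_plus)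
  also have "\<dots> = ennreal (L/2) * (\<integral>\<^sup>+V. ennreal (?G V powr s) \<partial>\<Omega>) + ennreal (1 / (2 * L))"
    by (subst nn_integral_add) (auto simp: nn_integral_cmult P.emeasure_space_1)
  also have "\<dots> \<le> ennreal (L/2) * ennreal (max K 0 * exp (- zdist d x y / l)) + ennreal (1 / (2 * L))"
    by (intro add_mono mult_left_mono fractional_moment E \<eta> x y order_refl) auto
  also have "\<dots> = ennreal (max K 0 / 2 * (L * exp (- zdist d x y / l)) + (1/2) * (1 / L))"
    using L by (subst ennreal_mult[symmetric]) (auto simp: ennreal_plus[symmetric] simp del: ennreal_plus)
  also have "L * exp (- zdist d x y / l) = exp (- zdist d x y / (2 * l))"
    unfolding L_def exp_add[symmetric] using l by (simp add: field_simps)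
  also have "1 / L = exp (- zdist d x y / (2 * l))" unfolding L_def by (simp add: exp_minus inverse_eq_divide)
  finally show ?thesis by (simp add: algebra_simps add_divide_distrib)
qed

lemma no_atom:
  assumes E: "E \<in> {a<..<b}" and x: "x \<in> X"
  shows "AE V in \<Omega>. spec_form d V (indicator {E}) (kron x) (kron x) = 0"
proof -
  have point: "bdd_borel (indicator {E} :: real \<Rightarrow> real)" by (rule bdd_borel_indicator) simp
  note [measurable] = measurable_spec_form[OF point x x]
  let ?m = "\<lambda>V. spec_form d V (indicator {E}) (kron x) (kron x)"
  have bound: "(\<integral>\<^sup>+V. ennreal (?m V) \<partial>\<Omega>) \<le> ennreal (\<eta> powr s * max K 0)" if \<eta>: "0 < \<eta>" for \<eta>
  proof -
    note [measurable] = measurable_cmod_resolvent[OF \<eta> x x, of E]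
    have "AE V in \<Omega>. ennreal (?m V) \<le> ennreal (\<eta> powr s) * ennreal (cmod (resolvent d V E \<eta> x x) powr s)"
      using AE_admissible
      by eventually_elim (simp add: ennreal_mult[symmetric] ennreal_leI
          bounded_potential.spec_form_singleton_le[OF admissibleD \<eta> s x])
    then have "(\<integral>\<^sup>+V. ennreal (?m V) \<partial>\<Omega>) \<le> ennreal (\<eta> powr s) * (\<integral>\<^sup>+V. ennreal (cmod (resolvent d V E \<eta> x x) powr s) \<partial>\<Omega>)"
      by (subst nn_integral_cmult[symmetric]) (auto intro: nn_integral_mono_AE)
    also have "\<dots> \<le> ennreal (\<eta> powr s) * ennreal (max K 0 * exp (- zdist d x x / l))"
      by (intro mult_left_mono fractional_moment E \<eta> x) auto
    finally show ?thesis by (simp add: ennreal_mult zdist_def)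
  qed
  have "(\<integral>\<^sup>+V. ennreal (?m V) \<partial>\<Omega>) \<le> ennreal 0"
  proof (rule tendsto_lowerbound[where F="at_right 0" and f="\<lambda>\<eta>. ennreal (\<eta> powr s * max K 0)"])
    have "((\<lambda>\<eta>. \<eta> powr s) \<longlongrightarrow> 0) (at_right 0)"
      using tendsto_zero_powrI[of "\<lambda>x. x" "at_right 0" "\<lambda>_. s" s] s
      by (auto simp: tendsto_ident_at eventually_at_right_less[THEN eventually_mono])
    then have "((\<lambda>\<eta>. \<eta> powr s * max K 0) \<longlongrightarrow> 0 * max K 0) (at_right 0)" by (intro tendsto_mult_right)
    then show "((\<lambda>\<eta>. ennreal (\<eta> powr s * max K 0)) \<longlongrightarrow> ennreal 0) (at_right 0)" by (intro tendsto_ennrealI) simp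
    show "eventually (\<lambda>\<eta>. (\<integral>\<^sup>+V. ennreal (?m V) \<partial>\<Omega>) \<le> ennreal (\<eta> powr s * max K 0)) (at_right 0)"
      using eventually_at_right_less[of 0] by eventually_elim (rule bound)
  qed simp
  then have "AE V in \<Omega>. ennreal (?m V) = 0"
    by (subst nn_integral_0_iff_AE[symmetric]) auto
  with AE_admissible show ?thesis
  proof eventually_elim
    case (elim V)
    have "0 \<le> ?m V"
      by (rule bounded_potential.spec_form_nonneg[OF admissibleD[OF elim(1)] finsupp_kron[OF x] point]) simp
    with elim(2) show ?case by (simp add: ennreal_eq_0_iff)
  qed
qed

lemma bdd_borel_atMost: "bdd_borel (indicator {..E} :: real \<Rightarrow> real)"
  by (rule bdd_borel_indicator) simp

lemma fermiP_eq_spec_form: "fermiP d V E x y = complex_of_real (spec_form d V (indicator {..E}) (kron x) (kron y))"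
proof -
  have "(\<lambda>t. if t \<le> E then 1 else 0) = (\<lambda>t. complex_of_real (indicator {..E} t))" by (auto simp: indicator_def)
  then show ?thesis unfolding fermiP_def using fmat_eq_spec_form[of d V "indicator {..E}" x y] by simp
qed

lemma abs_kernel_atMost_le: "x \<in> X \<Longrightarrow> y \<in> X \<Longrightarrow> \<bar>kernel (indicator {..E}) V x y\<bar> \<le> 1"
  by (rule abs_kernel_le[OF bdd_borel_atMost]) (auto simp: indicator_def)

lemma AE_kernel_atMost_le:
  assumes E: "E \<in> {a<..<b}" and x: "x \<in> X" and y: "y \<in> X" and xy: "x \<noteq> y"
  shows "AE V in \<Omega>. ennreal \<bar>kernel (indicator {..E}) V x y\<bar>
    \<le> (\<integral>\<^sup>+\<eta>. ennreal \<bar>kernel (res_re E (exp (ln \<bar>\<eta>\<bar>))) V x y\<bar> \<partial>lborel)"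
  using AE_admissible no_atom[OF E x]
proof eventually_elim
  case (elim V)
  have "ennreal \<bar>kernel (indicator {..E}) V x y\<bar> \<le> (\<integral>\<^sup>+\<eta>. ennreal \<bar>kernel (res_re E \<eta>) V x y\<bar> \<partial>lborel)"
    using bounded_potential.abs_spec_form_atMost_le[OF admissibleD x y xy] elim by (simp add: kernel_def)
  also have "\<dots> = (\<integral>\<^sup>+\<eta>. ennreal \<bar>kernel (res_re E (exp (ln \<bar>\<eta>\<bar>))) V x y\<bar> \<partial>lborel)"
  proof (rule nn_integral_cong_AE)
    have even: "res_re E (exp (ln \<bar>\<eta>\<bar>)) = res_re E \<eta>" if "\<eta> \<noteq> 0" for \<eta>
      using that by (simp add: res_re_def fun_eq_iff)
    from AE_lborel_singleton[of 0]
    show "AE \<eta> in lborel. ennreal \<bar>kernel (res_re E \<eta>) V x y\<bar> = ennreal \<bar>kernel (res_re E (exp (ln \<bar>\<eta>\<bar>))) V x y\<bar>"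
      by eventually_elim (simp only: even not_False_eq_True)
  qed
  finally show ?case .
qed

lemma E_abs_kernel_res_re_le:
  assumes E: "E \<in> {a<..<b}" and x: "x \<in> X" and y: "y \<in> X" and \<eta>: "\<eta> \<noteq> 0"
  shows "E_abs (\<lambda>V. kernel (res_re E \<eta>) V x y)
    \<le> ennreal (res_weight (spec_bound + \<bar>a\<bar> + \<bar>b\<bar>) (1 - s/2) \<eta>) * ennreal ((max K 0 + 1) / 2 * exp (- zdist d x y / (2 * l)))"
proof -
  have pos: "0 < \<bar>\<eta>\<bar>" using \<eta> by simp
  let ?w = "res_weight (spec_bound + \<bar>a\<bar> + \<bar>b\<bar>) (1 - s/2) \<eta>" and ?G = "\<lambda>V. cmod (resolvent d V E \<bar>\<eta>\<bar> x y) powr (s/2)"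
  note [measurable] = measurable_cmod_resolvent[OF pos x y, of E]
  have "0 \<le> ?w" by (simp add: res_weight_def)
  have "AE V in \<Omega>. ennreal \<bar>kernel (res_re E \<eta>) V x y\<bar> \<le> ennreal ?w * ennreal (?G V)"
    using AE_admissible
  proof eventually_elim
    case (elim V)
    interpret bounded_potential d V V_max by (rule admissibleD) fact
    have "\<bar>t - E\<bar> \<le> spec_bound + \<bar>a\<bar> + \<bar>b\<bar>" if "t \<in> {-rad..rad}" for t
      using that E by (auto simp: spec_bound_def)
    then show ?case
      using abs_spec_form_res_re_le[OF \<eta> _ _ _ x y, of "s/2" E] s elim \<open>0 \<le> ?w\<close>
      by (simp add: kernel_def ennreal_mult[symmetric] ennreal_leI)
  qed
  then have "E_abs (\<lambda>V. kernel (res_re E \<eta>) V x y) \<le> ennreal ?w * (\<integral>\<^sup>+V. ennreal (?G V) \<partial>\<Omega>)"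
    by (subst nn_integral_cmult[symmetric]) (auto intro: nn_integral_mono_AE)
  also have "\<dots> \<le> ennreal ?w * ennreal ((max K 0 + 1) / 2 * exp (- zdist d x y / (2 * l)))"
    by (intro mult_left_mono half_fractional_moment[OF E pos x y]) auto
  finally show ?thesis .
qed

text \<open>The real part of the resolvent integrates to \<open>\<pi> sgn (H - E)\<close> along the vertical line through \<open>E\<close>.\<close>

theorem fermi_projection_decay:
  "\<exists>K1\<ge>1. \<forall>E\<in>{a<..<b}. \<forall>x\<in>X. \<forall>y\<in>X.
     E_abs (\<lambda>V. kernel (indicator {..E}) V x y) \<le> ennreal (K1 * exp (- zdist d x y / (2 * l)))"
proof -
  define w where "w \<eta> = res_weight (spec_bound + \<bar>a\<bar> + \<bar>b\<bar>) (1 - s/2) \<eta>" for \<eta>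
  define W where "W = enn2real (\<integral>\<^sup>+\<eta>. ennreal (w \<eta>) \<partial>lborel)"
  have "(\<integral>\<^sup>+\<eta>. ennreal (w \<eta>) \<partial>lborel) < \<infinity>"
    unfolding w_def by (rule nn_integral_res_weight_finite) (use s spec_bound_pos in auto)
  then have W: "(\<integral>\<^sup>+\<eta>. ennreal (w \<eta>) \<partial>lborel) = ennreal W" "0 \<le> W"
    by (simp_all add: W_def less_top)
  have [measurable]: "w \<in> borel_measurable borel" unfolding w_def res_weight_def by measurable
  define K1 where "K1 = max 1 (W * ((max K 0 + 1) / 2))"
  have "E_abs (\<lambda>V. kernel (indicator {..E}) V x y) \<le> ennreal (K1 * exp (- zdist d x y / (2 * l)))"
    if E: "E \<in> {a<..<b}" and x: "x \<in> X" and y: "y \<in> X" for E x y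
  proof (cases "x = y")
    case True
    have "E_abs (\<lambda>V. kernel (indicator {..E}) V x y) \<le> (\<integral>\<^sup>+V. ennreal 1 \<partial>\<Omega>)"
      by (intro nn_integral_mono ennreal_leI abs_kernel_atMost_le x y)
    also have "\<dots> = ennreal 1" by (simp add: P.emeasure_space_1)
    also have "\<dots> \<le> ennreal (K1 * exp (- zdist d x y / (2 * l)))"
      using True by (intro ennreal_leI) (simp add: zdist_def K1_def)
    finally show ?thesis .
  next
    case False
    let ?e = "(max K 0 + 1) / 2 * exp (- zdist d x y / (2 * l))"
    let ?H = "\<lambda>V \<eta>. ennreal \<bar>kernel (res_re E (exp (ln \<bar>\<eta>\<bar>))) V x y\<bar>"
    interpret pair_sigma_finite \<Omega> lborel ..
    have "(\<lambda>(V, \<eta>). ?H V \<eta>) \<in> borel_measurable (\<Omega> \<Otimes>\<^sub>M lborel)"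
      using measurable_kernel_res_re[OF x y, of E] by (simp add: split_def)
    note swap = Fubini[OF this]
    have "E_abs (\<lambda>V. kernel (indicator {..E}) V x y) \<le> (\<integral>\<^sup>+V. (\<integral>\<^sup>+\<eta>. ?H V \<eta> \<partial>lborel) \<partial>\<Omega>)"
      by (rule nn_integral_mono_AE[OF AE_kernel_atMost_le[OF E x y False]])
    also have "\<dots> = (\<integral>\<^sup>+\<eta>. (\<integral>\<^sup>+V. ?H V \<eta> \<partial>\<Omega>) \<partial>lborel)" using swap by simp
    also have "\<dots> \<le> (\<integral>\<^sup>+\<eta>. ennreal (w \<eta>) * ennreal ?e \<partial>lborel)"
    proof (rule nn_integral_mono_AE)
      have "res_re E (exp (ln \<bar>\<eta>\<bar>)) = res_re E \<eta>" if "\<eta> \<noteq> 0" for \<eta>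
        using that by (simp add: res_re_def fun_eq_iff)
      then show "AE \<eta> in lborel. (\<integral>\<^sup>+V. ?H V \<eta> \<partial>\<Omega>) \<le> ennreal (w \<eta>) * ennreal ?e"
        using AE_lborel_singleton[of 0] E_abs_kernel_res_re_le[OF E x y] unfolding w_def by (auto elim!: eventually_mono)
    qed
    also have "\<dots> = ennreal W * ennreal ?e" by (simp add: nn_integral_multc W(1))
    also have "\<dots> \<le> ennreal (K1 * exp (- zdist d x y / (2 * l)))"
      using W(2) by (simp add: ennreal_mult[symmetric] K1_def mult.assoc[symmetric] ennreal_leI mult_right_mono)
    finally show ?thesis .
  qed
  moreover have "1 \<le> K1" by (simp add: K1_def)
  ultimately show ?thesis by blast
qed

end

section \<open>Sums as integrals over counting measures\<close>

lemma integrable_count_space_iff_summable: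
  fixes f :: "'a \<Rightarrow> real"
  shows "integrable (count_space A) f \<longleftrightarrow> (\<lambda>x. \<bar>f x\<bar>) summable_on A"
  using abs_summable_equivalent[of f A] by (simp add: abs_summable_on_def)

lemma integrable_count_space_iff_finite:
  fixes f :: "'a \<Rightarrow> real"
  shows "integrable (count_space A) f \<longleftrightarrow> (\<integral>\<^sup>+x. ennreal \<bar>f x\<bar> \<partial>count_space A) < \<infinity>"
  by (simp add: integrable_iff_bounded)

lemma infsum_eq_integral_count_space:
  fixes f :: "'a \<Rightarrow> real"
  shows "infsum f A = (\<integral>x. f x \<partial>count_space A)"
proof (cases "integrable (count_space A) f")
  case True
  then show ?thesis using infsetsum_infsum[of f A] by (simp add: abs_summable_on_def infsetsum_def)
next
  case False
  then have "\<not> f summable_on A"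
    using abs_summable_equivalent[of f A] summable_on_iff_abs_summable_on_real[of f A] by (simp add: abs_summable_on_def)
  then show ?thesis using False by (simp add: infsum_not_exists not_integrable_integral_eq)
qed

lemma infsum_complex_of_real: "infsum (\<lambda>x. complex_of_real (f x)) A = complex_of_real (infsum f A)"
proof (cases "f summable_on A")
  case True
  then show ?thesis using has_sum_of_real[OF has_sum_infsum[OF True], where 'a=complex] by (simp add: infsumI)
next
  case False
  then have "\<not> (\<lambda>x. complex_of_real (f x)) summable_on A" using summable_on_Re by fastforce
  then show ?thesis using False by (simp add: infsum_not_exists)
qed

lemma integrable_count_space_bound:
  fixes f g :: "'a \<Rightarrow> real"
  assumes "integrable (count_space A) g" "\<And>x. x \<in> A \<Longrightarrow> \<bar>f x\<bar> \<le> \<bar>g x\<bar>"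
  shows "integrable (count_space A) f"
  by (rule Bochner_Integration.integrable_bound[OF assms(1)]) (auto simp: AE_count_space assms(2))

lemma integral_count_space_finite_support:
  fixes f :: "'a \<Rightarrow> real"
  assumes "finite S" "S \<subseteq> A" "\<And>x. x \<in> A \<Longrightarrow> x \<notin> S \<Longrightarrow> f x = 0"
  shows "(\<integral>x. f x \<partial>count_space A) = (\<Sum>x\<in>S. f x)"
proof -
  have "(\<Sum>x\<in>S. f x) = infsum f S" using assms(1) by simp
  also have "\<dots> = infsum f A" by (rule infsum_cong_neutral) (use assms in auto)
  finally show ?thesis by (simp add: infsum_eq_integral_count_space)
qed

lemma integral_count_space_split:
  fixes f :: "'a \<Rightarrow> real"
  assumes i: "integrable (count_space A) f" and S: "finite S" "S \<subseteq> A"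
  shows "(\<integral>x. f x \<partial>count_space A) = (\<Sum>x\<in>S. f x) + (\<integral>x. f x \<partial>count_space (A - S))"
    and "integrable (count_space (A - S)) f"
proof -
  have "(\<lambda>x. \<bar>f x\<bar>) summable_on A" using i by (simp add: integrable_count_space_iff_summable)
  then have "f summable_on A" by (subst summable_on_iff_abs_summable_on_real) simp
  then have "infsum f (A - S) = infsum f A - infsum f S" by (rule infsum_Diff) (use S in auto)
  then show "(\<integral>x. f x \<partial>count_space A) = (\<Sum>x\<in>S. f x) + (\<integral>x. f x \<partial>count_space (A - S))"
    using S by (simp add: infsum_eq_integral_count_space[symmetric])
  show "integrable (count_space (A - S)) f"
    using i by (auto simp: integrable_count_space_iff_summable intro: summable_on_subset_banach)
qed

lemma nn_integral_count_space_le: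
  fixes f :: "'a \<Rightarrow> real"
  assumes "\<And>x. x \<in> A \<Longrightarrow> 0 \<le> f x" "\<And>S. finite S \<Longrightarrow> S \<subseteq> A \<Longrightarrow> sum f S \<le> B"
  shows "(\<integral>\<^sup>+x. ennreal (f x) \<partial>count_space A) \<le> ennreal B"
proof -
  have s: "f summable_on A" by (rule nonneg_bdd_above_summable_on) (use assms in \<open>auto intro!: bdd_aboveI[of _ B]\<close>)
  then have "(\<lambda>x. \<bar>f x\<bar>) summable_on A" by (rule summable_on_cong[THEN iffD1, rotated]) (simp add: assms)
  then have "integrable (count_space A) f" by (simp add: integrable_count_space_iff_summable)
  then have "(\<integral>\<^sup>+x. ennreal (f x) \<partial>count_space A) = ennreal (infsum f A)"
    unfolding infsum_eq_integral_count_space by (rule nn_integral_eq_integral) (simp add: AE_count_space assms)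
  also have "\<dots> \<le> ennreal B" by (intro ennreal_leI infsum_le_finite_sums s assms(2))
  finally show ?thesis .
qed

lemma nn_integral_count_space_Times:
  assumes "countable A" "countable B"
  shows "(\<integral>\<^sup>+p. f p \<partial>count_space (A \<times> B)) = (\<integral>\<^sup>+x. (\<integral>\<^sup>+y. f (x, y) \<partial>count_space B) \<partial>count_space A)"
proof -
  interpret B: sigma_finite_measure "count_space B" using assms by (intro sigma_finite_measure_count_space_countable)
  show ?thesis unfolding pair_measure_countable[OF assms, symmetric]
    by (subst B.nn_integral_fst[symmetric]) (auto simp: pair_measure_countable assms)
qed

lemma nn_integral_count_space_Times_swap:
  assumes "countable A" "countable B"
  shows "(\<integral>\<^sup>+p. f p \<partial>count_space (A \<times> B)) = (\<integral>\<^sup>+y. (\<integral>\<^sup>+x. f (x, y) \<partial>count_space A) \<partial>count_space B)"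
  unfolding nn_integral_count_space_Times[OF assms]
  by (rule nn_integral_count_space_nn_integral[OF assms(2)]) simp

lemma integral_count_space_Times:
  fixes f :: "'a \<times> 'b \<Rightarrow> real"
  assumes "countable A" "countable B" "integrable (count_space (A \<times> B)) f"
  shows "(\<integral>p. f p \<partial>count_space (A \<times> B)) = (\<integral>x. (\<integral>y. f (x, y) \<partial>count_space B) \<partial>count_space A)"
    and integral_count_space_Times_swap:
      "(\<integral>p. f p \<partial>count_space (A \<times> B)) = (\<integral>y. (\<integral>x. f (x, y) \<partial>count_space A) \<partial>count_space B)"
    and integrable_integral_count_space: "integrable (count_space A) (\<lambda>x. \<integral>y. f (x, y) \<partial>count_space B)"
proof -
  interpret A: sigma_finite_measure "count_space A" using assms by (intro sigma_finite_measure_count_space_countable)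
  interpret B: sigma_finite_measure "count_space B" using assms by (intro sigma_finite_measure_count_space_countable)
  interpret pair_sigma_finite "count_space A" "count_space B" ..
  have i: "integrable (count_space A \<Otimes>\<^sub>M count_space B) (case_prod (\<lambda>x y. f (x, y)))"
    using assms by (simp add: pair_measure_countable)
  show "(\<integral>p. f p \<partial>count_space (A \<times> B)) = (\<integral>x. (\<integral>y. f (x, y) \<partial>count_space B) \<partial>count_space A)"
    using integral_fst[OF i] by (simp add: pair_measure_countable assms)
  show "(\<integral>p. f p \<partial>count_space (A \<times> B)) = (\<integral>y. (\<integral>x. f (x, y) \<partial>count_space A) \<partial>count_space B)"
    using integral_snd[OF i] by (simp add: pair_measure_countable assms)
  show "integrable (count_space A) (\<lambda>x. \<integral>y. f (x, y) \<partial>count_space B)" using integrable_fst[OF i] .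
qed

lemma integrable_count_space_section:
  fixes f :: "'a \<times> 'b \<Rightarrow> real"
  assumes "integrable (count_space (A \<times> B)) f" "x \<in> A"
  shows "integrable (count_space B) (\<lambda>y. f (x, y))"
proof -
  have "(\<lambda>y. \<bar>f (x, y)\<bar>) summable_on B"
    using assms summable_on_reindex[of "Pair x" B "\<lambda>t. \<bar>f t\<bar>"]
    by (auto simp: integrable_count_space_iff_summable inj_on_def o_def intro: summable_on_subset_banach)
  then show ?thesis by (simp add: integrable_count_space_iff_summable)
qed

lemma integral_count_space_Times_factor:
  fixes A B :: "'a \<Rightarrow> real"
  assumes "countable S" and i: "integrable (count_space (S \<times> S)) (\<lambda>p. c * (A (fst p) * B (snd p)))"
  shows "(\<integral>p. c * (A (fst p) * B (snd p)) \<partial>count_space (S \<times> S)) = c * ((\<integral>x. A x \<partial>count_space S) * (\<integral>y. B y \<partial>count_space S))"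
  unfolding integral_count_space_Times[OF assms(1,1) i] by simp

lemma integrable_count_space_kernel:
  fixes A B :: "'a \<Rightarrow> real"
  assumes S: "countable S" and A: "integrable (count_space S) A" and B: "integrable (count_space S) B"
    and k: "\<And>x y. x \<in> S \<Longrightarrow> y \<in> S \<Longrightarrow> \<bar>k x y\<bar> \<le> 1"
  shows "integrable (count_space (S \<times> S)) (\<lambda>p. k (fst p) (snd p) * (A (fst p) * B (snd p)))"
proof -
  have fin: "(\<integral>\<^sup>+x. ennreal \<bar>A x\<bar> \<partial>count_space S) < \<infinity>" "(\<integral>\<^sup>+x. ennreal \<bar>B x\<bar> \<partial>count_space S) < \<infinity>"
    using A B by (simp_all add: integrable_count_space_iff_finite)
  have "(\<integral>\<^sup>+p. ennreal \<bar>k (fst p) (snd p) * (A (fst p) * B (snd p))\<bar> \<partial>count_space (S \<times> S))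
     \<le> (\<integral>\<^sup>+p. ennreal \<bar>A (fst p)\<bar> * ennreal \<bar>B (snd p)\<bar> \<partial>count_space (S \<times> S))"
  proof (rule nn_integral_mono)
    fix p assume "p \<in> space (count_space (S \<times> S))"
    then have "\<bar>k (fst p) (snd p)\<bar> \<le> 1" using k by auto
    then have "\<bar>k (fst p) (snd p)\<bar> * (\<bar>A (fst p)\<bar> * \<bar>B (snd p)\<bar>) \<le> 1 * (\<bar>A (fst p)\<bar> * \<bar>B (snd p)\<bar>)"
      by (rule mult_right_mono) simp
    then show "ennreal \<bar>k (fst p) (snd p) * (A (fst p) * B (snd p))\<bar> \<le> ennreal \<bar>A (fst p)\<bar> * ennreal \<bar>B (snd p)\<bar>"
      by (simp add: ennreal_mult[symmetric] ennreal_leI abs_mult)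
  qed
  also have "\<dots> = (\<integral>\<^sup>+x. ennreal \<bar>A x\<bar> \<partial>count_space S) * (\<integral>\<^sup>+x. ennreal \<bar>B x\<bar> \<partial>count_space S)"
    by (simp add: nn_integral_count_space_Times S nn_integral_cmult nn_integral_multc)
  also have "\<dots> < \<infinity>" using fin by (simp add: ennreal_mult_less_top)
  finally show ?thesis by (simp add: integrable_count_space_iff_finite)
qed

lemma
  fixes k :: "'a \<Rightarrow> 'a \<Rightarrow> real"
  assumes S: "countable S" and A: "integrable (count_space S) A" and B: "integrable (count_space S) B"
    and k: "\<And>x y. x \<in> S \<Longrightarrow> y \<in> S \<Longrightarrow> \<bar>k x y\<bar> \<le> 1"
  shows integral_kernel_Times: "(\<integral>p. k (fst p) (snd p) * (A (fst p) * B (snd p)) \<partial>count_space (S \<times> S))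
      = (\<integral>x. A x * (\<integral>y. k x y * B y \<partial>count_space S) \<partial>count_space S)"
    and integral_kernel_Times_swap: "(\<integral>p. k (fst p) (snd p) * (A (fst p) * B (snd p)) \<partial>count_space (S \<times> S))
      = (\<integral>y. B y * (\<integral>x. k x y * A x \<partial>count_space S) \<partial>count_space S)"
proof -
  note i = integrable_count_space_kernel[OF S A B k]
  show "(\<integral>p. k (fst p) (snd p) * (A (fst p) * B (snd p)) \<partial>count_space (S \<times> S))
      = (\<integral>x. A x * (\<integral>y. k x y * B y \<partial>count_space S) \<partial>count_space S)"
    using integral_count_space_Times[OF S S i] by (simp add: mult.left_commute)
  have "(\<integral>p. k (fst p) (snd p) * (A (fst p) * B (snd p)) \<partial>count_space (S \<times> S))
      = (\<integral>y. (\<integral>x. B y * (k x y * A x) \<partial>count_space S) \<partial>count_space S)"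
    using integral_count_space_Times_swap[OF S S i] by (simp add: mult_ac)
  then show "(\<integral>p. k (fst p) (snd p) * (A (fst p) * B (snd p)) \<partial>count_space (S \<times> S))
      = (\<integral>y. B y * (\<integral>x. k x y * A x \<partial>count_space S) \<partial>count_space S)" by simp
qed

lemma integral_kernel_quadratic_cong:
  fixes k :: "'a \<Rightarrow> 'a \<Rightarrow> real"
  assumes S: "countable S" and A: "integrable (count_space S) A" and B: "integrable (count_space S) B"
    and k: "\<And>x y. x \<in> S \<Longrightarrow> y \<in> S \<Longrightarrow> \<bar>k x y\<bar> \<le> 1" and sym: "\<And>x y. x \<in> S \<Longrightarrow> y \<in> S \<Longrightarrow> k x y = k y x"
    and eq: "\<And>x. x \<in> S \<Longrightarrow> (\<integral>y. k x y * A y \<partial>count_space S) = (\<integral>y. k x y * B y \<partial>count_space S)"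
  shows "(\<integral>p. k (fst p) (snd p) * (A (fst p) * A (snd p)) \<partial>count_space (S \<times> S))
    = (\<integral>p. k (fst p) (snd p) * (B (fst p) * B (snd p)) \<partial>count_space (S \<times> S))"
proof -
  have transpose: "(\<integral>x. k x y * C x \<partial>count_space S) = (\<integral>x. k y x * C x \<partial>count_space S)" if "y \<in> S" for y C
    using that by (intro Bochner_Integration.integral_cong refl) (simp add: sym)
  have "(\<integral>p. k (fst p) (snd p) * (A (fst p) * A (snd p)) \<partial>count_space (S \<times> S))
      = (\<integral>x. A x * (\<integral>y. k x y * B y \<partial>count_space S) \<partial>count_space S)"
    by (subst integral_kernel_Times[OF S A A k]) (auto intro!: Bochner_Integration.integral_cong simp: eq)
  also have "\<dots> = (\<integral>y. B y * (\<integral>x. k x y * A x \<partial>count_space S) \<partial>count_space S)"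
    using integral_kernel_Times[OF S A B k] integral_kernel_Times_swap[OF S A B k] by simp
  also have "\<dots> = (\<integral>y. B y * (\<integral>x. k x y * B x \<partial>count_space S) \<partial>count_space S)"
    by (intro Bochner_Integration.integral_cong refl) (simp add: transpose eq)
  also have "\<dots> = (\<integral>p. k (fst p) (snd p) * (B (fst p) * B (snd p)) \<partial>count_space (S \<times> S))"
    by (rule integral_kernel_Times_swap[OF S B B k, symmetric])
  finally show ?thesis .
qed

lemma integral_kernel_quadratic_le:
  fixes k :: "'a \<Rightarrow> 'a \<Rightarrow> real"
  assumes S: "countable S" and A: "integrable (count_space S) A"
    and k: "\<And>x y. x \<in> S \<Longrightarrow> y \<in> S \<Longrightarrow> \<bar>k x y\<bar> \<le> 1"
    and CS: "\<And>x y. x \<in> S \<Longrightarrow> y \<in> S \<Longrightarrow> \<bar>k x y\<bar> \<le> sqrt (k x x) * sqrt (k y y)"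
    and w: "integrable (count_space S) (\<lambda>x. \<bar>A x\<bar> * sqrt (k x x))"
  shows "(\<integral>p. k (fst p) (snd p) * (A (fst p) * A (snd p)) \<partial>count_space (S \<times> S))
    \<le> (\<integral>x. \<bar>A x\<bar> * sqrt (k x x) \<partial>count_space S)\<^sup>2"
proof -
  let ?w = "\<lambda>x. \<bar>A x\<bar> * sqrt (k x x)"
  have iw: "integrable (count_space (S \<times> S)) (\<lambda>p. 1 * (?w (fst p) * ?w (snd p)))"
    by (rule integrable_count_space_kernel[OF S w w]) simp
  have "(\<integral>p. k (fst p) (snd p) * (A (fst p) * A (snd p)) \<partial>count_space (S \<times> S))
      \<le> (\<integral>p. 1 * (?w (fst p) * ?w (snd p)) \<partial>count_space (S \<times> S))"
  proof (rule integral_mono[OF integrable_count_space_kernel[OF S A A k] iw])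
    fix p assume "p \<in> space (count_space (S \<times> S))"
    then have p: "fst p \<in> S" "snd p \<in> S" by auto
    have "k (fst p) (snd p) * (A (fst p) * A (snd p)) \<le> \<bar>k (fst p) (snd p)\<bar> * (\<bar>A (fst p)\<bar> * \<bar>A (snd p)\<bar>)"
      by (metis abs_ge_self abs_mult)
    also have "\<dots> \<le> (sqrt (k (fst p) (fst p)) * sqrt (k (snd p) (snd p))) * (\<bar>A (fst p)\<bar> * \<bar>A (snd p)\<bar>)"
      by (intro mult_right_mono CS p) auto
    finally show "k (fst p) (snd p) * (A (fst p) * A (snd p)) \<le> 1 * (?w (fst p) * ?w (snd p))"
      by (simp add: mult_ac)
  qed
  also have "\<dots> = (\<integral>x. ?w x \<partial>count_space S)\<^sup>2"
    using integral_count_space_Times_factor[OF S iw] by (simp add: power2_eq_square)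
  finally show ?thesis .
qed

lemma integral_count_space_Times_nonneg:
  fixes k :: "'a \<times> 'a \<Rightarrow> real"
  assumes i: "integrable (count_space (A \<times> A)) k"
    and pos: "\<And>S. finite S \<Longrightarrow> S \<subseteq> A \<Longrightarrow> 0 \<le> (\<Sum>p\<in>S \<times> S. k p)"
  shows "0 \<le> (\<integral>p. k p \<partial>count_space (A \<times> A))"
proof (rule tendsto_lowerbound)
  have "k summable_on A \<times> A"
    using i by (subst summable_on_iff_abs_summable_on_real) (simp add: integrable_count_space_iff_summable)
  then have "(sum k \<longlongrightarrow> infsum k (A \<times> A)) (finite_subsets_at_top (A \<times> A))"
    using has_sum_infsum unfolding has_sum_def by blast
  moreover have "filterlim (\<lambda>S. S \<times> S) (finite_subsets_at_top (A \<times> A)) (finite_subsets_at_top A)"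
    unfolding filterlim_finite_subsets_at_top
  proof (intro allI impI)
    fix F assume "finite F \<and> F \<subseteq> A \<times> A"
    then have "finite (fst ` F \<union> snd ` F)" "fst ` F \<union> snd ` F \<subseteq> A" by auto
    moreover have "F \<subseteq> S \<times> S" if "fst ` F \<union> snd ` F \<subseteq> S" for S
      using that by (auto simp: mem_Times_iff)
    ultimately show "\<forall>\<^sub>F S in finite_subsets_at_top A. finite (S \<times> S) \<and> F \<subseteq> S \<times> S \<and> S \<times> S \<subseteq> A \<times> A"
      unfolding eventually_finite_subsets_at_top
      by (metis Sigma_mono finite_cartesian_product)
  qed
  ultimately have "((\<lambda>S. sum k (S \<times> S)) \<longlongrightarrow> infsum k (A \<times> A)) (finite_subsets_at_top A)"
    by (rule filterlim_compose)
  then show "((\<lambda>S. sum k (S \<times> S)) \<longlongrightarrow> (\<integral>p. k p \<partial>count_space (A \<times> A))) (finite_subsets_at_top A)"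
    by (simp add: infsum_eq_integral_count_space)
  show "\<forall>\<^sub>F S in finite_subsets_at_top A. 0 \<le> sum k (S \<times> S)"
    by (rule eventually_finite_subsets_at_top_weakI) (rule pos)
qed simp

context sigma_finite_measure
begin

lemma pair_sigma_finite_count_space: "countable A \<Longrightarrow> pair_sigma_finite (count_space A) M"
  by (intro pair_sigma_finite.intro sigma_finite_measure_count_space_countable sigma_finite_measure_axioms)

lemma measurable_swap_count_space:
  assumes "countable A" "\<And>t. t \<in> A \<Longrightarrow> \<Psi> t \<in> measurable M N"
  shows "(\<lambda>(x, t). \<Psi> t x) \<in> measurable (M \<Otimes>\<^sub>M count_space A) N"
proof -
  have "(\<lambda>p. \<Psi> (fst p) (snd p)) \<in> measurable (count_space A \<Otimes>\<^sub>M M) N"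
    by (rule measurable_pair_measure_countable1[OF assms(1)]) (simp add: assms(2))
  then show ?thesis by (subst measurable_pair_swap_iff) (simp add: case_prod_beta')
qed

lemma measurable_nn_integral_count_space:
  fixes \<Psi> :: "'c \<Rightarrow> 'a \<Rightarrow> ennreal"
  assumes A: "countable A" and m: "\<And>t. t \<in> A \<Longrightarrow> \<Psi> t \<in> borel_measurable M"
  shows "(\<lambda>x. \<integral>\<^sup>+t. \<Psi> t x \<partial>count_space A) \<in> borel_measurable M"
proof -
  note swap = measurable_swap_count_space[OF A m]
  interpret pair_sigma_finite "count_space A" M by (rule pair_sigma_finite_count_space[OF A])
  from swap show ?thesis by (rule M1.borel_measurable_nn_integral[where f="\<lambda>x t. \<Psi> t x"])
qed

lemma measurable_integral_count_space:
  fixes \<Psi> :: "'c \<Rightarrow> 'a \<Rightarrow> real"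
  assumes A: "countable A" and m: "\<And>t. t \<in> A \<Longrightarrow> \<Psi> t \<in> borel_measurable M"
  shows "(\<lambda>x. \<integral>t. \<Psi> t x \<partial>count_space A) \<in> borel_measurable M"
proof -
  note swap = measurable_swap_count_space[OF A m]
  interpret pair_sigma_finite "count_space A" M by (rule pair_sigma_finite_count_space[OF A])
  from swap show ?thesis by (rule M1.borel_measurable_lebesgue_integral)
qed

lemma nn_integral_pair_count_space:
  assumes A: "countable A" and m: "\<And>t. t \<in> A \<Longrightarrow> \<Psi> t \<in> borel_measurable M"
  shows "(\<integral>\<^sup>+p. ennreal \<bar>\<Psi> (fst p) (snd p)\<bar> \<partial>(count_space A \<Otimes>\<^sub>M M)) = (\<integral>\<^sup>+t. (\<integral>\<^sup>+x. ennreal \<bar>\<Psi> t x\<bar> \<partial>M) \<partial>count_space A)"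
proof -
  have "(\<lambda>p. \<Psi> (fst p) (snd p)) \<in> borel_measurable (count_space A \<Otimes>\<^sub>M M)"
    by (rule measurable_pair_measure_countable1[OF A]) (simp add: m)
  then show ?thesis using nn_integral_fst[of "\<lambda>p. ennreal \<bar>\<Psi> (fst p) (snd p)\<bar>" "count_space A"] by simp
qed

lemma integrable_pair_count_space:
  fixes \<Psi> :: "'c \<Rightarrow> 'a \<Rightarrow> real"
  assumes A: "countable A" and m: "\<And>t. t \<in> A \<Longrightarrow> \<Psi> t \<in> borel_measurable M"
    and fin: "(\<integral>\<^sup>+t. (\<integral>\<^sup>+x. ennreal \<bar>\<Psi> t x\<bar> \<partial>M) \<partial>count_space A) < \<infinity>"
  shows "integrable (count_space A \<Otimes>\<^sub>M M) (\<lambda>p. \<Psi> (fst p) (snd p))"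
proof (rule integrableI_bounded)
  show "(\<lambda>p. \<Psi> (fst p) (snd p)) \<in> borel_measurable (count_space A \<Otimes>\<^sub>M M)"
    by (rule measurable_pair_measure_countable1[OF A]) (simp add: m)
qed (simp add: nn_integral_pair_count_space[where \<Psi>=\<Psi>, OF A m] fin[simplified])

lemma
  fixes \<Psi> :: "'c \<Rightarrow> 'a \<Rightarrow> real"
  assumes A: "countable A" and i: "integrable (count_space A \<Otimes>\<^sub>M M) (\<lambda>p. \<Psi> (fst p) (snd p))"
  shows AE_integrable_count_space: "AE x in M. integrable (count_space A) (\<lambda>t. \<Psi> t x)"
    and integral_pair_count_space_snd:
      "(\<integral>p. \<Psi> (fst p) (snd p) \<partial>(count_space A \<Otimes>\<^sub>M M)) = (\<integral>x. (\<integral>t. \<Psi> t x \<partial>count_space A) \<partial>M)"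
    and integrable_pair_count_space_snd: "integrable M (\<lambda>x. \<integral>t. \<Psi> t x \<partial>count_space A)"
    and integral_pair_count_space_fst:
      "(\<integral>p. \<Psi> (fst p) (snd p) \<partial>(count_space A \<Otimes>\<^sub>M M)) = (\<integral>t. (\<integral>x. \<Psi> t x \<partial>M) \<partial>count_space A)"
proof -
  interpret pp: pair_sigma_finite "count_space A" M by (rule pair_sigma_finite_count_space[OF A])
  have "integrable (count_space A \<Otimes>\<^sub>M M) (case_prod \<Psi>)" using i by (simp add: case_prod_beta')
  from pp.AE_integrable_snd[OF this] pp.integral_snd[OF this] pp.integrable_snd[OF this] pp.integral_fst[OF this]
  show "AE x in M. integrable (count_space A) (\<lambda>t. \<Psi> t x)"
    "(\<integral>p. \<Psi> (fst p) (snd p) \<partial>(count_space A \<Otimes>\<^sub>M M)) = (\<integral>x. (\<integral>t. \<Psi> t x \<partial>count_space A) \<partial>M)"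
    "integrable M (\<lambda>x. \<integral>t. \<Psi> t x \<partial>count_space A)"
    "(\<integral>p. \<Psi> (fst p) (snd p) \<partial>(count_space A \<Otimes>\<^sub>M M)) = (\<integral>t. (\<integral>x. \<Psi> t x \<partial>M) \<partial>count_space A)"
    by (simp_all add: case_prod_beta')
qed

end

section \<open>Lattice sums\<close>

lemma zdist_L2_set: "zdist d x y = L2_set (\<lambda>i. real_of_int (x i - y i)) {..<d}"
  by (simp add: zdist_def L2_set_def)

lemma zdist_nonneg: "0 \<le> zdist d x y" by (simp add: zdist_def sum_nonneg)

lemma zdist_commute: "zdist d x y = zdist d y x"
  unfolding zdist_def by (intro arg_cong[where f=sqrt] sum.cong refl) (simp add: power2_commute)

lemma abs_coord_diff_le_zdist: "i < d \<Longrightarrow> \<bar>real_of_int (x i - y i)\<bar> \<le> zdist d x y"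
  unfolding zdist_L2_set using member_le_L2_set[of "{..<d}" i "\<lambda>i. \<bar>real_of_int (x i - y i)\<bar>"]
  by (simp add: L2_set_def)

lemma zdist_triangle: "zdist d x z \<le> zdist d x y + zdist d y z"
proof -
  have "zdist d x z = L2_set (\<lambda>i. real_of_int (x i - y i) + real_of_int (y i - z i)) {..<d}"
    unfolding zdist_L2_set by (intro L2_set_cong) auto
  also have "\<dots> \<le> zdist d x y + zdist d y z" unfolding zdist_L2_set by (rule L2_set_triangle_ineq)
  finally show ?thesis .
qed

lemma zdist_shift: "zdist d (shift a x) (shift a y) = zdist d x y" by (simp add: zdist_def shift_def)

lemma zdist_self: "zdist d x x = 0" by (simp add: zdist_def)

lemma zdist_nbrs: "y \<in> nbrs d x \<Longrightarrow> zdist d x y \<le> 1"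
proof -
  have unit_step: "zdist d x (x(i := x i + c)) \<le> 1" if "i < d" "\<bar>c\<bar> = 1" for i c
  proof -
    have "(\<Sum>j<d. (real_of_int (x j - (x(i := x i + c)) j))\<^sup>2) = (\<Sum>j<d. if j = i then 1 else 0)"
      using that(2) by (intro sum.cong refl) (auto simp: power2_eq_square abs_if split: if_splits)
    then show ?thesis using that(1) by (simp add: zdist_def)
  qed
  assume "y \<in> nbrs d x"
  then show ?thesis unfolding nbrs_def using unit_step[of _ 1] unit_step[of _ "-1"] by auto
qed

lemma finite_box: "finite (box d n)" and card_box: "card (box d n) \<le> (2 * n + 1) ^ d"
proof -
  let ?A = "PiE {..<d} (\<lambda>_. {- int n..int n})"
  have img: "box d n \<subseteq> (\<lambda>f i. if i < d then f i else 0) ` ?A"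
  proof
    fix x assume x: "x \<in> box d n"
    have "x = (\<lambda>i. if i < d then (restrict x {..<d}) i else 0)" using x by (auto simp: box_def)
    moreover have "restrict x {..<d} \<in> ?A" using x by (auto simp: box_def abs_le_iff)
    ultimately show "x \<in> (\<lambda>f i. if i < d then f i else 0) ` ?A" by blast
  qed
  have fin: "finite ?A" by (intro finite_PiE) auto
  show "finite (box d n)" using finite_subset[OF img] fin by blast
  have "card (box d n) \<le> card ?A" using surj_card_le[OF fin img] .
  also have "card ?A = (2 * n + 1) ^ d"
  proof -
    have "card {- int n..int n} = 2 * n + 1" by simp
    then show ?thesis by (simp only: card_PiE finite_lessThan prod_constant card_lessThan)
  qed
  finally show "card (box d n) \<le> (2 * n + 1) ^ d" .
qed

lemma box_subset_Zd: "box d n \<subseteq> Zd d" by (auto simp: box_def Zd_def)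

lemma box_mono: "m \<le> n \<Longrightarrow> box d m \<subseteq> box d n" by (force simp: box_def)

lemma box_0: "box d 0 = {\<lambda>_. 0}"
  by (auto simp: box_def fun_eq_iff) (metis leI)

lemma in_some_box: "x \<in> Zd d \<Longrightarrow> \<exists>n. x \<in> box d n"
proof -
  assume x: "x \<in> Zd d"
  define n where "n = (\<Sum>i<d. nat \<bar>x i\<bar>)"
  have "\<bar>x i\<bar> \<le> int n" if "i < d" for i
  proof -
    have "nat \<bar>x i\<bar> \<le> n" unfolding n_def using that by (intro member_le_sum) auto
    then show ?thesis by linarith
  qed
  then show ?thesis using x by (auto simp: box_def Zd_def)
qed

lemma finite_subset_box:
  assumes "finite F" "F \<subseteq> Zd d" obtains N where "F \<subseteq> box d N"
proof -
  have "\<forall>x\<in>F. \<exists>n. x \<in> box d n" using assms in_some_box by auto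
  then obtain n where n: "\<And>x. x \<in> F \<Longrightarrow> x \<in> box d (n x)" by metis
  have "F \<subseteq> box d (\<Sum>x\<in>F. n x)"
  proof
    fix x assume x: "x \<in> F"
    have "n x \<le> (\<Sum>x\<in>F. n x)" using assms x by (intro member_le_sum) auto
    then show "x \<in> box d (\<Sum>x\<in>F. n x)" using n[OF x] box_mono by blast
  qed
  then show ?thesis by (rule that)
qed

lemma zdist_ge_outside_box: "x \<in> Zd d \<Longrightarrow> x \<notin> box d n \<Longrightarrow> real n + 1 \<le> zdist d x (\<lambda>_. 0)"
proof -
  assume x: "x \<in> Zd d" "x \<notin> box d n"
  then obtain i where i: "i < d" "int n < \<bar>x i\<bar>" by (auto simp: box_def Zd_def not_le)
  then have "real n + 1 \<le> \<bar>real_of_int (x i - 0)\<bar>" by linarith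
  also have "\<dots> \<le> zdist d x (\<lambda>_. 0)" using abs_coord_diff_le_zdist[OF i(1), of x "\<lambda>_. 0"] by simp
  finally show ?thesis .
qed

lemma abs_coord_le_box: "x \<in> box d n \<Longrightarrow> i < d \<Longrightarrow> \<bar>real_of_int (x i)\<bar> \<le> real n"
proof -
  assume "x \<in> box d n" "i < d"
  then have "\<bar>x i\<bar> \<le> int n" by (auto simp: box_def)
  then show ?thesis by linarith
qed

lemma summable_odd_power_exp:
  assumes k: "0 < \<kappa>" and d: "1 \<le> d"
  shows "summable (\<lambda>n. real ((2 * n + 1) ^ d) * exp (- \<kappa> * real n))"
proof -
  define q where "q = min 1 (\<kappa> / (4 * real d))"
  have q: "0 < q" "q \<le> 1" "2 * q \<le> \<kappa> / (2 * real d)" using k d by (auto simp: q_def)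
  have le_exp: "real ((2 * n + 1) ^ d) \<le> (1 / q) ^ d * exp (\<kappa> / 2 * real n)" for n
  proof -
    have "2 * q * real n \<le> \<kappa> / (2 * real d) * real n" using q by (intro mult_right_mono) auto
    then have "q * (2 * real n + 1) \<le> 1 + (\<kappa> / 2 * real n) / real d" using q by (simp add: algebra_simps)
    then have "(q * (2 * real n + 1)) ^ d \<le> (1 + (\<kappa> / 2 * real n) / real d) ^ d" using q by (intro power_mono) auto
    also have "\<dots> \<le> exp (\<kappa> / 2 * real n)"
    proof (rule exp_ge_one_plus_x_over_n_power_n)
      have "0 \<le> \<kappa> / 2 * real n" using k by simp
      then show "- real d \<le> \<kappa> / 2 * real n" by linarith
    qed (use d in simp)
    finally have "q ^ d * real ((2 * n + 1) ^ d) \<le> exp (\<kappa> / 2 * real n)" by (simp add: power_mult_distrib add.commute)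
    then show ?thesis using q by (simp add: power_divide field_simps)
  qed
  have geometric: "summable (\<lambda>n. (1 / q) ^ d * exp (- (\<kappa> / 2)) ^ n)"
    by (intro summable_mult summable_geometric) (use k in auto)
  show ?thesis
  proof (rule summable_comparison_test'[OF geometric, of 0])
    fix n
    have "norm (real ((2 * n + 1) ^ d) * exp (- \<kappa> * real n)) = real ((2 * n + 1) ^ d) * exp (- \<kappa> * real n)" by simp
    also have "\<dots> \<le> ((1 / q) ^ d * exp (\<kappa> / 2 * real n)) * exp (- \<kappa> * real n)" by (rule mult_right_mono[OF le_exp]) simp
    also have "\<dots> = (1 / q) ^ d * exp (- (\<kappa> / 2)) ^ n"
      by (simp add: exp_of_nat_mult[symmetric] exp_add[symmetric] mult.assoc del: exp_of_nat_mult)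
    finally show "norm (real ((2 * n + 1) ^ d) * exp (- \<kappa> * real n)) \<le> (1 / q) ^ d * exp (- (\<kappa> / 2)) ^ n" .
  qed
qed

lemma sum_exp_zdist_box_le:
  assumes k: "0 < \<kappa>"
  shows "(\<Sum>x\<in>box d N. exp (- \<kappa> * zdist d x (\<lambda>_. 0))) \<le> (\<Sum>n\<le>N. real ((2 * n + 1) ^ d) * exp (- \<kappa> * real n))"
proof (induction N)
  case 0 show ?case by (simp add: box_0 zdist_self)
next
  case (Suc N)
  let ?g = "\<lambda>x. exp (- \<kappa> * zdist d x (\<lambda>_. 0))" and ?shell = "box d (Suc N) - box d N"
  have "(\<Sum>x\<in>box d (Suc N). ?g x) = (\<Sum>x\<in>?shell. ?g x) + (\<Sum>x\<in>box d N. ?g x)"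
    by (rule sum.subset_diff[OF box_mono finite_box]) simp
  also have "(\<Sum>x\<in>?shell. ?g x) \<le> (\<Sum>x\<in>?shell. exp (- \<kappa> * real (Suc N)))"
  proof (rule sum_mono)
    fix x assume "x \<in> ?shell"
    then have "x \<in> Zd d" "x \<notin> box d N" using box_subset_Zd[of d "Suc N"] by blast+
    from zdist_ge_outside_box[OF this] have "real (Suc N) \<le> zdist d x (\<lambda>_. 0)" by simp
    then show "?g x \<le> exp (- \<kappa> * real (Suc N))" using k by simp
  qed
  also have "\<dots> = real (card ?shell) * exp (- \<kappa> * real (Suc N))" by simp
  also have "\<dots> \<le> real ((2 * Suc N + 1) ^ d) * exp (- \<kappa> * real (Suc N))"
  proof (rule mult_right_mono)
    have "card ?shell \<le> card (box d (Suc N))" by (intro card_mono finite_box) auto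
    also have "\<dots> \<le> (2 * Suc N + 1) ^ d" by (rule card_box)
    finally show "real (card ?shell) \<le> real ((2 * Suc N + 1) ^ d)" by (rule of_nat_mono)
  qed simp
  finally show ?case using Suc by simp
qed

lemma integrable_exp_zdist:
  assumes k: "0 < \<kappa>" and d: "1 \<le> d"
  shows "integrable (count_space (Zd d)) (\<lambda>x. exp (- \<kappa> * zdist d x (\<lambda>_. 0)))"
proof -
  let ?g = "\<lambda>x. exp (- \<kappa> * zdist d x (\<lambda>_. 0))" and ?u = "\<lambda>n. real ((2 * n + 1) ^ d) * exp (- \<kappa> * real n)"
  have "?g summable_on Zd d"
  proof (rule nonneg_bdd_above_summable_on)
    show "bdd_above (sum ?g ` {F. F \<subseteq> Zd d \<and> finite F})"
    proof (rule bdd_aboveI2[where M="suminf ?u"])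
      fix F assume F: "F \<in> {F. F \<subseteq> Zd d \<and> finite F}"
      then obtain N where N: "F \<subseteq> box d N" using finite_subset_box by blast
      have "sum ?g F \<le> sum ?g (box d N)" using N by (intro sum_mono2 finite_box) auto
      also have "\<dots> \<le> (\<Sum>n\<le>N. ?u n)" by (rule sum_exp_zdist_box_le[OF k])
      also have "\<dots> \<le> suminf ?u" by (rule sum_le_suminf[OF summable_odd_power_exp[OF k d]]) auto
      finally show "sum ?g F \<le> suminf ?u" .
    qed
  qed simp
  then show ?thesis unfolding integrable_count_space_iff_summable by simp
qed

definition lattice_sum :: "nat \<Rightarrow> real \<Rightarrow> real" where
  "lattice_sum d \<kappa> = (\<integral>x. exp (- \<kappa> * zdist d x (\<lambda>_. 0)) \<partial>count_space (Zd d))"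

lemma lattice_sum_nonneg: "0 \<le> lattice_sum d \<kappa>"
  unfolding lattice_sum_def by (intro Bochner_Integration.integral_nonneg) simp

lemma bij_betw_shift: "a \<in> Zd d \<Longrightarrow> bij_betw (shift a) (Zd d) (Zd d)"
  by (rule bij_betw_byWitness[where f'="shift (neg a)"]) (auto intro: shift_Zd neg_Zd)

lemma nn_integral_exp_zdist:
  assumes k: "0 < \<kappa>" and d: "1 \<le> d" and y: "y \<in> Zd d"
  shows "(\<integral>\<^sup>+x. ennreal (exp (- \<kappa> * zdist d x y)) \<partial>count_space (Zd d)) = ennreal (lattice_sum d \<kappa>)"
proof -
  have recenter: "zdist d (shift y x) y = zdist d x (\<lambda>_. 0)" for x
    using zdist_shift[of d y x "\<lambda>_. 0"] by (simp add: shift_def)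
  have "(\<integral>\<^sup>+x. ennreal (exp (- \<kappa> * zdist d x y)) \<partial>count_space (Zd d))
      = (\<integral>\<^sup>+x. ennreal (exp (- \<kappa> * zdist d (shift y x) y)) \<partial>count_space (Zd d))"
    by (rule nn_integral_bij_count_space[OF bij_betw_shift[OF y], symmetric])
  also have "\<dots> = ennreal (lattice_sum d \<kappa>)"
    unfolding recenter lattice_sum_def by (rule nn_integral_eq_integral[OF integrable_exp_zdist[OF k d]]) simp
  finally show ?thesis .
qed

section \<open>Decay of kernels in the mean\<close>

lemma Hop_real_power_range: "(Hop_real d V ^^ n) (kron y) x \<noteq> 0 \<Longrightarrow> zdist d x y \<le> real n"
proof (induction n arbitrary: x)
  case 0 then show ?case by (auto simp: kron_def zdist_self split: if_splits)
next
  case (Suc n)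
  show ?case
  proof (rule ccontr)
    assume far: "\<not> zdist d x y \<le> real (Suc n)"
    have nbrs: "(Hop_real d V ^^ n) (kron y) u = 0" if "u \<in> nbrs d x" for u
    proof (rule ccontr)
      assume "(Hop_real d V ^^ n) (kron y) u \<noteq> 0"
      then have "zdist d u y \<le> real n" by (rule Suc.IH)
      then show False using zdist_triangle[of d x y u] zdist_nbrs[OF that] far by simp
    qed
    have self: "(Hop_real d V ^^ n) (kron y) x = 0" using Suc.IH[of x] far by fastforce
    have "(Hop_real d V ^^ Suc n) (kron y) x = 0"
      unfolding funpow.simps o_apply Hop_real_def[where x=x] using nbrs self by simp
    then show False using Suc.prems by simp
  qed
qed

lemma Hop_real_power_range_box:
  assumes "x \<in> Zd d" "(Hop_real d V ^^ n) (kron (\<lambda>_. 0)) x \<noteq> 0"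
  shows "x \<in> box d n"
  using Hop_real_power_range[OF assms(2)] zdist_ge_outside_box[OF assms(1), of n] by force

text \<open>The smallest of the rates \<open>q i\<close> dominates their geometric mean, so a product of bounded variables inherits a
  \<open>card I\<close>-th of the decay of each factor.\<close>

lemma nn_integral_abs_prod_le:
  fixes Z :: "'i \<Rightarrow> 'a \<Rightarrow> real"
  assumes I: "finite I" "I \<noteq> {}" and meas: "\<And>i. i \<in> I \<Longrightarrow> Z i \<in> borel_measurable M"
    and bound: "\<And>i x. i \<in> I \<Longrightarrow> \<bar>Z i x\<bar> \<le> N"
    and mean: "\<And>i. i \<in> I \<Longrightarrow> (\<integral>\<^sup>+x. ennreal \<bar>Z i x\<bar> \<partial>M) \<le> ennreal (A * q i ^ card I)"
    and A: "0 \<le> A" and q: "\<And>i. i \<in> I \<Longrightarrow> 0 \<le> q i"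
  shows "(\<integral>\<^sup>+x. ennreal \<bar>\<Prod>i\<in>I. Z i x\<bar> \<partial>M) \<le> ennreal (N ^ (card I - 1) * A * (\<Prod>i\<in>I. q i))"
proof -
  have "Min (q ` I) \<in> q ` I" using I by (intro Min_in) auto
  then obtain k where k: "k \<in> I" "q k = Min (q ` I)" by auto
  then have k_least: "q k \<le> q i" if "i \<in> I" for i using that I by simp
  have N: "0 \<le> N" using bound[OF k(1)] abs_ge_zero order_trans by blast
  have "\<bar>\<Prod>i\<in>I. Z i x\<bar> \<le> N ^ (card I - 1) * \<bar>Z k x\<bar>" for x
  proof -
    have "\<bar>\<Prod>i\<in>I. Z i x\<bar> = \<bar>Z k x\<bar> * (\<Prod>i\<in>I - {k}. \<bar>Z i x\<bar>)"
      by (simp add: abs_mult abs_prod prod.remove[OF I(1) k(1)])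
    also have "\<dots> \<le> \<bar>Z k x\<bar> * (\<Prod>i\<in>I - {k}. N)" by (intro mult_left_mono prod_mono) (auto simp: bound)
    finally show ?thesis using I k by (simp add: mult.commute)
  qed
  then have "(\<integral>\<^sup>+x. ennreal \<bar>\<Prod>i\<in>I. Z i x\<bar> \<partial>M) \<le> (\<integral>\<^sup>+x. ennreal (N ^ (card I - 1)) * ennreal \<bar>Z k x\<bar> \<partial>M)"
    using N by (intro nn_integral_mono) (simp add: ennreal_mult[symmetric] ennreal_leI)
  also have "\<dots> = ennreal (N ^ (card I - 1)) * (\<integral>\<^sup>+x. ennreal \<bar>Z k x\<bar> \<partial>M)"
    using meas[OF k(1)] by (intro nn_integral_cmult) auto
  also have "\<dots> \<le> ennreal (N ^ (card I - 1)) * ennreal (A * (\<Prod>i\<in>I. q i))"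
  proof (rule mult_left_mono[OF order_trans[OF mean[OF k(1)]]])
    have "(\<Prod>i\<in>I. q k) \<le> (\<Prod>i\<in>I. q i)" using k_least q[OF k(1)] by (intro prod_mono) auto
    then show "ennreal (A * q k ^ card I) \<le> ennreal (A * (\<Prod>i\<in>I. q i))"
      using A by (intro ennreal_leI mult_left_mono) auto
  qed simp
  also have "\<dots> = ennreal (N ^ (card I - 1) * A * (\<Prod>i\<in>I. q i))"
    using N A q by (simp add: ennreal_mult[symmetric] prod_nonneg mult.assoc)
  finally show ?thesis .
qed

lemma nn_integral_abs_mult_le:
  fixes Z W :: "'a \<Rightarrow> real"
  assumes "Z \<in> borel_measurable M" "W \<in> borel_measurable M" "\<And>x. \<bar>Z x\<bar> \<le> N" "\<And>x. \<bar>W x\<bar> \<le> N"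
    and "(\<integral>\<^sup>+x. ennreal \<bar>Z x\<bar> \<partial>M) \<le> ennreal (A * q\<^sup>2)" "(\<integral>\<^sup>+x. ennreal \<bar>W x\<bar> \<partial>M) \<le> ennreal (A * r\<^sup>2)"
    and "0 \<le> A" "0 \<le> q" "0 \<le> r"
  shows "(\<integral>\<^sup>+x. ennreal \<bar>Z x * W x\<bar> \<partial>M) \<le> ennreal (N * A * (q * r))"
proof -
  have "(\<integral>\<^sup>+x. ennreal \<bar>\<Prod>c\<in>UNIV. case_bool Z W c x\<bar> \<partial>M)
      \<le> ennreal (N ^ (card (UNIV :: bool set) - 1) * A * (\<Prod>c\<in>UNIV. case_bool q r c))"
  proof (rule nn_integral_abs_prod_le)
    show "case_bool Z W c \<in> borel_measurable M" "\<bar>case_bool Z W c x\<bar> \<le> N" "0 \<le> case_bool q r c" for c x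
      using assms by (cases c; simp)+
    show "(\<integral>\<^sup>+x. ennreal \<bar>case_bool Z W c x\<bar> \<partial>M) \<le> ennreal (A * case_bool q r c ^ card (UNIV :: bool set))" for c
      using assms by (cases c) (simp_all add: card_UNIV_bool)
  qed (use assms in auto)
  then show ?thesis by (simp add: UNIV_bool mult_ac)
qed

lemma nn_integral_abs_mult3_le:
  fixes Z :: "nat \<Rightarrow> 'a \<Rightarrow> real"
  assumes "\<And>i. i < 3 \<Longrightarrow> Z i \<in> borel_measurable M" "\<And>i x. i < 3 \<Longrightarrow> \<bar>Z i x\<bar> \<le> N"
    and "\<And>i. i < 3 \<Longrightarrow> (\<integral>\<^sup>+x. ennreal \<bar>Z i x\<bar> \<partial>M) \<le> ennreal (A * q i ^ 3)"
    and "0 \<le> A" "\<And>i. i < 3 \<Longrightarrow> 0 \<le> q i"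
  shows "(\<integral>\<^sup>+x. ennreal \<bar>Z 0 x * Z 1 x * Z 2 x\<bar> \<partial>M) \<le> ennreal (N\<^sup>2 * A * (q 0 * q 1 * q 2))"
  using nn_integral_abs_prod_le[of "{..<3}" Z M N A q] assms
  by (simp add: numeral_3_eq_3 numeral_2_eq_2 lessThan_empty_iff)

context anderson
begin

abbreviation "sites \<equiv> count_space X"
abbreviation "site_pairs \<equiv> count_space (X \<times> X)"

lemma kernel_eq_spec_form: "admissible V \<Longrightarrow> kernel f V x y = spec_form d V f (kron x) (kron y)"
  by (simp add: kernel_def)

lemma kernel_zero: "x \<in> X \<Longrightarrow> y \<in> X \<Longrightarrow> kernel (\<lambda>t. 0) V x y = 0"
  using kernel_cmult[OF bdd_borel_const[of 0], of x y 0 V] by simp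

lemma kernel_nonneg: "bdd_borel f \<Longrightarrow> (\<And>t. 0 \<le> f t) \<Longrightarrow> x \<in> X \<Longrightarrow> 0 \<le> kernel f V x x"
  using bounded_potential.spec_form_nonneg[OF admissibleD finsupp_kron] by (auto simp: kernel_def)

lemma kernel_Cauchy_Schwarz:
  "bdd_borel f \<Longrightarrow> (\<And>t. 0 \<le> f t) \<Longrightarrow> x \<in> X \<Longrightarrow> y \<in> X \<Longrightarrow> (kernel f V x y)\<^sup>2 \<le> kernel f V x x * kernel f V y y"
  using bounded_potential.spec_form_Cauchy_Schwarz[OF admissibleD finsupp_kron finsupp_kron]
  by (auto simp: kernel_def)

lemma
  assumes f: "bdd_borel f" and h: "bdd_borel h" and x: "x \<in> X" "y \<in> X"
  shows kernel_mult: "(\<integral>v. kernel f V x v * kernel h V v y \<partial>sites) = kernel (\<lambda>t. f t * h t) V x y"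
    and integrable_kernel_mult: "integrable sites (\<lambda>v. kernel f V x v * kernel h V v y)"
proof -
  have "(\<integral>v. kernel f V x v * kernel h V v y \<partial>sites) = kernel (\<lambda>t. f t * h t) V x y
      \<and> integrable sites (\<lambda>v. kernel f V x v * kernel h V v y)"
  proof (cases "admissible V")
    case True
    from bounded_potential.spec_form_mult[OF admissibleD[OF True] finsupp_kron[OF x(1)] finsupp_kron[OF x(2)] f h]
    show ?thesis
      by (simp add: kernel_def True infsumI infsum_eq_integral_count_space[symmetric] integrable_count_space_iff_summable)
  qed (simp add: kernel_def)
  then show "(\<integral>v. kernel f V x v * kernel h V v y \<partial>sites) = kernel (\<lambda>t. f t * h t) V x y"
    "integrable sites (\<lambda>v. kernel f V x v * kernel h V v y)" by auto
qed

lemma nn_integral_abs_kernel_mult_le: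
  assumes x: "x \<in> X" "y \<in> X" and f: "bdd_borel f" "\<And>t. \<bar>f t\<bar> \<le> c" and g: "bdd_borel g" "\<And>t. \<bar>g t\<bar> \<le> c"
  shows "(\<integral>\<^sup>+u. ennreal \<bar>kernel f V x u * kernel g V u y\<bar> \<partial>sites) \<le> ennreal (4 * c\<^sup>2)"
proof (cases "admissible V")
  case True
  interpret bounded_potential d V V_max by (rule admissibleD) fact
  let ?f = "\<lambda>u. spec_form d V f (kron x) (kron u)" and ?g = "\<lambda>u. spec_form d V g (kron u) (kron y)"
  have "(\<integral>\<^sup>+u. ennreal \<bar>?f u * ?g u\<bar> \<partial>sites) \<le> ennreal (4 * c\<^sup>2)"
  proof (rule nn_integral_count_space_le)
    fix S assume S: "finite S" "S \<subseteq> X"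
    have "(\<Sum>u\<in>S. \<bar>?f u * ?g u\<bar>) \<le> (\<Sum>u\<in>S. ((?f u)\<^sup>2 + (?g u)\<^sup>2) / 2)"
    proof (rule sum_mono)
      show "\<bar>?f u * ?g u\<bar> \<le> ((?f u)\<^sup>2 + (?g u)\<^sup>2) / 2" for u
        using sum_squares_bound[of "\<bar>?f u\<bar>" "\<bar>?g u\<bar>"] by (simp add: abs_mult)
    qed
    also have "\<dots> = ((\<Sum>u\<in>S. (?f u)\<^sup>2) + (\<Sum>u\<in>S. (?g u)\<^sup>2)) / 2"
      by (simp add: sum.distrib sum_divide_distrib[symmetric])
    also have "\<dots> \<le> (4 * c\<^sup>2 * 1 + 4 * c\<^sup>2 * 1) / 2"
      using sq_sum_leD[OF bessel[OF finsupp_kron[OF x(1)] f] S] sq_sum_leD[OF bessel_left[OF finsupp_kron[OF x(2)] g] S]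
      by (simp add: dot_kron_kron)
    finally show "(\<Sum>u\<in>S. \<bar>?f u * ?g u\<bar>) \<le> 4 * c\<^sup>2" by simp
  qed simp
  then show ?thesis by (simp add: kernel_def True)
qed (simp add: kernel_def)

end

context localized_anderson
begin

definition \<kappa> :: real where "\<kappa> = 1 / (12 * l)"

lemma kappa_pos: "0 < \<kappa>" using l by (simp add: \<kappa>_def)

definition decay :: "site \<Rightarrow> site \<Rightarrow> real" where
  "decay x y = exp (- \<kappa> * zdist d x y)"

lemma decay_nonneg: "0 \<le> decay x y"
  by (simp add: decay_def)

lemma decay_le_1: "decay x y \<le> 1"
  using kappa_pos zdist_nonneg[of d x y] by (simp add: decay_def)

lemma decay_commute: "decay x y = decay y x"
  by (simp add: decay_def zdist_commute)

lemma exp_zdist_eq_decay: "exp (- zdist d x y / (2 * l)) = decay x y ^ 6"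
  using l exp_of_nat_mult[of 6 "- \<kappa> * zdist d x y"] by (simp add: decay_def \<kappa>_def)

lemma abs_coord_diff_mult_decay_le: "\<bar>real_of_int (x 0 - y 0)\<bar> * decay x y \<le> 1 / \<kappa>"
proof -
  have "\<bar>real_of_int (x 0 - y 0)\<bar> \<le> zdist d x y" by (rule abs_coord_diff_le_zdist) (use d in simp)
  then have "\<kappa> * \<bar>real_of_int (x 0 - y 0)\<bar> \<le> \<kappa> * zdist d x y" using kappa_pos by simp
  also have "\<dots> \<le> exp (\<kappa> * zdist d x y)" using exp_ge_add_one_self[of "\<kappa> * zdist d x y"] by linarith
  finally have "\<kappa> * \<bar>real_of_int (x 0 - y 0)\<bar> * decay x y \<le> exp (\<kappa> * zdist d x y) * decay x y"
    using decay_nonneg by (rule mult_right_mono)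
  then show ?thesis using kappa_pos by (simp add: decay_def exp_minus field_simps)
qed

abbreviation "decay_sum \<equiv> lattice_sum d \<kappa>"

lemma nn_integral_decay:
  assumes "x \<in> X"
  shows "(\<integral>\<^sup>+u. ennreal (decay u x) \<partial>sites) = ennreal decay_sum"
    and "(\<integral>\<^sup>+u. ennreal (decay x u) \<partial>sites) = ennreal decay_sum"
  using nn_integral_exp_zdist[OF kappa_pos d assms] unfolding decay_commute[of x] by (simp_all add: decay_def)

definition mean_decay :: "(real \<Rightarrow> real) \<Rightarrow> bool" where
  "mean_decay f \<longleftrightarrow> bdd_borel f \<and> (\<exists>A\<ge>0. \<forall>x\<in>X. \<forall>y\<in>X. E_abs (\<lambda>V. kernel f V x y) \<le> ennreal (A * decay x y ^ 6))"

lemma mean_decayI: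
  assumes "bdd_borel f" "0 \<le> A" "\<And>x y. x \<in> X \<Longrightarrow> y \<in> X \<Longrightarrow> E_abs (\<lambda>V. kernel f V x y) \<le> ennreal (A * decay x y ^ 6)"
  shows "mean_decay f"
  using assms unfolding mean_decay_def by blast

lemma mean_decayD: "mean_decay f \<Longrightarrow> bdd_borel f" by (simp add: mean_decay_def)

lemma mean_decayE:
  assumes "mean_decay f"
  obtains A where "0 \<le> A" "\<And>x y. x \<in> X \<Longrightarrow> y \<in> X \<Longrightarrow> E_abs (\<lambda>V. kernel f V x y) \<le> ennreal (A * decay x y ^ 6)"
  using assms unfolding mean_decay_def by blast

lemma E_abs_linear_le:
  assumes [measurable]: "F \<in> borel_measurable \<Omega>" "G \<in> borel_measurable \<Omega>"
    and F: "E_abs F \<le> ennreal A" and G: "E_abs G \<le> ennreal B" and AB: "0 \<le> A" "0 \<le> B"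
  shows "E_abs (\<lambda>V. \<alpha> * F V + \<beta> * G V) \<le> ennreal (\<bar>\<alpha>\<bar> * A + \<bar>\<beta>\<bar> * B)"
proof -
  have "\<bar>\<alpha> * F V + \<beta> * G V\<bar> \<le> \<bar>\<alpha>\<bar> * \<bar>F V\<bar> + \<bar>\<beta>\<bar> * \<bar>G V\<bar>" for V
    using abs_triangle_ineq[of "\<alpha> * F V" "\<beta> * G V"] by (simp add: abs_mult)
  then have "E_abs (\<lambda>V. \<alpha> * F V + \<beta> * G V) \<le> (\<integral>\<^sup>+V. ennreal \<bar>\<alpha>\<bar> * ennreal \<bar>F V\<bar> + ennreal \<bar>\<beta>\<bar> * ennreal \<bar>G V\<bar> \<partial>\<Omega>)"
    by (intro nn_integral_mono) (simp add: ennreal_plus[symmetric] ennreal_mult[symmetric] ennreal_leI del: ennreal_plus)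
  also have "\<dots> = ennreal \<bar>\<alpha>\<bar> * E_abs F + ennreal \<bar>\<beta>\<bar> * E_abs G"
    by (simp add: nn_integral_add nn_integral_cmult)
  also have "\<dots> \<le> ennreal \<bar>\<alpha>\<bar> * ennreal A + ennreal \<bar>\<beta>\<bar> * ennreal B"
    by (intro add_mono mult_left_mono F G) auto
  also have "\<dots> = ennreal (\<bar>\<alpha>\<bar> * A + \<bar>\<beta>\<bar> * B)" using AB by (simp add: ennreal_mult)
  finally show ?thesis .
qed

lemma E_abs_coord_mult_le:
  assumes F: "F \<in> borel_measurable \<Omega>" and le: "E_abs F \<le> ennreal (decay x y * B)" and B: "0 \<le> B"
  shows "E_abs (\<lambda>V. real_of_int (x 0 - y 0) * F V) \<le> ennreal (1 / \<kappa> * B)"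
proof -
  have "E_abs (\<lambda>V. real_of_int (x 0 - y 0) * F V) = ennreal \<bar>real_of_int (x 0 - y 0)\<bar> * E_abs F"
    unfolding abs_mult using F by (subst nn_integral_cmult[symmetric]) (auto simp: ennreal_mult)
  also have "\<dots> \<le> ennreal \<bar>real_of_int (x 0 - y 0)\<bar> * ennreal (decay x y * B)"
    by (intro mult_left_mono le) simp
  also have "\<dots> = ennreal ((\<bar>real_of_int (x 0 - y 0)\<bar> * decay x y) * B)"
    using B by (simp add: ennreal_mult[symmetric] decay_nonneg mult.assoc)
  also have "\<dots> \<le> ennreal (1 / \<kappa> * B)"
    by (intro ennreal_leI mult_right_mono abs_coord_diff_mult_decay_le B)
  finally show ?thesis .
qed

lemma mean_decay_linear:
  assumes f: "mean_decay f" and g: "mean_decay g"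
  shows "mean_decay (\<lambda>t. \<alpha> * f t + \<beta> * g t)"
proof -
  obtain A where A: "0 \<le> A" "\<And>x y. x \<in> X \<Longrightarrow> y \<in> X \<Longrightarrow> E_abs (\<lambda>V. kernel f V x y) \<le> ennreal (A * decay x y ^ 6)"
    using mean_decayE[OF f] by blast
  obtain B where B: "0 \<le> B" "\<And>x y. x \<in> X \<Longrightarrow> y \<in> X \<Longrightarrow> E_abs (\<lambda>V. kernel g V x y) \<le> ennreal (B * decay x y ^ 6)"
    using mean_decayE[OF g] by blast
  note bf = mean_decayD[OF f] and bg = mean_decayD[OF g]
  show ?thesis
  proof (rule mean_decayI[of _ "\<bar>\<alpha>\<bar> * A + \<bar>\<beta>\<bar> * B"])
    fix x y assume x: "x \<in> X" "y \<in> X"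
    have "kernel (\<lambda>t. \<alpha> * f t + \<beta> * g t) V x y = \<alpha> * kernel f V x y + \<beta> * kernel g V x y" for V
      by (simp add: kernel_add bdd_borel_cmult bf bg kernel_cmult x)
    then show "E_abs (\<lambda>V. kernel (\<lambda>t. \<alpha> * f t + \<beta> * g t) V x y) \<le> ennreal ((\<bar>\<alpha>\<bar> * A + \<bar>\<beta>\<bar> * B) * decay x y ^ 6)"
      using E_abs_linear_le[OF measurable_kernel[OF bf x] measurable_kernel[OF bg x] A(2)[OF x] B(2)[OF x], of \<alpha> \<beta>] A(1) B(1)
      by (simp add: decay_nonneg algebra_simps)
  qed (use A(1) B(1) in \<open>auto intro!: bdd_borel_add bdd_borel_cmult bf bg\<close>)
qed

lemma mean_decay_sum: "(\<And>i. i \<in> I \<Longrightarrow> mean_decay (f i)) \<Longrightarrow> mean_decay (\<lambda>t. \<Sum>i\<in>I. c i * f i t)"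
proof (induction I rule: infinite_finite_induct)
  case (insert i I)
  then show ?case using mean_decay_linear[of "f i" "\<lambda>t. \<Sum>i\<in>I. c i * f i t" "c i" 1] by simp
qed (auto intro!: mean_decayI[of _ 0] simp: bdd_borel_const kernel_zero)

lemma mean_decay_cut_pow: "mean_decay (cut_power n)"
proof (rule mean_decayI[of _ "spec_bound ^ n * exp (\<kappa> * real n) ^ 6"])
  fix x y assume x: "x \<in> X" "y \<in> X"
  have "\<bar>kernel (cut_power n) V x y\<bar> \<le> spec_bound ^ n * exp (\<kappa> * real n) ^ 6 * decay x y ^ 6" for V
  proof (cases "admissible V \<and> zdist d x y \<le> real n")
    case True
    have "\<bar>kernel (cut_power n) V x y\<bar> \<le> spec_bound ^ n * 1"
      by (rule abs_kernel_le[OF bdd_borel_cut_pow _ _ x])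
        (use spec_bound_pos in \<open>auto simp: cut_pow_def power_abs intro!: power_mono\<close>)
    also have "\<dots> \<le> spec_bound ^ n * (exp (\<kappa> * real n) * decay x y) ^ 6"
      using True spec_bound_pos kappa_pos by (intro mult_left_mono one_le_power) (auto simp: decay_def exp_add[symmetric])
    finally show ?thesis by (simp add: power_mult_distrib mult.assoc)
  next
    case False
    then have "kernel (cut_power n) V x y = 0"
      using kernel_cut_pow[OF _ x, of V n] Hop_real_power_range[of n d V y x] by (cases "admissible V") (auto simp: kernel_def)
    then show ?thesis using spec_bound_pos by (simp add: decay_nonneg)
  qed
  then have "E_abs (\<lambda>V. kernel (cut_power n) V x y)
      \<le> (\<integral>\<^sup>+V. ennreal (spec_bound ^ n * exp (\<kappa> * real n) ^ 6 * decay x y ^ 6) \<partial>\<Omega>)"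
    by (intro nn_integral_mono ennreal_leI)
  then show "E_abs (\<lambda>V. kernel (cut_power n) V x y) \<le> ennreal (spec_bound ^ n * exp (\<kappa> * real n) ^ 6 * decay x y ^ 6)"
    by (simp add: P.emeasure_space_1)
qed (use spec_bound_pos bdd_borel_cut_pow in auto)

definition decay_const :: real where
  "decay_const = (SOME A. 1 \<le> A \<and> (\<forall>E\<in>{a<..<b}. \<forall>x\<in>X. \<forall>y\<in>X.
     E_abs (\<lambda>V. kernel (indicator {..E}) V x y) \<le> ennreal (A * decay x y ^ 6)))"

lemma
  shows decay_const_ge_1: "1 \<le> decay_const"
    and E_abs_kernel_atMost_le: "E \<in> {a<..<b} \<Longrightarrow> x \<in> X \<Longrightarrow> y \<in> X \<Longrightarrow>
      E_abs (\<lambda>V. kernel (indicator {..E}) V x y) \<le> ennreal (decay_const * decay x y ^ 6)"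
proof -
  have "1 \<le> decay_const \<and> (\<forall>E\<in>{a<..<b}. \<forall>x\<in>X. \<forall>y\<in>X.
     E_abs (\<lambda>V. kernel (indicator {..E}) V x y) \<le> ennreal (decay_const * decay x y ^ 6))"
    unfolding decay_const_def by (rule someI_ex) (rule fermi_projection_decay[unfolded exp_zdist_eq_decay])
  then show "1 \<le> decay_const" "E \<in> {a<..<b} \<Longrightarrow> x \<in> X \<Longrightarrow> y \<in> X \<Longrightarrow>
      E_abs (\<lambda>V. kernel (indicator {..E}) V x y) \<le> ennreal (decay_const * decay x y ^ 6)" by auto
qed

lemma mean_decay_atMost: "E \<in> {a<..<b} \<Longrightarrow> mean_decay (indicator {..E})"
  using decay_const_ge_1 by (intro mean_decayI[of _ decay_const] bdd_borel_atMost E_abs_kernel_atMost_le) auto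

end

section \<open>The velocity kernel\<close>

locale fermi_level = localized_anderson +
  fixes EF :: real
  assumes EF: "a < EF" "EF < b"
begin

abbreviation "origin \<equiv> (\<lambda>_. 0) :: site"

definition fermi_kernel :: "(site \<Rightarrow> real) \<Rightarrow> site \<Rightarrow> site \<Rightarrow> real" where
  "fermi_kernel = kernel (indicator {..EF})"

definition velocity :: "(site \<Rightarrow> real) \<Rightarrow> site \<Rightarrow> site \<Rightarrow> real" where
  "velocity V x y = real_of_int (x 0 - y 0) * fermi_kernel V x y"

lemma EF_in: "EF \<in> {a<..<b}" using EF by simp

lemma measurable_fermi_kernel: "x \<in> X \<Longrightarrow> y \<in> X \<Longrightarrow> (\<lambda>V. fermi_kernel V x y) \<in> borel_measurable \<Omega>"
  unfolding fermi_kernel_def by (rule measurable_kernel[OF bdd_borel_atMost])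

lemma measurable_velocity: "x \<in> X \<Longrightarrow> y \<in> X \<Longrightarrow> (\<lambda>V. velocity V x y) \<in> borel_measurable \<Omega>"
  unfolding velocity_def using measurable_fermi_kernel by measurable

lemma abs_fermi_kernel_le: "x \<in> X \<Longrightarrow> y \<in> X \<Longrightarrow> \<bar>fermi_kernel V x y\<bar> \<le> 1"
  unfolding fermi_kernel_def by (rule abs_kernel_atMost_le)

lemma E_abs_fermi_kernel_le:
  "x \<in> X \<Longrightarrow> y \<in> X \<Longrightarrow> E_abs (\<lambda>V. fermi_kernel V x y) \<le> ennreal (decay_const * decay x y ^ 6)"
  unfolding fermi_kernel_def by (rule E_abs_kernel_atMost_le[OF EF_in])

lemma E_abs_fermi_kernel_fermi_le:
  assumes f: "mean_decay f"
  obtains A where "0 \<le> A" "\<And>x y u v z w. x \<in> X \<Longrightarrow> y \<in> X \<Longrightarrow> u \<in> X \<Longrightarrow> v \<in> X \<Longrightarrow> z \<in> X \<Longrightarrow> w \<in> X \<Longrightarrow>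
     E_abs (\<lambda>V. fermi_kernel V x y * kernel f V u v * fermi_kernel V z w)
       \<le> ennreal (A * ((decay x y)\<^sup>2 * (decay u v)\<^sup>2 * (decay z w)\<^sup>2))"
proof -
  note bf = mean_decayD[OF f]
  obtain A where A: "0 \<le> A" "\<And>x y. x \<in> X \<Longrightarrow> y \<in> X \<Longrightarrow> E_abs (\<lambda>V. kernel f V x y) \<le> ennreal (A * decay x y ^ 6)"
    using mean_decayE[OF f] by blast
  obtain M where M: "0 \<le> M" "\<And>t. \<bar>f t\<bar> \<le> M" using bdd_borelE[OF bf] by metis
  define B where "B = max A decay_const"
  have B: "0 \<le> B" using A by (simp add: B_def)
  have le_B: "ennreal (A * decay x y ^ 6) \<le> ennreal (B * decay x y ^ 6)"
    "ennreal (decay_const * decay x y ^ 6) \<le> ennreal (B * decay x y ^ 6)" for x y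
    by (auto intro!: ennreal_leI mult_right_mono simp: B_def decay_nonneg)
  show thesis
  proof (rule that[of "(max M 1)\<^sup>2 * B"])
    fix x y u v z w assume h: "x \<in> X" "y \<in> X" "u \<in> X" "v \<in> X" "z \<in> X" "w \<in> X"
    define Z where "Z = nth [\<lambda>V. fermi_kernel V x y, \<lambda>V. kernel f V u v, \<lambda>V. fermi_kernel V z w]"
    define q where "q = nth [(decay x y)\<^sup>2, (decay u v)\<^sup>2, (decay z w)\<^sup>2]"
    have i3: "i = 0 \<or> i = 1 \<or> i = 2" if "i < 3" for i :: nat using that by auto
    have "E_abs (\<lambda>V. Z 0 V * Z 1 V * Z 2 V) \<le> ennreal ((max M 1)\<^sup>2 * B * (q 0 * q 1 * q 2))"
    proof (rule nn_integral_abs_mult3_le)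
      fix i :: nat assume "i < 3"
      then show "Z i \<in> borel_measurable \<Omega>" "0 \<le> q i"
        using i3[of i] measurable_fermi_kernel h measurable_kernel[OF bf] by (auto simp: Z_def q_def)
      show "\<bar>Z i V\<bar> \<le> max M 1" for V
        using i3[OF \<open>i < 3\<close>] abs_fermi_kernel_le[of _ _ V] h abs_kernel_le[OF bf M(2,1) h(3,4), of V]
        by (auto simp: Z_def le_max_iff_disj)
      show "E_abs (Z i) \<le> ennreal (B * q i ^ 3)"
        using i3[OF \<open>i < 3\<close>] order_trans[OF A(2)[OF h(3,4)] le_B(1)]
          order_trans[OF E_abs_fermi_kernel_le[OF h(1,2)] le_B(2)] order_trans[OF E_abs_fermi_kernel_le[OF h(5,6)] le_B(2)]
        by (auto simp: Z_def q_def power_mult[symmetric])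
    qed (rule B)
    then show "E_abs (\<lambda>V. fermi_kernel V x y * kernel f V u v * fermi_kernel V z w)
       \<le> ennreal ((max M 1)\<^sup>2 * B * ((decay x y)\<^sup>2 * (decay u v)\<^sup>2 * (decay z w)\<^sup>2))"
      by (simp add: Z_def q_def)
  qed (use B in simp)
qed

lemma E_abs_velocity_kernel_velocity_le:
  assumes f: "mean_decay f"
  obtains A where "0 \<le> A" "\<And>x y u v z w. x \<in> X \<Longrightarrow> y \<in> X \<Longrightarrow> u \<in> X \<Longrightarrow> v \<in> X \<Longrightarrow> z \<in> X \<Longrightarrow> w \<in> X \<Longrightarrow>
     E_abs (\<lambda>V. velocity V x y * kernel f V u v * velocity V z w) \<le> ennreal (A * (decay x y * (decay u v * decay z w)))"
proof -
  obtain A where A: "0 \<le> A" "\<And>x y u v z w. x \<in> X \<Longrightarrow> y \<in> X \<Longrightarrow> u \<in> X \<Longrightarrow> v \<in> X \<Longrightarrow> z \<in> X \<Longrightarrow> w \<in> X \<Longrightarrow>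
     E_abs (\<lambda>V. fermi_kernel V x y * kernel f V u v * fermi_kernel V z w)
       \<le> ennreal (A * ((decay x y)\<^sup>2 * (decay u v)\<^sup>2 * (decay z w)\<^sup>2))"
    using E_abs_fermi_kernel_fermi_le[OF f] by blast
  show thesis
  proof (rule that[of "(1/\<kappa>)\<^sup>2 * A"])
    fix x y u v z w assume h: "x \<in> X" "y \<in> X" "u \<in> X" "v \<in> X" "z \<in> X" "w \<in> X"
    let ?F = "\<lambda>V. fermi_kernel V x y * kernel f V u v * fermi_kernel V z w" and ?p = "decay x y" and ?q = "decay u v" and ?r = "decay z w"
    have meas: "?F \<in> borel_measurable \<Omega>"
      by (intro borel_measurable_times measurable_fermi_kernel measurable_kernel mean_decayD[OF f] h)
    have "E_abs ?F \<le> ennreal (?r * (A * (?p\<^sup>2 * ?q\<^sup>2 * ?r)))"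
      using A(2)[OF h] by (simp add: power2_eq_square mult_ac)
    then have "E_abs (\<lambda>V. real_of_int (z 0 - w 0) * ?F V) \<le> ennreal (1/\<kappa> * (A * (?p\<^sup>2 * ?q\<^sup>2 * ?r)))"
      by (rule E_abs_coord_mult_le[OF meas]) (use A(1) in \<open>simp add: decay_nonneg\<close>)
    also have "1/\<kappa> * (A * (?p\<^sup>2 * ?q\<^sup>2 * ?r)) = ?p * (1/\<kappa> * (A * (?p * ?q\<^sup>2 * ?r)))"
      by (simp add: power2_eq_square)
    finally have "E_abs (\<lambda>V. real_of_int (x 0 - y 0) * (real_of_int (z 0 - w 0) * ?F V)) \<le> ennreal (1/\<kappa> * (1/\<kappa> * (A * (?p * ?q\<^sup>2 * ?r))))"
      using meas A(1) kappa_pos by (intro E_abs_coord_mult_le) (auto simp: decay_nonneg)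
    also have "\<dots> \<le> ennreal (1/\<kappa> * (1/\<kappa> * (A * (?p * ?q * ?r))))"
      using power_decreasing[of 1 2 ?q] A(1) kappa_pos
      by (intro ennreal_leI mult_left_mono mult_right_mono) (auto simp: decay_nonneg decay_le_1)
    finally show "E_abs (\<lambda>V. velocity V x y * kernel f V u v * velocity V z w) \<le> ennreal ((1/\<kappa>)\<^sup>2 * A * (?p * (?q * ?r)))"
      by (simp add: velocity_def power2_eq_square mult_ac)
  qed (use A(1) in simp)
qed

abbreviation "X3 \<equiv> X \<times> X \<times> X"
abbreviation "\<Omega>3 \<equiv> count_space X3 \<Otimes>\<^sub>M \<Omega>"

lemma countable_X3: "countable X3" by (intro countable_SIGMA countable_Zd)

definition Y_pair :: "site \<times> site \<times> site \<Rightarrow> (site \<Rightarrow> real) \<Rightarrow> real" where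
  "Y_pair t V = (case t of (x, x', u) \<Rightarrow> velocity V x origin * velocity V x' u)"

lemma measurable_Y_pair: "t \<in> X3 \<Longrightarrow> Y_pair t \<in> borel_measurable \<Omega>"
  unfolding Y_pair_def[abs_def] by (auto intro!: borel_measurable_times measurable_velocity zero_Zd)

lemma nn_integral_decay_tree:
  assumes r: "\<And>x. x \<in> X \<Longrightarrow> r x \<in> X"
  shows "(\<integral>\<^sup>+x. (\<integral>\<^sup>+y. (\<integral>\<^sup>+z. ennreal (decay x origin) * (ennreal (decay (r x) y) * ennreal (decay y z))
      \<partial>sites) \<partial>sites) \<partial>sites) = ennreal (decay_sum ^ 3)"
proof -
  let ?S = "ennreal decay_sum"
  have "(\<integral>\<^sup>+y. (\<integral>\<^sup>+z. ennreal (decay x origin) * (ennreal (decay (r x) y) * ennreal (decay y z)) \<partial>sites) \<partial>sites)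
      = ennreal (decay x origin) * (?S * ?S)" if "x \<in> X" for x
  proof -
    have "(\<integral>\<^sup>+y. (\<integral>\<^sup>+z. ennreal (decay x origin) * (ennreal (decay (r x) y) * ennreal (decay y z)) \<partial>sites) \<partial>sites)
        = (\<integral>\<^sup>+y. ennreal (decay x origin) * (ennreal (decay (r x) y) * ?S) \<partial>sites)"
      by (intro nn_integral_cong) (simp add: nn_integral_cmult nn_integral_decay)
    then show ?thesis by (simp add: nn_integral_cmult nn_integral_multc nn_integral_decay r[OF that])
  qed
  then have "(\<integral>\<^sup>+x. (\<integral>\<^sup>+y. (\<integral>\<^sup>+z. ennreal (decay x origin) * (ennreal (decay (r x) y) * ennreal (decay y z))
      \<partial>sites) \<partial>sites) \<partial>sites) = (\<integral>\<^sup>+x. ennreal (decay x origin) * (?S * ?S) \<partial>sites)"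
    by (intro nn_integral_cong) simp
  also have "\<dots> = ennreal (decay_sum ^ 3)"
    by (simp add: nn_integral_multc nn_integral_decay zero_Zd power3_eq_cube ennreal_mult lattice_sum_nonneg mult.assoc)
  finally show ?thesis .
qed

lemma integrable_Y_pair_kernel:
  assumes f: "mean_decay f" and p: "\<And>t. t \<in> X3 \<Longrightarrow> p t \<in> X" and q: "\<And>t. t \<in> X3 \<Longrightarrow> q t \<in> X"
    and fin: "(\<integral>\<^sup>+t. ennreal (decay (fst t) origin) * (ennreal (decay (p t) (q t)) * ennreal (decay (fst (snd t)) (snd (snd t))))
      \<partial>count_space X3) < \<infinity>"
  shows "integrable \<Omega>3 (\<lambda>z. Y_pair (fst z) (snd z) * kernel f (snd z) (p (fst z)) (q (fst z)))"
proof (rule P.integrable_pair_count_space[OF countable_X3, where \<Psi>="\<lambda>t V. Y_pair t V * kernel f V (p t) (q t)"])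
  obtain A where A: "0 \<le> A" "\<And>x y u v z w. x \<in> X \<Longrightarrow> y \<in> X \<Longrightarrow> u \<in> X \<Longrightarrow> v \<in> X \<Longrightarrow> z \<in> X \<Longrightarrow> w \<in> X \<Longrightarrow>
     E_abs (\<lambda>V. velocity V x y * kernel f V u v * velocity V z w) \<le> ennreal (A * (decay x y * (decay u v * decay z w)))"
    using E_abs_velocity_kernel_velocity_le[OF f] by blast
  let ?e = "\<lambda>t. ennreal (decay (fst t) origin) * (ennreal (decay (p t) (q t)) * ennreal (decay (fst (snd t)) (snd (snd t))))"
  have "E_abs (\<lambda>V. Y_pair t V * kernel f V (p t) (q t)) \<le> ennreal A * ?e t" if t: "t \<in> X3" for t
  proof -
    obtain x x' u where xs: "t = (x, x', u)" "x \<in> X" "x' \<in> X" "u \<in> X" using t by auto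
    have "E_abs (\<lambda>V. Y_pair t V * kernel f V (p t) (q t))
        = E_abs (\<lambda>V. velocity V x origin * kernel f V (p t) (q t) * velocity V x' u)"
      by (simp add: Y_pair_def xs(1) mult_ac)
    also have "\<dots> \<le> ennreal (A * (decay x origin * (decay (p t) (q t) * decay x' u)))"
      by (rule A(2)[OF xs(2) zero_Zd p[OF t] q[OF t] xs(3,4)])
    finally show ?thesis using A(1) by (simp add: xs(1) ennreal_mult decay_nonneg)
  qed
  then have "(\<integral>\<^sup>+t. E_abs (\<lambda>V. Y_pair t V * kernel f V (p t) (q t)) \<partial>count_space X3) \<le> (\<integral>\<^sup>+t. ennreal A * ?e t \<partial>count_space X3)"
    by (intro nn_integral_mono) simp
  also have "\<dots> = ennreal A * (\<integral>\<^sup>+t. ?e t \<partial>count_space X3)" by (rule nn_integral_cmult) simp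
  also have "\<dots> < \<infinity>" using fin by (simp add: ennreal_mult_less_top)
  finally show "(\<integral>\<^sup>+t. E_abs (\<lambda>V. Y_pair t V * kernel f V (p t) (q t)) \<partial>count_space X3) < \<infinity>" .
qed (intro borel_measurable_times measurable_Y_pair measurable_kernel mean_decayD[OF f] p q)

lemma integrable_Y_pair_kernel_left:
  assumes "mean_decay f"
  shows "integrable \<Omega>3 (\<lambda>z. Y_pair (fst z) (snd z) * kernel f (snd z) (fst (fst z)) (fst (snd (fst z))))"
proof (rule integrable_Y_pair_kernel[OF assms])
  show "(\<integral>\<^sup>+t. ennreal (decay (fst t) origin) * (ennreal (decay (fst t) (fst (snd t))) * ennreal (decay (fst (snd t)) (snd (snd t))))
      \<partial>count_space X3) < \<infinity>"
    using nn_integral_decay_tree[of "\<lambda>x. x"] by (simp add: nn_integral_count_space_Times countable_Zd)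
qed auto

lemma integrable_Y_pair_kernel_right:
  assumes "mean_decay g"
  shows "integrable \<Omega>3 (\<lambda>z. Y_pair (fst z) (snd z) * kernel g (snd z) (snd (snd (fst z))) origin)"
proof (rule integrable_Y_pair_kernel[OF assms])
  have "(\<integral>\<^sup>+t. ennreal (decay (fst t) origin) * (ennreal (decay (snd (snd t)) origin) * ennreal (decay (fst (snd t)) (snd (snd t))))
      \<partial>count_space X3) = (\<integral>\<^sup>+x. (\<integral>\<^sup>+q. ennreal (decay x origin) * (ennreal (decay (snd q) origin) * ennreal (decay (fst q) (snd q)))
      \<partial>site_pairs) \<partial>sites)"
    by (subst nn_integral_count_space_Times) (auto simp: countable_Zd)
  also have "\<dots> = (\<integral>\<^sup>+x. (\<integral>\<^sup>+u. (\<integral>\<^sup>+x'. ennreal (decay x origin) * (ennreal (decay origin u) * ennreal (decay u x'))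
      \<partial>sites) \<partial>sites) \<partial>sites)"
    by (simp add: nn_integral_count_space_Times_swap countable_Zd decay_commute)
  also have "\<dots> < \<infinity>" using nn_integral_decay_tree[of "\<lambda>_. origin"] by (simp add: zero_Zd)
  finally show "(\<integral>\<^sup>+t. ennreal (decay (fst t) origin) * (ennreal (decay (snd (snd t)) origin) * ennreal (decay (fst (snd t)) (snd (snd t))))
      \<partial>count_space X3) < \<infinity>" .
qed (auto simp: zero_Zd)

end

context fermi_level
begin

definition Y_term :: "(real \<Rightarrow> real) \<Rightarrow> (real \<Rightarrow> real) \<Rightarrow> site \<times> site \<times> site \<Rightarrow> (site \<Rightarrow> real) \<Rightarrow> real" where
  "Y_term f g t V = Y_pair t V * (kernel f V (fst t) (fst (snd t)) * kernel g V (snd (snd t)) origin)"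

text \<open>\<open>Y_form f g\<close> stands for \<open>\<langle>\<langle>Y, f(H\<^sub>L) g(H\<^sub>R) Y\<rangle>\<rangle>\<close>.\<close>

definition Y_form :: "(real \<Rightarrow> real) \<Rightarrow> (real \<Rightarrow> real) \<Rightarrow> real" where
  "Y_form f g = (\<integral>p. Y_term f g (fst p) (snd p) \<partial>\<Omega>3)"

lemma measurable_Y_term:
  assumes "bdd_borel f" "bdd_borel g"
  shows "(\<lambda>p. Y_term f g (fst p) (snd p)) \<in> borel_measurable \<Omega>3"
proof (rule measurable_pair_measure_countable1[OF countable_X3])
  fix t assume "t \<in> X3"
  then show "(\<lambda>V. Y_term f g (fst (t, V)) (snd (t, V))) \<in> borel_measurable \<Omega>"
    unfolding Y_term_def fst_conv snd_conv
    by (intro borel_measurable_times measurable_Y_pair measurable_kernel assms zero_Zd) auto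
qed

lemma normal_functional_Y_term:
  assumes "t \<in> X3"
  shows "normal_functional (\<lambda>f. Y_term f g t V)" "normal_functional (\<lambda>g. Y_term f g t V)"
  using normal_functional_cmult[OF normal_functional_kernel[of "fst t" "fst (snd t)" V],
      of "Y_pair t V * kernel g V (snd (snd t)) origin"]
    normal_functional_cmult[OF normal_functional_kernel[of "snd (snd t)" origin V],
      of "Y_pair t V * kernel f V (fst t) (fst (snd t))"] assms zero_Zd
  by (auto simp: Y_term_def mult_ac)

lemma abs_Y_term_le:
  assumes t: "t \<in> X3"
  shows "bdd_borel f \<Longrightarrow> (\<And>s. \<bar>f s\<bar> \<le> B) \<Longrightarrow> \<bar>Y_term f g t V\<bar> \<le> B * \<bar>Y_pair t V * kernel g V (snd (snd t)) origin\<bar>"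
    and "bdd_borel g \<Longrightarrow> (\<And>s. \<bar>g s\<bar> \<le> B) \<Longrightarrow> \<bar>Y_term f g t V\<bar> \<le> B * \<bar>Y_pair t V * kernel f V (fst t) (fst (snd t))\<bar>"
proof -
  have B0: "0 \<le> B" if "\<And>s. \<bar>h s\<bar> \<le> B" for h :: "real \<Rightarrow> real" using that[of 0] by linarith
  { assume f: "bdd_borel f" "\<And>s. \<bar>f s\<bar> \<le> B"
    have "\<bar>kernel f V (fst t) (fst (snd t))\<bar> \<le> B" by (rule abs_kernel_le[OF f B0[OF f(2)]]) (use t in auto)
    then have "\<bar>kernel f V (fst t) (fst (snd t))\<bar> * \<bar>Y_pair t V * kernel g V (snd (snd t)) origin\<bar>
        \<le> B * \<bar>Y_pair t V * kernel g V (snd (snd t)) origin\<bar>"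
      by (rule mult_right_mono) simp
    then show "\<bar>Y_term f g t V\<bar> \<le> B * \<bar>Y_pair t V * kernel g V (snd (snd t)) origin\<bar>"
      by (simp add: Y_term_def abs_mult mult_ac) }
  { assume g: "bdd_borel g" "\<And>s. \<bar>g s\<bar> \<le> B"
    have "\<bar>kernel g V (snd (snd t)) origin\<bar> \<le> B" by (rule abs_kernel_le[OF g B0[OF g(2)] _ zero_Zd]) (use t in auto)
    then have "\<bar>kernel g V (snd (snd t)) origin\<bar> * \<bar>Y_pair t V * kernel f V (fst t) (fst (snd t))\<bar>
        \<le> B * \<bar>Y_pair t V * kernel f V (fst t) (fst (snd t))\<bar>"
      by (rule mult_right_mono) simp
    then show "\<bar>Y_term f g t V\<bar> \<le> B * \<bar>Y_pair t V * kernel f V (fst t) (fst (snd t))\<bar>"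
      by (simp add: Y_term_def abs_mult mult_ac) }
qed

lemma
  assumes f: "mean_decay f"
  shows integrable_Y_term: "bdd_borel g \<Longrightarrow> integrable \<Omega>3 (\<lambda>p. Y_term f g (fst p) (snd p))"
    and normal_functional_Y_form_right: "normal_functional (Y_form f)"
proof -
  let ?W = "\<lambda>p. \<bar>Y_pair (fst p) (snd p) * kernel f (snd p) (fst (fst p)) (fst (snd (fst p)))\<bar>"
  have W: "integrable \<Omega>3 ?W" by (rule integrable_abs[OF integrable_Y_pair_kernel_left[OF f]])
  have A: "normal_functional (\<lambda>g. Y_term f g (fst p) (snd p))" if "p \<in> space \<Omega>3" for p
    using that by (intro normal_functional_Y_term) (auto simp: space_pair_measure)
  note meas = measurable_Y_term[OF mean_decayD[OF f]]
  have dom: "\<bar>Y_term f g (fst p) (snd p)\<bar> \<le> B * ?W p"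
    if "bdd_borel g" "\<And>t. \<bar>g t\<bar> \<le> B" "p \<in> space \<Omega>3" for g B p
    using abs_Y_term_le(2)[of "fst p" g B f "snd p"] that by (auto simp: space_pair_measure)
  show "bdd_borel g \<Longrightarrow> integrable \<Omega>3 (\<lambda>p. Y_term f g (fst p) (snd p))"
    by (rule integrable_normal_functional[where A="\<lambda>g p. Y_term f g (fst p) (snd p)", OF A meas W dom])
  show "normal_functional (Y_form f)"
    unfolding Y_form_def[abs_def]
    by (rule normal_functional_integral_dominated[where A="\<lambda>g p. Y_term f g (fst p) (snd p)", OF A meas W dom])
qed

lemma normal_functional_Y_form_left:
  assumes g: "mean_decay g" shows "normal_functional (\<lambda>f. Y_form f g)"
  unfolding Y_form_def
proof (rule normal_functional_integral_dominated)
  let ?W = "\<lambda>p. \<bar>Y_pair (fst p) (snd p) * kernel g (snd p) (snd (snd (fst p))) origin\<bar>"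
  show "integrable \<Omega>3 ?W" by (rule integrable_abs[OF integrable_Y_pair_kernel_right[OF g]])
  fix p assume "p \<in> space \<Omega>3"
  then have p: "fst p \<in> X3" by (auto simp: space_pair_measure)
  show "normal_functional (\<lambda>f. Y_term f g (fst p) (snd p))" by (rule normal_functional_Y_term(1)[OF p])
  show "\<bar>Y_term f g (fst p) (snd p)\<bar> \<le> B * ?W p" if "bdd_borel f" "\<And>t. \<bar>f t\<bar> \<le> B" for f B
    by (rule abs_Y_term_le(1)[OF p that])
qed (intro measurable_Y_term mean_decayD[OF g])

definition raw_velocity :: "(site \<Rightarrow> real) \<Rightarrow> site \<Rightarrow> site \<Rightarrow> real" where
  "raw_velocity V x y = real_of_int (x 0 - y 0) * spec_form d V (indicator {..EF}) (kron x) (kron y)"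

definition velocity_power :: "nat \<Rightarrow> (site \<Rightarrow> real) \<Rightarrow> site \<Rightarrow> real" where
  "velocity_power n V x = (\<Sum>u\<in>box d n. (Hop_real d V ^^ n) (kron origin) u * raw_velocity V x u)"

lemma raw_velocity_eq: "admissible V \<Longrightarrow> raw_velocity V x y = velocity V x y"
  by (simp add: raw_velocity_def velocity_def fermi_kernel_def kernel_eq_spec_form)

lemma measurable_raw_velocity: "x \<in> X \<Longrightarrow> y \<in> X \<Longrightarrow> (\<lambda>V. raw_velocity V x y) \<in> borel_measurable \<Omega>"
  unfolding raw_velocity_def by (intro borel_measurable_times measurable_spec_form bdd_borel_atMost) auto

lemma measurable_Hop_real_power_velocity_power:
  "x \<in> X \<Longrightarrow> (\<lambda>V. (Hop_real d V ^^ m) (velocity_power n V) x) \<in> borel_measurable \<Omega>"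
proof (induction m arbitrary: x)
  case 0
  then show ?case unfolding velocity_power_def funpow_0
    using box_subset_Zd[of d n] by (intro borel_measurable_sum borel_measurable_times measurable_Hop_real_power measurable_raw_velocity) auto
next
  case (Suc m)
  have [measurable]: "(\<lambda>V. (Hop_real d V ^^ m) (velocity_power n V) y) \<in> borel_measurable \<Omega>" if "y \<in> nbrs d x" for y
    using nbrs_Zd[OF Suc.prems] that by (intro Suc.IH) auto
  note [measurable] = Suc.IH[OF Suc.prems] measurable_site[OF Suc.prems]
  show ?case unfolding funpow.simps o_apply Hop_real_def[where x=x] by measurable
qed

lemma Yapply_eq:
  "Yapply d V EF n (\<lambda>x. complex_of_real (v x)) = (\<lambda>x. \<i> * complex_of_real (\<Sum>u\<in>box d n. v u * raw_velocity V x u))"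
  by (auto simp: Yapply_def raw_velocity_def fermiP_eq_spec_form fun_eq_iff sum_distrib_left mult_ac intro!: sum.cong)

lemma Ymoment_integrand:
  "innerZ d (Yapply d V EF 0 (delta origin)) ((Hop d V ^^ m) (Yapply d V EF n ((Hop d V ^^ n) (delta origin))))
    = complex_of_real (\<integral>x. raw_velocity V x origin * (Hop_real d V ^^ m) (velocity_power n V) x \<partial>sites)"
proof -
  have left: "Yapply d V EF 0 (delta origin) = (\<lambda>x. \<i> * complex_of_real (raw_velocity V x origin))"
    unfolding delta_eq_kron Yapply_eq box_0 by (simp add: kron_def)
  have right: "(Hop d V ^^ m) (Yapply d V EF n ((Hop d V ^^ n) (delta origin)))
      = (\<lambda>x. \<i> * complex_of_real ((Hop_real d V ^^ m) (velocity_power n V) x))"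
    unfolding delta_eq_kron Hop_power_of_real Yapply_eq velocity_power_def[symmetric] Hop_power_cmult ..
  have cnj: "cnj (\<i> * complex_of_real a) * (\<i> * complex_of_real b) = complex_of_real (a * b)" for a b
    by (simp add: complex_eq_iff)
  show ?thesis unfolding left right innerZ_def cnj infsum_complex_of_real infsum_eq_integral_count_space ..
qed

lemma velocity_power_eq_integral:
  assumes V: "admissible V" and x: "x \<in> X"
  shows "velocity_power n V x = (\<integral>u. velocity V x u * kernel (cut_power n) V u origin \<partial>sites)"
proof -
  have "(\<integral>u. velocity V x u * kernel (cut_power n) V u origin \<partial>sites)
      = (\<Sum>u\<in>box d n. velocity V x u * kernel (cut_power n) V u origin)"
    by (rule integral_count_space_finite_support[OF finite_box box_subset_Zd])
      (use Hop_real_power_range_box[of _ d n V] kernel_cut_pow[OF V _ zero_Zd] in fastforce)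
  also have "\<dots> = velocity_power n V x" unfolding velocity_power_def
    by (intro sum.cong refl) (use box_subset_Zd[of d n] kernel_cut_pow[OF V _ zero_Zd] in \<open>auto simp: raw_velocity_eq[OF V]\<close>)
  finally show ?thesis by simp
qed

lemma Hop_real_power_eq_integral:
  assumes V: "admissible V" and x: "x \<in> X"
  shows "(Hop_real d V ^^ m) w x = (\<integral>y. kernel (cut_power m) V x y * w y \<partial>sites)"
proof -
  let ?S = "supp ((Hop_real d V ^^ m) (kron x))"
  have fin: "finsupp d ((Hop_real d V ^^ m) (kron x))" by (intro finsupp_Hop_real_power finsupp_kron x)
  have k: "kernel (cut_power m) V x y = (Hop_real d V ^^ m) (kron x) y" if "y \<in> X" for y
    using kernel_cut_pow[OF V that x] kernel_sym[OF bdd_borel_cut_pow x that] by simp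
  have "(\<integral>y. kernel (cut_power m) V x y * w y \<partial>sites) = (\<Sum>y\<in>?S. kernel (cut_power m) V x y * w y)"
    by (rule integral_count_space_finite_support) (use fin k in \<open>auto simp: finsupp_def supp_def\<close>)
  also have "\<dots> = dot ((Hop_real d V ^^ m) (kron x)) w"
    unfolding dot_def by (intro sum.cong refl) (use fin k in \<open>auto simp: finsupp_def\<close>)
  also have "\<dots> = (Hop_real d V ^^ m) w x"
    by (simp add: dot_Hop_real_power_sym_left_finsupp[OF finsupp_kron[OF x]] dot_kron_left)
  finally show ?thesis by simp
qed

lemma integral_Y_term_cut_pow:
  fixes m n
  defines "\<Psi> \<equiv> Y_term (cut_power m) (cut_power n)"
  assumes V: "admissible V" and i: "integrable (count_space X3) (\<lambda>t. \<Psi> t V)"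
  shows "(\<integral>t. \<Psi> t V \<partial>count_space X3)
    = (\<integral>x. raw_velocity V x origin * (Hop_real d V ^^ m) (velocity_power n V) x \<partial>sites)"
proof -
  have cXX: "countable (X \<times> X)" by (intro countable_SIGMA countable_Zd)
  have "(\<integral>t. \<Psi> t V \<partial>count_space X3) = (\<integral>x. (\<integral>q. \<Psi> (x, q) V \<partial>site_pairs) \<partial>sites)"
    by (rule integral_count_space_Times[OF countable_Zd cXX i])
  also have "\<dots> = (\<integral>x. (\<integral>x'. (\<integral>u. \<Psi> (x, x', u) V \<partial>sites) \<partial>sites) \<partial>sites)"
    by (intro Bochner_Integration.integral_cong refl integral_count_space_Times[OF countable_Zd countable_Zd]
        integrable_count_space_section[OF i]) simp
  also have "\<dots> = (\<integral>x. raw_velocity V x origin * (Hop_real d V ^^ m) (velocity_power n V) x \<partial>sites)"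
  proof (intro Bochner_Integration.integral_cong refl)
    fix x assume "x \<in> space sites" then have x: "x \<in> X" by simp
    have "(\<integral>u. \<Psi> (x, x', u) V \<partial>sites)
        = velocity V x origin * (kernel (cut_power m) V x x' * velocity_power n V x')" if "x' \<in> X" for x'
    proof -
      have "(\<integral>u. \<Psi> (x, x', u) V \<partial>sites) = (\<integral>u. velocity V x origin * kernel (cut_power m) V x x' *
          (velocity V x' u * kernel (cut_power n) V u origin) \<partial>sites)"
        by (simp add: \<Psi>_def Y_term_def Y_pair_def mult_ac)
      then show ?thesis by (simp add: velocity_power_eq_integral[OF V that] mult.assoc)
    qed
    then have "(\<integral>x'. (\<integral>u. \<Psi> (x, x', u) V \<partial>sites) \<partial>sites)
        = (\<integral>x'. velocity V x origin * (kernel (cut_power m) V x x' * velocity_power n V x') \<partial>sites)"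
      by (intro Bochner_Integration.integral_cong) auto
    then show "(\<integral>x'. (\<integral>u. \<Psi> (x, x', u) V \<partial>sites) \<partial>sites)
        = raw_velocity V x origin * (Hop_real d V ^^ m) (velocity_power n V) x"
      by (simp add: Hop_real_power_eq_integral[OF V x] raw_velocity_eq[OF V])
  qed
  finally show ?thesis .
qed

lemma measurable_Ymoment_integrand:
  "(\<lambda>V. \<integral>x. raw_velocity V x origin * (Hop_real d V ^^ m) (velocity_power n V) x \<partial>sites) \<in> borel_measurable \<Omega>"
  by (intro P.measurable_integral_count_space countable_Zd borel_measurable_times
      measurable_raw_velocity measurable_Hop_real_power_velocity_power zero_Zd)

lemma Ymoment_eq_Y_form:
  "Ymoment d \<rho> EF m n = complex_of_real (Y_form (cut_power m) (cut_power n))"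
proof -
  define \<Psi> where "\<Psi> = Y_term (cut_power m) (cut_power n)"
  let ?I = "\<lambda>V. \<integral>x. raw_velocity V x origin * (Hop_real d V ^^ m) (velocity_power n V) x \<partial>sites"
  have i: "integrable \<Omega>3 (\<lambda>p. \<Psi> (fst p) (snd p))"
    unfolding \<Psi>_def by (rule integrable_Y_term[OF mean_decay_cut_pow bdd_borel_cut_pow])
  have "Ymoment d \<rho> EF m n = complex_of_real (\<integral>V. ?I V \<partial>\<Omega>)"
    unfolding Ymoment_def Ymoment_integrand by simp
  also have "(\<integral>V. ?I V \<partial>\<Omega>) = (\<integral>V. (\<integral>t. \<Psi> t V \<partial>count_space X3) \<partial>\<Omega>)"
  proof (rule integral_cong_AE[OF measurable_Ymoment_integrand
        borel_measurable_integrable[OF P.integrable_pair_count_space_snd[OF countable_X3 i]]])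
    show "AE V in \<Omega>. ?I V = (\<integral>t. \<Psi> t V \<partial>count_space X3)"
      using P.AE_integrable_count_space[OF countable_X3 i] AE_admissible
      by eventually_elim (simp add: integral_Y_term_cut_pow \<Psi>_def)
  qed
  also have "\<dots> = Y_form (cut_power m) (cut_power n)"
    unfolding Y_form_def using P.integral_pair_count_space_snd[OF countable_X3 i] by (simp add: \<Psi>_def)
  finally show ?thesis .
qed

end

section \<open>Translation invariance and the trace formula\<close>

lemma (in sigma_finite_measure)
  fixes F G :: "'c \<Rightarrow> 'a \<Rightarrow> real"
  assumes A: "countable A" and \<sigma>: "bij_betw \<sigma> A A"
    and T: "\<And>t. t \<in> A \<Longrightarrow> T t \<in> measurable M M" "\<And>t. t \<in> A \<Longrightarrow> distr M M (T t) = M"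
    and F: "\<And>t. t \<in> A \<Longrightarrow> F t \<in> borel_measurable M" and G: "\<And>t. t \<in> A \<Longrightarrow> G t \<in> borel_measurable M"
    and eq: "\<And>t x. t \<in> A \<Longrightarrow> F t (T t x) = G (\<sigma> t) x"
    and i: "integrable (count_space A \<Otimes>\<^sub>M M) (\<lambda>p. F (fst p) (snd p))"
  shows integrable_count_space_reindex: "integrable (count_space A \<Otimes>\<^sub>M M) (\<lambda>p. G (fst p) (snd p))"
    and integral_count_space_reindex:
      "(\<integral>p. G (fst p) (snd p) \<partial>(count_space A \<Otimes>\<^sub>M M)) = (\<integral>p. F (fst p) (snd p) \<partial>(count_space A \<Otimes>\<^sub>M M))"
proof -
  have nn: "(\<integral>\<^sup>+x. ennreal \<bar>G (\<sigma> t) x\<bar> \<partial>M) = (\<integral>\<^sup>+x. ennreal \<bar>F t x\<bar> \<partial>M)" if t: "t \<in> A" for t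
  proof -
    have "(\<integral>\<^sup>+x. ennreal \<bar>F t (T t x)\<bar> \<partial>M) = (\<integral>\<^sup>+x. ennreal \<bar>F t x\<bar> \<partial>distr M M (T t))"
      by (rule nn_integral_distr[symmetric, OF T(1)[OF t]]) (use F[OF t] in simp)
    then show ?thesis by (simp add: T(2) eq t)
  qed
  have int: "(\<integral>x. G (\<sigma> t) x \<partial>M) = (\<integral>x. F t x \<partial>M)" if t: "t \<in> A" for t
    using integral_distr[OF T(1)[OF t] F[OF t]] by (simp add: T(2) eq t)
  have "(\<integral>\<^sup>+t. (\<integral>\<^sup>+x. ennreal \<bar>G t x\<bar> \<partial>M) \<partial>count_space A) = (\<integral>\<^sup>+t. (\<integral>\<^sup>+x. ennreal \<bar>G (\<sigma> t) x\<bar> \<partial>M) \<partial>count_space A)"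
    by (rule nn_integral_bij_count_space[OF \<sigma>, symmetric])
  also have "\<dots> = (\<integral>\<^sup>+t. (\<integral>\<^sup>+x. ennreal \<bar>F t x\<bar> \<partial>M) \<partial>count_space A)" by (intro nn_integral_cong nn) simp
  also have "\<dots> < \<infinity>"
    using i nn_integral_pair_count_space[where \<Psi>=F, OF A F] by (simp add: integrable_iff_bounded)
  finally have "(\<integral>\<^sup>+t. (\<integral>\<^sup>+x. ennreal \<bar>G t x\<bar> \<partial>M) \<partial>count_space A) < \<infinity>" .
  from A G this show iG: "integrable (count_space A \<Otimes>\<^sub>M M) (\<lambda>p. G (fst p) (snd p))"
    by (rule integrable_pair_count_space)
  have "(\<integral>p. G (fst p) (snd p) \<partial>(count_space A \<Otimes>\<^sub>M M)) = (\<integral>t. (\<integral>x. G (\<sigma> t) x \<partial>M) \<partial>count_space A)"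
    unfolding integral_pair_count_space_fst[OF A iG] by (rule integral_bij_count_space[OF \<sigma>, symmetric])
  also have "\<dots> = (\<integral>p. F (fst p) (snd p) \<partial>(count_space A \<Otimes>\<^sub>M M))"
    unfolding integral_pair_count_space_fst[OF A i] by (intro Bochner_Integration.integral_cong refl int) simp
  finally show "(\<integral>p. G (fst p) (snd p) \<partial>(count_space A \<Otimes>\<^sub>M M)) = (\<integral>p. F (fst p) (snd p) \<partial>(count_space A \<Otimes>\<^sub>M M))" .
qed

context fermi_level
begin

lemma admissible_shift_potential: "c \<in> X \<Longrightarrow> admissible (shift_potential d c V) \<longleftrightarrow> admissible V"
proof
  assume c: "c \<in> X" and adm: "admissible (shift_potential d c V)"
  show "admissible V" unfolding admissible_def
  proof
    fix x assume x: "x \<in> X"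
    have "shift (neg c) x \<in> X" by (intro shift_Zd neg_Zd c x)
    then show "\<bar>V x\<bar> \<le> V_max" using adm unfolding admissible_def shift_potential_def by (metis restrict_apply' shift_neg(1))
  qed
qed (auto simp: admissible_def shift_potential_def shift_Zd)

lemma kernel_shift: "c \<in> X \<Longrightarrow> x \<in> X \<Longrightarrow> y \<in> X \<Longrightarrow>
    kernel f (shift_potential d c V) x y = kernel f V (shift c x) (shift c y)"
  by (simp add: kernel_def admissible_shift_potential spec_form_shift)

lemma velocity_shift: "c \<in> X \<Longrightarrow> x \<in> X \<Longrightarrow> y \<in> X \<Longrightarrow>
    velocity (shift_potential d c V) x y = velocity V (shift c x) (shift c y)"
  by (simp add: velocity_def fermi_kernel_def kernel_shift shift_def)

abbreviation "X4 \<equiv> X3 \<times> X"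
abbreviation "\<Omega>4 \<equiv> count_space X4 \<Otimes>\<^sub>M \<Omega>"

lemma countable_X4: "countable X4" by (intro countable_SIGMA countable_Zd)

definition trace_term :: "(real \<Rightarrow> real) \<Rightarrow> (real \<Rightarrow> real) \<Rightarrow> (site \<times> site \<times> site) \<times> site \<Rightarrow> (site \<Rightarrow> real) \<Rightarrow> real" where
  "trace_term f h t V = (case t of ((x, x', u), v) \<Rightarrow>
     velocity V x origin * velocity V x' u * kernel f V x x' * (kernel h V u v * kernel h V v origin))"

definition cycled_term :: "(real \<Rightarrow> real) \<Rightarrow> (real \<Rightarrow> real) \<Rightarrow> (site \<times> site \<times> site) \<times> site \<Rightarrow> (site \<Rightarrow> real) \<Rightarrow> real" where
  "cycled_term f h t V = (case t of ((x, x', u), v) \<Rightarrow>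
     velocity V x v * velocity V x' u * kernel f V x x' * (kernel h V u origin * kernel h V origin v))"

definition recenter :: "(site \<times> site \<times> site) \<times> site \<Rightarrow> (site \<times> site \<times> site) \<times> site" where
  "recenter t = (case t of ((x, x', u), v) \<Rightarrow> ((shift (neg v) x, shift (neg v) x', shift (neg v) u), neg v))"

lemma bij_betw_recenter: "bij_betw recenter X4 X4"
proof -
  have "neg (neg v) = v" for v by (simp add: neg_def)
  then show ?thesis
    by (intro bij_betw_byWitness[where f'=recenter]) (auto simp: recenter_def shift_Zd neg_Zd)
qed

lemma measurable_trace_term:
  "bdd_borel f \<Longrightarrow> bdd_borel h \<Longrightarrow> t \<in> X4 \<Longrightarrow> trace_term f h t \<in> borel_measurable \<Omega>"
  and measurable_cycled_term:
  "bdd_borel f \<Longrightarrow> bdd_borel h \<Longrightarrow> t \<in> X4 \<Longrightarrow> cycled_term f h t \<in> borel_measurable \<Omega>"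
  unfolding trace_term_def[abs_def] cycled_term_def[abs_def]
  by (auto intro!: borel_measurable_times measurable_velocity measurable_kernel zero_Zd)

lemma trace_term_shift: "t \<in> X4 \<Longrightarrow> trace_term f h t (shift_potential d (neg (snd t)) V) = cycled_term f h (recenter t) V"
proof -
  have "shift (neg v) v = origin" "shift v origin = v" for v :: site by (simp_all add: shift_def neg_def)
  then show "t \<in> X4 \<Longrightarrow> trace_term f h t (shift_potential d (neg (snd t)) V) = cycled_term f h (recenter t) V"
    by (auto simp: trace_term_def cycled_term_def recenter_def kernel_shift velocity_shift neg_Zd zero_Zd)
qed

lemma nn_integral_abs_trace_term_le:
  assumes h: "bdd_borel h" "\<And>t. \<bar>h t\<bar> \<le> c" and t: "t \<in> X3"
  shows "(\<integral>\<^sup>+v. ennreal \<bar>trace_term f h (t, v) V\<bar> \<partial>sites)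
    \<le> ennreal (4 * c\<^sup>2) * ennreal \<bar>Y_pair t V * kernel f V (fst t) (fst (snd t))\<bar>"
proof -
  obtain x x' u where xs: "t = (x, x', u)" "u \<in> X" using t by auto
  let ?b = "ennreal \<bar>Y_pair t V * kernel f V (fst t) (fst (snd t))\<bar>"
  have "(\<integral>\<^sup>+v. ennreal \<bar>trace_term f h (t, v) V\<bar> \<partial>sites)
      = (\<integral>\<^sup>+v. ?b * ennreal \<bar>kernel h V u v * kernel h V v origin\<bar> \<partial>sites)"
    by (simp add: trace_term_def Y_pair_def xs abs_mult ennreal_mult[symmetric] mult_ac)
  also have "\<dots> = ?b * (\<integral>\<^sup>+v. ennreal \<bar>kernel h V u v * kernel h V v origin\<bar> \<partial>sites)"
    by (rule nn_integral_cmult) simp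
  also have "\<dots> \<le> ?b * ennreal (4 * c\<^sup>2)"
    by (intro mult_left_mono nn_integral_abs_kernel_mult_le xs zero_Zd h) simp
  finally show ?thesis by (simp add: mult.commute)
qed

lemma integrable_trace_term:
  assumes f: "mean_decay f" and h: "bdd_borel h"
  shows "integrable \<Omega>4 (\<lambda>p. trace_term f h (fst p) (snd p))"
proof (rule P.integrable_pair_count_space[OF countable_X4])
  note bf = mean_decayD[OF f]
  show meas: "trace_term f h t \<in> borel_measurable \<Omega>" if "t \<in> X4" for t by (rule measurable_trace_term[OF bf h that])
  obtain c where c: "\<And>t. \<bar>h t\<bar> \<le> c" using bdd_borelE[OF h] by metis
  let ?b = "\<lambda>t V. Y_pair t V * kernel f V (fst t) (fst (snd t))"
  have mb: "?b t \<in> borel_measurable \<Omega>" if "t \<in> X3" for t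
    using that by (intro borel_measurable_times measurable_Y_pair measurable_kernel bf) auto
  have "(\<integral>\<^sup>+q. E_abs (trace_term f h q) \<partial>count_space X4)
      = (\<integral>\<^sup>+t. (\<integral>\<^sup>+V. (\<integral>\<^sup>+v. ennreal \<bar>trace_term f h (t, v) V\<bar> \<partial>sites) \<partial>\<Omega>) \<partial>count_space X3)"
    unfolding nn_integral_count_space_Times[OF countable_X3 countable_Zd]
    by (intro nn_integral_cong nn_integral_count_space_nn_integral[symmetric] countable_Zd) (use meas in simp)
  also have "\<dots> \<le> (\<integral>\<^sup>+t. (\<integral>\<^sup>+V. ennreal (4 * c\<^sup>2) * ennreal \<bar>?b t V\<bar> \<partial>\<Omega>) \<partial>count_space X3)"
    by (intro nn_integral_mono nn_integral_abs_trace_term_le h c) simp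
  also have "\<dots> = (\<integral>\<^sup>+t. ennreal (4 * c\<^sup>2) * E_abs (?b t) \<partial>count_space X3)"
    using mb by (intro nn_integral_cong nn_integral_cmult) auto
  also have "\<dots> = ennreal (4 * c\<^sup>2) * (\<integral>\<^sup>+t. E_abs (?b t) \<partial>count_space X3)"
    by (rule nn_integral_cmult) simp
  also have "(\<integral>\<^sup>+t. E_abs (?b t) \<partial>count_space X3) = (\<integral>\<^sup>+p. ennreal \<bar>?b (fst p) (snd p)\<bar> \<partial>\<Omega>3)"
    by (rule P.nn_integral_pair_count_space[where \<Psi>="?b", OF countable_X3 mb, symmetric])
  also have "ennreal (4 * c\<^sup>2) * (\<integral>\<^sup>+p. ennreal \<bar>?b (fst p) (snd p)\<bar> \<partial>\<Omega>3) < \<infinity>"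
    using integrable_Y_pair_kernel_left[OF f] by (simp add: integrable_iff_bounded ennreal_mult_less_top)
  finally show "(\<integral>\<^sup>+q. E_abs (trace_term f h q) \<partial>count_space X4) < \<infinity>" .
qed

lemma
  assumes f: "mean_decay f" and h: "bdd_borel h"
  shows integrable_cycled_term: "integrable \<Omega>4 (\<lambda>p. cycled_term f h (fst p) (snd p))"
    and integral_cycled_term: "(\<integral>p. cycled_term f h (fst p) (snd p) \<partial>\<Omega>4) = (\<integral>p. trace_term f h (fst p) (snd p) \<partial>\<Omega>4)"
proof -
  note bf = mean_decayD[OF f]
  have T: "shift_potential d (neg (snd t)) \<in> measurable \<Omega> \<Omega>"
    "distr \<Omega> \<Omega> (shift_potential d (neg (snd t))) = \<Omega>" if "t \<in> X4" for t :: "(site \<times> site \<times> site) \<times> site"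
    using that by (auto intro!: measurable_shift_potential distr_shift_potential neg_Zd)
  note reindex = countable_X4 bij_betw_recenter T measurable_trace_term[OF bf h] measurable_cycled_term[OF bf h]
    trace_term_shift integrable_trace_term[OF f h]
  show "integrable \<Omega>4 (\<lambda>p. cycled_term f h (fst p) (snd p))"
    by (rule P.integrable_count_space_reindex[OF reindex])
  show "(\<integral>p. cycled_term f h (fst p) (snd p) \<partial>\<Omega>4) = (\<integral>p. trace_term f h (fst p) (snd p) \<partial>\<Omega>4)"
    by (rule P.integral_count_space_reindex[OF reindex])
qed

lemma Y_form_eq_integral_cycled_term:
  assumes f: "mean_decay f" and h: "bdd_borel h"
  shows "Y_form f (\<lambda>t. h t * h t) = (\<integral>V. (\<integral>t. cycled_term f h t V \<partial>count_space X4) \<partial>\<Omega>)"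
proof -
  let ?\<Psi> = "Y_term f (\<lambda>t. h t * h t)"
  note i3 = integrable_Y_term[OF f bdd_borel_mult[OF h h]] and i4 = integrable_trace_term[OF f h]
  have "Y_form f (\<lambda>t. h t * h t) = (\<integral>V. (\<integral>t. ?\<Psi> t V \<partial>count_space X3) \<partial>\<Omega>)"
    unfolding Y_form_def by (rule P.integral_pair_count_space_snd[OF countable_X3 i3])
  also have "\<dots> = (\<integral>V. (\<integral>t. trace_term f h t V \<partial>count_space X4) \<partial>\<Omega>)"
  proof (rule integral_cong_AE)
    show "AE V in \<Omega>. (\<integral>t. ?\<Psi> t V \<partial>count_space X3) = (\<integral>t. trace_term f h t V \<partial>count_space X4)"
      using P.AE_integrable_count_space[OF countable_X4 i4]
    proof eventually_elim
      case (elim V)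
      have "(\<integral>t. trace_term f h t V \<partial>count_space X4) = (\<integral>t. (\<integral>v. trace_term f h (t, v) V \<partial>sites) \<partial>count_space X3)"
        by (rule integral_count_space_Times[OF countable_X3 countable_Zd elim])
      also have "\<dots> = (\<integral>t. ?\<Psi> t V \<partial>count_space X3)"
        by (intro Bochner_Integration.integral_cong refl)
          (auto simp: trace_term_def Y_term_def Y_pair_def kernel_mult[OF h h _ zero_Zd])
      finally show ?case ..
    qed
  qed (use P.integrable_pair_count_space_snd[OF countable_X3 i3] P.integrable_pair_count_space_snd[OF countable_X4 i4] in auto)
  also have "\<dots> = (\<integral>V. (\<integral>t. cycled_term f h t V \<partial>count_space X4) \<partial>\<Omega>)"
    using P.integral_pair_count_space_snd[OF countable_X4 i4]
      P.integral_pair_count_space_snd[OF countable_X4 integrable_cycled_term[OF f h]] integral_cycled_term[OF f h] by simp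
  finally show ?thesis .
qed

text \<open>\<open>Y_vec h V\<close> is the vector \<open>\<psi> = Y h(H) \<delta>\<^sub>0\<close> up to the factor \<open>\<i>\<close>, and
  \<open>Y_quad f h V = \<langle>\<psi>, f(H) \<psi>\<rangle>\<close>.\<close>

definition Y_vec :: "(real \<Rightarrow> real) \<Rightarrow> (site \<Rightarrow> real) \<Rightarrow> site \<Rightarrow> real" where
  "Y_vec h V x = (\<integral>u. velocity V x u * kernel h V u origin \<partial>sites)"

definition Y_quad :: "(real \<Rightarrow> real) \<Rightarrow> (real \<Rightarrow> real) \<Rightarrow> (site \<Rightarrow> real) \<Rightarrow> real" where
  "Y_quad f h V = (\<integral>p. kernel f V (fst p) (snd p) * (Y_vec h V (fst p) * Y_vec h V (snd p)) \<partial>site_pairs)"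

lemma measurable_Y_quad:
  assumes "bdd_borel f" "bdd_borel h"
  shows "Y_quad f h \<in> borel_measurable \<Omega>"
proof -
  have "(\<lambda>V. Y_vec h V x) \<in> borel_measurable \<Omega>" if "x \<in> X" for x
    unfolding Y_vec_def
    by (intro P.measurable_integral_count_space countable_Zd borel_measurable_times measurable_velocity measurable_kernel
        assms that zero_Zd)
  then show ?thesis
    unfolding Y_quad_def[abs_def]
    by (intro P.measurable_integral_count_space countable_SIGMA countable_Zd borel_measurable_times measurable_kernel assms) auto
qed

lemma
  assumes h: "bdd_borel h" and i: "integrable (count_space X4) (\<lambda>t. cycled_term f h t V)"
  shows integral_cycled_term_eq_Y_quad: "(\<integral>t. cycled_term f h t V \<partial>count_space X4) = Y_quad f h V"
    and integrable_Y_quad_summand: "integrable site_pairs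
      (\<lambda>p. kernel f V (fst p) (snd p) * (Y_vec h V (fst p) * Y_vec h V (snd p)))"
proof -
  define k where "k p q = kernel f V (fst p) (snd p) *
    ((velocity V (fst p) (fst q) * kernel h V (fst q) origin) * (velocity V (snd p) (snd q) * kernel h V (snd q) origin))" for p q
  let ?r = "\<lambda>(p, q). ((fst p, snd p, snd q), fst q)"
  have cXX: "countable (X \<times> X)" by (intro countable_SIGMA countable_Zd)
  have bij: "bij_betw ?r ((X \<times> X) \<times> (X \<times> X)) X4"
    by (rule bij_betw_byWitness[where f'="\<lambda>((x, x', u), v). ((x, x'), (v, u))"]) auto
  have r: "cycled_term f h (?r t) V = k (fst t) (snd t)" if "t \<in> (X \<times> X) \<times> (X \<times> X)" for t
    using that kernel_sym[OF h, of _ origin V] zero_Zd by (auto simp: cycled_term_def k_def)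
  have ik: "integrable (count_space ((X \<times> X) \<times> (X \<times> X))) (\<lambda>t. k (fst t) (snd t))"
    using i integrable_bij_count_space[OF bij, of "\<lambda>t. cycled_term f h t V"] r
    by (subst Bochner_Integration.integrable_cong[OF refl, of _ _ "\<lambda>t. cycled_term f h (?r t) V"]) auto
  have inner: "(\<integral>q. k p q \<partial>site_pairs) = kernel f V (fst p) (snd p) * (Y_vec h V (fst p) * Y_vec h V (snd p))"
    if "p \<in> X \<times> X" for p
    unfolding k_def Y_vec_def
    by (rule integral_count_space_Times_factor[OF countable_Zd])
      (use integrable_count_space_section[OF ik that] in \<open>simp add: k_def\<close>)
  have "(\<integral>t. cycled_term f h t V \<partial>count_space X4) = (\<integral>t. cycled_term f h (?r t) V \<partial>count_space ((X \<times> X) \<times> (X \<times> X)))"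
    by (rule integral_bij_count_space[OF bij, symmetric])
  also have "\<dots> = (\<integral>t. k (fst t) (snd t) \<partial>count_space ((X \<times> X) \<times> (X \<times> X)))"
    by (rule Bochner_Integration.integral_cong[OF refl r]) simp
  also have "\<dots> = (\<integral>p. (\<integral>q. k p q \<partial>site_pairs) \<partial>site_pairs)"
    using integral_count_space_Times[OF cXX cXX ik] by simp
  also have "\<dots> = Y_quad f h V" unfolding Y_quad_def by (intro Bochner_Integration.integral_cong refl inner) simp
  finally show "(\<integral>t. cycled_term f h t V \<partial>count_space X4) = Y_quad f h V" .
  have "integrable site_pairs (\<lambda>p. \<integral>q. k p q \<partial>site_pairs)"
    using integrable_integral_count_space[OF cXX cXX ik] by simp
  then show "integrable site_pairs (\<lambda>p. kernel f V (fst p) (snd p) * (Y_vec h V (fst p) * Y_vec h V (snd p)))"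
    by (rule Bochner_Integration.integrable_cong[THEN iffD1, OF refl, rotated]) (rule inner, simp)
qed

theorem
  assumes f: "mean_decay f" and h: "bdd_borel h"
  shows Y_form_eq_integral_Y_quad: "Y_form f (\<lambda>t. h t * h t) = (\<integral>V. Y_quad f h V \<partial>\<Omega>)"
    and integrable_Y_quad: "integrable \<Omega> (Y_quad f h)"
proof -
  note i = integrable_cycled_term[OF f h]
  note snd = P.integrable_pair_count_space_snd[OF countable_X4 i]
    and meas = measurable_Y_quad[OF mean_decayD[OF f] h]
  have eq: "AE V in \<Omega>. (\<integral>t. cycled_term f h t V \<partial>count_space X4) = Y_quad f h V"
    using P.AE_integrable_count_space[OF countable_X4 i]
    by eventually_elim (rule integral_cycled_term_eq_Y_quad[OF h])
  show "Y_form f (\<lambda>t. h t * h t) = (\<integral>V. Y_quad f h V \<partial>\<Omega>)"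
    unfolding Y_form_eq_integral_cycled_term[OF f h]
    by (rule integral_cong_AE[OF borel_measurable_integrable[OF snd] meas eq])
  show "integrable \<Omega> (Y_quad f h)"
    by (rule integrable_cong_AE_imp[OF snd meas]) (use eq in \<open>eventually_elim, simp\<close>)
qed

lemma AE_Y_quad_nonneg:
  assumes f: "mean_decay f" "\<And>t. t \<in> {-spec_bound..spec_bound} \<Longrightarrow> 0 \<le> f t" and h: "bdd_borel h"
  shows "AE V in \<Omega>. 0 \<le> Y_quad f h V"
  using P.AE_integrable_count_space[OF countable_X4 integrable_cycled_term[OF f(1) h]] AE_admissible
proof eventually_elim
  case (elim V)
  interpret bounded_potential d V V_max by (rule admissibleD[OF elim(2)])
  show ?case
    unfolding Y_quad_def
  proof (rule integral_count_space_Times_nonneg[OF integrable_Y_quad_summand[OF h elim(1)]])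
    fix S assume "finite S" "S \<subseteq> X"
    then show "0 \<le> (\<Sum>p\<in>S \<times> S. kernel f V (fst p) (snd p) * (Y_vec h V (fst p) * Y_vec h V (snd p)))"
      using sum_spec_form_nonneg[OF mean_decayD[OF f(1)], of S "Y_vec h V"] f(2) elim(2)
      by (simp add: spec_bound_def kernel_eq_spec_form case_prod_beta')
  qed
qed

lemma Y_form_nonneg:
  assumes "mean_decay f" "\<And>t. t \<in> {-spec_bound..spec_bound} \<Longrightarrow> 0 \<le> f t" "bdd_borel h"
  shows "0 \<le> Y_form f (\<lambda>t. h t * h t)"
  unfolding Y_form_eq_integral_Y_quad[OF assms(1,3)]
  by (rule integral_nonneg_AE[OF AE_Y_quad_nonneg[OF assms]])

end

section \<open>The joint spectral measure\<close>

context fermi_level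
begin

definition cut_poly :: "real poly \<Rightarrow> real \<Rightarrow> real" where
  "cut_poly p t = (\<Sum>i\<le>degree p. coeff p i * cut_power i t)"

lemma cut_poly_eq: "cut_poly p t = poly p t * indicator {-spec_bound..spec_bound} t"
  by (simp add: cut_poly_def cut_pow_def poly_altdef sum_distrib_right mult.assoc)

lemma mean_decay_cut_poly: "mean_decay (cut_poly p)"
  unfolding cut_poly_def[abs_def] by (rule mean_decay_sum) (rule mean_decay_cut_pow)

lemma Y_form_cut_poly:
  "Y_form (cut_poly p) (cut_poly q) = moment_form (\<lambda>m n. Y_form (cut_power m) (cut_power n)) p q"
proof -
  have "Y_form (cut_poly p) (cut_poly q) = (\<Sum>j\<le>degree q. coeff q j * Y_form (cut_poly p) (cut_power j))"
    unfolding cut_poly_def[of q, abs_def]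
    by (rule normal_functional.linear_combination[OF normal_functional_Y_form_right[OF mean_decay_cut_poly] bdd_borel_cut_pow])
  also have "\<dots> = (\<Sum>j\<le>degree q. coeff q j * (\<Sum>i\<le>degree p. coeff p i * Y_form (cut_power i) (cut_power j)))"
    unfolding cut_poly_def[of p, abs_def]
    by (intro sum.cong refl arg_cong2[where f="(*)"] bdd_borel_cut_pow
        normal_functional.linear_combination[OF normal_functional_Y_form_left[OF mean_decay_cut_pow]])
  also have "\<dots> = moment_form (\<lambda>m n. Y_form (cut_power m) (cut_power n)) p q"
    unfolding moment_form_def by (subst sum.swap) (simp add: sum_distrib_left mult_ac)
  finally show ?thesis .
qed

lemma Y_form_bernstein_nonneg:
  "0 \<le> moment_form (\<lambda>m n. Y_form (cut_power m) (cut_power n)) (bernstein spec_bound i j) (bernstein spec_bound i' j')"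
proof -
  let ?f = "cut_poly (bernstein spec_bound i j)" and ?g = "cut_poly (bernstein spec_bound i' j')"
  have nonneg: "0 \<le> cut_poly (bernstein spec_bound i j) t" for i j t
    using poly_bernstein_nonneg[OF spec_bound_pos] by (simp add: cut_poly_eq indicator_def)
  have bg: "bdd_borel ?g" by (rule mean_decayD[OF mean_decay_cut_poly])
  obtain B where B: "\<And>t. \<bar>?g t\<bar> \<le> B" using bdd_borelE[OF bg] by metis
  have "bdd_borel (\<lambda>t. sqrt (?g t))"
  proof (rule bdd_borelI)
    show "\<bar>sqrt (?g t)\<bar> \<le> sqrt B" for t using B[of t] nonneg[of i' j' t] by simp
  qed (use bdd_borel_measurable[OF bg] in measurable)
  then have "0 \<le> Y_form ?f (\<lambda>t. sqrt (?g t) * sqrt (?g t))"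
    by (intro Y_form_nonneg mean_decay_cut_poly nonneg)
  also have "(\<lambda>t. sqrt (?g t) * sqrt (?g t)) = ?g" using nonneg by auto
  finally show ?thesis by (simp add: Y_form_cut_poly)
qed

abbreviation "Y_measure \<equiv> Yjoint d \<rho> EF"

lemma
  shows finite_borel_on_Y_measure: "finite_borel_on (square spec_bound) Y_measure"
    and Y_measure_moments: "(\<integral>p. monomial m n p \<partial>Y_measure) = Y_form (cut_power m) (cut_power n)"
proof -
  obtain M where M: "finite_borel_on (square spec_bound) M"
    "\<And>m n. (\<integral>p. monomial m n p \<partial>M) = Y_form (cut_power m) (cut_power n)"
    by (rule hausdorff_moment_problem_square[OF spec_bound_pos Y_form_bernstein_nonneg]) blast
  have "Y_measure = M"
    unfolding Yjoint_def
  proof (rule the_equality)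
    show "sets M = sets borel \<and> finite_measure M \<and> (\<exists>R. emeasure M (UNIV - {- R..R} \<times> {- R..R}) = 0) \<and>
        (\<forall>m n. complex_of_real (\<integral>p. fst p ^ m * snd p ^ n \<partial>M) = Ymoment d \<rho> EF m n)"
      using M by (auto simp: Ymoment_eq_Y_form monomial_def square_def finite_borel_on_def)
    fix N :: "(real \<times> real) measure"
    assume N: "sets N = sets borel \<and> finite_measure N \<and> (\<exists>R. emeasure N (UNIV - {- R..R} \<times> {- R..R}) = 0) \<and>
        (\<forall>m n. complex_of_real (\<integral>p. fst p ^ m * snd p ^ n \<partial>N) = Ymoment d \<rho> EF m n)"
    then obtain R where R: "finite_borel_on (square R) N" unfolding finite_borel_on_def square_def by blast
    have "(\<integral>p. monomial m n p \<partial>N) = (\<integral>p. monomial m n p \<partial>M)" for m n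
      using N M(2) by (auto simp: Ymoment_eq_Y_form monomial_def)
    then show "N = M" by (rule joint_moments_determine_measure[OF R M(1)])
  qed
  with M show "finite_borel_on (square spec_bound) Y_measure"
    "(\<integral>p. monomial m n p \<partial>Y_measure) = Y_form (cut_power m) (cut_power n)" by auto
qed

abbreviation "trunc f \<equiv> (\<lambda>t :: real. f t * indicator {-spec_bound..spec_bound} t)"

lemma Y_form_trunc:
  assumes "bdd_borel f" "bdd_borel g"
  shows "Y_form (trunc f) g = Y_form f g" "Y_form f (trunc g) = Y_form f g"
  unfolding Y_form_def
  by (rule Bochner_Integration.integral_cong[OF refl],
      auto simp: Y_term_def space_pair_measure kernel_restrict assms zero_Zd)+

lemma
  assumes f: "bdd_borel (f :: real \<Rightarrow> real)"
  shows bdd_borel_fst: "bdd_borel (\<lambda>p :: real \<times> real. f (fst p))"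
    and bdd_borel_snd: "bdd_borel (\<lambda>p :: real \<times> real. f (snd p))"
  by (rule bdd_borel_compose[OF f], rule borel_measurable_continuous_onI, intro continuous_intros)+

lemma bdd_borel_tensor:
  "bdd_borel f \<Longrightarrow> bdd_borel g \<Longrightarrow> bdd_borel (\<lambda>p :: real \<times> real. f (fst p) * g (snd p))"
  by (rule bdd_borel_mult[OF bdd_borel_fst bdd_borel_snd])

lemma integral_Y_measure_trunc:
  assumes f: "bdd_borel f" and g: "bdd_borel g"
  shows "(\<integral>p. trunc f (fst p) * g (snd p) \<partial>Y_measure) = (\<integral>p. f (fst p) * g (snd p) \<partial>Y_measure)"
    and "(\<integral>p. f (fst p) * trunc g (snd p) \<partial>Y_measure) = (\<integral>p. f (fst p) * g (snd p) \<partial>Y_measure)"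
proof -
  have bdd_borel_trunc: "bdd_borel (trunc h)" if "bdd_borel h" for h
    using that by (intro bdd_borel_mult bdd_borel_indicator) auto
  note restrict = integral_eq_integral_indicator[OF finite_borel_on_Y_measure square_borel
      bdd_borel_measurable[OF bdd_borel_tensor]]
  have "(\<lambda>p. trunc f (fst p) * g (snd p) * indicator (square spec_bound) p) = (\<lambda>p. f (fst p) * g (snd p) * indicator (square spec_bound) p)"
    "(\<lambda>p. f (fst p) * trunc g (snd p) * indicator (square spec_bound) p) = (\<lambda>p. f (fst p) * g (snd p) * indicator (square spec_bound) p)"
    by (auto simp: square_def indicator_def fun_eq_iff)
  then show "(\<integral>p. trunc f (fst p) * g (snd p) \<partial>Y_measure) = (\<integral>p. f (fst p) * g (snd p) \<partial>Y_measure)"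
    "(\<integral>p. f (fst p) * trunc g (snd p) \<partial>Y_measure) = (\<integral>p. f (fst p) * g (snd p) \<partial>Y_measure)"
    unfolding restrict[OF bdd_borel_trunc[OF f] g] restrict[OF f bdd_borel_trunc[OF g]] restrict[OF f g] by simp_all
qed

lemma normal_functional_integral_Y_measure:
  assumes "bdd_borel k"
  shows "normal_functional (\<lambda>f. \<integral>p. f (fst p) * k (snd p) \<partial>Y_measure)"
    and "normal_functional (\<lambda>f. \<integral>p. k (fst p) * f (snd p) \<partial>Y_measure)"
proof -
  note int = normal_functional_integral[OF finite_borel_on_Y_measure]
  have "fst \<in> borel_measurable (borel :: (real \<times> real) measure)" "snd \<in> borel_measurable (borel :: (real \<times> real) measure)"
    by (auto intro!: borel_measurable_continuous_onI continuous_intros)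
  from normal_functional_pullback[OF int this(1) bdd_borel_snd[OF assms]]
    normal_functional_pullback[OF int this(2) bdd_borel_fst[OF assms]]
  show "normal_functional (\<lambda>f. \<integral>p. f (fst p) * k (snd p) \<partial>Y_measure)"
    "normal_functional (\<lambda>f. \<integral>p. k (fst p) * f (snd p) \<partial>Y_measure)"
    by (simp_all add: mult.commute)
qed

theorem integral_Y_measure:
  assumes f: "mean_decay f" and g: "bdd_borel g"
  shows "(\<integral>p. f (fst p) * g (snd p) \<partial>Y_measure) = Y_form f g"
proof (rule normal_functional_eqI_cut_pow[where C=spec_bound, OF normal_functional_integral_Y_measure(2)
      normal_functional_Y_form_right[OF f] g])
  note bf = mean_decayD[OF f]
  show "(\<integral>p. f (fst p) * cut_power n (snd p) \<partial>Y_measure) = Y_form f (cut_power n)" for n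
  proof (rule normal_functional_eqI_cut_pow[where C=spec_bound, OF normal_functional_integral_Y_measure(1)[OF bdd_borel_cut_pow]
        normal_functional_Y_form_left[OF mean_decay_cut_pow] bf])
    fix m
    have "(\<integral>p. cut_power m (fst p) * cut_power n (snd p) \<partial>Y_measure)
        = (\<integral>p. monomial m n p * indicator (square spec_bound) p \<partial>Y_measure)"
      by (rule Bochner_Integration.integral_cong[OF refl])
        (auto simp: cut_pow_def monomial_def square_def indicator_def)
    also have "\<dots> = (\<integral>p. monomial m n p \<partial>Y_measure)"
      by (rule integral_eq_integral_indicator[OF finite_borel_on_Y_measure square_borel
            borel_measurable_continuous_onI[OF continuous_monomial], symmetric])
    finally show "(\<integral>p. cut_power m (fst p) * cut_power n (snd p) \<partial>Y_measure) = Y_form (cut_power m) (cut_power n)"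
      by (simp add: Y_measure_moments)
  qed (intro integral_Y_measure_trunc Y_form_trunc bf bdd_borel_cut_pow)+
qed (intro integral_Y_measure_trunc Y_form_trunc mean_decayD[OF f] g)+

definition upper_band :: "real \<Rightarrow> real \<Rightarrow> real" where "upper_band \<nu> = indicator {EF<..EF + \<nu>}"
definition lower_band :: "real \<Rightarrow> real \<Rightarrow> real" where "lower_band \<nu> = indicator {EF - \<nu><..EF}"

lemma upper_band_eq_diff: "0 \<le> \<nu> \<Longrightarrow> upper_band \<nu> = (\<lambda>t. indicator {..EF + \<nu>} t - indicator {..EF} t)"
  and lower_band_eq_diff: "0 \<le> \<nu> \<Longrightarrow> lower_band \<nu> = (\<lambda>t. indicator {..EF} t - indicator {..EF - \<nu>} t)"
  by (auto simp: upper_band_def lower_band_def indicator_def fun_eq_iff)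

lemma bdd_borel_upper_band: "bdd_borel (upper_band \<nu>)"
  and bdd_borel_lower_band: "bdd_borel (lower_band \<nu>)"
  unfolding upper_band_def lower_band_def by (auto intro!: bdd_borel_indicator)

lemma lower_band_square: "lower_band \<nu> t * lower_band \<nu> t = lower_band \<nu> t"
  by (simp add: lower_band_def indicator_def)

lemma mean_decay_upper_band: "0 \<le> \<nu> \<Longrightarrow> EF + \<nu> < b \<Longrightarrow> mean_decay (upper_band \<nu>)"
  using mean_decay_linear[OF mean_decay_atMost[of "EF + \<nu>"] mean_decay_atMost[OF EF_in], of 1 "-1"] EF
  by (simp add: upper_band_eq_diff)

text \<open>The weight \<open>- (\<lambda>\<^sub>1 - \<lambda>\<^sub>2) (\<chi>(\<lambda>\<^sub>1) - \<chi>(\<lambda>\<^sub>2))\<close> vanishes on \<open>0 \<le> \<lambda>\<^sub>1 - \<lambda>\<^sub>2 \<le> \<nu>\<close>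
  unless \<open>\<lambda>\<^sub>1\<close> lies in the upper and \<open>\<lambda>\<^sub>2\<close> in the lower band.\<close>

lemma sigma_in_le_Y_form:
  assumes \<nu>: "0 < \<nu>" "EF + \<nu> < b" "a < EF - \<nu>"
  shows "sigma_in d \<rho> EF \<nu> \<le> pi * Y_form (upper_band \<nu>) (lower_band \<nu>)"
proof -
  let ?c = "\<lambda>p :: real \<times> real. indicator {q. fst q - snd q \<in> {0..\<nu>}} p *
       (- (fst p - snd p) * ((if fst p \<le> EF then 1 else 0) - (if snd p \<le> EF then 1 else 0)))"
  let ?b = "\<lambda>p. \<nu> * (upper_band \<nu> (fst p) * lower_band \<nu> (snd p))"
  have i: "integrable Y_measure ?b"
    by (intro integrable_mult_right integrable_bdd_borel[OF finite_borel_on_Y_measure] bdd_borel_tensor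
        bdd_borel_upper_band bdd_borel_lower_band)
  have le: "0 \<le> ?b p" "?c p \<le> ?b p" for p
    using \<nu> by (auto simp: upper_band_def lower_band_def indicator_def)
  have "(\<integral>p. ?c p \<partial>Y_measure) \<le> (\<integral>p. ?b p \<partial>Y_measure)"
    by (rule integral_mono'[OF i le(2,1)])
  also have "\<dots> = \<nu> * Y_form (upper_band \<nu>) (lower_band \<nu>)"
    using \<nu> by (simp add: integral_Y_measure[OF mean_decay_upper_band bdd_borel_lower_band])
  finally have "pi * (\<integral>p. ?c p \<partial>Y_measure) / \<nu> \<le> pi * (\<nu> * Y_form (upper_band \<nu>) (lower_band \<nu>)) / \<nu>"
    using \<nu>(1) by (intro divide_right_mono mult_left_mono) auto
  then show ?thesis using \<nu>(1) by (simp add: sigma_in_def cond_measure_def)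
qed

end

section \<open>The commutator and the box decomposition\<close>

lemma (in anderson)
  assumes f: "bdd_borel f" "\<And>t. \<bar>f t\<bar> \<le> c" and h: "bdd_borel h" "\<And>t. \<bar>h t\<bar> \<le> c"
    and z: "z \<in> X" and \<phi>: "integrable sites \<phi>"
  shows integrable_kernel_mult_vec:
      "integrable sites (\<lambda>x. kernel f V z x * (\<integral>u. kernel h V x u * \<phi> u \<partial>sites))"
    and kernel_mult_vec: "(\<integral>x. kernel f V z x * (\<integral>u. kernel h V x u * \<phi> u \<partial>sites) \<partial>sites)
      = (\<integral>u. kernel (\<lambda>t. f t * h t) V z u * \<phi> u \<partial>sites)"
proof -
  note cX = countable_Zd[of d]
  let ?k = "\<lambda>p. (kernel f V z (fst p) * kernel h V (fst p) (snd p)) * \<phi> (snd p)"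
  have "(\<integral>\<^sup>+p. ennreal \<bar>?k p\<bar> \<partial>site_pairs)
      = (\<integral>\<^sup>+u. (\<integral>\<^sup>+x. ennreal \<bar>kernel f V z x * kernel h V x u\<bar> \<partial>sites) * ennreal \<bar>\<phi> u\<bar> \<partial>sites)"
    by (simp add: nn_integral_count_space_Times_swap[OF cX cX] abs_mult ennreal_mult nn_integral_multc)
  also have "\<dots> \<le> (\<integral>\<^sup>+u. ennreal (4 * c\<^sup>2) * ennreal \<bar>\<phi> u\<bar> \<partial>sites)"
    by (intro nn_integral_mono mult_right_mono nn_integral_abs_kernel_mult_le z f h) auto
  also have "\<dots> < \<infinity>"
    using \<phi> by (simp add: nn_integral_cmult integrable_count_space_iff_finite ennreal_mult_less_top)
  finally have i: "integrable site_pairs ?k" by (simp add: integrable_count_space_iff_finite)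
  show "integrable sites (\<lambda>x. kernel f V z x * (\<integral>u. kernel h V x u * \<phi> u \<partial>sites))"
    using integrable_integral_count_space[OF cX cX i] by (simp add: mult.assoc)
  have "(\<integral>x. kernel f V z x * (\<integral>u. kernel h V x u * \<phi> u \<partial>sites) \<partial>sites)
      = (\<integral>u. (\<integral>x. kernel f V z x * (kernel h V x u * \<phi> u) \<partial>sites) \<partial>sites)"
    using integral_count_space_Times[OF cX cX i] integral_count_space_Times_swap[OF cX cX i] by (simp add: mult.assoc)
  also have "\<dots> = (\<integral>u. kernel (\<lambda>t. f t * h t) V z u * \<phi> u \<partial>sites)"
    by (intro Bochner_Integration.integral_cong refl) (simp add: kernel_mult[OF f(1) h(1) z] mult.assoc[symmetric])
  finally show "(\<integral>x. kernel f V z x * (\<integral>u. kernel h V x u * \<phi> u \<partial>sites) \<partial>sites)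
      = (\<integral>u. kernel (\<lambda>t. f t * h t) V z u * \<phi> u \<partial>sites)" .
qed

lemma (in anderson) integrable_kernel_vec:
  assumes f: "bdd_borel f" "\<And>t. \<bar>f t\<bar> \<le> 1" and z: "z \<in> X" and \<phi>: "integrable sites \<phi>"
  shows "integrable sites (\<lambda>u. kernel f V z u * \<phi> u)"
proof (rule integrable_count_space_bound[OF \<phi>])
  fix u assume "u \<in> X"
  then have "\<bar>kernel f V z u\<bar> \<le> 1" by (intro abs_kernel_le f z) auto
  then show "\<bar>kernel f V z u * \<phi> u\<bar> \<le> \<bar>\<phi> u\<bar>" by (simp add: abs_mult mult_left_le_one_le)
qed

context fermi_level
begin

lemma upper_band_range: "0 \<le> upper_band \<nu> t" "\<bar>upper_band \<nu> t\<bar> \<le> 1"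
  and lower_band_range: "0 \<le> lower_band \<nu> t" "\<bar>lower_band \<nu> t\<bar> \<le> 1"
  by (auto simp: upper_band_def lower_band_def indicator_def)

lemma abs_kernel_upper_band_le: "x \<in> X \<Longrightarrow> y \<in> X \<Longrightarrow> \<bar>kernel (upper_band \<nu>) V x y\<bar> \<le> 1"
  by (rule abs_kernel_le[OF bdd_borel_upper_band upper_band_range(2)]) auto

lemma abs_kernel_lower_band_le: "x \<in> X \<Longrightarrow> y \<in> X \<Longrightarrow> \<bar>kernel (lower_band \<nu>) V x y\<bar> \<le> 1"
  by (rule abs_kernel_le[OF bdd_borel_lower_band lower_band_range(2)]) auto

lemma kernel_upper_band_diag: "x \<in> X \<Longrightarrow> 0 \<le> kernel (upper_band \<nu>) V x x" "x \<in> X \<Longrightarrow> kernel (upper_band \<nu>) V x x \<le> 1"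
  using kernel_nonneg[OF bdd_borel_upper_band upper_band_range(1)] abs_kernel_upper_band_le[of x x \<nu> V] by auto

definition position_vec :: "real \<Rightarrow> (site \<Rightarrow> real) \<Rightarrow> site \<Rightarrow> real" where
  "position_vec \<nu> V x = real_of_int (x 0) * kernel (lower_band \<nu>) V x origin"

lemma Y_vec_lower_band:
  assumes \<phi>: "integrable sites (position_vec \<nu> V)" and x: "x \<in> X"
  shows "Y_vec (lower_band \<nu>) V x = position_vec \<nu> V x - (\<integral>u. fermi_kernel V x u * position_vec \<nu> V u \<partial>sites)"
proof -
  have P_lower: "(\<lambda>t. indicator {..EF} t * lower_band \<nu> t) = lower_band \<nu>" by (auto simp: lower_band_def indicator_def)
  note mult = kernel_mult[OF bdd_borel_atMost[of EF] bdd_borel_lower_band[of \<nu>] x zero_Zd, of V, folded fermi_kernel_def, unfolded P_lower]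
    and i_mult = integrable_kernel_mult[OF bdd_borel_atMost[of EF] bdd_borel_lower_band[of \<nu>] x zero_Zd, of V, folded fermi_kernel_def]
  have i: "integrable sites (\<lambda>u. fermi_kernel V x u * position_vec \<nu> V u)"
    unfolding fermi_kernel_def by (rule integrable_kernel_vec[OF bdd_borel_atMost _ x \<phi>]) (simp add: indicator_def)
  have "Y_vec (lower_band \<nu>) V x = (\<integral>u. real_of_int (x 0) * (fermi_kernel V x u * kernel (lower_band \<nu>) V u origin)
      - fermi_kernel V x u * position_vec \<nu> V u \<partial>sites)"
    unfolding Y_vec_def velocity_def position_vec_def by (simp add: algebra_simps)
  also have "\<dots> = real_of_int (x 0) * kernel (lower_band \<nu>) V x origin - (\<integral>u. fermi_kernel V x u * position_vec \<nu> V u \<partial>sites)"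
    using mult i_mult by (subst Bochner_Integration.integral_diff[OF _ i]) auto
  finally show ?thesis by (simp add: position_vec_def)
qed

text \<open>Since \<open>P F\<^sub>- = F\<^sub>-\<close> and \<open>F\<^sub>+ P = 0\<close> for the spectral projections \<open>F\<^sub>\<plusminus>\<close> of the bands, the commutator with \<open>P\<close>
  may be replaced by multiplication with the coordinate: \<open>F\<^sub>+ [X, P] F\<^sub>- = F\<^sub>+ X F\<^sub>-\<close>.\<close>

lemma integral_upper_band_Y_vec:
  assumes \<phi>: "integrable sites (position_vec \<nu> V)" and z: "z \<in> X"
  shows "(\<integral>x. kernel (upper_band \<nu>) V z x * Y_vec (lower_band \<nu>) V x \<partial>sites)
    = (\<integral>x. kernel (upper_band \<nu>) V z x * position_vec \<nu> V x \<partial>sites)"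
proof -
  have upper_P: "(\<lambda>t. upper_band \<nu> t * indicator {..EF} t) = (\<lambda>t. 0)" by (auto simp: upper_band_def indicator_def)
  let ?P\<phi> = "\<lambda>x. \<integral>u. kernel (indicator {..EF}) V x u * position_vec \<nu> V u \<partial>sites"
  have P_le: "\<bar>indicator {..EF} t\<bar> \<le> (1 :: real)" for t by (simp add: indicator_def)
  note upper = bdd_borel_upper_band upper_band_range(2)
  have "(\<integral>x. kernel (upper_band \<nu>) V z x * ?P\<phi> x \<partial>sites) = (\<integral>u. kernel (\<lambda>t. 0) V z u * position_vec \<nu> V u \<partial>sites)"
    using kernel_mult_vec[OF upper bdd_borel_atMost P_le z \<phi>, of \<nu> V] unfolding upper_P .
  also have "\<dots> = (\<integral>u. 0 \<partial>sites)"
    by (rule Bochner_Integration.integral_cong[OF refl]) (simp add: kernel_zero z)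
  finally have zero: "(\<integral>x. kernel (upper_band \<nu>) V z x * ?P\<phi> x \<partial>sites) = 0" by simp
  have "(\<integral>x. kernel (upper_band \<nu>) V z x * Y_vec (lower_band \<nu>) V x \<partial>sites)
      = (\<integral>x. kernel (upper_band \<nu>) V z x * position_vec \<nu> V x - kernel (upper_band \<nu>) V z x * ?P\<phi> x \<partial>sites)"
    by (rule Bochner_Integration.integral_cong)
      (simp_all add: Y_vec_lower_band[OF \<phi>] right_diff_distrib fermi_kernel_def)
  also have "\<dots> = (\<integral>x. kernel (upper_band \<nu>) V z x * position_vec \<nu> V x \<partial>sites)"
    using Bochner_Integration.integral_diff[OF integrable_kernel_vec[OF upper z \<phi>, of \<nu> V]
        integrable_kernel_mult_vec[OF upper bdd_borel_atMost P_le z \<phi>, of \<nu> V]] zero by simp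
  finally show ?thesis .
qed

lemma integrable_position_weight:
  assumes \<phi>: "integrable sites (position_vec \<nu> V)"
  shows "integrable sites (\<lambda>x. \<bar>position_vec \<nu> V x\<bar> * sqrt (kernel (upper_band \<nu>) V x x))"
proof (rule integrable_count_space_bound[OF \<phi>])
  fix x assume x: "x \<in> X"
  have "\<bar>position_vec \<nu> V x\<bar> * \<bar>sqrt (kernel (upper_band \<nu>) V x x)\<bar> \<le> \<bar>position_vec \<nu> V x\<bar> * 1"
    using kernel_upper_band_diag[OF x] by (intro mult_left_mono) auto
  then show "\<bar>\<bar>position_vec \<nu> V x\<bar> * sqrt (kernel (upper_band \<nu>) V x x)\<bar> \<le> \<bar>position_vec \<nu> V x\<bar>" by (simp add: abs_mult)
qed

lemma Y_quad_le_square: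
  assumes \<phi>: "integrable sites (position_vec \<nu> V)"
    and i: "integrable site_pairs (\<lambda>p. velocity V (fst p) (snd p) * kernel (lower_band \<nu>) V (snd p) origin)"
  shows "Y_quad (upper_band \<nu>) (lower_band \<nu>) V
    \<le> (\<integral>x. \<bar>position_vec \<nu> V x\<bar> * sqrt (kernel (upper_band \<nu>) V x x) \<partial>sites)\<^sup>2"
proof -
  note cX = countable_Zd[of d]
  have \<psi>: "integrable sites (Y_vec (lower_band \<nu>) V)"
    using integrable_integral_count_space[OF cX cX i] by (simp add: Y_vec_def[abs_def])
  have "Y_quad (upper_band \<nu>) (lower_band \<nu>) V
      = (\<integral>p. kernel (upper_band \<nu>) V (fst p) (snd p) * (position_vec \<nu> V (fst p) * position_vec \<nu> V (snd p)) \<partial>site_pairs)"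
    unfolding Y_quad_def
    by (rule integral_kernel_quadratic_cong[OF cX \<psi> \<phi> abs_kernel_upper_band_le kernel_sym[OF bdd_borel_upper_band]
          integral_upper_band_Y_vec[OF \<phi>]])
  also have "\<dots> \<le> (\<integral>x. \<bar>position_vec \<nu> V x\<bar> * sqrt (kernel (upper_band \<nu>) V x x) \<partial>sites)\<^sup>2"
  proof (rule integral_kernel_quadratic_le[where k="kernel (upper_band \<nu>) V", OF cX \<phi> abs_kernel_upper_band_le _ integrable_position_weight[OF \<phi>]])
    fix x y assume "x \<in> X" "y \<in> X"
    from real_sqrt_le_mono[OF kernel_Cauchy_Schwarz[OF bdd_borel_upper_band upper_band_range(1) this, of \<nu> V]]
    show "\<bar>kernel (upper_band \<nu>) V x y\<bar> \<le> sqrt (kernel (upper_band \<nu>) V x x) * sqrt (kernel (upper_band \<nu>) V y y)"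
      by (simp add: real_sqrt_mult)
  qed
  finally show ?thesis .
qed

abbreviation "band \<nu> \<equiv> indicator {EF - \<nu><..EF + \<nu>} :: real \<Rightarrow> real"

lemma bdd_borel_band: "bdd_borel (band \<nu>)" by (rule bdd_borel_indicator) simp

lemma spec_det_band_nonneg:
  assumes V: "admissible V" and j: "j \<in> X" "k \<in> X"
  shows "0 \<le> spec_det d V (band \<nu>) j k"
  using kernel_Cauchy_Schwarz[OF bdd_borel_band _ j, of \<nu> V] unfolding spec_det_def kernel_eq_spec_form[OF V] by simp

lemma upper_lower_diag_le_spec_det:
  assumes V: "admissible V" and \<nu>: "0 \<le> \<nu>" and j: "j \<in> X" "k \<in> X"
  shows "kernel (upper_band \<nu>) V j j * kernel (lower_band \<nu>) V k k
    \<le> spec_det d V (band \<nu>) j k + 2 * (kernel (upper_band \<nu>) V j k * kernel (lower_band \<nu>) V j k)"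
proof -
  have split: "band \<nu> = (\<lambda>t. upper_band \<nu> t + lower_band \<nu> t)"
    using \<nu> by (auto simp: upper_band_def lower_band_def indicator_def fun_eq_iff)
  have e: "spec_form d V (band \<nu>) (kron x) (kron y) = kernel (upper_band \<nu>) V x y + kernel (lower_band \<nu>) V x y"
    if "x \<in> X" "y \<in> X" for x y
    using kernel_add[OF bdd_borel_upper_band bdd_borel_lower_band that, of \<nu> \<nu> V] by (simp add: split kernel_eq_spec_form[OF V])
  have "(kernel (upper_band \<nu>) V j k)\<^sup>2 \<le> kernel (upper_band \<nu>) V j j * kernel (upper_band \<nu>) V k k"
    "(kernel (lower_band \<nu>) V j k)\<^sup>2 \<le> kernel (lower_band \<nu>) V j j * kernel (lower_band \<nu>) V k k"
    by (intro kernel_Cauchy_Schwarz bdd_borel_upper_band bdd_borel_lower_band upper_band_range lower_band_range j)+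
  moreover have "0 \<le> kernel (lower_band \<nu>) V j j * kernel (upper_band \<nu>) V k k"
    by (intro mult_nonneg_nonneg kernel_nonneg bdd_borel_upper_band bdd_borel_lower_band upper_band_range lower_band_range j)
  ultimately show ?thesis
    unfolding spec_det_def e[OF j(1,1)] e[OF j(2,2)] e[OF j] by (simp add: algebra_simps power2_eq_square)
qed

lemma sum_lower_band_square_le:
  assumes S: "finite S" "S \<subseteq> X"
  shows "(\<Sum>x\<in>S. \<bar>kernel (lower_band \<nu>) V x origin\<bar>\<^sup>2) \<le> kernel (lower_band \<nu>) V origin origin"
proof -
  let ?m = "kernel (lower_band \<nu>) V"
  note mult = kernel_mult[OF bdd_borel_lower_band[of \<nu>] bdd_borel_lower_band[of \<nu>] zero_Zd zero_Zd, of V, unfolded lower_band_square]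
    and i_mult = integrable_kernel_mult[OF bdd_borel_lower_band[of \<nu>] bdd_borel_lower_band[of \<nu>] zero_Zd zero_Zd, of V]
  have sq: "?m origin x * ?m x origin = \<bar>?m x origin\<bar>\<^sup>2" if "x \<in> X" for x
    using kernel_sym[OF bdd_borel_lower_band zero_Zd that, of \<nu> V] by (simp add: power2_eq_square)
  have "(\<Sum>x\<in>S. \<bar>?m x origin\<bar>\<^sup>2) = (\<Sum>x\<in>S. ?m origin x * ?m x origin)" using sq S by (intro sum.cong) auto
  also have "\<dots> \<le> (\<Sum>x\<in>S. ?m origin x * ?m x origin) + (\<integral>x. ?m origin x * ?m x origin \<partial>count_space (X - S))"
    using sq by (simp add: integral_nonneg_AE AE_count_space)
  also have "\<dots> = ?m origin origin" using integral_count_space_split(1)[OF i_mult S] mult by simp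
  finally show ?thesis .
qed

lemma sum_upper_lower_le_tail:
  assumes S: "finite S" "S \<subseteq> X"
  shows "(\<Sum>j\<in>S. kernel (upper_band \<nu>) V origin j * kernel (lower_band \<nu>) V j origin)
    \<le> (\<integral>j. \<bar>kernel (upper_band \<nu>) V origin j * kernel (lower_band \<nu>) V j origin\<bar> \<partial>count_space (X - S))"
proof -
  let ?t = "\<lambda>j. kernel (upper_band \<nu>) V origin j * kernel (lower_band \<nu>) V j origin"
  have "(\<lambda>t. upper_band \<nu> t * lower_band \<nu> t) = (\<lambda>t. 0)" by (auto simp: upper_band_def lower_band_def indicator_def)
  then have "(\<integral>j. ?t j \<partial>sites) = 0"
    using kernel_mult[OF bdd_borel_upper_band[of \<nu>] bdd_borel_lower_band[of \<nu>] zero_Zd zero_Zd, of V]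
    by (simp add: kernel_zero zero_Zd)
  then have "(\<Sum>j\<in>S. ?t j) = - (\<integral>j. ?t j \<partial>count_space (X - S))"
    using integral_count_space_split(1)[OF integrable_kernel_mult[OF bdd_borel_upper_band bdd_borel_lower_band zero_Zd zero_Zd] S]
    by simp
  also have "\<dots> \<le> (\<integral>j. \<bar>?t j\<bar> \<partial>count_space (X - S))" using integral_abs_bound[of "count_space (X - S)" ?t] by linarith
  finally show ?thesis .
qed

lemma lower_band_mult_sum_upper_band_le:
  assumes V: "admissible V" and \<nu>: "0 \<le> \<nu>" and S: "finite S" "S \<subseteq> X"
  shows "kernel (lower_band \<nu>) V origin origin * (\<Sum>x\<in>S. kernel (upper_band \<nu>) V x x)
    \<le> (\<Sum>j\<in>S. spec_det d V (band \<nu>) j origin)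
      + 2 * (\<integral>j. \<bar>kernel (upper_band \<nu>) V origin j * kernel (lower_band \<nu>) V j origin\<bar> \<partial>count_space (X - S))"
proof -
  let ?p = "kernel (upper_band \<nu>) V" and ?m = "kernel (lower_band \<nu>) V"
  have "?m origin origin * (\<Sum>x\<in>S. ?p x x) = (\<Sum>j\<in>S. ?p j j * ?m origin origin)" by (simp add: sum_distrib_left mult.commute)
  also have "\<dots> \<le> (\<Sum>j\<in>S. spec_det d V (band \<nu>) j origin + 2 * (?p origin j * ?m j origin))"
  proof (rule sum_mono)
    fix j assume "j \<in> S"
    then have j: "j \<in> X" using S by auto
    show "?p j j * ?m origin origin \<le> spec_det d V (band \<nu>) j origin + 2 * (?p origin j * ?m j origin)"
      using upper_lower_diag_le_spec_det[OF V \<nu> j zero_Zd] kernel_sym[OF bdd_borel_upper_band zero_Zd j, of \<nu> V] by simp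
  qed
  also have "\<dots> = (\<Sum>j\<in>S. spec_det d V (band \<nu>) j origin) + 2 * (\<Sum>j\<in>S. ?p origin j * ?m j origin)"
    by (simp add: sum.distrib sum_distrib_left)
  finally show ?thesis using sum_upper_lower_le_tail[OF S, of \<nu> V] by linarith
qed

lemma sum_position_weight_square_le:
  shows "(\<Sum>x\<in>box d L. \<bar>position_vec \<nu> V x\<bar> * sqrt (kernel (upper_band \<nu>) V x x))\<^sup>2
    \<le> (real L)\<^sup>2 * (kernel (lower_band \<nu>) V origin origin * (\<Sum>x\<in>box d L. kernel (upper_band \<nu>) V x x))"
proof -
  let ?p = "kernel (upper_band \<nu>) V" and ?m = "kernel (lower_band \<nu>) V" and ?B = "box d L"
  note B = finite_box[of d L] box_subset_Zd[of d L]
  have p: "0 \<le> ?p x x" if "x \<in> ?B" for x using kernel_upper_band_diag that B by auto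
  have "(\<Sum>x\<in>?B. \<bar>position_vec \<nu> V x\<bar> * sqrt (?p x x)) \<le> (\<Sum>x\<in>?B. real L * (\<bar>?m x origin\<bar> * sqrt (?p x x)))"
  proof (rule sum_mono)
    fix x assume x: "x \<in> ?B"
    have "\<bar>real_of_int (x 0)\<bar> * (\<bar>?m x origin\<bar> * sqrt (?p x x)) \<le> real L * (\<bar>?m x origin\<bar> * sqrt (?p x x))"
      using abs_coord_le_box[OF x, of 0] d p[OF x] by (intro mult_right_mono) auto
    then show "\<bar>position_vec \<nu> V x\<bar> * sqrt (?p x x) \<le> real L * (\<bar>?m x origin\<bar> * sqrt (?p x x))"
      by (simp add: position_vec_def abs_mult mult.assoc)
  qed
  then have "(\<Sum>x\<in>?B. \<bar>position_vec \<nu> V x\<bar> * sqrt (?p x x))\<^sup>2 \<le> (real L * (\<Sum>x\<in>?B. \<bar>?m x origin\<bar> * sqrt (?p x x)))\<^sup>2"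
    using p by (intro power_mono) (auto simp: sum_distrib_left intro!: sum_nonneg)
  also have "\<dots> \<le> (real L)\<^sup>2 * ((\<Sum>x\<in>?B. \<bar>?m x origin\<bar>\<^sup>2) * (\<Sum>x\<in>?B. (sqrt (?p x x))\<^sup>2))"
    unfolding power_mult_distrib by (intro mult_left_mono Cauchy_Schwarz_ineq_sum) simp
  also have "(\<Sum>x\<in>?B. (sqrt (?p x x))\<^sup>2) = (\<Sum>x\<in>?B. ?p x x)" using p by (intro sum.cong) auto
  also have "(real L)\<^sup>2 * ((\<Sum>x\<in>?B. \<bar>?m x origin\<bar>\<^sup>2) * (\<Sum>x\<in>?B. ?p x x)) \<le> (real L)\<^sup>2 * (?m origin origin * (\<Sum>x\<in>?B. ?p x x))"
    using p by (intro mult_left_mono mult_right_mono sum_lower_band_square_le B) (auto intro!: sum_nonneg)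
  finally show ?thesis .
qed

lemma Y_quad_le:
  assumes V: "admissible V" and \<nu>: "0 \<le> \<nu>" and \<phi>: "integrable sites (position_vec \<nu> V)"
    and i: "integrable site_pairs (\<lambda>p. velocity V (fst p) (snd p) * kernel (lower_band \<nu>) V (snd p) origin)"
  shows "Y_quad (upper_band \<nu>) (lower_band \<nu>) V \<le> 2 * (real L)\<^sup>2 * (\<Sum>j\<in>box d L. spec_det d V (band \<nu>) j origin)
     + 4 * (real L)\<^sup>2 * (\<integral>j. \<bar>kernel (upper_band \<nu>) V origin j * kernel (lower_band \<nu>) V j origin\<bar> \<partial>count_space (X - box d L))
     + 2 * (\<integral>x. \<bar>position_vec \<nu> V x\<bar> \<partial>count_space (X - box d L))\<^sup>2"
proof -
  let ?B = "box d L" and ?w = "\<lambda>x. \<bar>position_vec \<nu> V x\<bar> * sqrt (kernel (upper_band \<nu>) V x x)"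
  let ?T = "\<integral>j. \<bar>kernel (upper_band \<nu>) V origin j * kernel (lower_band \<nu>) V j origin\<bar> \<partial>count_space (X - ?B)"
  note B = finite_box[of d L] box_subset_Zd[of d L]
  note split = integral_count_space_split[OF integrable_position_weight[OF \<phi>] B]
  have tail: "(\<integral>x. ?w x \<partial>count_space (X - ?B)) \<le> (\<integral>x. \<bar>position_vec \<nu> V x\<bar> \<partial>count_space (X - ?B))"
  proof (rule integral_mono[OF split(2)])
    show "integrable (count_space (X - ?B)) (\<lambda>x. \<bar>position_vec \<nu> V x\<bar>)"
      by (rule integrable_abs[OF integral_count_space_split(2)[OF \<phi> B]])
    fix x assume "x \<in> space (count_space (X - ?B))"
    then have "sqrt (kernel (upper_band \<nu>) V x x) \<le> 1" using kernel_upper_band_diag by simp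
    then show "?w x \<le> \<bar>position_vec \<nu> V x\<bar>" by (simp add: mult_left_le)
  qed
  have tail_nonneg: "0 \<le> (\<integral>x. ?w x \<partial>count_space (X - ?B))"
    using kernel_upper_band_diag by (intro integral_nonneg_AE) (simp add: AE_count_space)
  have head: "(\<Sum>x\<in>?B. ?w x)\<^sup>2 \<le> (real L)\<^sup>2 * ((\<Sum>j\<in>?B. spec_det d V (band \<nu>) j origin) + 2 * ?T)"
    by (rule order_trans[OF sum_position_weight_square_le mult_left_mono[OF lower_band_mult_sum_upper_band_le[OF V \<nu> B]]]) simp
  have "Y_quad (upper_band \<nu>) (lower_band \<nu>) V \<le> ((\<Sum>x\<in>?B. ?w x) + (\<integral>x. ?w x \<partial>count_space (X - ?B)))\<^sup>2"
    using Y_quad_le_square[OF \<phi> i] unfolding split(1) .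
  also have "\<dots> \<le> 2 * (\<Sum>x\<in>?B. ?w x)\<^sup>2 + 2 * (\<integral>x. ?w x \<partial>count_space (X - ?B))\<^sup>2"
    using sum_squares_bound[of "\<Sum>x\<in>?B. ?w x" "\<integral>x. ?w x \<partial>count_space (X - ?B)"] by (simp only: power2_sum)
  also have "\<dots> \<le> 2 * ((real L)\<^sup>2 * ((\<Sum>j\<in>?B. spec_det d V (band \<nu>) j origin) + 2 * ?T))
      + 2 * (\<integral>x. \<bar>position_vec \<nu> V x\<bar> \<partial>count_space (X - ?B))\<^sup>2"
    by (intro add_mono mult_left_mono head power_mono tail tail_nonneg) auto
  finally show ?thesis by (simp add: algebra_simps)
qed

end

section \<open>Averaging over the disorder\<close>

context fermi_level
begin

lemma E_abs_lower_band_le: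
  assumes \<nu>: "0 \<le> \<nu>" "a < EF - \<nu>" and x: "x \<in> X"
  shows "E_abs (\<lambda>V. kernel (lower_band \<nu>) V x origin) \<le> ennreal (2 * decay_const * decay x origin ^ 6)"
proof -
  have "EF - \<nu> \<in> {a<..<b}" using EF \<nu> by auto
  note le = E_abs_kernel_atMost_le[OF EF_in x zero_Zd] E_abs_kernel_atMost_le[OF this x zero_Zd]
  have "kernel (lower_band \<nu>) V x origin = 1 * kernel (indicator {..EF}) V x origin + (-1) * kernel (indicator {..EF - \<nu>}) V x origin" for V
    unfolding lower_band_eq_diff[OF \<nu>(1)] by (simp add: kernel_diff bdd_borel_atMost x zero_Zd)
  then show ?thesis
    using E_abs_linear_le[OF measurable_kernel measurable_kernel le, of 1 "-1"] decay_const_ge_1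
    by (simp add: bdd_borel_atMost x zero_Zd decay_nonneg mult.assoc)
qed

lemma measurable_lower_band: "x \<in> X \<Longrightarrow> (\<lambda>V. kernel (lower_band \<nu>) V x origin) \<in> borel_measurable \<Omega>"
  by (rule measurable_kernel[OF bdd_borel_lower_band _ zero_Zd])

lemma measurable_position_vec: "x \<in> X \<Longrightarrow> (\<lambda>V. position_vec \<nu> V x) \<in> borel_measurable \<Omega>"
  unfolding position_vec_def using measurable_lower_band by measurable

lemma E_abs_position_vec_le:
  assumes \<nu>: "0 \<le> \<nu>" "a < EF - \<nu>" and x: "x \<in> X"
  shows "E_abs (\<lambda>V. position_vec \<nu> V x) \<le> ennreal (1 / \<kappa> * (2 * decay_const) * decay x origin)"
proof -
  have "E_abs (\<lambda>V. position_vec \<nu> V x) \<le> ennreal (1 / \<kappa> * (2 * decay_const * decay x origin ^ 5))"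
    using E_abs_coord_mult_le[OF measurable_lower_band[OF x], where y=origin and B="2 * decay_const * decay x origin ^ 5"]
      E_abs_lower_band_le[OF \<nu> x] decay_const_ge_1
    by (simp add: position_vec_def decay_nonneg power_numeral_reduce mult_ac)
  also have "\<dots> \<le> ennreal (1 / \<kappa> * (2 * decay_const * decay x origin))"
    using power_decreasing[of 1 5 "decay x origin"] decay_const_ge_1 kappa_pos
    by (intro ennreal_leI mult_left_mono) (auto simp: decay_nonneg decay_le_1)
  finally show ?thesis by (simp add: mult.assoc)
qed

lemma nn_integral_scaled_decay:
  "0 \<le> A \<Longrightarrow> (\<integral>\<^sup>+x. ennreal (A * decay x origin) \<partial>sites) = ennreal (A * decay_sum)"
  by (simp add: ennreal_mult decay_nonneg nn_integral_cmult nn_integral_decay zero_Zd lattice_sum_nonneg)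

lemma AE_integrable_position_vec:
  assumes \<nu>: "0 \<le> \<nu>" "a < EF - \<nu>"
  shows "AE V in \<Omega>. integrable sites (position_vec \<nu> V)"
proof -
  have "(\<integral>\<^sup>+x. E_abs (\<lambda>V. position_vec \<nu> V x) \<partial>sites)
      \<le> (\<integral>\<^sup>+x. ennreal (1 / \<kappa> * (2 * decay_const) * decay x origin) \<partial>sites)"
    by (intro nn_integral_mono E_abs_position_vec_le \<nu>) simp
  also have "\<dots> < \<infinity>" by (subst nn_integral_scaled_decay) (use kappa_pos decay_const_ge_1 in auto)
  finally have "integrable (sites \<Otimes>\<^sub>M \<Omega>) (\<lambda>p. position_vec \<nu> (snd p) (fst p))"
    using measurable_position_vec by (intro P.integrable_pair_count_space[OF countable_Zd, where \<Psi>="\<lambda>x V. position_vec \<nu> V x"])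
  from P.AE_integrable_count_space[OF countable_Zd this] show ?thesis .
qed

lemma E_abs_velocity_lower_band_le:
  assumes \<nu>: "0 \<le> \<nu>" "a < EF - \<nu>" and x: "x \<in> X" and u: "u \<in> X"
  shows "E_abs (\<lambda>V. velocity V x u * kernel (lower_band \<nu>) V u origin)
    \<le> ennreal (1 / \<kappa> * (2 * decay_const) * (decay x u * decay u origin))"
proof -
  let ?F = "\<lambda>V. fermi_kernel V x u * kernel (lower_band \<nu>) V u origin"
  let ?B = "2 * decay_const * ((decay x u)\<^sup>2 * decay u origin ^ 3)"
  note D = decay_const_ge_1
  have "E_abs ?F \<le> ennreal (1 * (2 * decay_const) * (decay x u ^ 3 * decay u origin ^ 3))"
  proof (rule nn_integral_abs_mult_le[OF measurable_fermi_kernel[OF x u] measurable_lower_band[OF u]])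
    show "E_abs (\<lambda>V. fermi_kernel V x u) \<le> ennreal (2 * decay_const * (decay x u ^ 3)\<^sup>2)"
      using D by (intro order_trans[OF E_abs_fermi_kernel_le[OF x u]] ennreal_leI)
        (simp add: power_mult[symmetric] decay_nonneg mult_right_mono)
    show "E_abs (\<lambda>V. kernel (lower_band \<nu>) V u origin) \<le> ennreal (2 * decay_const * (decay u origin ^ 3)\<^sup>2)"
      using E_abs_lower_band_le[OF \<nu> u] by (simp add: power_mult[symmetric])
  qed (use D abs_fermi_kernel_le[OF x u] abs_kernel_lower_band_le[OF u zero_Zd] in \<open>auto simp: decay_nonneg\<close>)
  then have F: "E_abs ?F \<le> ennreal (decay x u * ?B)" by (simp add: power2_eq_square power3_eq_cube mult_ac)
  have meas: "?F \<in> borel_measurable \<Omega>" by (intro borel_measurable_times measurable_fermi_kernel measurable_lower_band x u)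
  have "E_abs (\<lambda>V. velocity V x u * kernel (lower_band \<nu>) V u origin) \<le> ennreal (1 / \<kappa> * ?B)"
    using E_abs_coord_mult_le[OF meas F] D by (simp add: velocity_def decay_nonneg mult.assoc)
  also have "\<dots> \<le> ennreal (1 / \<kappa> * (2 * decay_const * (decay x u * decay u origin)))"
    using power_decreasing[of 1 2 "decay x u"] power_decreasing[of 1 3 "decay u origin"] kappa_pos D
    by (intro ennreal_leI mult_left_mono mult_mono) (auto simp: decay_nonneg decay_le_1)
  finally show ?thesis by (simp add: mult.assoc)
qed

lemma AE_integrable_velocity_lower_band:
  assumes \<nu>: "0 \<le> \<nu>" "a < EF - \<nu>"
  shows "AE V in \<Omega>. integrable site_pairs (\<lambda>p. velocity V (fst p) (snd p) * kernel (lower_band \<nu>) V (snd p) origin)"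
proof -
  let ?\<Psi> = "\<lambda>p V. velocity V (fst p) (snd p) * kernel (lower_band \<nu>) V (snd p) origin"
  define A where "A = 1 / \<kappa> * (2 * decay_const)"
  have A: "0 \<le> A" using kappa_pos decay_const_ge_1 by (simp add: A_def)
  have cXX: "countable (X \<times> X)" by (intro countable_SIGMA countable_Zd)
  have "(\<integral>\<^sup>+p. E_abs (?\<Psi> p) \<partial>site_pairs)
      \<le> (\<integral>\<^sup>+p. ennreal (decay (fst p) (snd p)) * ennreal (A * decay (snd p) origin) \<partial>site_pairs)"
  proof (rule nn_integral_mono)
    fix p assume "p \<in> space site_pairs"
    then show "E_abs (?\<Psi> p) \<le> ennreal (decay (fst p) (snd p)) * ennreal (A * decay (snd p) origin)"
      using E_abs_velocity_lower_band_le[OF \<nu>, folded A_def, of "fst p" "snd p"] A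
      by (auto simp: ennreal_mult[symmetric] decay_nonneg mult_ac)
  qed
  also have "\<dots> = (\<integral>\<^sup>+u. (\<integral>\<^sup>+x. ennreal (decay x u) * ennreal (A * decay u origin) \<partial>sites) \<partial>sites)"
    by (simp add: nn_integral_count_space_Times_swap[OF countable_Zd countable_Zd])
  also have "\<dots> = (\<integral>\<^sup>+u. ennreal decay_sum * ennreal (A * decay u origin) \<partial>sites)"
    by (intro nn_integral_cong) (simp add: nn_integral_multc nn_integral_decay)
  also have "\<dots> = ennreal decay_sum * ennreal (A * decay_sum)"
    by (subst nn_integral_cmult) (simp_all only: nn_integral_scaled_decay[OF A] measurable_count_space_eq1 space_borel Pi_UNIV UNIV_I)
  also have "\<dots> < \<infinity>" by (simp add: ennreal_mult_less_top)
  finally have "integrable (site_pairs \<Otimes>\<^sub>M \<Omega>) (\<lambda>p. ?\<Psi> (fst p) (snd p))"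
    by (intro P.integrable_pair_count_space[OF cXX, where \<Psi>="?\<Psi>"])
      (auto intro!: borel_measurable_times measurable_velocity measurable_lower_band)
  from P.AE_integrable_count_space[OF cXX this] show ?thesis .
qed

lemma E_position_vec_pair_le:
  assumes \<nu>: "0 \<le> \<nu>" "a < EF - \<nu>" and x: "x \<in> X" and y: "y \<in> X"
  shows "(\<integral>\<^sup>+V. ennreal \<bar>position_vec \<nu> V x\<bar> * ennreal \<bar>position_vec \<nu> V y\<bar> \<partial>\<Omega>)
    \<le> ennreal (2 * decay_const / \<kappa>\<^sup>2 * ((decay x origin)\<^sup>2 * (decay y origin)\<^sup>2))"
proof -
  let ?m = "\<lambda>x V. kernel (lower_band \<nu>) V x origin" and ?p = "decay x origin" and ?q = "decay y origin"
  note D = decay_const_ge_1 and meas = measurable_lower_band[OF x] measurable_lower_band[OF y]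
  have "E_abs (\<lambda>V. ?m x V * ?m y V) \<le> ennreal (1 * (2 * decay_const) * (?p ^ 3 * ?q ^ 3))"
    using E_abs_lower_band_le[OF \<nu> x] E_abs_lower_band_le[OF \<nu> y] D
      abs_kernel_lower_band_le[OF x zero_Zd] abs_kernel_lower_band_le[OF y zero_Zd]
    by (intro nn_integral_abs_mult_le meas) (auto simp: power_mult[symmetric] decay_nonneg)
  then have "E_abs (\<lambda>V. ?m x V * ?m y V) \<le> ennreal (?q * (2 * decay_const * (?p ^ 3 * ?q\<^sup>2)))"
    by (simp add: power2_eq_square power3_eq_cube mult_ac)
  from E_abs_coord_mult_le[OF borel_measurable_times[OF meas] this]
  have "E_abs (\<lambda>V. real_of_int (y 0 - origin 0) * (?m x V * ?m y V)) \<le> ennreal (1 / \<kappa> * (2 * decay_const * (?p ^ 3 * ?q\<^sup>2)))"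
    using D by (simp add: decay_nonneg)
  also have "1 / \<kappa> * (2 * decay_const * (?p ^ 3 * ?q\<^sup>2)) = ?p * (1 / \<kappa> * (2 * decay_const * (?p\<^sup>2 * ?q\<^sup>2)))"
    by (simp add: power2_eq_square power3_eq_cube)
  finally have "E_abs (\<lambda>V. real_of_int (x 0 - origin 0) * (real_of_int (y 0 - origin 0) * (?m x V * ?m y V)))
      \<le> ennreal (1 / \<kappa> * (1 / \<kappa> * (2 * decay_const * (?p\<^sup>2 * ?q\<^sup>2))))"
    using D kappa_pos meas by (intro E_abs_coord_mult_le borel_measurable_times) (auto simp: decay_nonneg)
  then show ?thesis
    by (simp add: position_vec_def ennreal_mult[symmetric] abs_mult[symmetric] power2_eq_square mult_ac)
qed

lemma decay_outside_box: "x \<in> X - box d L \<Longrightarrow> decay x origin \<le> exp (- \<kappa> * real L)"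
  using zdist_ge_outside_box[of x d L] kappa_pos by (auto simp: decay_def)

lemma nn_integral_scaled_decay_subset_le:
  "0 \<le> A \<Longrightarrow> (\<integral>\<^sup>+x. ennreal (A * decay x origin) \<partial>count_space (X - S)) \<le> ennreal (A * decay_sum)"
  unfolding nn_integral_scaled_decay[symmetric]
  by (subst (1 2) nn_integral_count_space_indicator) (auto intro!: nn_integral_mono simp: indicator_def)

lemma E_overlap_tail_le:
  assumes \<nu>: "0 \<le> \<nu>" "a < EF - \<nu>"
  shows "(\<integral>\<^sup>+V. (\<integral>\<^sup>+j. ennreal \<bar>kernel (upper_band \<nu>) V origin j * kernel (lower_band \<nu>) V j origin\<bar>
      \<partial>count_space (X - box d L)) \<partial>\<Omega>) \<le> ennreal (2 * decay_const * exp (- \<kappa> * real L) ^ 5 * decay_sum)"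
proof -
  let ?t = "\<lambda>j V. kernel (upper_band \<nu>) V origin j * kernel (lower_band \<nu>) V j origin" and ?A = "X - box d L"
  let ?e = "exp (- \<kappa> * real L)"
  have meas: "?t j \<in> borel_measurable \<Omega>" if "j \<in> ?A" for j
    using that by (intro borel_measurable_times measurable_kernel bdd_borel_upper_band bdd_borel_lower_band zero_Zd) auto
  have "(\<integral>\<^sup>+V. (\<integral>\<^sup>+j. ennreal \<bar>?t j V\<bar> \<partial>count_space ?A) \<partial>\<Omega>) = (\<integral>\<^sup>+j. E_abs (?t j) \<partial>count_space ?A)"
    using meas by (intro nn_integral_count_space_nn_integral countable_Diff countable_Zd) auto
  also have "\<dots> \<le> (\<integral>\<^sup>+j. ennreal (2 * decay_const * ?e ^ 5 * decay j origin) \<partial>count_space ?A)"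
  proof (rule nn_integral_mono)
    fix j assume "j \<in> space (count_space ?A)"
    then have jA: "j \<in> ?A" and j: "j \<in> X" by auto
    have "E_abs (?t j) \<le> E_abs (\<lambda>V. kernel (lower_band \<nu>) V j origin)"
      by (intro nn_integral_mono ennreal_leI)
        (simp add: abs_mult mult_left_le_one_le abs_kernel_upper_band_le[OF zero_Zd j])
    also have "\<dots> \<le> ennreal (2 * decay_const * decay j origin ^ 6)" by (rule E_abs_lower_band_le[OF \<nu> j])
    also have "\<dots> = ennreal (2 * decay_const * (decay j origin ^ 5 * decay j origin))"
      by (simp add: power_numeral_reduce mult_ac)
    also have "\<dots> \<le> ennreal (2 * decay_const * (?e ^ 5 * decay j origin))"
      using decay_const_ge_1
      by (intro ennreal_leI mult_left_mono mult_right_mono power_mono decay_outside_box[OF jA]) (auto simp: decay_nonneg)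
    finally show "E_abs (?t j) \<le> ennreal (2 * decay_const * ?e ^ 5 * decay j origin)" by (simp add: mult.assoc)
  qed
  also have "\<dots> \<le> ennreal (2 * decay_const * ?e ^ 5 * decay_sum)"
    by (rule nn_integral_scaled_decay_subset_le) (use decay_const_ge_1 in simp)
  finally show ?thesis .
qed

lemma E_position_tail_square_le:
  assumes \<nu>: "0 \<le> \<nu>" "a < EF - \<nu>"
  shows "(\<integral>\<^sup>+V. (\<integral>\<^sup>+x. ennreal \<bar>position_vec \<nu> V x\<bar> \<partial>count_space (X - box d L))\<^sup>2 \<partial>\<Omega>)
     \<le> ennreal (2 * decay_const / \<kappa>\<^sup>2 * (exp (- \<kappa> * real L) * decay_sum)\<^sup>2)"
proof -
  let ?A = "X - box d L" and ?e = "exp (- \<kappa> * real L)"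
  have cA: "countable ?A" by (intro countable_Diff countable_Zd)
  define c where "c = 2 * decay_const / \<kappa>\<^sup>2"
  have c: "0 \<le> c" using decay_const_ge_1 by (simp add: c_def)
  have "(\<integral>\<^sup>+V. (\<integral>\<^sup>+x. ennreal \<bar>position_vec \<nu> V x\<bar> \<partial>count_space ?A)\<^sup>2 \<partial>\<Omega>)
      = (\<integral>\<^sup>+V. (\<integral>\<^sup>+p. ennreal \<bar>position_vec \<nu> V (fst p)\<bar> * ennreal \<bar>position_vec \<nu> V (snd p)\<bar> \<partial>count_space (?A \<times> ?A)) \<partial>\<Omega>)"
    by (simp add: nn_integral_count_space_Times[OF cA cA] nn_integral_cmult nn_integral_multc power2_eq_square)
  also have "\<dots> = (\<integral>\<^sup>+p. (\<integral>\<^sup>+V. ennreal \<bar>position_vec \<nu> V (fst p)\<bar> * ennreal \<bar>position_vec \<nu> V (snd p)\<bar> \<partial>\<Omega>) \<partial>count_space (?A \<times> ?A))"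
  proof (rule nn_integral_count_space_nn_integral)
    fix p assume "p \<in> ?A \<times> ?A"
    then have "fst p \<in> X" "snd p \<in> X" by auto
    note [measurable] = this[THEN measurable_position_vec]
    show "(\<lambda>V. ennreal \<bar>position_vec \<nu> V (fst p)\<bar> * ennreal \<bar>position_vec \<nu> V (snd p)\<bar>) \<in> borel_measurable \<Omega>" by measurable
  qed (intro countable_SIGMA cA)
  also have "\<dots> \<le> (\<integral>\<^sup>+p. ennreal c * (ennreal (?e * decay (fst p) origin) * ennreal (?e * decay (snd p) origin)) \<partial>count_space (?A \<times> ?A))"
  proof (rule nn_integral_mono)
    fix p assume "p \<in> space (count_space (?A \<times> ?A))"
    then have p: "fst p \<in> ?A" "snd p \<in> ?A" by auto
    then have "(\<integral>\<^sup>+V. ennreal \<bar>position_vec \<nu> V (fst p)\<bar> * ennreal \<bar>position_vec \<nu> V (snd p)\<bar> \<partial>\<Omega>)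
        \<le> ennreal (c * ((decay (fst p) origin)\<^sup>2 * (decay (snd p) origin)\<^sup>2))"
      by (intro E_position_vec_pair_le[folded c_def] \<nu>) auto
    also have "\<dots> \<le> ennreal (c * ((?e * decay (fst p) origin) * (?e * decay (snd p) origin)))"
      unfolding power2_eq_square using decay_outside_box p c
      by (intro ennreal_leI mult_left_mono mult_mono) (auto simp: decay_nonneg)
    finally show "(\<integral>\<^sup>+V. ennreal \<bar>position_vec \<nu> V (fst p)\<bar> * ennreal \<bar>position_vec \<nu> V (snd p)\<bar> \<partial>\<Omega>)
        \<le> ennreal c * (ennreal (?e * decay (fst p) origin) * ennreal (?e * decay (snd p) origin))"
      using c by (simp add: ennreal_mult[symmetric] decay_nonneg)
  qed
  also have "\<dots> = ennreal c * (\<integral>\<^sup>+x. ennreal (?e * decay x origin) \<partial>count_space ?A)\<^sup>2"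
    by (simp add: nn_integral_count_space_Times[OF cA cA] nn_integral_cmult nn_integral_multc power2_eq_square)
  also have "\<dots> \<le> ennreal c * (ennreal (?e * decay_sum))\<^sup>2"
    by (intro mult_left_mono power_mono nn_integral_scaled_decay_subset_le) auto
  also have "\<dots> = ennreal (c * (?e * decay_sum)\<^sup>2)"
    using c lattice_sum_nonneg[of d \<kappa>] by (simp add: ennreal_mult[symmetric] ennreal_power)
  finally show ?thesis unfolding c_def .
qed

lemma sum_E_spec_det_le:
  assumes "0 < \<nu>"
  shows "(\<Sum>j\<in>box d L. \<integral>\<^sup>+V. ennreal (spec_det d V (band \<nu>) j origin) \<partial>\<Omega>)
    \<le> ennreal (real ((2 * L + 1) ^ d) * (4 * \<nu>\<^sup>2 * pi\<^sup>2 * rho_sup\<^sup>2))"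
proof -
  have "(\<Sum>j\<in>box d L. \<integral>\<^sup>+V. ennreal (spec_det d V (band \<nu>) j origin) \<partial>\<Omega>) \<le> (\<Sum>j\<in>box d L. ennreal (4 * \<nu>\<^sup>2 * pi\<^sup>2 * rho_sup\<^sup>2))"
    by (intro sum_mono minami[OF assms _ zero_Zd]) (use box_subset_Zd[of d L] in auto)
  also have "\<dots> = ennreal (real (card (box d L)) * (4 * \<nu>\<^sup>2 * pi\<^sup>2 * rho_sup\<^sup>2))" by (subst sum_ennreal) auto
  also have "\<dots> \<le> ennreal (real ((2 * L + 1) ^ d) * (4 * \<nu>\<^sup>2 * pi\<^sup>2 * rho_sup\<^sup>2))"
    using card_box[of d L] by (intro ennreal_leI mult_right_mono) (auto simp only: of_nat_le_iff, simp)
  finally show ?thesis .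
qed

lemma ennreal_Y_quad_le:
  assumes V: "admissible V" and \<nu>: "0 \<le> \<nu>" and \<phi>: "integrable sites (position_vec \<nu> V)"
    and i: "integrable site_pairs (\<lambda>p. velocity V (fst p) (snd p) * kernel (lower_band \<nu>) V (snd p) origin)"
  shows "ennreal (Y_quad (upper_band \<nu>) (lower_band \<nu>) V)
    \<le> ennreal (2 * (real L)\<^sup>2) * (\<Sum>j\<in>box d L. ennreal (spec_det d V (band \<nu>) j origin))
      + ennreal (4 * (real L)\<^sup>2) * (\<integral>\<^sup>+j. ennreal \<bar>kernel (upper_band \<nu>) V origin j * kernel (lower_band \<nu>) V j origin\<bar>
          \<partial>count_space (X - box d L)) + ennreal 2 * (\<integral>\<^sup>+x. ennreal \<bar>position_vec \<nu> V x\<bar> \<partial>count_space (X - box d L))\<^sup>2"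
proof -
  let ?A = "X - box d L" and ?t = "\<lambda>j. kernel (upper_band \<nu>) V origin j * kernel (lower_band \<nu>) V j origin"
  note B = finite_box[of d L] box_subset_Zd[of d L]
  have "integrable (count_space ?A) (\<lambda>j. \<bar>?t j\<bar>)"
    by (intro integrable_abs integral_count_space_split(2)[OF integrable_kernel_mult B]
        bdd_borel_upper_band bdd_borel_lower_band zero_Zd)
  then have overlap: "(\<integral>\<^sup>+j. ennreal \<bar>?t j\<bar> \<partial>count_space ?A) = ennreal (\<integral>j. \<bar>?t j\<bar> \<partial>count_space ?A)"
    by (rule nn_integral_eq_integral) simp
  have position: "(\<integral>\<^sup>+x. ennreal \<bar>position_vec \<nu> V x\<bar> \<partial>count_space ?A) = ennreal (\<integral>x. \<bar>position_vec \<nu> V x\<bar> \<partial>count_space ?A)"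
    by (rule nn_integral_eq_integral) (intro integrable_abs integral_count_space_split(2)[OF \<phi> B], simp)
  have "0 \<le> spec_det d V (band \<nu>) j origin" if "j \<in> box d L" for j
    by (rule spec_det_band_nonneg[OF V _ zero_Zd]) (use that B in auto)
  then show ?thesis
    unfolding overlap position using ennreal_leI[OF Y_quad_le[OF V \<nu> \<phi> i, of L]]
    by (simp add: ennreal_plus ennreal_mult sum_nonneg ennreal_power sum_ennreal del: ennreal_numeral)
qed

lemma Y_form_bands_le:
  assumes \<nu>: "0 < \<nu>" "EF + \<nu> < b" "a < EF - \<nu>"
  shows "Y_form (upper_band \<nu>) (lower_band \<nu>) \<le> 2 * (real L)\<^sup>2 * (real ((2 * L + 1) ^ d) * (4 * \<nu>\<^sup>2 * pi\<^sup>2 * rho_sup\<^sup>2))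
      + 4 * (real L)\<^sup>2 * (2 * decay_const * exp (- \<kappa> * real L) ^ 5 * decay_sum)
      + 2 * (2 * decay_const / \<kappa>\<^sup>2 * (exp (- \<kappa> * real L) * decay_sum)\<^sup>2)"
    (is "_ \<le> ?c1 * ?r1 + ?c2 * ?r2 + 2 * ?r3")
proof -
  have \<nu>0: "0 \<le> \<nu>" using \<nu> by simp
  have ennreal_collect: "ennreal p * ennreal q + ennreal r * ennreal s + ennreal u * ennreal v = ennreal (p * q + r * s + u * v)"
    if "0 \<le> p" "0 \<le> q" "0 \<le> r" "0 \<le> s" "0 \<le> u" "0 \<le> v" for p q r s u v
    using that by (simp add: ennreal_mult)
  let ?D = "\<lambda>V. \<Sum>j\<in>box d L. ennreal (spec_det d V (band \<nu>) j origin)"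
  let ?T1 = "\<lambda>V. \<integral>\<^sup>+j. ennreal \<bar>kernel (upper_band \<nu>) V origin j * kernel (lower_band \<nu>) V j origin\<bar> \<partial>count_space (X - box d L)"
  let ?T2 = "\<lambda>V. \<integral>\<^sup>+x. ennreal \<bar>position_vec \<nu> V x\<bar> \<partial>count_space (X - box d L)"
  note upper = mean_decay_upper_band[OF \<nu>0 \<nu>(2)] and lower = bdd_borel_lower_band[of \<nu>]
  note overlap_meas = borel_measurable_times[OF measurable_kernel[OF bdd_borel_upper_band zero_Zd] measurable_lower_band]
  have [measurable]: "?T1 \<in> borel_measurable \<Omega>" "?T2 \<in> borel_measurable \<Omega>"
    by (intro P.measurable_nn_integral_count_space countable_Diff countable_Zd measurable_compose[OF _ measurable_ennreal]
        borel_measurable_abs overlap_meas measurable_position_vec; simp)+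
  have [measurable]: "(\<lambda>V. spec_det d V (band \<nu>) j origin) \<in> borel_measurable \<Omega>" if "j \<in> box d L" for j
    using that box_subset_Zd[of d L] by (intro measurable_spec_det bdd_borel_band zero_Zd) auto
  have "Y_form (upper_band \<nu>) (lower_band \<nu>) = (\<integral>V. Y_quad (upper_band \<nu>) (lower_band \<nu>) V \<partial>\<Omega>)"
    using Y_form_eq_integral_Y_quad[OF upper lower] by (simp add: lower_band_square)
  then have "ennreal (Y_form (upper_band \<nu>) (lower_band \<nu>)) = (\<integral>\<^sup>+V. ennreal (Y_quad (upper_band \<nu>) (lower_band \<nu>) V) \<partial>\<Omega>)"
    by (simp add: nn_integral_eq_integral[OF integrable_Y_quad AE_Y_quad_nonneg] upper lower upper_band_range)
  also have "\<dots> \<le> (\<integral>\<^sup>+V. ennreal ?c1 * ?D V + ennreal ?c2 * ?T1 V + ennreal 2 * (?T2 V)\<^sup>2 \<partial>\<Omega>)"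
    using AE_admissible AE_integrable_position_vec[OF \<nu>0 \<nu>(3)] AE_integrable_velocity_lower_band[OF \<nu>0 \<nu>(3)]
    by (intro nn_integral_mono_AE, eventually_elim) (rule ennreal_Y_quad_le[OF _ \<nu>0])
  also have "\<dots> = ennreal ?c1 * (\<Sum>j\<in>box d L. \<integral>\<^sup>+V. ennreal (spec_det d V (band \<nu>) j origin) \<partial>\<Omega>)
      + ennreal ?c2 * (\<integral>\<^sup>+V. ?T1 V \<partial>\<Omega>) + ennreal 2 * (\<integral>\<^sup>+V. (?T2 V)\<^sup>2 \<partial>\<Omega>)"
    by (simp add: nn_integral_add nn_integral_cmult nn_integral_sum del: ennreal_numeral)
  also have "\<dots> \<le> ennreal ?c1 * ennreal ?r1 + ennreal ?c2 * ennreal ?r2 + ennreal 2 * ennreal ?r3"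
    by (intro add_mono mult_left_mono sum_E_spec_det_le[OF \<nu>(1)] E_overlap_tail_le[OF \<nu>0 \<nu>(3)] E_position_tail_square_le[OF \<nu>0 \<nu>(3)]) auto
  also have "\<dots> = ennreal (?c1 * ?r1 + ?c2 * ?r2 + 2 * ?r3)"
    by (rule ennreal_collect) (use decay_const_ge_1 lattice_sum_nonneg[of d \<kappa>] in auto)
  finally show ?thesis
    by (rule ennreal_le_iff[THEN iffD1, rotated]) (use decay_const_ge_1 lattice_sum_nonneg[of d \<kappa>] in simp)
qed

end

section \<open>The low-frequency limit\<close>

lemma box_term_scaled_le:
  fixes l t \<nu> r :: real and L d :: nat
  assumes L: "real L \<le> 13 * (l * t)" "real (2 * L + 1) \<le> 27 * (l * t)"
  shows "2 * (real L)\<^sup>2 * (real ((2 * L + 1) ^ d) * (4 * \<nu>\<^sup>2 * pi\<^sup>2 * r\<^sup>2))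
    \<le> 1352 * 27 ^ d * pi\<^sup>2 * r\<^sup>2 * l ^ (d + 2) * (\<nu>\<^sup>2 * t ^ (d + 2))"
proof -
  have "(real L)\<^sup>2 * real ((2 * L + 1) ^ d) \<le> (13 * (l * t))\<^sup>2 * (27 * (l * t)) ^ d"
    unfolding of_nat_power using L by (intro mult_mono power_mono) auto
  then have "(real L)\<^sup>2 * real ((2 * L + 1) ^ d) * (8 * \<nu>\<^sup>2 * pi\<^sup>2 * r\<^sup>2)
      \<le> (13 * (l * t))\<^sup>2 * (27 * (l * t)) ^ d * (8 * \<nu>\<^sup>2 * pi\<^sup>2 * r\<^sup>2)"
    by (rule mult_right_mono) simp
  also have "\<dots> = 1352 * 27 ^ d * pi\<^sup>2 * r\<^sup>2 * l ^ (d + 2) * (\<nu>\<^sup>2 * t ^ (d + 2))"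
    by (simp add: power_mult_distrib power_add power2_eq_square mult_ac)
  finally show ?thesis by (simp add: mult_ac)
qed

lemma overlap_term_scaled_le:
  fixes l t \<nu> e K S :: real and L d :: nat
  assumes L: "real L \<le> 13 * (l * t)" and t: "1 \<le> t" and e: "0 \<le> e" "e \<le> \<nu>" and \<nu>: "\<nu> \<le> 1" and K: "0 \<le> K" "0 \<le> S"
  shows "4 * (real L)\<^sup>2 * (2 * K * e ^ 5 * S) \<le> 1352 * l\<^sup>2 * K * S * \<nu> * (\<nu>\<^sup>2 * t ^ (d + 2))"
proof -
  have "(real L)\<^sup>2 \<le> (13 * (l * t))\<^sup>2" using L by (rule power_mono) simp
  also have "\<dots> \<le> 169 * (l\<^sup>2 * t ^ (d + 2))"
    using power_increasing[of 2 "d + 2" t] t by (simp add: power_mult_distrib mult_left_mono)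
  finally have L_sq: "(real L)\<^sup>2 \<le> 169 * (l\<^sup>2 * t ^ (d + 2))" .
  have "e ^ 5 \<le> \<nu> ^ 5" using e by (intro power_mono) auto
  also have "\<dots> \<le> \<nu> ^ 3" using e \<nu> by (intro power_decreasing) auto
  finally have "(real L)\<^sup>2 * e ^ 5 \<le> (169 * (l\<^sup>2 * t ^ (d + 2))) * \<nu> ^ 3"
    using L_sq e t by (intro mult_mono) auto
  then have "(real L)\<^sup>2 * e ^ 5 * (8 * K * S) \<le> (169 * (l\<^sup>2 * t ^ (d + 2))) * \<nu> ^ 3 * (8 * K * S)"
    by (rule mult_right_mono) (use K in simp)
  also have "\<dots> = 1352 * l\<^sup>2 * K * S * \<nu> * (\<nu>\<^sup>2 * t ^ (d + 2))" by (simp add: power2_eq_square power3_eq_cube mult_ac)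
  finally show ?thesis by (simp only: mult_ac)
qed

lemma position_term_scaled_le:
  fixes t \<nu> e K S :: real and d :: nat
  assumes t: "1 \<le> t" and e: "0 \<le> e" "e \<le> \<nu>" and K: "0 \<le> K"
  shows "2 * (2 * K / \<kappa>\<^sup>2 * (e * S)\<^sup>2) \<le> 4 * K / \<kappa>\<^sup>2 * S\<^sup>2 * (1 / t) * (\<nu>\<^sup>2 * t ^ (d + 2))"
proof -
  have "1 \<le> t ^ (d + 2) / t" using t power_increasing[of 1 "d + 2" t] by simp
  then have "e\<^sup>2 * 1 \<le> \<nu>\<^sup>2 * (t ^ (d + 2) / t)" using e by (intro mult_mono power_mono) auto
  then have "e\<^sup>2 * (4 * K / \<kappa>\<^sup>2 * S\<^sup>2) \<le> \<nu>\<^sup>2 * (t ^ (d + 2) / t) * (4 * K / \<kappa>\<^sup>2 * S\<^sup>2)"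
    using K by (intro mult_right_mono) auto
  also have "\<dots> = 4 * K / \<kappa>\<^sup>2 * S\<^sup>2 * (1 / t) * (\<nu>\<^sup>2 * t ^ (d + 2))" by simp
  finally show ?thesis by (simp add: power_mult_distrib mult_ac)
qed

context fermi_level
begin

text \<open>The box of side \<open>L = \<lceil>12 l ln (1/\<nu>)\<rceil>\<close> makes both tails negligible: \<open>\<kappa> L \<ge> ln (1/\<nu>)\<close>.\<close>

lemma sigma_in_scaled_le:
  assumes \<nu>: "0 < \<nu>" "EF + \<nu> < b" "a < EF - \<nu>" and ln: "1 \<le> ln (1/\<nu>)" "1 \<le> l * ln (1/\<nu>)"
  shows "sigma_in d \<rho> EF \<nu> / (\<nu>\<^sup>2 * ln (1/\<nu>) ^ (d + 2)) \<le> 1352 * 27 ^ d * pi ^ 3 * rho_sup\<^sup>2 * l ^ (d + 2)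
    + pi * (1352 * l\<^sup>2 * decay_const * decay_sum) * \<nu> + pi * (4 * decay_const / \<kappa>\<^sup>2 * decay_sum\<^sup>2) * (1 / ln (1/\<nu>))"
proof -
  define t where "t = ln (1/\<nu>)"
  define L where "L = nat \<lceil>12 * l * t\<rceil>"
  let ?e = "exp (- \<kappa> * real L)" and ?N = "\<nu>\<^sup>2 * t ^ (d + 2)"
  let ?c1 = "1352 * 27 ^ d * pi\<^sup>2 * rho_sup\<^sup>2 * l ^ (d + 2)" and ?c2 = "1352 * l\<^sup>2 * decay_const * decay_sum * \<nu>"
    and ?c3 = "4 * decay_const / \<kappa>\<^sup>2 * decay_sum\<^sup>2 * (1 / t)"
  have t: "1 \<le> t" "1 \<le> l * t" using ln by (simp_all add: t_def)
  have \<nu>_eq: "\<nu> = exp (- t)" using \<nu>(1) by (simp add: t_def ln_div)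
  have "0 \<le> 12 * l * t" using t l by simp
  then have L: "12 * l * t \<le> real L" "real L \<le> 12 * l * t + 1" unfolding L_def by linarith+
  have L_le: "real L \<le> 13 * (l * t)" "real (2 * L + 1) \<le> 27 * (l * t)" using L(2) t by simp_all
  have "\<kappa> * (12 * l * t) \<le> \<kappa> * real L" using L(1) kappa_pos by (intro mult_left_mono) auto
  moreover have "\<kappa> * (12 * l * t) = t" using l by (simp add: \<kappa>_def)
  ultimately have e: "?e \<le> \<nu>" unfolding \<nu>_eq by simp
  have \<nu>1: "\<nu> \<le> 1" using t \<nu>_eq by simp
  have D: "0 \<le> decay_const" using decay_const_ge_1 by simp
  have "Y_form (upper_band \<nu>) (lower_band \<nu>) \<le> ?c1 * ?N + ?c2 * ?N + ?c3 * ?N"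
    by (rule order_trans[OF Y_form_bands_le[OF \<nu>, of L]])
      (intro add_mono box_term_scaled_le overlap_term_scaled_le position_term_scaled_le L_le e \<nu>1 t D lattice_sum_nonneg; simp)
  then have "pi * Y_form (upper_band \<nu>) (lower_band \<nu>) \<le> pi * (?c1 * ?N + ?c2 * ?N + ?c3 * ?N)"
    by (rule mult_left_mono) simp
  with sigma_in_le_Y_form[OF \<nu>] have "sigma_in d \<rho> EF \<nu> \<le> pi * (?c1 * ?N + ?c2 * ?N + ?c3 * ?N)"
    by (rule order_trans)
  also have "\<dots> = (1352 * 27 ^ d * pi ^ 3 * rho_sup\<^sup>2 * l ^ (d + 2) + pi * (1352 * l\<^sup>2 * decay_const * decay_sum) * \<nu>
      + pi * (4 * decay_const / \<kappa>\<^sup>2 * decay_sum\<^sup>2) * (1 / t)) * ?N"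
    by (simp add: distrib_left distrib_right power2_eq_square power3_eq_cube mult_ac)
  finally show ?thesis using \<nu>(1) t unfolding t_def[symmetric] by (simp add: pos_divide_le_eq)
qed

lemma Limsup_sigma_in_le:
  "Limsup (at_right 0) (\<lambda>\<nu>. ereal (sigma_in d \<rho> EF \<nu> / (\<nu>\<^sup>2 * ln (1/\<nu>) ^ (d + 2))))
    \<le> ereal (1352 * 27 ^ d * pi ^ 3 * rho_sup\<^sup>2 * l ^ (d + 2))"
proof -
  let ?c = "1352 * 27 ^ d * pi ^ 3 * rho_sup\<^sup>2 * l ^ (d + 2)" and ?\<sigma> = "\<lambda>\<nu>. sigma_in d \<rho> EF \<nu> / (\<nu>\<^sup>2 * ln (1/\<nu>) ^ (d + 2))"
  let ?R = "\<lambda>\<nu>. ?c + pi * (1352 * l\<^sup>2 * decay_const * decay_sum) * \<nu>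
    + pi * (4 * decay_const / \<kappa>\<^sup>2 * decay_sum\<^sup>2) * (1 / ln (1/\<nu>))"
  have "((\<lambda>\<nu>::real. \<nu>) \<longlongrightarrow> 0) (at_right 0)" "((\<lambda>\<nu>::real. 1 / ln (1/\<nu>)) \<longlongrightarrow> 0) (at_right 0)" by real_asymp+
  then have "(?R \<longlongrightarrow> ?c + pi * (1352 * l\<^sup>2 * decay_const * decay_sum) * 0
      + pi * (4 * decay_const / \<kappa>\<^sup>2 * decay_sum\<^sup>2) * 0) (at_right 0)"
    by (intro tendsto_intros)
  then have "((\<lambda>\<nu>. ereal (?R \<nu>)) \<longlongrightarrow> ereal ?c) (at_right 0)" by simp
  then have lim: "Limsup (at_right 0) (\<lambda>\<nu>. ereal (?R \<nu>)) = ereal ?c" by (rule lim_imp_Limsup[rotated]) simp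
  have "0 < min (b - EF) (EF - a)" using EF by simp
  then have "\<forall>\<^sub>F \<nu> in at_right 0. \<nu> \<in> {0<..<min (b - EF) (EF - a)}" by (rule eventually_at_right_real)
  moreover have "LIM (\<nu>::real) at_right 0. ln (1/\<nu>) :> at_top" by real_asymp
  then have "\<forall>\<^sub>F \<nu> in at_right 0. max 1 (1 / l) \<le> ln (1/\<nu>)" by (simp only: filterlim_at_top)
  ultimately have "\<forall>\<^sub>F \<nu> in at_right 0. ereal (?\<sigma> \<nu>) \<le> ereal (?R \<nu>)"
  proof eventually_elim
    case (elim \<nu>)
    have "1 \<le> l * ln (1/\<nu>)" using elim(2) l by (simp add: pos_divide_le_eq mult.commute)
    then have "?\<sigma> \<nu> \<le> ?R \<nu>" by (intro sigma_in_scaled_le) (use elim in auto)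
    then show ?case by simp
  qed
  then show ?thesis unfolding lim[symmetric] by (rule Limsup_mono)
qed

end

theorem theorem2p3:
  shows "\<exists>C>0. \<forall>(d::nat) \<rho> E\<^sub>F l a b s K.
     1 \<le> d \<and> single_site_density \<rho> \<and> a < E\<^sub>F \<and> E\<^sub>F < b \<and> 0 < s \<and> s < 1 \<and> 0 < l \<and>
     loc_estimate d \<rho> a b s K l \<longrightarrow>
     Limsup (at_right 0) (\<lambda>\<nu>. ereal (sigma_in d \<rho> E\<^sub>F \<nu> / (\<nu>^2 * (ln (1/\<nu>))^(d+2))))
       \<le> ereal (C^(d+2) * pi^3 * l^(d+2)) * (normInf \<rho>)^2"
proof (intro exI[of _ 100] conjI allI impI)
  fix d :: nat and \<rho> :: "real \<Rightarrow> real" and EF l a b s K :: real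
  assume "1 \<le> d \<and> single_site_density \<rho> \<and> a < EF \<and> EF < b \<and> 0 < s \<and> s < 1 \<and> 0 < l \<and> loc_estimate d \<rho> a b s K l"
  then interpret fermi_level d \<rho> a b s K l EF by unfold_locales auto
  have "(1352::real) * 27 ^ d \<le> 100 ^ 2 * 100 ^ d" by (intro mult_mono power_mono) auto
  then have "1352 * 27 ^ d * (pi ^ 3 * rho_sup\<^sup>2 * l ^ (d + 2)) \<le> (100 ^ 2 * 100 ^ d) * (pi ^ 3 * rho_sup\<^sup>2 * l ^ (d + 2))"
    using l by (intro mult_right_mono) auto
  then have "1352 * 27 ^ d * pi ^ 3 * rho_sup\<^sup>2 * l ^ (d + 2) \<le> 100 ^ (d + 2) * pi ^ 3 * l ^ (d + 2) * rho_sup\<^sup>2"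
    unfolding power_add[of 100] by (simp only: mult_ac)
  moreover have "ereal (100 ^ (d + 2) * pi ^ 3 * l ^ (d + 2)) * (normInf \<rho>)\<^sup>2 = ereal (100 ^ (d + 2) * pi ^ 3 * l ^ (d + 2) * rho_sup\<^sup>2)"
    unfolding normInf_rho by (simp add: power2_eq_square)
  ultimately show "Limsup (at_right 0) (\<lambda>\<nu>. ereal (sigma_in d \<rho> EF \<nu> / (\<nu>\<^sup>2 * ln (1/\<nu>) ^ (d + 2))))
      \<le> ereal (100 ^ (d + 2) * pi ^ 3 * l ^ (d + 2)) * (normInf \<rho>)\<^sup>2"
    using order_trans[OF Limsup_sigma_in_le] by simp
qed simp

end
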